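(* Let $\xi=\sum_{j=1}^N\delta_{u_j}$ with $N\in\mathbb N$ and $u_1<\dots<u_N$ in $\mathbb R$. The noncolliding Brownian motion started at $\xi$ is determinantal, with correlation kernel $$\mathbb K_\xi(s,x;t,y)=\int_{\mathbb R}\xi(dv)\,p(s,x|v)\,\mathcal M_\xi^v(t,y)-\mathbf 1(s>t)\,p(s-t,x|y),\qquad (s,x),(t,y)\in[0,\infty)\times\mathbb R,$$ where $p(t,y|x)=\frac{1}{\sqrt{2\pi t}}e^{-(x-y)^2/2t}$ and $$\mathcal M_\xi^v(t,y)=\int_{\mathbb R}dw\,\frac{1}{\sqrt{2\pi t}}e^{-(iy+w)^2/2t}\,\Phi_\xi^v(iw),\qquad \Phi_\xi^v(z)=\prod_{r\in\operatorname{supp}\xi,\ r\ne v}\frac{z-r}{v-r}.$$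
   Context: At time $0$: $p(0,y|x)=\delta(y-x)$, and $\mathcal M_\xi^v(0,y)$ is understood as $\Phi_\xi^v(y)$. Noncolliding Brownian motion: the solution $\boldsymbol X(t)$ of $dX_j(t)=dB_j(t)+\sum_{k\ne j}\frac{dt}{X_j(t)-X_k(t)}$, $1\le j\le N$, with $X_j(0)=u_j$ and $B_j$ independent one-dimensional standard Brownian motions, regarded as the process $\Xi(t,\cdot)=\sum_{j=1}^N\delta_{X_j(t)}(\cdot)$ with law $\mathbb P_\xi$, expectation $\mathbb E_\xi$. Determinantal with correlation kernel $\mathbb K_\xi$ means: for every $M\in\mathbb N$, $0<t_1<\dots<t_M<\infty$ and continuous compactly supported $f_{t_1},\dots,f_{t_M}:\mathbb R\to\mathbb R$, with $\chi_{t_m}=e^{f_{t_m}}-1$ and $\mathbb W_n=\{\boldsymbol x\in\mathbb R^n:x_1<\dots<x_n\}$, $$\mathbb E_\xi\Big[\exp\Big\{\sum_{m=1}^M\int f_{t_m}(x)\,\Xi(t_m,dx)\Big\}\Big]=\sum_{N_1,\dots,N_M\ge0}\int_{\prod_m\mathbb W_{N_m}}\prod_{m=1}^M\Big\{d\boldsymbol x^{(m)}\prod_{j=1}^{N_m}\chi_{t_m}(x^{(m)}_j)\Big\}\det_{\substack{1\le j\le N_m,\,1\le k\le N_n\\1\le m,n\le M}}\big[\mathbb K_\xi(t_m,x_j^{(m)};t_n,x_k^{(n)})\big],$$ i.e. the spatio-temporal correlation functions are $\rho_\xi(t_1,\boldsymbol x^{(1)};\dots;t_M,\boldsymbol x^{(M)})=\det[\mathbb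 K_\xi(t_m,x_j^{(m)};t_n,x_k^{(n)})]$. *)

theory Defs
  imports "HOL-Probability.Probability" "Jordan_Normal_Form.Determinant"
begin

hide_const (open) Finite_Cartesian_Product.mat Determinants.det

text \<open>The labels $1, \dots, N$ of the paper are $0, \dots, N-1$ here, and likewise for the
  labels of times and of points.\<close>

section \<open>Noncolliding Brownian motion\<close>

definition standard_BM :: "'a measure \<Rightarrow> (real \<Rightarrow> 'a \<Rightarrow> real) \<Rightarrow> bool" where
  "standard_BM P B \<longleftrightarrow>
     (\<forall>t\<ge>0. B t \<in> borel_measurable P) \<and>
     (AE \<omega> in P. B 0 \<omega> = 0) \<and>
     (\<forall>n (\<tau> :: nat \<Rightarrow> real). 0 \<le> \<tau> 0 \<and> strict_mono_on {..n} \<tau> \<longrightarrow>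
        prob_space.indep_vars P (\<lambda>_. borel) (\<lambda>i \<omega>. B (\<tau> (Suc i)) \<omega> - B (\<tau> i) \<omega>) {..<n}) \<and>
     (\<forall>s t. 0 \<le> s \<and> s < t \<longrightarrow>
        distributed P lborel (\<lambda>\<omega>. B t \<omega> - B s \<omega>)
          (\<lambda>x. ennreal (normal_density 0 (sqrt (t - s)) x))) \<and>
     (AE \<omega> in P. continuous_on {0..} (\<lambda>t. B t \<omega>))"

text \<open>Processes indexed by $j$ are independent as random elements of the path space
  $\mathbb{R}^{[0,\infty)}$.\<close>

definition independent_BMs :: "'a measure \<Rightarrow> nat \<Rightarrow> (nat \<Rightarrow> real \<Rightarrow> 'a \<Rightarrow> real) \<Rightarrow> bool" where
  "independent_BMs P N B \<longleftrightarrow>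
     (\<forall>j<N. standard_BM P (B j)) \<and>
     prob_space.indep_vars P (\<lambda>_. Pi\<^sub>M {0..} (\<lambda>_. borel)) (\<lambda>j \<omega>. \<lambda>t\<in>{0..}. B j t \<omega>) {..<N}"

text \<open>The noise of the stochastic differential equation is additive, so that its integral form
  needs no stochastic integral and is read path by path. The drift is defined only at
  configurations of distinct points, and a solution takes its values there; its paths are
  continuous, so the drift is then integrable on every interval $[0,t]$. Adaptedness of the
  solution is not part of the definition.\<close>

definition noncolliding_BM ::
  "'a measure \<Rightarrow> nat \<Rightarrow> (nat \<Rightarrow> real) \<Rightarrow> (nat \<Rightarrow> real \<Rightarrow> 'a \<Rightarrow> real)
    \<Rightarrow> (nat \<Rightarrow> real \<Rightarrow> 'a \<Rightarrow> real) \<Rightarrow> bool" where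
  "noncolliding_BM P N u B X \<longleftrightarrow>
     independent_BMs P N B \<and>
     (\<forall>j<N. \<forall>t\<ge>0. X j t \<in> borel_measurable P) \<and>
     (AE \<omega> in P.
        (\<forall>j<N. continuous_on {0..} (\<lambda>t. X j t \<omega>)) \<and>
        (\<forall>t\<ge>0. inj_on (\<lambda>j. X j t \<omega>) {..<N}) \<and>
        (\<forall>j<N. X j 0 \<omega> = u j) \<and>
        (\<forall>j<N. \<forall>t\<ge>0. X j t \<omega> = u j + B j t \<omega> +
           (\<Sum>k\<in>{..<N} - {j}. LINT s:{0..t}|lborel. 1 / (X j s \<omega> - X k s \<omega>))))"

text \<open>The counting measure $\sum_{j<N} \delta_{x_j}$.\<close>

definition point_config :: "nat \<Rightarrow> (nat \<Rightarrow> real) \<Rightarrow> real measure" where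
  "point_config N x = distr (count_space {..<N}) borel x"

section \<open>Determinantal processes\<close>

definition block_indices :: "nat \<Rightarrow> (nat \<Rightarrow> nat) \<Rightarrow> (nat \<times> nat) list" where
  "block_indices M n = [(m, j). m \<leftarrow> [0..<M], j \<leftarrow> [0..<n m]]"

text \<open>\<open>x (m, j)\<close> is the \<open>j\<close>-th of the \<open>n m\<close> points at time \<open>t m\<close>. Rows and columns of the
  matrix are labelled by the pairs \<open>(m, j)\<close> in lexicographic order.\<close>

definition kernel_matrix ::
  "(real \<Rightarrow> real \<Rightarrow> real \<Rightarrow> real \<Rightarrow> complex) \<Rightarrow> nat \<Rightarrow> (nat \<Rightarrow> real) \<Rightarrow> (nat \<Rightarrow> nat)
    \<Rightarrow> (nat \<times> nat \<Rightarrow> real) \<Rightarrow> complex mat" where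
  "kernel_matrix K M t n x =
     (let I = block_indices M n in
      Matrix.mat (length I) (length I)
        (\<lambda>(a, b). K (t (fst (I ! a))) (x (I ! a)) (t (fst (I ! b))) (x (I ! b))))"

definition weyl_chambers :: "nat \<Rightarrow> (nat \<Rightarrow> nat) \<Rightarrow> (nat \<times> nat \<Rightarrow> real) set" where
  "weyl_chambers M n = {x. \<forall>m<M. \<forall>j k. j < k \<and> k < n m \<longrightarrow> x (m, j) < x (m, k)}"

definition fredholm_term ::
  "(real \<Rightarrow> real \<Rightarrow> real \<Rightarrow> real \<Rightarrow> complex) \<Rightarrow> nat \<Rightarrow> (nat \<Rightarrow> real) \<Rightarrow> (nat \<Rightarrow> real \<Rightarrow> real)
    \<Rightarrow> (nat \<Rightarrow> nat) \<Rightarrow> complex" where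
  "fredholm_term K M t g n =
     set_lebesgue_integral (Pi\<^sub>M (SIGMA m:{..<M}. {..<n m}) (\<lambda>_. lborel)) (weyl_chambers M n)
       (\<lambda>x. complex_of_real (\<Prod>m<M. \<Prod>j<n m. g m (x (m, j)))
          * Determinant.det (kernel_matrix K M t n x))"

text \<open>Kernels take complex values because the kernel below is a complex integral.\<close>

definition determinantal ::
  "'a measure \<Rightarrow> (real \<Rightarrow> 'a \<Rightarrow> real measure) \<Rightarrow> (real \<Rightarrow> real \<Rightarrow> real \<Rightarrow> real \<Rightarrow> complex) \<Rightarrow> bool"
where
  "determinantal P \<Xi> K \<longleftrightarrow>
     (\<forall>(M :: nat) (t :: nat \<Rightarrow> real) (f :: nat \<Rightarrow> real \<Rightarrow> real).
        (\<forall>m<M. 0 < t m) \<and> strict_mono_on {..<M} t \<and>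
        (\<forall>m<M. continuous_on UNIV (f m) \<and> compact (closure {x. f m x \<noteq> 0})) \<longrightarrow>
        (fredholm_term K M t (\<lambda>m x. exp (f m x) - 1) has_sum
           complex_of_real (LINT \<omega>|P. exp (\<Sum>m<M. LINT x|\<Xi> (t m) \<omega>. f m x)))
          ({..<M} \<rightarrow>\<^sub>E UNIV))"

section \<open>The correlation kernel\<close>

text \<open>The transition density $p(t, y \mid x)$, for $t > 0$. At $t = 0$ it is a delta measure and
  not a function; \<open>determinantal\<close> evaluates the kernel at positive times only.\<close>

definition heat_density :: "real \<Rightarrow> real \<Rightarrow> real \<Rightarrow> real" where
  "heat_density t y x = 1 / sqrt (2 * pi * t) * exp (- ((x - y)\<^sup>2 / (2 * t)))"

definition msupp :: "real measure \<Rightarrow> real set" where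
  "msupp \<xi> = {r. \<forall>S. open S \<and> r \<in> S \<longrightarrow> emeasure \<xi> S \<noteq> 0}"

definition Phi :: "real measure \<Rightarrow> real \<Rightarrow> complex \<Rightarrow> complex" where
  "Phi \<xi> v z = (\<Prod>r\<in>msupp \<xi> - {v}. (z - complex_of_real r) / complex_of_real (v - r))"

definition mart :: "real measure \<Rightarrow> real \<Rightarrow> real \<Rightarrow> real \<Rightarrow> complex" where
  "mart \<xi> v t y =
     (if t = 0 then Phi \<xi> v (complex_of_real y)
      else LINT w|lborel.
        complex_of_real (1 / sqrt (2 * pi * t))
          * exp (- ((\<i> * complex_of_real y + complex_of_real w)\<^sup>2 / complex_of_real (2 * t)))
          * Phi \<xi> v (\<i> * complex_of_real w))"

definition corr_kernel :: "real measure \<Rightarrow> real \<Rightarrow> real \<Rightarrow> real \<Rightarrow> real \<Rightarrow> complex" where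
  "corr_kernel \<xi> s x t y =
     (LINT v|\<xi>. complex_of_real (heat_density s x v) * mart \<xi> v t y)
       - (if s > t then complex_of_real (heat_density (s - t) x y) else 0)"

end

theory Submission
  imports Defs "HOL-Real_Asymp.Real_Asymp"
begin

text \<open>
  Let $h$ be the Vandermonde determinant. The noncolliding Brownian motion is the $h$-transform of
  independent Brownian motions, but no stochastic calculus is needed to use this. For functions
  $\psi_v$ whose determinant $\det \psi_v(y_j)$ is dominated by $h(y)$, put
  $F_\psi = \det \psi_v(x_j) / h(x)$. One step of the Euler scheme for the stochastic differential
  equation maps $F_\psi$ to $F_{P_\delta \psi}$ up to an error of order $\delta^{3/2}$, where $P$ is the
  heat semigroup, because the drift is the gradient of $\log h$; total positivity of the Gaussian
  kernel preserves the domination. The Euler scheme converges path by path, since a path stays away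
  from collisions on every bounded time interval. Hence $F_\psi$ satisfies the Markov property, and
  expectations of products $\prod_m \prod_j g_m(X_j(t_m))$ become $N \times N$ determinants of functions
  obtained by applying heat semigroups and multiplications by $g_m$ in turn to the polynomials
  $\mathcal M^v(t_M, \cdot)$, which form a martingale family and satisfy
  $\det \mathcal M^v(t, y_j) = h(y) / h(u)$.

  On the Fredholm side, the determinant of the correlation kernel is a Schur complement: it equals
  the determinant of a larger matrix in which the $N$ starting points are added. There the columns of
  the points at the last time vanish outside the first $N$ rows, so these points can be integrated out
  by expanding along their columns. Summed over their number, the result is again a determinant of the
  same form with modified rows, and removing all times in this way leaves the same $N \times N$
  determinant.
\<close>

section \<open>Determinants, Vandermonde products and total positivity\<close>

section \<open>Determinants of functions of two indices\<close>

text \<open>A solution is given path by path and comes with no filtration, so a Markov property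
  cannot be quoted for it. It is first obtained for the Euler chain, which is an explicit function
  of the Brownian increments; what the chain has seen is therefore independent of what comes next.
  The obstacle is the singular drift: the constant of the one-step estimate deteriorates as the
  separation of the points shrinks. Hence the mesh is chosen after the separation level, and the
  chain is abandoned once it leaves the separated configurations. Abandoning it costs no more than a
  multiple of a probability, because \<open>fdet_ratio\<close> is bounded by a constant
  \<open>c\<close> that does not grow with the number of steps. Producing such a \<open>c\<close> is
  the reason for demanding domination by the Vandermonde determinant. On the Fredholm side every
  integrated point uses up one of \<open>N\<close> rows, so more than \<open>N\<close> points at one
  time contribute nothing and the series is a finite sum.\<close>

definition fdet :: "nat \<Rightarrow> (nat \<Rightarrow> nat \<Rightarrow> 'a::comm_ring_1) \<Rightarrow> 'a" where
  "fdet n f = Determinant.det (Matrix.mat n n (\<lambda>(i, j). f i j))"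

lemma fdet_leibniz:
  "fdet n f = (\<Sum>p | p permutes {..<n}. of_int (sign p) * (\<Prod>i<n. f i (p i)))"
proof -
  have "fdet n f = (\<Sum>p | p permutes {..<n}. of_int (sign p) *
      (\<Prod>i<n. Matrix.mat n n (\<lambda>(i, j). f i j) $$ (i, p i)))"
    unfolding fdet_def by (subst Determinant.det_def'[of _ n]) (auto simp: atLeast0LessThan)
  also have "\<dots> = (\<Sum>p | p permutes {..<n}. of_int (sign p) * (\<Prod>i<n. f i (p i)))"
  proof (intro sum.cong arg_cong2[where f = "(*)"] prod.cong refl)
    fix p i assume "p \<in> {p. p permutes {..<n}}" "i \<in> {..<n}"
    then have "p i < n" using permutes_in_image[of p "{..<n}" i] by auto
    then show "Matrix.mat n n (\<lambda>(i, j). f i j) $$ (i, p i) = f i (p i)"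
      using \<open>i \<in> {..<n}\<close> by simp
  qed
  finally show ?thesis .
qed

lemma fdet_cong: "(\<And>i j. i < n \<Longrightarrow> j < n \<Longrightarrow> f i j = g i j) \<Longrightarrow> fdet n f = fdet n g"
  unfolding fdet_def by (rule arg_cong[where f = Determinant.det]) (auto intro!: eq_matI)

lemma fdet_transpose: "fdet n (\<lambda>i j. f j i) = fdet n f"
proof -
  have "transpose_mat (Matrix.mat n n (\<lambda>(i, j). f i j)) = Matrix.mat n n (\<lambda>(i, j). f j i)"
    by (auto intro!: eq_matI)
  then show ?thesis
    unfolding fdet_def
    using Determinant.det_transpose[of "Matrix.mat n n (\<lambda>(i, j). f i j)" n] by simp
qed

lemma fdet_permute_rows:
  assumes "p permutes {..<n}"
  shows "fdet n (\<lambda>i. f (p i)) = of_int (sign p) * fdet n f"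
proof -
  have "Matrix.mat n n (\<lambda>(i, j). Matrix.mat n n (\<lambda>(i, j). f i j) $$ (p i, j))
      = Matrix.mat n n (\<lambda>(i, j). f (p i) j)"
  proof -
    have "p i < n" if "i < n" for i
      using permutes_in_image[OF assms, of i] that by simp
    then show ?thesis by (intro eq_matI) auto
  qed
  moreover have "Determinant.det (Matrix.mat n n (\<lambda>(i, j). Matrix.mat n n (\<lambda>(i, j). f i j) $$ (p i, j)))
      = of_int (sign p) * Determinant.det (Matrix.mat n n (\<lambda>(i, j). f i j))"
    using assms unfolding atLeast0LessThan[symmetric]
    by (rule Determinant.det_permute_rows[OF mat_carrier])
  ultimately show ?thesis
    unfolding fdet_def by argo
qed

lemma fdet_permute_cols:
  assumes "p permutes {..<n}"
  shows "fdet n (\<lambda>i j. f i (p j)) = of_int (sign p) * fdet n f"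
  using fdet_permute_rows[OF assms, of "\<lambda>i j. f j i"]
    fdet_transpose[of n "\<lambda>i j. f i (p j)"] fdet_transpose[of n f] by simp

lemma fdet_identical_rows:
  fixes f :: "nat \<Rightarrow> nat \<Rightarrow> 'a::comm_ring_1"
  assumes "i < n" "j < n" "i \<noteq> j" "\<And>k. k < n \<Longrightarrow> f i k = f j k"
  shows "fdet n f = 0"
  unfolding fdet_def
  by (rule Determinant.det_identical_rows[of _ n i j]) (use assms in \<open>auto intro!: eq_vecI\<close>)

lemma fdet_mult: "fdet n (\<lambda>i j. \<Sum>k<n. f i k * g k j) = fdet n f * fdet n g"
proof -
  have "Matrix.mat n n (\<lambda>(i, j). \<Sum>k<n. f i k * g k j)
      = Matrix.mat n n (\<lambda>(i, j). f i j) * Matrix.mat n n (\<lambda>(i, j). g i j)"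
    by (auto intro!: eq_matI sum.cong simp: scalar_prod_def atLeast0LessThan)
  then show ?thesis
    unfolding fdet_def by (simp add: Determinant.det_mult[of _ n])
qed

lemma fdet_scale_rows: "fdet n (\<lambda>i j. c i * f i j) = (\<Prod>i<n. c i) * fdet n f"
  by (simp add: fdet_leibniz sum_distrib_left prod.distrib algebra_simps)

lemma fdet_scale_cols: "fdet n (\<lambda>i j. c j * f i j) = (\<Prod>i<n. c i) * fdet n f"
  using fdet_scale_rows[of n c "\<lambda>i j. f j i"]
    fdet_transpose[of n "\<lambda>i j. c j * f i j"] fdet_transpose[of n f] by simp

lemma fdet_upper_triangular:
  assumes "\<And>i j. i < n \<Longrightarrow> j < i \<Longrightarrow> f i j = 0"
  shows "fdet n f = (\<Prod>i<n. f i i)"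
proof -
  have "upper_triangular (Matrix.mat n n (\<lambda>(i, j). f i j))"
    using assms by (auto simp: upper_triangular_def)
  then have "fdet n f = prod_list (diag_mat (Matrix.mat n n (\<lambda>(i, j). f i j)))"
    unfolding fdet_def by (subst Determinant.det_upper_triangular[of _ n]) auto
  also have "\<dots> = (\<Prod>i<n. f i i)"
    by (simp add: diag_mat_def prod.list_conv_set_nth atLeast0LessThan)
  finally show ?thesis .
qed

lemma fdet_identity: "fdet n (\<lambda>i j. if i = j then 1 else 0) = 1"
  by (subst fdet_upper_triangular) auto

lemma fdet_of_real: "fdet n (\<lambda>i j. complex_of_real (f i j)) = complex_of_real (fdet n f)"
  by (simp add: fdet_leibniz)

lemma measurable_fdet [measurable]:
  fixes f :: "nat \<Rightarrow> nat \<Rightarrow> 'b \<Rightarrow> real"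
  assumes "\<And>i j. i < n \<Longrightarrow> j < n \<Longrightarrow> f i j \<in> borel_measurable M"
  shows "(\<lambda>x. fdet n (\<lambda>i j. f i j x)) \<in> borel_measurable M"
  unfolding fdet_leibniz
proof (intro borel_measurable_sum borel_measurable_times borel_measurable_prod borel_measurable_const)
  fix p i assume "p \<in> {p. p permutes {..<n}}" "i \<in> {..<n}"
  then show "f i (p i) \<in> borel_measurable M"
    using assms permutes_in_image[of p "{..<n}" i] by auto
qed

section \<open>Vandermonde determinants\<close>

definition vandermonde :: "nat \<Rightarrow> (nat \<Rightarrow> 'a::comm_ring_1) \<Rightarrow> 'a" where
  "vandermonde n x = (\<Prod>j<n. \<Prod>i<j. x j - x i)"

text \<open>The coefficient matrix of monic polynomials of degrees 0, ..., n - 1 is triangular with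
  ones on its diagonal, so passing from powers to any such family leaves the determinant unchanged.
  The Hermite polynomials of each fixed time are such a family.\<close>

lemma fdet_monic_polys:
  fixes x :: "nat \<Rightarrow> 'a::comm_ring_1"
  assumes "\<And>j. j < n \<Longrightarrow> degree (q j) = j" "\<And>j. j < n \<Longrightarrow> lead_coeff (q j) = 1"
  shows "fdet n (\<lambda>i j. poly (q j) (x i)) = fdet n (\<lambda>i j. x i ^ j)"
proof -
  have "fdet n (\<lambda>i j. poly (q j) (x i)) = fdet n (\<lambda>i j. \<Sum>k<n. x i ^ k * Polynomial.coeff (q j) k)"
  proof (rule fdet_cong)
    fix i j assume "i < n" "j < n"
    have "poly (q j) (x i) = (\<Sum>k\<le>degree (q j). Polynomial.coeff (q j) k * x i ^ k)"
      by (rule poly_altdef)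
    also have "\<dots> = (\<Sum>k<n. Polynomial.coeff (q j) k * x i ^ k)"
      using assms(1)[OF \<open>j < n\<close>] \<open>j < n\<close>
      by (intro sum.mono_neutral_left) (auto simp: coeff_eq_0)
    finally show "poly (q j) (x i) = (\<Sum>k<n. x i ^ k * Polynomial.coeff (q j) k)"
      by (simp add: mult.commute)
  qed
  also have "\<dots> = fdet n (\<lambda>i j. x i ^ j) * fdet n (\<lambda>k j. Polynomial.coeff (q j) k)"
    by (rule fdet_mult)
  also have "fdet n (\<lambda>k j. Polynomial.coeff (q j) k) = (\<Prod>i<n. Polynomial.coeff (q i) i)"
    using assms(1) by (intro fdet_upper_triangular) (auto simp: coeff_eq_0)
  also have "\<dots> = 1"
    using assms by (intro prod.neutral) force
  finally show ?thesis by simp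
qed

text \<open>The Newton polynomials vanish at the earlier nodes, which makes the matrix of their
  values triangular; its diagonal gives the product of differences.\<close>

lemma fdet_vandermonde: 
  fixes x :: "nat \<Rightarrow> 'a::idom"
  shows "fdet n (\<lambda>i j. x i ^ j) = vandermonde n x"
proof -
  define q where "q j = (\<Prod>k<j. [:- x k, 1:])" for j
  have deg: "degree (q j) = j" for j
    unfolding q_def by (subst degree_prod_eq_sum_degree) auto
  have lead: "lead_coeff (q j) = 1" for j
    unfolding q_def by (simp add: lead_coeff_prod)
  have "fdet n (\<lambda>i j. x i ^ j) = fdet n (\<lambda>i j. poly (q j) (x i))"
    by (intro fdet_monic_polys[symmetric] deg lead)
  also have "\<dots> = fdet n (\<lambda>i j. poly (q i) (x j))"
    by (rule fdet_transpose[symmetric])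
  also have "\<dots> = (\<Prod>i<n. poly (q i) (x i))"
    unfolding q_def poly_prod by (intro fdet_upper_triangular) auto
  also have "\<dots> = vandermonde n x"
    by (simp add: vandermonde_def q_def poly_prod)
  finally show ?thesis .
qed

text \<open>Translates the absence of collisions into nonvanishing denominators.\<close>

lemma vandermonde_eq_0_iff:
  fixes x :: "nat \<Rightarrow> 'a::idom"
  shows "vandermonde n x = 0 \<longleftrightarrow> \<not> inj_on x {..<n}"
proof -
  have "vandermonde n x = 0 \<longleftrightarrow> (\<exists>j<n. \<exists>i<j. x j = x i)"
    by (auto simp: vandermonde_def)
  also have "\<dots> \<longleftrightarrow> \<not> inj_on x {..<n}"
  proof
    assume "\<not> inj_on x {..<n}"
    then obtain i j where "i < n" "j < n" "x i = x j" "i \<noteq> j"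
      by (auto simp: inj_on_def)
    then show "\<exists>j<n. \<exists>i<j. x j = x i" by (cases i j rule: linorder_cases) force+
  qed (force simp: inj_on_def)
  finally show ?thesis .
qed

lemma vandermonde_permute:
  fixes x :: "nat \<Rightarrow> 'a::idom"
  assumes "p permutes {..<n}"
  shows "vandermonde n (x \<circ> p) = of_int (sign p) * vandermonde n x"
  using fdet_permute_rows[OF assms, of "\<lambda>i j. x i ^ j"]
    fdet_vandermonde[of n "x \<circ> p"] fdet_vandermonde[of n x] by (simp add: comp_def)

lemma vandermonde_pos:
  fixes x :: "nat \<Rightarrow> real"
  assumes "strict_mono_on {..<n} x"
  shows "vandermonde n x > 0"
  unfolding vandermonde_def using assms
  by (intro prod_pos) (auto simp: strict_mono_on_def)

text \<open>Reduces statements about arbitrary distinct points to increasing ones, and later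
  supplies the Weyl chamber that contains a given configuration.\<close>

lemma ex_sorting_permutation:
  fixes x :: "nat \<Rightarrow> 'a::linorder"
  assumes inj: "inj_on x {..<n}"
  shows "\<exists>p. p permutes {..<n} \<and> strict_mono_on {..<n} (x \<circ> p)"
proof -
  define e where "e = sorted_list_of_set (x ` {..<n})"
  have len: "length e = n" 
    using inj by (simp add: e_def card_image)
  have e: "sorted_wrt (<) e" "set e = x ` {..<n}"
    by (simp_all add: e_def)
  define p where "p i = (if i < n then inv_into {..<n} x (e ! i) else i)" for i
  have in_e: "e ! i \<in> x ` {..<n}" if "i < n" for i
    using that e(2) len nth_mem by metis
  have xp: "x (p i) = e ! i" if "i < n" for i
    using in_e[OF that] that by (simp add: p_def f_inv_into_f)
  have pn: "p i < n" if "i < n" for i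
    using inv_into_into[OF in_e[OF that]] that by (simp add: p_def)
  have mono: "strict_mono_on {..<n} (x \<circ> p)"
    using sorted_wrt_nth_less[OF e(1)] len by (auto simp: strict_mono_on_def xp)
  have "inj_on (x \<circ> p) {..<n}"
    using mono by (rule strict_mono_on_imp_inj_on)
  then have "inj_on p {..<n}" by (rule inj_on_imageI2)
  moreover have "p ` {..<n} \<subseteq> {..<n}" using pn by auto
  ultimately have "bij_betw p {..<n} {..<n}"
    by (simp add: bij_betw_def endo_inj_surj)
  then have "p permutes {..<n}"
    by (rule bij_imp_permutes) (simp add: p_def)
  with mono show ?thesis by blast
qed

section \<open>Total positivity of the exponential kernel\<close>

text \<open>Exponentials with distinct exponents form a Chebyshev system. Induction on their number:
  Rolle's theorem turns n + 1 zeros of a sum of n + 1 exponentials into n zeros of a sum of n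
  exponentials.\<close>

lemma exp_sum_few_zeros:
  fixes b c z :: "nat \<Rightarrow> real"
  assumes "strict_mono_on {..<n} z" "inj_on b {..<n}"
    and "\<And>i. i < n \<Longrightarrow> (\<Sum>j<n. c j * exp (b j * z i)) = 0"
  shows "\<forall>j<n. c j = 0"
  using assms
proof (induction n arbitrary: b c z)
  case 0
  then show ?case by simp
next
  case (Suc n)
  \<comment> \<open>The factor \<open>exp (- b n * x)\<close> does not change the zeros but makes
    the last term constant, so that this term disappears from the derivative
    \<open>g'\<close>.\<close>
  define g where "g x = (\<Sum>j<Suc n. c j * exp ((b j - b n) * x))" for x
  define g' where "g' x = (\<Sum>j<Suc n. c j * (b j - b n) * exp ((b j - b n) * x))" for x
  have der: "(g has_real_derivative g' x) (at x)" for x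
    unfolding g_def g'_def by (auto intro!: derivative_eq_intros sum.cong)
  have g_eq: "g x = exp (- b n * x) * (\<Sum>j<Suc n. c j * exp (b j * x))" for x
  proof -
    have "exp ((b j - b n) * x) = exp (- b n * x) * exp (b j * x)" for j
      by (simp add: left_diff_distrib flip: exp_add)
    then show ?thesis by (simp add: g_def sum_distrib_left algebra_simps)
  qed
  have g0: "g (z i) = 0" if "i < Suc n" for i
    using Suc.prems(3)[OF that] by (simp add: g_eq)
  have "\<exists>w. z i < w \<and> w < z (Suc i) \<and> g' w = 0" if "i < n" for i
  proof -
    have lt: "z i < z (Suc i)" using Suc.prems(1) that by (auto simp: strict_mono_on_def)
    have "continuous_on {z i..z (Suc i)} g"
      using der by (intro continuous_at_imp_continuous_on ballI DERIV_isCont)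
    then have "\<exists>w. z i < w \<and> w < z (Suc i) \<and> (\<lambda>v. g' w * v) = (\<lambda>v. 0)"
      using g0[of i] g0[of "Suc i"] that
      by (intro Rolle_deriv[OF lt]) (auto intro: der[unfolded has_field_derivative_def])
    then obtain w where w: "z i < w" "w < z (Suc i)" "(\<lambda>v. g' w * v) = (\<lambda>v. 0)" by blast
    from fun_cong[OF w(3), of 1] w(1,2) show ?thesis by auto
  qed
  then obtain w where w: "\<And>i. i < n \<Longrightarrow> z i < w i \<and> w i < z (Suc i) \<and> g' (w i) = 0"
    by metis
  have mono_w: "strict_mono_on {..<n} w"
  proof (rule strict_mono_onI)
    fix i j assume ij: "i \<in> {..<n}" "j \<in> {..<n}" "i < j"
    have "z (Suc i) \<le> z j"
      using Suc.prems(1) ij by (cases "Suc i = j") (auto simp: strict_mono_on_def intro!: less_imp_le)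
    with w[of i] w[of j] ij show "w i < w j" by auto
  qed
  have "\<forall>j<n. c j * (b j - b n) = 0"
  proof (rule Suc.IH[OF mono_w])
    show "inj_on (\<lambda>j. b j - b n) {..<n}"
      using Suc.prems(2) by (auto simp: inj_on_def)
    show "(\<Sum>j<n. c j * (b j - b n) * exp ((b j - b n) * w i)) = 0" if "i < n" for i
      using w[OF that] by (simp add: g'_def)
  qed
  moreover have "b j \<noteq> b n" if "j < n" for j
    using Suc.prems(2) that by (auto simp: inj_on_def)
  ultimately have *: "c j = 0" if "j < n" for j using that by auto
  with Suc.prems(3)[of 0] have "c n = 0" by simp
  with * show ?case by (auto simp: less_Suc_eq)
qed

text \<open>A nonzero vector in the kernel of the matrix would be the coefficients of an exponential
  sum with exponents \<open>b j\<close> that vanishes at the n points \<open>a i\<close>.\<close>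

lemma fdet_exp_nonzero:
  fixes a b :: "nat \<Rightarrow> real"
  assumes "strict_mono_on {..<n} a" "inj_on b {..<n}"
  shows "fdet n (\<lambda>i j. exp (a i * b j)) \<noteq> 0"
proof
  assume "fdet n (\<lambda>i j. exp (a i * b j)) = 0"
  then obtain v where v: "v \<in> carrier_vec n" "v \<noteq> 0\<^sub>v n"
    "Matrix.mat n n (\<lambda>(i, j). exp (a i * b j)) *\<^sub>v v = 0\<^sub>v n"
    unfolding fdet_def by (subst (asm) det_0_iff_vec_prod_zero[of _ n]) auto
  have "(\<Sum>j<n. v $ j * exp (b j * a i)) = 0" if "i < n" for i
  proof -
    have "(Matrix.mat n n (\<lambda>(i, j). exp (a i * b j)) *\<^sub>v v) $ i = 0"
      using v(3) that by simp
    then show ?thesis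
      using that v(1) by (simp add: scalar_prod_def atLeast0LessThan mult.commute)
  qed
  from exp_sum_few_zeros[OF assms this] have "\<forall>j<n. v $ j = 0" .
  with v(1) have "v = 0\<^sub>v n" by (intro eq_vecI) auto
  with v(2) show False by simp
qed

text \<open>The determinant does not vanish while \<open>b\<close> is moved linearly to \<open>0, 1, \<dots>, n - 1\<close>, where it is a
  Vandermonde determinant.\<close>

lemma fdet_exp_pos:
  fixes a b :: "nat \<Rightarrow> real"
  assumes a: "strict_mono_on {..<n} a" and b: "strict_mono_on {..<n} b"
  shows "fdet n (\<lambda>i j. exp (a i * b j)) > 0"
proof -
  define B where "B s j = (1 - s) * b j + s * real j" for s j
  define D where "D s = fdet n (\<lambda>i j. exp (a i * B s j))" for s
  have mono_B: "strict_mono_on {..<n} (B s)" if "0 \<le> s" "s \<le> 1" for s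
  proof (rule strict_mono_onI)
    fix i j assume ij: "i \<in> {..<n}" "j \<in> {..<n}" "i < j"
    then have bij: "b i < b j" using b by (auto simp: strict_mono_on_def)
    show "B s i < B s j"
    proof (cases "s = 1")
      case False
      then have "(1 - s) * b i < (1 - s) * b j" using that bij by simp
      moreover have "s * real i \<le> s * real j" using that ij by (intro mult_left_mono) auto
      ultimately show ?thesis unfolding B_def by linarith
    qed (use ij in \<open>simp add: B_def\<close>)
  qed
  have nz: "D s \<noteq> 0" if "0 \<le> s" "s \<le> 1" for s
    unfolding D_def using a strict_mono_on_imp_inj_on[OF mono_B[OF that]]
    by (rule fdet_exp_nonzero)
  have cont: "continuous_on {0..1} D"
    unfolding D_def fdet_leibniz B_def by (intro continuous_intros)
  have "D 1 = fdet n (\<lambda>i j. exp (a i) ^ j)"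
    unfolding D_def B_def by (intro fdet_cong) (simp add: exp_of_nat_mult mult.commute)
  also have "\<dots> = vandermonde n (\<lambda>i. exp (a i))" by (rule fdet_vandermonde)
  also have "\<dots> > 0" using a by (intro vandermonde_pos) (auto simp: strict_mono_on_def)
  finally have D1: "D 1 > 0" .
  have "D 0 > 0"
  proof (rule ccontr)
    assume "\<not> D 0 > 0"
    then obtain s where "0 \<le> s" "s \<le> 1" "D s = 0"
      using IVT'[of D 0 0 1] cont D1 by auto
    with nz show False by blast
  qed
  then show ?thesis by (simp add: D_def B_def)
qed

text \<open>Removes the ordering. Sorting either tuple multiplies both the determinant and the
  corresponding Vandermonde factor by the sign of the permutation, and signs square to 1; for a
  tuple with repetitions the product is 0.\<close>

lemma fdet_exp_vandermonde_nonneg: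
  fixes a b :: "nat \<Rightarrow> real"
  shows "fdet n (\<lambda>i j. exp (a i * b j)) * vandermonde n a * vandermonde n b \<ge> 0"
proof (cases "inj_on a {..<n} \<and> inj_on b {..<n}")
  case True
  then obtain p q where p: "p permutes {..<n}" "strict_mono_on {..<n} (a \<circ> p)"
    and q: "q permutes {..<n}" "strict_mono_on {..<n} (b \<circ> q)"
    using ex_sorting_permutation by meson
  have sq: "real_of_int (sign r) * real_of_int (sign r) = 1" for r :: "nat \<Rightarrow> nat"
    by (simp add: sign_def)
  have "0 < fdet n (\<lambda>i j. exp ((a \<circ> p) i * (b \<circ> q) j)) * vandermonde n (a \<circ> p) * vandermonde n (b \<circ> q)"
    using p q by (intro mult_pos_pos fdet_exp_pos vandermonde_pos)
  also have "fdet n (\<lambda>i j. exp ((a \<circ> p) i * (b \<circ> q) j))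
      = of_int (sign p) * (of_int (sign q) * fdet n (\<lambda>i j. exp (a i * b j)))"
    using fdet_permute_rows[OF p(1), of "\<lambda>i j. exp (a i * b (q j))"]
      fdet_permute_cols[OF q(1), of "\<lambda>i j. exp (a i * b j)"] by simp
  also have "of_int (sign p) * (of_int (sign q) * fdet n (\<lambda>i j. exp (a i * b j)))
        * vandermonde n (a \<circ> p) * vandermonde n (b \<circ> q)
      = (of_int (sign p) * of_int (sign p)) * (of_int (sign q) * of_int (sign q))
        * (fdet n (\<lambda>i j. exp (a i * b j)) * vandermonde n a * vandermonde n b)"
    by (simp add: vandermonde_permute p q)
  finally show ?thesis by (simp add: sq)
qed (auto simp: vandermonde_eq_0_iff[symmetric])

section \<open>The heat semigroup, Hermite polynomials and complex Gaussian integrals\<close>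

section \<open>The heat semigroup on the line\<close>

text \<open>The variance is \<open>\<tau>\<close>. At \<open>\<tau> = 0\<close> the density is 0 by
  division by zero, so \<open>heat 0\<close> is the zero map and not the identity; the semigroup
  identities therefore ask for positive times.\<close>

definition heat :: "real \<Rightarrow> (real \<Rightarrow> real) \<Rightarrow> real \<Rightarrow> real" where
  "heat \<tau> f x = (LINT y|lborel. normal_density x (sqrt \<tau>) y * f y)"

text \<open>Completing the square: an exponential tilt moves the mean of a Gaussian by
  \<open>a * \<sigma>\<^sup>2\<close>.\<close>

lemma normal_density_exp:
  assumes "\<sigma> > 0"
  shows "normal_density m \<sigma> y * exp (a * y) = exp (a * m + a\<^sup>2 * \<sigma>\<^sup>2 / 2) * normal_density (m + a * \<sigma>\<^sup>2) \<sigma> y"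
proof -
  have "- (y - m)\<^sup>2 / (2 * \<sigma>\<^sup>2) + a * y = (a * m + a\<^sup>2 * \<sigma>\<^sup>2 / 2) + - (y - (m + a * \<sigma>\<^sup>2))\<^sup>2 / (2 * \<sigma>\<^sup>2)"
    using assms by (simp add: field_simps power2_eq_square)
  then show ?thesis
    unfolding normal_density_def by (simp add: mult.assoc mult.left_commute flip: exp_add)
qed

lemma normal_density_cosh_has_integral:
  assumes "\<sigma> > 0"
  shows "has_bochner_integral lborel (\<lambda>y. normal_density m \<sigma> y * cosh (a * y)) (exp (a\<^sup>2 * \<sigma>\<^sup>2 / 2) * cosh (a * m))"
proof -
  have *: "has_bochner_integral lborel (\<lambda>y. normal_density m \<sigma> y * exp (b * y)) (exp (b * m + b\<^sup>2 * \<sigma>\<^sup>2 / 2))" for b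
    using assms
    by (simp add: normal_density_exp has_bochner_integral_iff integrable_normal_density integral_normal_density)
  have "has_bochner_integral lborel
      (\<lambda>y. (normal_density m \<sigma> y * exp (a * y) + normal_density m \<sigma> y * exp (- a * y)) / 2)
      ((exp (a * m + a\<^sup>2 * \<sigma>\<^sup>2 / 2) + exp ((- a) * m + (- a)\<^sup>2 * \<sigma>\<^sup>2 / 2)) / 2)"
    by (intro has_bochner_integral_divide_zero has_bochner_integral_add *)
  moreover have "(exp (a * m + a\<^sup>2 * \<sigma>\<^sup>2 / 2) + exp ((- a) * m + (- a)\<^sup>2 * \<sigma>\<^sup>2 / 2)) / 2
      = exp (a\<^sup>2 * \<sigma>\<^sup>2 / 2) * cosh (a * m)"
    by (simp add: cosh_def algebra_simps add_divide_distrib flip: exp_add)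
  moreover have "(normal_density m \<sigma> y * exp (a * y) + normal_density m \<sigma> y * exp (- a * y)) / 2
      = normal_density m \<sigma> y * cosh (a * y)" for y
    by (simp add: cosh_def algebra_simps add_divide_distrib)
  ultimately show ?thesis by simp
qed

lemma normal_density_cosh:
  assumes "\<sigma> > 0"
  shows "integrable lborel (\<lambda>y. normal_density m \<sigma> y * cosh y)"
    and "(LINT y|lborel. normal_density m \<sigma> y * cosh y) = exp (\<sigma>\<^sup>2 / 2) * cosh m"
  using normal_density_cosh_has_integral[OF assms, of m 1]
  by (simp_all add: has_bochner_integral_iff)

text \<open>A growth class that contains the polynomials, keeps all heat integrals finite and is
  stable under the heat semigroup and under multiplication by bounded functions.\<close>

definition cosh_bounded :: "real \<Rightarrow> (real \<Rightarrow> real) \<Rightarrow> bool" where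
  "cosh_bounded C f \<longleftrightarrow> f \<in> borel_measurable borel \<and> (\<forall>x. \<bar>f x\<bar> \<le> C * cosh x)"

lemma cosh_boundedD:
  assumes "cosh_bounded C f"
  shows "f \<in> borel_measurable borel" "\<bar>f x\<bar> \<le> C * cosh x" "C \<ge> 0"
proof -
  show "f \<in> borel_measurable borel" "\<bar>f x\<bar> \<le> C * cosh x"
    using assms by (auto simp: cosh_bounded_def)
  have "\<bar>f 0\<bar> \<le> C * cosh 0"
    using assms unfolding cosh_bounded_def by blast
  then show "C \<ge> 0" by simp
qed

lemma integrable_heat:
  assumes "cosh_bounded C f" "\<sigma> > 0"
  shows "integrable lborel (\<lambda>y. normal_density x \<sigma> y * f y)"
proof (rule Bochner_Integration.integrable_bound)
  show "integrable lborel (\<lambda>y. C * (normal_density x \<sigma> y * cosh y))"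
    using normal_density_cosh[OF assms(2)] by simp
  show "(\<lambda>y. normal_density x \<sigma> y * f y) \<in> borel_measurable lborel"
    using cosh_boundedD(1)[OF assms(1)] by simp
  show "AE y in lborel. norm (normal_density x \<sigma> y * f y) \<le> norm (C * (normal_density x \<sigma> y * cosh y))"
  proof (rule AE_I2)
    fix y
    have "\<bar>normal_density x \<sigma> y * f y\<bar> \<le> normal_density x \<sigma> y * (C * cosh y)"
      unfolding abs_mult using cosh_boundedD(2)[OF assms(1), of y] by (intro mult_mono) auto
    also have "\<dots> = \<bar>C * (normal_density x \<sigma> y * cosh y)\<bar>"
      using cosh_boundedD(3)[OF assms(1)] by (simp add: abs_mult)
    finally show "norm (normal_density x \<sigma> y * f y) \<le> norm (C * (normal_density x \<sigma> y * cosh y))"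
      by simp
  qed
qed

text \<open>With the Gaussian centred at 0 the starting point enters only through the argument of
  \<open>f\<close>, which is how the noise of an Euler step appears.\<close>

lemma heat_shift: "heat \<tau> f x = (LINT w|lborel. normal_density 0 (sqrt \<tau>) w * f (x + w))"
  unfolding heat_def
  by (subst lborel_integral_real_affine[where c = 1 and t = x]) (auto simp: normal_density_def)

lemma heat_measurable [measurable]:
  assumes [measurable]: "f \<in> borel_measurable borel"
  shows "heat \<tau> f \<in> borel_measurable borel"
  unfolding heat_def normal_density_def by measurable

lemma heat_bounded:
  assumes "cosh_bounded C f" "\<tau> > 0"
  shows "cosh_bounded (exp (\<tau> / 2) * C) (heat \<tau> f)"
  unfolding cosh_bounded_def
proof (intro conjI allI)
  show "heat \<tau> f \<in> borel_measurable borel"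
    using cosh_boundedD(1)[OF assms(1)] by simp
  fix x
  have "\<bar>heat \<tau> f x\<bar> \<le> (LINT y|lborel. C * (normal_density x (sqrt \<tau>) y * cosh y))"
    unfolding heat_def
  proof (rule integral_abs_bound_integral)
    show "integrable lborel (\<lambda>y. normal_density x (sqrt \<tau>) y * f y)"
      using assms by (intro integrable_heat) auto
    show "integrable lborel (\<lambda>y. C * (normal_density x (sqrt \<tau>) y * cosh y))"
      using normal_density_cosh[of "sqrt \<tau>"] assms by simp
    show "\<bar>normal_density x (sqrt \<tau>) y * f y\<bar> \<le> C * (normal_density x (sqrt \<tau>) y * cosh y)" for y
      using mult_left_mono[OF cosh_boundedD(2)[OF assms(1), of y], of "normal_density x (sqrt \<tau>) y"]
      by (simp add: abs_mult algebra_simps)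
  qed
  also have "\<dots> = exp (\<tau> / 2) * C * cosh x"
    using normal_density_cosh[of "sqrt \<tau>"] assms by simp
  finally show "\<bar>heat \<tau> f x\<bar> \<le> exp (\<tau> / 2) * C * cosh x" .
qed

text \<open>The Chapman-Kolmogorov identity, reduced to the convolution of two centred Gaussians by
  a shift of the variable by \<open>z\<close>.\<close>

lemma normal_density_convolution:
  assumes "\<sigma> > 0" "\<tau> > 0"
  shows "has_bochner_integral lborel (\<lambda>y. normal_density x \<sigma> y * normal_density y \<tau> z)
    (normal_density x (sqrt (\<sigma>\<^sup>2 + \<tau>\<^sup>2)) z)"
proof (rule has_bochner_integral_nn_integral)
  have "(\<integral>\<^sup>+ y. ennreal (normal_density x \<sigma> y * normal_density y \<tau> z) \<partial>lborel)
      = (\<integral>\<^sup>+ y. ennreal (normal_density 0 \<sigma> ((x - z) - y) * normal_density 0 \<tau> y) \<partial>lborel)"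
    by (subst nn_integral_real_affine[where c = 1 and t = z])
      (auto simp: normal_density_def power2_commute algebra_simps intro!: nn_integral_cong)
  also have "\<dots> = ennreal (normal_density 0 (sqrt (\<sigma>\<^sup>2 + \<tau>\<^sup>2)) (x - z))"
    using fun_cong[OF conv_normal_density_zero_mean[OF assms]] by simp
  also have "normal_density 0 (sqrt (\<sigma>\<^sup>2 + \<tau>\<^sup>2)) (x - z) = normal_density x (sqrt (\<sigma>\<^sup>2 + \<tau>\<^sup>2)) z"
    by (simp add: normal_density_def power2_commute)
  finally show "(\<integral>\<^sup>+ y. ennreal (normal_density x \<sigma> y * normal_density y \<tau> z) \<partial>lborel)
      = ennreal (normal_density x (sqrt (\<sigma>\<^sup>2 + \<tau>\<^sup>2)) z)" .
qed (auto simp: normal_density_def)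

text \<open>Fubini and the Chapman-Kolmogorov identity. The exchange is justified by applying
  \<open>heat_bounded\<close> to the absolute value of \<open>f\<close>.\<close>

lemma heat_heat:
  assumes f: "cosh_bounded C f" and "s > 0" "t > 0"
  shows "heat s (heat t f) x = heat (s + t) f x"
proof -
  have [measurable]: "f \<in> borel_measurable borel" by (rule cosh_boundedD[OF f])
  define h where "h y z = normal_density x (sqrt s) y * (normal_density y (sqrt t) z * f z)" for y z
  have meas [measurable]: "case_prod h \<in> borel_measurable (lborel \<Otimes>\<^sub>M lborel)"
    unfolding h_def normal_density_def by measurable
  have abs_f: "cosh_bounded C (\<lambda>z. \<bar>f z\<bar>)" using f by (auto simp: cosh_bounded_def)
  have int: "integrable (lborel \<Otimes>\<^sub>M lborel) (case_prod h)"
  proof (rule lborel_pair.Fubini_integrable[OF meas])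
    have "(LINT z|lborel. norm (h y z)) = normal_density x (sqrt s) y * heat t (\<lambda>z. \<bar>f z\<bar>) y" for y
      by (simp add: h_def abs_mult heat_def)
    then show "integrable lborel (\<lambda>y. LINT z|lborel. norm (case (y, z) of (y, z) \<Rightarrow> h y z))"
      using integrable_heat[OF heat_bounded[OF abs_f \<open>t > 0\<close>], of "sqrt s"] \<open>s > 0\<close> by simp
    show "AE y in lborel. integrable lborel (\<lambda>z. case (y, z) of (y, z) \<Rightarrow> h y z)"
      using integrable_heat[OF f] \<open>t > 0\<close> by (simp add: h_def)
  qed
  have "heat s (heat t f) x = (LINT y|lborel. LINT z|lborel. h y z)"
    by (simp add: heat_def h_def)
  also have "\<dots> = (LINT z|lborel. LINT y|lborel. h y z)"
    using lborel_pair.Fubini_integral[OF int] by simp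
  also have "\<dots> = (LINT z|lborel. normal_density x (sqrt (s + t)) z * f z)"
  proof (intro Bochner_Integration.integral_cong refl)
    fix z
    have "(LINT y|lborel. h y z) = (LINT y|lborel. normal_density x (sqrt s) y * normal_density y (sqrt t) z) * f z"
      by (simp add: h_def mult.assoc[symmetric])
    then show "(LINT y|lborel. h y z) = normal_density x (sqrt (s + t)) z * f z"
      using normal_density_convolution[of "sqrt s" "sqrt t" x z] \<open>s > 0\<close> \<open>t > 0\<close>
      by (simp add: has_bochner_integral_iff)
  qed
  finally show ?thesis by (simp add: heat_def)
qed

text \<open>The weight \<open>cosh\<close> is an eigenfunction of the heat semigroup, so these bounds survive
  any number of steps with a constant that depends on the total time only.\<close>

definition cosh_lipschitz :: "real \<Rightarrow> real \<Rightarrow> (real \<Rightarrow> real) \<Rightarrow> bool" where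
  "cosh_lipschitz C D f \<longleftrightarrow> D \<ge> 0 \<and> (\<forall>x. \<bar>f x\<bar> \<le> C * cosh x) \<and>
     (\<forall>x y. \<bar>f x - f y\<bar> \<le> D * \<bar>x - y\<bar> * (cosh x + cosh y))"

lemma cosh_lipschitz_continuous:
  assumes "cosh_lipschitz C D f"
  shows "continuous_on UNIV f"
proof (rule continuous_at_imp_continuous_on, rule ballI)
  fix x :: real
  have lim: "((\<lambda>y. D * \<bar>y - x\<bar> * (cosh y + cosh x)) \<longlongrightarrow> D * \<bar>x - x\<bar> * (cosh x + cosh x)) (at x)"
    by (intro tendsto_intros)
  have "((\<lambda>y. f y - f x) \<longlongrightarrow> 0) (at x)"
  proof (rule Lim_null_comparison)
    show "((\<lambda>y. D * \<bar>y - x\<bar> * (cosh y + cosh x)) \<longlongrightarrow> 0) (at x)"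
      using lim by simp
  qed (use assms in \<open>auto simp: cosh_lipschitz_def\<close>)
  then show "isCont f x"
    by (simp add: continuous_at LIM_zero_iff)
qed

lemma cosh_lipschitz_bounded:
  assumes "cosh_lipschitz C D f"
  shows "cosh_bounded C f"
  using assms borel_measurable_continuous_onI[OF cosh_lipschitz_continuous[OF assms]]
  by (auto simp: cosh_bounded_def cosh_lipschitz_def)

lemma cosh_lipschitz_mono:
  assumes "cosh_lipschitz C D f" "C \<le> C'" "D \<le> D'"
  shows "cosh_lipschitz C' D' f"
  unfolding cosh_lipschitz_def
proof (intro conjI allI)
  show "D' \<ge> 0" using assms by (auto simp: cosh_lipschitz_def)
  show "\<bar>f x\<bar> \<le> C' * cosh x" for x
    using assms order_trans[OF _ mult_right_mono[OF assms(2)], of _ "cosh x"]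
    by (auto simp: cosh_lipschitz_def)
  fix x y :: real
  have "D * (\<bar>x - y\<bar> * (cosh x + cosh y)) \<le> D' * (\<bar>x - y\<bar> * (cosh x + cosh y))"
    using assms(3) by (intro mult_right_mono mult_nonneg_nonneg add_nonneg_nonneg) auto
  then show "\<bar>f x - f y\<bar> \<le> D' * \<bar>x - y\<bar> * (cosh x + cosh y)"
    using assms(1) by (auto simp: cosh_lipschitz_def mult.assoc intro: order_trans)
qed

text \<open>Both values are written as integrals against the same centred Gaussian, so the estimate
  for \<open>f\<close> at \<open>x + w\<close> and \<open>y + w\<close> can be integrated over
  \<open>w\<close>; the \<open>cosh\<close> terms only pick up the factor
  \<open>exp (\<tau> / 2)\<close>.\<close>

lemma heat_lipschitz:
  assumes f: "cosh_lipschitz C D f" and "\<tau> > 0"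
  shows "cosh_lipschitz (exp (\<tau> / 2) * C) (exp (\<tau> / 2) * D) (heat \<tau> f)"
  unfolding cosh_lipschitz_def
proof (intro conjI allI)
  note b = cosh_lipschitz_bounded[OF f]
  have D: "D \<ge> 0" using f by (simp add: cosh_lipschitz_def)
  then show "exp (\<tau> / 2) * D \<ge> 0" by simp
  show "\<bar>heat \<tau> f x\<bar> \<le> exp (\<tau> / 2) * C * cosh x" for x
    using cosh_boundedD(2)[OF heat_bounded[OF b \<open>\<tau> > 0\<close>]] .
  fix x y :: real
  let ?n = "normal_density 0 (sqrt \<tau>)"
  have shift: "has_bochner_integral lborel (\<lambda>w. ?n w * g (z + w)) (LINT w|lborel. normal_density z (sqrt \<tau>) w * g w)"
    if "integrable lborel (\<lambda>w. normal_density z (sqrt \<tau>) w * g w)" for g z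
  proof -
    have "has_bochner_integral lborel (\<lambda>w. normal_density z (sqrt \<tau>) w * g w)
        (LINT w|lborel. normal_density z (sqrt \<tau>) w * g w)"
      using that by (simp add: has_bochner_integral_iff)
    from lborel_has_bochner_integral_real_affine_iff[of 1, THEN iffD1, OF _ this, of z]
    show ?thesis by (simp add: normal_density_def)
  qed
  have fs: "has_bochner_integral lborel (\<lambda>w. ?n w * f (z + w)) (heat \<tau> f z)" for z
    unfolding heat_def using integrable_heat[OF b] \<open>\<tau> > 0\<close> by (intro shift) auto
  have cs: "has_bochner_integral lborel (\<lambda>w. ?n w * cosh (z + w)) (exp (\<tau> / 2) * cosh z)" for z
    using shift[of z cosh] normal_density_cosh[of "sqrt \<tau>" z] \<open>\<tau> > 0\<close> by simp
  have diff: "has_bochner_integral lborel (\<lambda>w. ?n w * f (x + w) - ?n w * f (y + w)) (heat \<tau> f x - heat \<tau> f y)"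
    by (intro has_bochner_integral_diff fs)
  have bnd: "has_bochner_integral lborel (\<lambda>w. D * \<bar>x - y\<bar> * (?n w * cosh (x + w) + ?n w * cosh (y + w)))
      (D * \<bar>x - y\<bar> * (exp (\<tau> / 2) * cosh x + exp (\<tau> / 2) * cosh y))"
    by (intro has_bochner_integral_mult_right has_bochner_integral_add cs)
  have "\<bar>heat \<tau> f x - heat \<tau> f y\<bar> \<le> D * \<bar>x - y\<bar> * (exp (\<tau> / 2) * cosh x + exp (\<tau> / 2) * cosh y)"
    unfolding has_bochner_integral_integral_eq[OF diff, symmetric] has_bochner_integral_integral_eq[OF bnd, symmetric]
  proof (rule integral_abs_bound_integral)
    fix w
    have "\<bar>f (x + w) - f (y + w)\<bar> \<le> D * \<bar>x - y\<bar> * (cosh (x + w) + cosh (y + w))"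
      using f[unfolded cosh_lipschitz_def] by (metis add_diff_cancel_right)
    from mult_left_mono[OF this, of "?n w"]
    show "\<bar>?n w * f (x + w) - ?n w * f (y + w)\<bar> \<le> D * \<bar>x - y\<bar> * (?n w * cosh (x + w) + ?n w * cosh (y + w))"
      unfolding right_diff_distrib[symmetric] abs_mult by (simp add: algebra_simps)
  qed (use diff bnd in \<open>auto simp: has_bochner_integral_iff\<close>)
  then show "\<bar>heat \<tau> f x - heat \<tau> f y\<bar> \<le> exp (\<tau> / 2) * D * \<bar>x - y\<bar> * (cosh x + cosh y)"
    by (simp add: algebra_simps)
qed

lemma cosh_lipschitz_mult:
  assumes f: "cosh_lipschitz C D f" and g: "\<And>x. \<bar>g x\<bar> \<le> c" "\<And>x y. \<bar>g x - g y\<bar> \<le> l * \<bar>x - y\<bar>"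
    and "l \<ge> 0"
  shows "cosh_lipschitz (c * C) (c * D + l * C) (\<lambda>x. g x * f x)"
  unfolding cosh_lipschitz_def
proof (intro conjI allI)
  have c: "c \<ge> 0" using g(1)[of 0] by linarith
  have D: "D \<ge> 0" using f by (simp add: cosh_lipschitz_def)
  note b = cosh_boundedD[OF cosh_lipschitz_bounded[OF f]]
  show "c * D + l * C \<ge> 0" using c D b(3) \<open>l \<ge> 0\<close> by simp
  show "\<bar>g x * f x\<bar> \<le> c * C * cosh x" for x
    unfolding abs_mult mult.assoc using g(1) b(2) c by (intro mult_mono) auto
  fix x y
  have "\<bar>g x * f x - g y * f y\<bar> = \<bar>g x * (f x - f y) + (g x - g y) * f y\<bar>"
    by (simp add: algebra_simps)
  also have "\<dots> \<le> \<bar>g x\<bar> * \<bar>f x - f y\<bar> + \<bar>g x - g y\<bar> * \<bar>f y\<bar>"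
    by (metis abs_mult abs_triangle_ineq)
  also have "\<dots> \<le> c * (D * \<bar>x - y\<bar> * (cosh x + cosh y)) + (l * \<bar>x - y\<bar>) * (C * cosh y)"
    using f g b(2)[of y] c \<open>l \<ge> 0\<close> unfolding cosh_lipschitz_def
    by (intro add_mono mult_mono) auto
  also have "\<dots> \<le> c * (D * \<bar>x - y\<bar> * (cosh x + cosh y)) + (l * \<bar>x - y\<bar>) * (C * (cosh x + cosh y))"
    using b(3) \<open>l \<ge> 0\<close> by (intro add_left_mono mult_left_mono) auto
  finally show "\<bar>g x * f x - g y * f y\<bar> \<le> (c * D + l * C) * \<bar>x - y\<bar> * (cosh x + cosh y)"
    by (simp add: algebra_simps)
qed

lemma power_le_cosh: "\<bar>x :: real\<bar> ^ n \<le> 2 * fact n * cosh x"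
proof -
  have "\<bar>x\<bar> ^ n /\<^sub>R fact n \<le> exp \<bar>x\<bar>"
  proof -
    have "(\<Sum>k\<in>{n}. \<bar>x\<bar> ^ k /\<^sub>R fact k) \<le> (\<Sum>k. \<bar>x\<bar> ^ k /\<^sub>R fact k)"
      by (intro sum_le_suminf summable_exp_generic) auto
    then show ?thesis by (simp add: exp_def)
  qed
  then have "\<bar>x\<bar> ^ n \<le> fact n * exp \<bar>x\<bar>" by (simp add: field_simps)
  also have "exp \<bar>x\<bar> \<le> 2 * cosh x"
    by (cases "x \<ge> 0") (auto simp: cosh_def)
  finally show ?thesis by (simp add: algebra_simps)
qed

lemma poly_le_cosh: "\<exists>C. \<forall>x :: real. \<bar>poly p x\<bar> \<le> C * cosh x"
proof (intro exI allI)
  fix x :: real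
  have "\<bar>poly p x\<bar> \<le> (\<Sum>i\<le>degree p. \<bar>Polynomial.coeff p i\<bar> * \<bar>x\<bar> ^ i)"
    unfolding poly_altdef by (rule order_trans[OF sum_abs]) (simp add: abs_mult power_abs)
  also have "\<dots> \<le> (\<Sum>i\<le>degree p. \<bar>Polynomial.coeff p i\<bar> * (2 * fact i * cosh x))"
    by (intro sum_mono mult_left_mono power_le_cosh) auto
  finally show "\<bar>poly p x\<bar> \<le> (\<Sum>i\<le>degree p. \<bar>Polynomial.coeff p i\<bar> * (2 * fact i)) * cosh x"
    by (simp add: sum_distrib_right mult.assoc)
qed

text \<open>The mean value theorem produces an unknown intermediate point; the symmetric weight
  \<open>cosh x + cosh y\<close> of \<open>cosh_lipschitz\<close> absorbs it.\<close>

lemma cosh_between: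
  assumes "x \<le> (z::real)" "z \<le> y"
  shows "cosh z \<le> cosh x + cosh y"
proof -
  have "\<bar>z\<bar> \<le> \<bar>x\<bar> \<or> \<bar>z\<bar> \<le> \<bar>y\<bar>" using assms by linarith
  then have "cosh z \<le> cosh x \<or> cosh z \<le> cosh y"
    by (metis abs_ge_zero cosh_real_abs cosh_real_nonneg_le_iff)
  then show ?thesis using cosh_real_pos[of x] cosh_real_pos[of y] by linarith
qed

lemma poly_cosh_lipschitz: "\<exists>C D. cosh_lipschitz C D (poly p)"
proof -
  obtain C C' where C: "\<And>x. \<bar>poly p x\<bar> \<le> C * cosh x" "\<And>x. \<bar>poly (pderiv p) x\<bar> \<le> C' * cosh x"
    using poly_le_cosh by metis
  have C': "C' \<ge> 0" using order_trans[OF abs_ge_zero C(2)[of 0]] by simp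
  have less: "\<bar>poly p x - poly p y\<bar> \<le> C' * \<bar>x - y\<bar> * (cosh x + cosh y)" if xy: "x < y" for x y
  proof -
    obtain z where z: "x < z" "z < y" "poly p y - poly p x = (y - x) * poly (pderiv p) z"
      using poly_MVT[OF xy] by blast
    have "\<bar>poly p x - poly p y\<bar> = \<bar>x - y\<bar> * \<bar>poly (pderiv p) z\<bar>"
      using z(3) by (metis abs_minus_commute abs_mult)
    also have "\<dots> \<le> \<bar>x - y\<bar> * (C' * (cosh x + cosh y))"
      using z C' by (intro mult_left_mono order_trans[OF C(2)] cosh_between) auto
    finally show ?thesis by (simp add: algebra_simps)
  qed
  have "\<bar>poly p x - poly p y\<bar> \<le> C' * \<bar>x - y\<bar> * (cosh x + cosh y)" for x y
    using less[of x y] less[of y x] by (cases x y rule: linorder_cases) (auto simp: abs_minus_commute add.commute)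
  with C C' have "cosh_lipschitz C C' (poly p)" by (auto simp: cosh_lipschitz_def)
  then show ?thesis by blast
qed

section \<open>Hermite polynomials and Gaussian integrals\<close>

text \<open>The backward heat flow of the power of degree n: formally
  \<open>exp (- t D\<^sup>2 / 2)\<close> applied to it, with \<open>D\<close> the derivative. For
  positive \<open>t\<close> this is the probabilists' Hermite polynomial rescaled to variance
  \<open>t\<close>. The recursion through the derivative matches Gaussian integration by
  parts.\<close>

primrec hermite :: "real \<Rightarrow> nat \<Rightarrow> real poly" where
  "hermite t 0 = 1"
| "hermite t (Suc n) = [:0, 1:] * hermite t n - Polynomial.smult t (pderiv (hermite t n))"

text \<open>The Appell property. It eliminates the derivative from the defining recursion and leaves
  the three-term recursion of \<open>hermite_Suc_Suc\<close>.\<close>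

lemma pderiv_hermite: "pderiv (hermite t (Suc n)) = Polynomial.smult (of_nat (Suc n)) (hermite t n)"
proof (induction n)
  case (Suc n)
  have "pderiv (hermite t (Suc (Suc n)))
      = hermite t (Suc n) + [:0, 1:] * pderiv (hermite t (Suc n)) - Polynomial.smult t (pderiv (pderiv (hermite t (Suc n))))"
    by (simp only: hermite.simps(2)[of t "Suc n"] pderiv_diff pderiv_mult pderiv_smult)
      (simp add: pderiv_pCons)
  also have "\<dots> = hermite t (Suc n) + [:0, 1:] * Polynomial.smult (of_nat (Suc n)) (hermite t n)
      - Polynomial.smult t (pderiv (Polynomial.smult (of_nat (Suc n)) (hermite t n)))"
    by (simp only: Suc.IH)
  also have "\<dots> = hermite t (Suc n) + Polynomial.smult (of_nat (Suc n)) (hermite t (Suc n))"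
    by (simp add: pderiv_smult smult_diff_right mult.commute)
  also have "\<dots> = Polynomial.smult (of_nat (Suc (Suc n))) (hermite t (Suc n))"
    by (simp only: of_nat_Suc[of "Suc n"] smult_add_left smult_1_left)
  finally show ?case .
qed (simp add: pderiv_pCons)

lemma hermite_Suc_Suc:
  "hermite t (Suc (Suc n)) = [:0, 1:] * hermite t (Suc n) - Polynomial.smult (t * of_nat (Suc n)) (hermite t n)"
  by (simp only: hermite.simps(2)[of t "Suc n"] pderiv_hermite smult_smult)

lemma degree_hermite [simp]: "degree (hermite t n) = n"
  and lead_coeff_hermite: "Polynomial.coeff (hermite t n) n = 1"
proof -
  have "degree (hermite t n) = n \<and> Polynomial.coeff (hermite t n) n = 1"
  proof (induction n)
    case (Suc n)
    have nz: "hermite t n \<noteq> 0" using Suc by auto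
    have "degree (Polynomial.smult t (pderiv (hermite t n))) \<le> n - 1"
      using Suc degree_smult_le[of t "pderiv (hermite t n)"] by (simp add: degree_pderiv)
    then have less: "degree (- Polynomial.smult t (pderiv (hermite t n))) < degree ([:0, 1:] * hermite t n)"
      using Suc nz by (simp add: degree_mult_eq)
    have "degree (hermite t (Suc n)) = Suc n"
      using degree_add_eq_left[OF less] Suc nz by (simp add: degree_mult_eq)
    moreover have "Polynomial.coeff (Polynomial.smult t (pderiv (hermite t n))) (Suc n) = 0"
      using less Suc nz by (intro coeff_eq_0) (simp add: degree_mult_eq)
    ultimately show ?case using Suc by simp
  qed simp
  then show "degree (hermite t n) = n" "Polynomial.coeff (hermite t n) n = 1" by auto
qed

text \<open>Since \<open>heat_hermite\<close> lowers the time in every entry, having this for all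
  \<open>t\<close> makes the Vandermonde determinant harmonic for independent Brownian
  motions.\<close>

lemma fdet_hermite: "fdet n (\<lambda>i j. poly (hermite t j) (x i)) = vandermonde n x"
  using fdet_monic_polys[of n "hermite t" x] by (simp add: lead_coeff_hermite fdet_vandermonde)

lemma hermite_0: "hermite 0 n = monom 1 n"
  by (induction n) (auto simp: monom_Suc one_pCons)

lemma cpoly_le_cosh: "\<exists>C. \<forall>x. cmod (poly p (complex_of_real x)) \<le> C * cosh x"
proof (intro exI allI)
  fix x :: real
  have "cmod (poly p (complex_of_real x)) \<le> (\<Sum>i\<le>degree p. cmod (Polynomial.coeff p i) * \<bar>x\<bar> ^ i)"
    unfolding poly_altdef by (rule order_trans[OF norm_sum]) (simp add: norm_mult norm_power)
  also have "\<dots> \<le> (\<Sum>i\<le>degree p. cmod (Polynomial.coeff p i) * (2 * fact i * cosh x))"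
    by (intro sum_mono mult_left_mono power_le_cosh) auto
  finally show "cmod (poly p (complex_of_real x)) \<le> (\<Sum>i\<le>degree p. cmod (Polynomial.coeff p i) * (2 * fact i)) * cosh x"
    by (simp add: sum_distrib_right mult.assoc)
qed

text \<open>Removes the boundary terms of the Gaussian integration by parts.\<close>

lemma normal_density_cosh_tendsto:
  assumes "\<sigma> > 0"
  shows "((\<lambda>w. normal_density m \<sigma> w * cosh w) \<longlongrightarrow> 0) at_top"
    and "((\<lambda>w. normal_density m \<sigma> w * cosh w) \<longlongrightarrow> 0) at_bot"
proof -
  have eq: "normal_density m \<sigma> w * cosh w = (exp (m + \<sigma>\<^sup>2 / 2) * normal_density (m + \<sigma>\<^sup>2) \<sigma> w
      + exp (- m + \<sigma>\<^sup>2 / 2) * normal_density (m - \<sigma>\<^sup>2) \<sigma> w) / 2" for w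
    using normal_density_exp[OF assms, of m w 1] normal_density_exp[OF assms, of m w "-1"]
    by (simp add: cosh_def algebra_simps)
  have top: "((\<lambda>w. normal_density a \<sigma> w) \<longlongrightarrow> 0) at_top" for a
    unfolding normal_density_def using assms by real_asymp
  have bot: "((\<lambda>w. normal_density a \<sigma> w) \<longlongrightarrow> 0) at_bot" for a
    unfolding normal_density_def using assms by real_asymp
  show "((\<lambda>w. normal_density m \<sigma> w * cosh w) \<longlongrightarrow> 0) at_top"
    unfolding eq by (auto intro!: tendsto_eq_intros top)
  show "((\<lambda>w. normal_density m \<sigma> w * cosh w) \<longlongrightarrow> 0) at_bot"
    unfolding eq by (auto intro!: tendsto_eq_intros bot)
qed

text \<open>For \<open>c = \<i> * y\<close> this is the integral in \<open>mart\<close>, for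
  \<open>c = - x\<close> it is the heat semigroup acting on a polynomial; one integration by parts
  serves both.\<close>

definition cgauss :: "complex \<Rightarrow> real \<Rightarrow> complex poly \<Rightarrow> complex" where
  "cgauss c t p = (LINT w|lborel. complex_of_real (1 / sqrt (2 * pi * t))
     * exp (- ((c + complex_of_real w)\<^sup>2 / complex_of_real (2 * t))) * poly p (complex_of_real w))"

text \<open>The real part of the complex exponent is a real Gaussian exponent centred at
  \<open>- Re c\<close> plus the constant \<open>(Im c)\<^sup>2 / (2 * t)\<close>.\<close>

lemma cgauss_integrand_bound:
  assumes "t > 0"
  shows "\<exists>K\<ge>0. \<forall>w. cmod (complex_of_real (1 / sqrt (2 * pi * t))
     * exp (- ((c + complex_of_real w)\<^sup>2 / complex_of_real (2 * t))) * poly p (complex_of_real w))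
     \<le> K * (normal_density (- Re c) (sqrt t) w * cosh w)"
proof -
  obtain C where C: "\<And>w. cmod (poly p (complex_of_real w)) \<le> C * cosh w"
    using cpoly_le_cosh[of p] by blast
  have C0: "C \<ge> 0" using order_trans[OF norm_ge_zero C[of 0]] by simp
  let ?K = "exp ((Im c)\<^sup>2 / (2 * t))"
  have nd: "cmod (complex_of_real (1 / sqrt (2 * pi * t)) * exp (- ((c + complex_of_real w)\<^sup>2 / complex_of_real (2 * t))))
      = ?K * normal_density (- Re c) (sqrt t) w" for w
  proof -
    have "Re (- ((c + complex_of_real w)\<^sup>2 / complex_of_real (2 * t)))
        = (Im c)\<^sup>2 / (2 * t) + - (w - - Re c)\<^sup>2 / (2 * t)"
      using assms by (simp add: Re_divide_of_real power2_eq_square field_simps)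
    then have "cmod (complex_of_real (1 / sqrt (2 * pi * t)) * exp (- ((c + complex_of_real w)\<^sup>2 / complex_of_real (2 * t))))
        = \<bar>1 / sqrt (2 * pi * t)\<bar> * (?K * exp (- (w - - Re c)\<^sup>2 / (2 * t)))"
      by (simp only: norm_mult norm_exp_eq_Re norm_of_real exp_add)
    then show ?thesis using assms by (simp add: normal_density_def)
  qed
  show ?thesis
  proof (intro exI[of _ "?K * C"] conjI allI)
    fix w
    have "?K * normal_density (- Re c) (sqrt t) w * cmod (poly p (complex_of_real w))
        \<le> ?K * normal_density (- Re c) (sqrt t) w * (C * cosh w)"
      by (intro mult_left_mono C) auto
    then show "cmod (complex_of_real (1 / sqrt (2 * pi * t))
       * exp (- ((c + complex_of_real w)\<^sup>2 / complex_of_real (2 * t))) * poly p (complex_of_real w))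
       \<le> ?K * C * (normal_density (- Re c) (sqrt t) w * cosh w)"
      by (subst norm_mult, subst nd) (simp only: mult_ac)
  qed (use C0 in simp)
qed

lemma cgauss_integrable:
  assumes "t > 0"
  shows "integrable lborel (\<lambda>w. complex_of_real (1 / sqrt (2 * pi * t))
     * exp (- ((c + complex_of_real w)\<^sup>2 / complex_of_real (2 * t))) * poly p (complex_of_real w))"
proof -
  obtain K where K: "K \<ge> 0" "\<And>w. cmod (complex_of_real (1 / sqrt (2 * pi * t))
     * exp (- ((c + complex_of_real w)\<^sup>2 / complex_of_real (2 * t))) * poly p (complex_of_real w))
     \<le> K * (normal_density (- Re c) (sqrt t) w * cosh w)"
    using cgauss_integrand_bound[OF assms, of c p] by blast
  show ?thesis
  proof (rule Bochner_Integration.integrable_bound)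
    show "integrable lborel (\<lambda>w. K * (normal_density (- Re c) (sqrt t) w * cosh w))"
      using normal_density_cosh[of "sqrt t"] assms by simp
    have "continuous_on UNIV (\<lambda>w. complex_of_real (1 / sqrt (2 * pi * t))
     * exp (- ((c + complex_of_real w)\<^sup>2 / complex_of_real (2 * t))) * poly p (complex_of_real w))"
      using assms by (intro continuous_intros) auto
    then show "(\<lambda>w. complex_of_real (1 / sqrt (2 * pi * t))
     * exp (- ((c + complex_of_real w)\<^sup>2 / complex_of_real (2 * t))) * poly p (complex_of_real w))
      \<in> borel_measurable lborel"
      by (simp add: borel_measurable_continuous_onI)
    show "AE w in lborel. norm (complex_of_real (1 / sqrt (2 * pi * t))
       * exp (- ((c + complex_of_real w)\<^sup>2 / complex_of_real (2 * t))) * poly p (complex_of_real w))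
      \<le> norm (K * (normal_density (- Re c) (sqrt t) w * cosh w))"
      by (rule AE_I2) (metis K(2) abs_ge_self order_trans real_norm_def)
  qed
qed

lemma integral_derivative_real_line:
  fixes G g :: "real \<Rightarrow> complex"
  assumes "\<And>x. (G has_vector_derivative g x) (at x)" "\<And>x. isCont g x" "integrable lborel g"
    "(G \<longlongrightarrow> 0) at_top" "(G \<longlongrightarrow> 0) at_bot"
  shows "(LINT x|lborel. g x) = 0"
proof -
  have "(LBINT x=-\<infinity>..\<infinity>. g x) = 0 - 0"
  proof (rule interval_integral_FTC_integrable)
    show "set_integrable lborel (einterval (- \<infinity>) \<infinity>) g"
      using assms(3) by (simp add: set_integrable_def)
    show "((G \<circ> real_of_ereal) \<longlongrightarrow> 0) (at_right (- \<infinity>))" "((G \<circ> real_of_ereal) \<longlongrightarrow> 0) (at_left \<infinity>)"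
      using assms(4,5) by (simp_all add: ereal_tendsto_simps)
  qed (use assms in auto)
  then show ?thesis
    by (simp add: interval_lebesgue_integral_def set_lebesgue_integral_def)
qed

lemma cgauss_add: "t > 0 \<Longrightarrow> cgauss c t (p + q) = cgauss c t p + cgauss c t q"
  unfolding cgauss_def poly_add distrib_left
  by (intro Bochner_Integration.integral_add cgauss_integrable)

lemma cgauss_smult: "cgauss c t (Polynomial.smult a p) = a * cgauss c t p"
  unfolding cgauss_def by (simp add: mult.left_commute)

lemma cgauss_sum: "t > 0 \<Longrightarrow> cgauss c t (\<Sum>i\<in>I. p i) = (\<Sum>i\<in>I. cgauss c t (p i))"
  by (induction I rule: infinite_finite_induct) (auto simp: cgauss_add, auto simp: cgauss_def)

text \<open>Gaussian integration by parts (Stein's identity) with a complex centre.\<close>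

lemma cgauss_stein:
  assumes t: "t > 0"
  shows "cgauss c t ([:0, 1:] * p) = - c * cgauss c t p + of_real t * cgauss c t (pderiv p)"
proof -
  define E where "E z = of_real (1 / sqrt (2 * pi * t)) * exp (- ((c + z)\<^sup>2 / of_real (2 * t)))" for z
  \<comment> \<open>A primitive of \<open>g\<close>: differentiating the Gaussian factor brings down
    \<open>- (c + z) / t\<close>, which explains the prefactor \<open>- t\<close>.\<close>
  define G where "G z = - of_real t * (E z * poly p z)" for z
  define g where "g z = E z * poly ([:c, 1:] * p - Polynomial.smult (of_real t) (pderiv p)) z" for z
  have der: "(G has_field_derivative g z) (at z)" for z
    unfolding G_def g_def E_def using t
    by (auto intro!: derivative_eq_intros simp: field_simps power2_eq_square)
  have "(LINT w|lborel. g (complex_of_real w)) = 0"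
  proof (rule integral_derivative_real_line[where G = "\<lambda>w. G (complex_of_real w)"])
    show "((\<lambda>w. G (complex_of_real w)) has_vector_derivative g (complex_of_real x)) (at x)" for x
      using der by (intro has_vector_derivative_real_field)
    show "isCont (\<lambda>w. g (complex_of_real w)) x" for x
      unfolding g_def E_def using t by (intro continuous_intros) auto
    show "integrable lborel (\<lambda>w. g (complex_of_real w))"
      unfolding g_def E_def by (rule cgauss_integrable[OF t])
    obtain K where K: "K \<ge> 0" "\<And>w. cmod (E (complex_of_real w) * poly p (complex_of_real w))
        \<le> K * (normal_density (- Re c) (sqrt t) w * cosh w)"
      using cgauss_integrand_bound[OF t, of c p] unfolding E_def by blast
    have bnd: "cmod (G (complex_of_real w)) \<le> t * K * (normal_density (- Re c) (sqrt t) w * cosh w)" for w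
      using mult_left_mono[OF K(2)[of w], of t] t by (simp add: G_def norm_mult mult_ac)
    have st: "sqrt t > 0" using t by simp
    show "((\<lambda>w. G (complex_of_real w)) \<longlongrightarrow> 0) at_top"
      by (rule Lim_null_comparison[OF always_eventually[OF allI[OF bnd]]])
        (rule tendsto_mult_right_zero[OF normal_density_cosh_tendsto(1)[OF st]])
    show "((\<lambda>w. G (complex_of_real w)) \<longlongrightarrow> 0) at_bot"
      by (rule Lim_null_comparison[OF always_eventually[OF allI[OF bnd]]])
        (rule tendsto_mult_right_zero[OF normal_density_cosh_tendsto(2)[OF st]])
  qed
  then have "cgauss c t ([:c, 1:] * p - Polynomial.smult (of_real t) (pderiv p)) = 0"
    by (simp add: cgauss_def g_def E_def)
  moreover have "[:c, 1:] * p - Polynomial.smult (of_real t) (pderiv p)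
      = [:0, 1:] * p + (Polynomial.smult c p + Polynomial.smult (- of_real t) (pderiv p))"
    by simp
  ultimately have "cgauss c t ([:0, 1:] * p) + (c * cgauss c t p + - of_real t * cgauss c t (pderiv p)) = 0"
    by (simp only: cgauss_add[OF t] cgauss_smult)
  then show ?thesis by (simp add: algebra_simps add_eq_0_iff)
qed

text \<open>The exponent separates into \<open>y\<^sup>2 / (2 * t)\<close>, the standard Gaussian
  exponent at \<open>w / sqrt t\<close> and an oscillating linear term. The integral is therefore
  the characteristic function of the standard normal law at \<open>- y / sqrt t\<close> times the
  reciprocal of its value, and no contour has to be shifted.\<close>

lemma cgauss_imaginary_1:
  assumes t: "t > 0"
  shows "cgauss (\<i> * complex_of_real y) t 1 = 1"
proof -
  let ?s = "- y / sqrt t"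
  have "exp (- (complex_of_real (?s\<^sup>2) / 2)) = char std_normal_distribution ?s"
    by (simp add: char_std_normal_distribution exp_of_real[symmetric])
  also have "\<dots> = (LINT x|lborel. std_normal_density x *\<^sub>R iexp (?s * x))"
    unfolding char_def by (subst integral_density) (auto simp: normal_density_nonneg)
  also have "\<dots> = (1 / sqrt t) *\<^sub>R (LINT w|lborel. std_normal_density (w / sqrt t) *\<^sub>R iexp (?s * (w / sqrt t)))"
    using t by (subst lborel_integral_real_affine[where c = "1 / sqrt t" and t = 0]) auto
  also have "\<dots> = (LINT w|lborel. (1 / sqrt t) *\<^sub>R (std_normal_density (w / sqrt t) *\<^sub>R iexp (?s * (w / sqrt t))))"
    by (rule integral_scaleR_right[symmetric])
  finally have 1: "exp (- (complex_of_real (?s\<^sup>2) / 2)) = \<dots>" .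
  have "cgauss (\<i> * complex_of_real y) t 1 = (LINT w|lborel. exp (complex_of_real (?s\<^sup>2) / 2) *
      ((1 / sqrt t) *\<^sub>R (std_normal_density (w / sqrt t) *\<^sub>R iexp (?s * (w / sqrt t)))))"
    unfolding cgauss_def
  proof (intro Bochner_Integration.integral_cong refl)
    fix w
    have "- ((\<i> * complex_of_real y + complex_of_real w)\<^sup>2 / complex_of_real (2 * t))
        = complex_of_real (?s\<^sup>2) / 2 + (complex_of_real (- (w / sqrt t)\<^sup>2 / 2) + \<i> * complex_of_real (?s * (w / sqrt t)))"
    proof -
      have *: "- ((\<i> * Y + W)\<^sup>2 / (2 * r\<^sup>2)) = (- Y / r)\<^sup>2 / 2 + (- (W / r)\<^sup>2 / 2 + \<i> * ((- Y / r) * (W / r)))"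
        if "r \<noteq> 0" for r Y W :: complex
        using that by (simp add: field_simps power2_eq_square)
      have "complex_of_real t = (complex_of_real (sqrt t))\<^sup>2"
        using t by (simp flip: of_real_power)
      then show ?thesis
        using *[of "complex_of_real (sqrt t)" "complex_of_real y" "complex_of_real w"] t
        by (simp add: power2_eq_square)
    qed
    then have "exp (- ((\<i> * complex_of_real y + complex_of_real w)\<^sup>2 / complex_of_real (2 * t)))
        = exp (complex_of_real (?s\<^sup>2) / 2) * (complex_of_real (exp (- (w / sqrt t)\<^sup>2 / 2)) * iexp (?s * (w / sqrt t)))"
      by (simp only: exp_add exp_of_real)
    moreover have "1 / sqrt (2 * pi * t) = 1 / sqrt t * (1 / sqrt (2 * pi))"
      by (simp add: real_sqrt_mult)
    ultimately show "complex_of_real (1 / sqrt (2 * pi * t)) *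
         exp (- ((\<i> * complex_of_real y + complex_of_real w)\<^sup>2 / complex_of_real (2 * t))) * poly 1 (complex_of_real w) =
         exp (complex_of_real (?s\<^sup>2) / 2) *
         ((1 / sqrt t) *\<^sub>R (std_normal_density (w / sqrt t) *\<^sub>R iexp (?s * (w / sqrt t))))"
      by (simp add: std_normal_density_def scaleR_conv_of_real)
  qed
  also have "\<dots> = exp (complex_of_real (?s\<^sup>2) / 2) * exp (- (complex_of_real (?s\<^sup>2) / 2))"
    unfolding 1 by (rule integral_mult_right_zero)
  also have "\<dots> = 1" by (simp flip: exp_add)
  finally show ?thesis .
qed

text \<open>Stein's identity at \<open>c = \<i> * y\<close>, multiplied by the factors
  \<open>\<i>\<close> of the powers, becomes the three-term recursion of the Hermite polynomials in
  \<open>y\<close>.\<close>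

lemma cgauss_imaginary_power:
  assumes t: "t > 0"
  shows "cgauss (\<i> * complex_of_real y) t ([:0, \<i>:] ^ n) = complex_of_real (poly (hermite t n) y)"
proof (induction n rule: less_induct)
  case (less n)
  let ?c = "\<i> * complex_of_real y"
  consider "n = 0" | "n = 1" | m where "n = Suc (Suc m)"
    by (metis One_nat_def not0_implies_Suc)
  then show ?case
  proof cases
    case 1
    then show ?thesis using cgauss_imaginary_1[OF t] by simp
  next
    case 2
    have "[:0, \<i>:] = Polynomial.smult \<i> ([:0, 1:] * 1)" by simp
    then have "cgauss ?c t [:0, \<i>:] = \<i> * (- ?c * cgauss ?c t 1 + of_real t * cgauss ?c t 0)"
      by (simp only: cgauss_smult cgauss_stein[OF t] pderiv_1)
    then show ?thesis using 2 cgauss_imaginary_1[OF t, of y]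
      by (simp add: cgauss_def[of _ _ 0])
  next
    case (3 m)
    let ?q = "[:0, \<i>:] :: complex poly"
    have e1: "?q ^ n = Polynomial.smult \<i> ([:0, 1:] * ?q ^ Suc m)" using 3 by simp
    have e2: "pderiv (?q ^ Suc m) = Polynomial.smult (\<i> * of_nat (Suc m)) (?q ^ m)"
      by (simp add: pderiv_power_Suc pderiv_pCons del: power_Suc)
    have "cgauss ?c t (?q ^ n) = \<i> * (- ?c * cgauss ?c t (?q ^ Suc m)
        + of_real t * (\<i> * of_nat (Suc m) * cgauss ?c t (?q ^ m)))"
      by (simp only: e1 cgauss_smult cgauss_stein[OF t] e2)
    also have "\<dots> = complex_of_real (y * poly (hermite t (Suc m)) y - t * of_nat (Suc m) * poly (hermite t m) y)"
      using less[of "Suc m"] less[of m] 3 by (simp add: algebra_simps del: hermite.simps power_Suc)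
    also have "\<dots> = complex_of_real (poly (hermite t n) y)"
      using 3 by (simp add: hermite_Suc_Suc del: hermite.simps)
    finally show ?thesis .
  qed
qed

lemma poly_map_poly_complex_of_real:
  "poly (map_poly complex_of_real p) (complex_of_real w) = complex_of_real (poly p w)"
  by (induction p) (auto simp: map_poly_pCons)

lemma heat_poly_eq_cgauss:
  assumes "t > 0"
  shows "complex_of_real (heat t (poly p) x) = cgauss (- complex_of_real x) t (map_poly complex_of_real p)"
proof -
  have "complex_of_real (heat t (poly p) x) = (LINT y|lborel. complex_of_real (normal_density x (sqrt t) y * poly p y))"
    unfolding heat_def by (rule integral_complex_of_real[symmetric])
  also have "\<dots> = cgauss (- complex_of_real x) t (map_poly complex_of_real p)"
    unfolding cgauss_def
  proof (intro Bochner_Integration.integral_cong refl)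
    fix w
    have "- ((- complex_of_real x + complex_of_real w)\<^sup>2 / complex_of_real (2 * t)) = complex_of_real (- (w - x)\<^sup>2 / (2 * t))"
      by simp
    then show "complex_of_real (normal_density x (sqrt t) w * poly p w) = complex_of_real (1 / sqrt (2 * pi * t)) *
         exp (- ((- complex_of_real x + complex_of_real w)\<^sup>2 / complex_of_real (2 * t))) *
         poly (map_poly complex_of_real p) (complex_of_real w)"
      using assms by (simp only: exp_of_real poly_map_poly_complex_of_real) (simp add: normal_density_def)
  qed
  finally show ?thesis .
qed

lemma heat_stein:
  assumes "t > 0"
  shows "heat t (poly ([:0, 1:] * p)) x = x * heat t (poly p) x + t * heat t (poly (pderiv p)) x"
proof -
  have "complex_of_real (heat t (poly ([:0, 1:] * p)) x)
      = complex_of_real (x * heat t (poly p) x + t * heat t (poly (pderiv p)) x)"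
  proof -
    have "map_poly complex_of_real (pderiv p) = pderiv (map_poly complex_of_real p)"
      by (intro poly_eqI) (simp add: coeff_pderiv coeff_map_poly)
    then show ?thesis
      unfolding of_real_add of_real_mult heat_poly_eq_cgauss[OF assms]
      using cgauss_stein[OF assms, of "- complex_of_real x" "map_poly complex_of_real p"]
      by (simp add: map_poly_pCons)
  qed
  then show ?thesis by (simp only: of_real_eq_iff)
qed

lemma poly_cosh_bounded: "\<exists>C. cosh_bounded C (poly p)"
  using poly_cosh_lipschitz cosh_lipschitz_bounded by blast

lemma heat_diff:
  assumes "cosh_bounded C f" "cosh_bounded D g" "\<tau> > 0"
  shows "heat \<tau> (\<lambda>x. f x - g x) x = heat \<tau> f x - heat \<tau> g x"
  using integrable_heat[OF assms(1), of "sqrt \<tau>" x] integrable_heat[OF assms(2), of "sqrt \<tau>" x] assms(3)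
  by (simp add: heat_def right_diff_distrib)

lemma heat_cmult: "heat \<tau> (\<lambda>x. c * f x) x = c * heat \<tau> f x"
  unfolding heat_def by (simp add: mult.left_commute)

lemma heat_add:
  assumes "cosh_bounded C f" "cosh_bounded D g" "\<tau> > 0"
  shows "heat \<tau> (\<lambda>x. f x + g x) x = heat \<tau> f x + heat \<tau> g x"
  using integrable_heat[OF assms(1), of "sqrt \<tau>" x] integrable_heat[OF assms(2), of "sqrt \<tau>" x] assms(3)
  by (simp add: heat_def distrib_left)

lemma heat_1: "\<tau> > 0 \<Longrightarrow> heat \<tau> (\<lambda>x. 1) x = 1"
  by (simp add: heat_def integral_normal_density)

text \<open>Both sides obey the three-term recursion: on the left Stein's identity contributes
  \<open>\<tau> * of_nat (Suc m)\<close> times the polynomial of degree \<open>m\<close>, which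
  turns the coefficient \<open>t + \<tau>\<close> into \<open>t\<close>.\<close>

lemma heat_hermite:
  assumes "\<tau> > 0"
  shows "heat \<tau> (poly (hermite (t + \<tau>) n)) x = poly (hermite t n) x"
proof (induction n rule: less_induct)
  case (less n)
  have pf: "poly (p - q) = (\<lambda>x. poly p x - poly q x)" "poly (Polynomial.smult a q) = (\<lambda>x. a * poly q x)"
    "poly 1 = (\<lambda>x. 1)" "poly 0 = (\<lambda>x. 0)" for p q :: "real poly" and a
    by auto
  have diff: "heat \<tau> (poly (p - Polynomial.smult a q)) x = heat \<tau> (poly p) x - a * heat \<tau> (poly q) x" for p q a
  proof -
    obtain C D where "cosh_bounded C (poly p)" "cosh_bounded D (poly (Polynomial.smult a q))"
      using poly_cosh_bounded by metis
    from heat_diff[OF this assms, of x] show ?thesis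
      by (simp only: pf heat_cmult)
  qed
  consider "n = 0" | "n = 1" | m where "n = Suc (Suc m)"
    by (metis One_nat_def not0_implies_Suc)
  then show ?case
  proof cases
    case 1
    then show ?thesis using heat_1[OF assms] by simp
  next
    case 2
    have "heat \<tau> (poly ([:0, 1:] * 1)) x = x"
      unfolding heat_stein[OF assms] pderiv_1 pf using heat_1[OF assms, of x] by (simp add: heat_def[of _ "\<lambda>_. 0"])
    moreover have "hermite (t + \<tau>) n = [:0, 1:] * 1" "poly (hermite t n) x = x"
      using 2 by (simp_all add: pderiv_1)
    ultimately show ?thesis by (simp only:)
  next
    case (3 m)
    have "heat \<tau> (poly (hermite (t + \<tau>) n)) x
        = x * heat \<tau> (poly (hermite (t + \<tau>) (Suc m))) x + \<tau> * heat \<tau> (poly (pderiv (hermite (t + \<tau>) (Suc m)))) x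
          - (t + \<tau>) * of_nat (Suc m) * heat \<tau> (poly (hermite (t + \<tau>) m)) x"
      unfolding 3 hermite_Suc_Suc diff heat_stein[OF assms] ..
    also have "heat \<tau> (poly (pderiv (hermite (t + \<tau>) (Suc m)))) x = of_nat (Suc m) * heat \<tau> (poly (hermite (t + \<tau>) m)) x"
      unfolding pderiv_hermite pf by (rule heat_cmult)
    also have "heat \<tau> (poly (hermite (t + \<tau>) (Suc m))) x = poly (hermite t (Suc m)) x"
      using 3 by (intro less) simp
    also have "heat \<tau> (poly (hermite (t + \<tau>) m)) x = poly (hermite t m) x"
      using 3 by (intro less) simp
    also have "x * poly (hermite t (Suc m)) x + \<tau> * (of_nat (Suc m) * poly (hermite t m) x)
          - (t + \<tau>) * of_nat (Suc m) * poly (hermite t m) x = poly (hermite t n) x"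
      unfolding 3 hermite_Suc_Suc by (simp add: algebra_simps del: hermite.simps)
    finally show ?thesis .
  qed
qed

section \<open>Product measures, the Karlin-McGregor kernel and Gaussian vectors\<close>

section \<open>Finite product measures\<close>

text \<open>Together with \<open>distr_PiM_components\<close> this reduces the Cameron-Martin
  formula for Gaussian vectors to dimension one. Both are checked on rectangles.\<close>

lemma density_PiM:
  assumes "finite I" "product_sigma_finite M" "product_sigma_finite (\<lambda>i. density (M i) (f i))"
    and f: "\<And>i. i \<in> I \<Longrightarrow> f i \<in> borel_measurable (M i)"
  shows "density (Pi\<^sub>M I M) (\<lambda>x. \<Prod>i\<in>I. f i (x i)) = Pi\<^sub>M I (\<lambda>i. density (M i) (f i))"
proof (rule product_sigma_finite.PiM_eqI[OF assms(3,1)])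
  show "sets (density (Pi\<^sub>M I M) (\<lambda>x. \<Prod>i\<in>I. f i (x i))) = sets (Pi\<^sub>M I (\<lambda>i. density (M i) (f i)))"
    by (auto intro!: sets_PiM_cong)
  fix A assume "\<And>i. i \<in> I \<Longrightarrow> A i \<in> sets (density (M i) (f i))"
  then have A: "\<And>i. i \<in> I \<Longrightarrow> A i \<in> sets (M i)" by simp
  have meas: "(\<lambda>x. \<Prod>i\<in>I. f i (x i)) \<in> borel_measurable (Pi\<^sub>M I M)"
    using f by (intro borel_measurable_prod_ennreal measurable_compose[OF measurable_component_singleton])
  have "emeasure (density (Pi\<^sub>M I M) (\<lambda>x. \<Prod>i\<in>I. f i (x i))) (Pi\<^sub>E I A)
      = (\<integral>\<^sup>+x. (\<Prod>i\<in>I. f i (x i)) * indicator (Pi\<^sub>E I A) x \<partial>Pi\<^sub>M I M)"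
    using A assms(1) meas by (intro emeasure_density sets_PiM_I_finite) auto
  also have "\<dots> = (\<integral>\<^sup>+x. (\<Prod>i\<in>I. f i (x i) * indicator (A i) (x i)) \<partial>Pi\<^sub>M I M)"
  proof (rule nn_integral_cong)
    fix x assume "x \<in> space (Pi\<^sub>M I M)"
    then have "indicator (Pi\<^sub>E I A) x = (\<Prod>i\<in>I. indicator (A i) (x i) :: ennreal)"
      using assms(1) by (auto simp: indicator_def space_PiM PiE_def Pi_def)
    then show "(\<Prod>i\<in>I. f i (x i)) * indicator (Pi\<^sub>E I A) x = (\<Prod>i\<in>I. f i (x i) * indicator (A i) (x i))"
      by (simp add: prod.distrib)
  qed
  also have "\<dots> = (\<Prod>i\<in>I. \<integral>\<^sup>+y. f i y * indicator (A i) y \<partial>M i)"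
    using A f assms(1) by (intro product_sigma_finite.product_nn_integral_prod[OF assms(2)]) auto
  also have "\<dots> = (\<Prod>i\<in>I. emeasure (density (M i) (f i)) (A i))"
    using A f by (intro prod.cong refl emeasure_density[symmetric])
  finally show "emeasure (density (Pi\<^sub>M I M) (\<lambda>x. \<Prod>i\<in>I. f i (x i))) (Pi\<^sub>E I A)
    = (\<Prod>i\<in>I. emeasure (density (M i) (f i)) (A i))" .
qed

lemma distr_PiM_components:
  assumes "finite I" "product_sigma_finite M" "product_sigma_finite (\<lambda>i. distr (M i) (M' i) (f i))"
    and f: "\<And>i. i \<in> I \<Longrightarrow> f i \<in> measurable (M i) (M' i)"
  shows "distr (Pi\<^sub>M I M) (Pi\<^sub>M I M') (\<lambda>x. \<lambda>i\<in>I. f i (x i)) = Pi\<^sub>M I (\<lambda>i. distr (M i) (M' i) (f i))"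
proof (rule product_sigma_finite.PiM_eqI[OF assms(3,1)])
  show "sets (distr (Pi\<^sub>M I M) (Pi\<^sub>M I M') (\<lambda>x. \<lambda>i\<in>I. f i (x i))) = sets (Pi\<^sub>M I (\<lambda>i. distr (M i) (M' i) (f i)))"
    by (auto intro!: sets_PiM_cong)
  fix A assume "\<And>i. i \<in> I \<Longrightarrow> A i \<in> sets (distr (M i) (M' i) (f i))"
  then have A: "\<And>i. i \<in> I \<Longrightarrow> A i \<in> sets (M' i)" by simp
  have meas: "(\<lambda>x. \<lambda>i\<in>I. f i (x i)) \<in> measurable (Pi\<^sub>M I M) (Pi\<^sub>M I M')"
    using f by (intro measurable_restrict measurable_compose[OF measurable_component_singleton])
  have "(\<lambda>x. \<lambda>i\<in>I. f i (x i)) -` Pi\<^sub>E I A \<inter> space (Pi\<^sub>M I M) = Pi\<^sub>E I (\<lambda>i. f i -` A i \<inter> space (M i))"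
    by (auto simp: space_PiM PiE_def Pi_def)
  then have "emeasure (distr (Pi\<^sub>M I M) (Pi\<^sub>M I M') (\<lambda>x. \<lambda>i\<in>I. f i (x i))) (Pi\<^sub>E I A)
      = emeasure (Pi\<^sub>M I M) (Pi\<^sub>E I (\<lambda>i. f i -` A i \<inter> space (M i)))"
    using A assms(1) meas by (subst emeasure_distr) (auto intro!: sets_PiM_I_finite)
  also have "\<dots> = (\<Prod>i\<in>I. emeasure (M i) (f i -` A i \<inter> space (M i)))"
    using A f assms(1) by (intro product_sigma_finite.emeasure_PiM[OF assms(2)] measurable_sets) auto
  also have "\<dots> = (\<Prod>i\<in>I. emeasure (distr (M i) (M' i) (f i)) (A i))"
    using A f by (intro prod.cong refl emeasure_distr[symmetric])
  finally show "emeasure (distr (Pi\<^sub>M I M) (Pi\<^sub>M I M') (\<lambda>x. \<lambda>i\<in>I. f i (x i))) (Pi\<^sub>E I A)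
    = (\<Prod>i\<in>I. emeasure (distr (M i) (M' i) (f i)) (A i))" .
qed

lemma measurable_comp_permutes:
  assumes "p permutes I"
  shows "(\<lambda>x. x \<circ> p) \<in> measurable (Pi\<^sub>M I (\<lambda>_. M)) (Pi\<^sub>M I (\<lambda>_. M))"
proof (rule measurable_PiM_single')
  show "(\<lambda>x. x \<circ> p) \<in> space (Pi\<^sub>M I (\<lambda>_. M)) \<rightarrow> (\<Pi>\<^sub>E i\<in>I. space M)"
    using assms permutes_in_image[OF assms] permutes_not_in[OF assms]
    by (auto simp: space_PiM PiE_def Pi_def extensional_def)
  show "(\<lambda>x. (x \<circ> p) i) \<in> measurable (Pi\<^sub>M I (\<lambda>_. M)) M" if "i \<in> I" for i
    using that permutes_in_image[OF assms, of i] by simp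
qed

text \<open>Serves twice: for the symmetrisation of determinantal integrals and for the tiling of
  space by Weyl chambers.\<close>

lemma distr_PiM_permutes:
  assumes "finite I" "sigma_finite_measure M" and p: "p permutes I"
  shows "distr (Pi\<^sub>M I (\<lambda>_. M)) (Pi\<^sub>M I (\<lambda>_. M)) (\<lambda>x. x \<circ> p) = Pi\<^sub>M I (\<lambda>_. M)"
proof -
  have ps: "product_sigma_finite (\<lambda>_::'a. M)"
    using assms(2) by (simp add: product_sigma_finite_def)
  show ?thesis
  proof (rule product_sigma_finite.PiM_eqI[OF ps assms(1)])
    fix A :: "'a \<Rightarrow> 'b set" assume A: "\<And>i. i \<in> I \<Longrightarrow> A i \<in> sets M"
    let ?q = "inv_into UNIV p"
    have ip: "?q permutes I" using p by (rule permutes_inv)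
    have qI: "?q i \<in> I" if "i \<in> I" for i using permutes_in_image[OF ip, of i] that by simp
    have "(\<lambda>x. x \<circ> p) -` Pi\<^sub>E I A \<inter> space (Pi\<^sub>M I (\<lambda>_. M)) = Pi\<^sub>E I (\<lambda>i. A (?q i))"
    proof (intro equalityI subsetI)
      fix x assume x: "x \<in> (\<lambda>x. x \<circ> p) -` Pi\<^sub>E I A \<inter> space (Pi\<^sub>M I (\<lambda>_. M))"
      have "x i \<in> A (?q i)" if "i \<in> I" for i
      proof -
        have "?q i \<in> I" using that by (rule qI)
        then have "(x \<circ> p) (?q i) \<in> A (?q i)" using x by (auto simp: PiE_def Pi_def)
        then show ?thesis using permutes_inverses(1)[OF p] by simp
      qed
      then show "x \<in> Pi\<^sub>E I (\<lambda>i. A (?q i))" using x by (auto simp: space_PiM PiE_def)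
    next
      fix x assume x: "x \<in> Pi\<^sub>E I (\<lambda>i. A (?q i))"
      have "(x \<circ> p) i \<in> A i" if "i \<in> I" for i
      proof -
        have "p i \<in> I" using permutes_in_image[OF p, of i] that by simp
        then have "x (p i) \<in> A (?q (p i))" using x by (auto simp: PiE_def Pi_def)
        then show ?thesis using permutes_inverses(2)[OF p] by simp
      qed
      moreover have "x \<circ> p \<in> extensional I"
        using x permutes_not_in[OF p] by (auto simp: extensional_def PiE_def)
      moreover have "x i \<in> space M" if "i \<in> I" for i
      proof -
        have "x i \<in> A (?q i)" using x that by (auto simp: PiE_def Pi_def)
        then show ?thesis using sets.sets_into_space[OF A[OF qI[OF that]]] by blast
      qed
      ultimately show "x \<in> (\<lambda>x. x \<circ> p) -` Pi\<^sub>E I A \<inter> space (Pi\<^sub>M I (\<lambda>_. M))"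
        using x by (auto simp: space_PiM PiE_def Pi_def)
    qed
    then have "emeasure (distr (Pi\<^sub>M I (\<lambda>_. M)) (Pi\<^sub>M I (\<lambda>_. M)) (\<lambda>x. x \<circ> p)) (Pi\<^sub>E I A)
        = emeasure (Pi\<^sub>M I (\<lambda>_. M)) (Pi\<^sub>E I (\<lambda>i. A (?q i)))"
      using A assms(1) measurable_comp_permutes[OF p, of M]
      by (subst emeasure_distr) (auto intro!: sets_PiM_I_finite)
    also have "\<dots> = (\<Prod>i\<in>I. emeasure M (A (?q i)))"
      using A assms(1) qI by (intro product_sigma_finite.emeasure_PiM[OF ps]) auto
    also have "\<dots> = (\<Prod>i\<in>I. emeasure M (A i))"
      using prod.permute[OF ip, of "\<lambda>i. emeasure M (A i)"] by (simp add: comp_def)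
    finally show "emeasure (distr (Pi\<^sub>M I (\<lambda>_. M)) (Pi\<^sub>M I (\<lambda>_. M)) (\<lambda>x. x \<circ> p)) (Pi\<^sub>E I A)
      = (\<Prod>i\<in>I. emeasure M (A i))" .
  qed simp
qed

lemma integral_PiM_permutes:
  fixes F :: "('i \<Rightarrow> 'b) \<Rightarrow> 'c::{banach, second_countable_topology}"
  assumes "finite I" "sigma_finite_measure M" "p permutes I" "F \<in> borel_measurable (Pi\<^sub>M I (\<lambda>_. M))"
  shows "(LINT x|Pi\<^sub>M I (\<lambda>_. M). F (x \<circ> p)) = (LINT x|Pi\<^sub>M I (\<lambda>_. M). F x)"
  using integral_distr[OF measurable_comp_permutes[OF assms(3), of M] assms(4)] distr_PiM_permutes[OF assms(1-3)]
  by simp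

lemma integrable_PiM_permutes:
  fixes F :: "('i \<Rightarrow> 'b) \<Rightarrow> 'c::{banach, second_countable_topology}"
  assumes "finite I" "sigma_finite_measure M" "p permutes I" "integrable (Pi\<^sub>M I (\<lambda>_. M)) F"
  shows "integrable (Pi\<^sub>M I (\<lambda>_. M)) (\<lambda>x. F (x \<circ> p))"
proof (rule integrable_distr[OF measurable_comp_permutes[OF assms(3), of M]])
  show "integrable (distr (Pi\<^sub>M I (\<lambda>_. M)) (Pi\<^sub>M I (\<lambda>_. M)) (\<lambda>x. x \<circ> p)) F"
    using assms(4) unfolding distr_PiM_permutes[OF assms(1-3)] .
qed

text \<open>Row \<open>j\<close> depends on the coordinate \<open>j\<close> alone, so every Leibniz
  term is a product of functions of different coordinates and the integral passes to the
  entries.\<close>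

lemma product_integral_fdet:
  fixes f :: "nat \<Rightarrow> nat \<Rightarrow> 'b \<Rightarrow> real"
  assumes ps: "product_sigma_finite M"
    and f: "\<And>j v. j < n \<Longrightarrow> v < n \<Longrightarrow> integrable (M j) (f j v)"
  shows "integrable (Pi\<^sub>M {..<n} M) (\<lambda>x. fdet n (\<lambda>j v. f j v (x j)))"
    and "(LINT x|Pi\<^sub>M {..<n} M. fdet n (\<lambda>j v. f j v (x j))) = fdet n (\<lambda>j v. integral\<^sup>L (M j) (f j v))"
proof -
  have pn: "p j < n" if "p permutes {..<n}" "j < n" for p j
    using permutes_in_image[OF that(1), of j] that(2) by simp
  have int: "integrable (Pi\<^sub>M {..<n} M) (\<lambda>x. of_int (sign p) * (\<Prod>j<n. f j (p j) (x j)))"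
    if "p \<in> {p. p permutes {..<n}}" for p
    using f pn that
    by (intro integrable_mult_right product_sigma_finite.product_integrable_prod[OF ps]) auto
  show "integrable (Pi\<^sub>M {..<n} M) (\<lambda>x. fdet n (\<lambda>j v. f j v (x j)))"
    unfolding fdet_leibniz by (rule Bochner_Integration.integrable_sum[OF int])
  have "(LINT x|Pi\<^sub>M {..<n} M. fdet n (\<lambda>j v. f j v (x j)))
      = (\<Sum>p | p permutes {..<n}. LINT x|Pi\<^sub>M {..<n} M. of_int (sign p) * (\<Prod>j<n. f j (p j) (x j)))"
    unfolding fdet_leibniz by (rule Bochner_Integration.integral_sum[OF int])
  also have "\<dots> = fdet n (\<lambda>j v. integral\<^sup>L (M j) (f j v))"
    unfolding fdet_leibniz
  proof (rule sum.cong[OF refl])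
    fix p assume "p \<in> {p. p permutes {..<n}}"
    then show "(LINT x|Pi\<^sub>M {..<n} M. of_int (sign p) * (\<Prod>j<n. f j (p j) (x j)))
        = of_int (sign p) * (\<Prod>j<n. integral\<^sup>L (M j) (f j (p j)))"
      using f pn by (subst integral_mult_right_zero, subst product_sigma_finite.product_integral_prod[OF ps]) auto
  qed
  finally show "(LINT x|Pi\<^sub>M {..<n} M. fdet n (\<lambda>j v. f j v (x j))) = fdet n (\<lambda>j v. integral\<^sup>L (M j) (f j v))" .
qed

lemma product_sigma_finite_lborel: "product_sigma_finite (\<lambda>_. lborel)"
  by (simp add: product_sigma_finite_def lborel.sigma_finite_measure_axioms)

section \<open>The Karlin-McGregor kernel preserves domination by the Vandermonde determinant\<close>

lemma vandermonde_scale: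
  fixes x :: "nat \<Rightarrow> real"
  shows "vandermonde n (\<lambda>j. c * x j) = (\<Prod>j<n. \<Prod>i<j. c) * vandermonde n x"
  unfolding vandermonde_def by (simp add: prod.distrib flip: right_diff_distrib)

text \<open>The Gaussian kernel is the exponential kernel up to a positive factor for each row and
  each column, and rescaling \<open>y\<close> multiplies its Vandermonde determinant by a positive
  constant.\<close>

lemma normal_kernel_vandermonde_nonneg:
  assumes "\<sigma> > 0"
  shows "fdet n (\<lambda>i j. normal_density (x i) \<sigma> (y j)) * vandermonde n x * vandermonde n y \<ge> 0"
proof -
  define a where "a i = 1 / sqrt (2 * pi * \<sigma>\<^sup>2) * exp (- (x i)\<^sup>2 / (2 * \<sigma>\<^sup>2))" for i
  define b where "b j = exp (- (y j)\<^sup>2 / (2 * \<sigma>\<^sup>2))" for j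
  have nd: "normal_density (x i) \<sigma> (y j) = a i * (b j * exp (x i * (1 / \<sigma>\<^sup>2 * y j)))" for i j
  proof -
    have "- (y j - x i)\<^sup>2 / (2 * \<sigma>\<^sup>2) = - (x i)\<^sup>2 / (2 * \<sigma>\<^sup>2) + (- (y j)\<^sup>2 / (2 * \<sigma>\<^sup>2) + x i * (1 / \<sigma>\<^sup>2 * y j))"
      using assms by (simp add: field_simps power2_eq_square)
    then show ?thesis by (simp only: normal_density_def a_def b_def exp_add mult.assoc)
  qed
  have pos: "(\<Prod>i<n. a i) > 0" "(\<Prod>i<n. b i) > 0" "(\<Prod>j<n. \<Prod>i<j. 1 / \<sigma>\<^sup>2) > 0"
    using assms by (auto intro!: prod_pos simp: a_def b_def)
  have "0 \<le> fdet n (\<lambda>i j. exp (x i * (1 / \<sigma>\<^sup>2 * y j))) * vandermonde n x * vandermonde n (\<lambda>j. 1 / \<sigma>\<^sup>2 * y j)"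
    by (rule fdet_exp_vandermonde_nonneg)
  then have "0 \<le> (\<Prod>j<n. \<Prod>i<j. 1 / \<sigma>\<^sup>2) *
      (fdet n (\<lambda>i j. exp (x i * (1 / \<sigma>\<^sup>2 * y j))) * vandermonde n x * vandermonde n y)"
    unfolding vandermonde_scale by (simp only: mult.left_commute mult.assoc)
  then have "0 \<le> fdet n (\<lambda>i j. exp (x i * (1 / \<sigma>\<^sup>2 * y j))) * vandermonde n x * vandermonde n y"
    using pos(3) by (subst (asm) zero_le_mult_iff) auto
  then have "0 \<le> ((\<Prod>i<n. a i) * (\<Prod>i<n. b i)) *
      (fdet n (\<lambda>i j. exp (x i * (1 / \<sigma>\<^sup>2 * y j))) * vandermonde n x * vandermonde n y)"
    using pos(1,2) by (intro mult_nonneg_nonneg[OF _ \<open>0 \<le> _ * vandermonde n y\<close>]) simp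
  then show ?thesis
    unfolding nd fdet_scale_rows fdet_scale_cols by (simp only: mult.assoc)
qed

text \<open>Let \<open>K\<close> be the Karlin-McGregor determinant. Up to \<open>fact n\<close> the
  determinant on the left is the integral of \<open>K\<close> against the determinant of the
  \<open>\<psi> v\<close>, and domination bounds this by \<open>c\<close> times the integral of
  \<open>K\<close> against the Vandermonde determinant in absolute value. Total positivity fixes the
  sign of that integrand, and harmonicity evaluates its integral.\<close>

lemma heat_fdet_le_vandermonde:
  assumes \<psi>: "\<And>v. v < n \<Longrightarrow> cosh_bounded C (\<psi> v)" and "\<tau> > 0"
    and dom: "\<And>y. \<bar>fdet n (\<lambda>j v. \<psi> v (y j))\<bar> \<le> c * \<bar>vandermonde n y\<bar>"
  shows "\<bar>fdet n (\<lambda>j v. heat \<tau> (\<psi> v) (x j))\<bar> \<le> c * \<bar>vandermonde n x\<bar>"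
proof (cases "inj_on x {..<n}")
  case False
  then obtain i j where "i < n" "j < n" "i \<noteq> j" "x i = x j" by (auto simp: inj_on_def)
  then have "fdet n (\<lambda>j v. heat \<tau> (\<psi> v) (x j)) = 0" by (intro fdet_identical_rows[of i n j]) auto
  then show ?thesis using False by (simp add: vandermonde_eq_0_iff[symmetric])
next
  case True
  let ?L = "Pi\<^sub>M {..<n} (\<lambda>_. lborel) :: (nat \<Rightarrow> real) measure"
  let ?nd = "\<lambda>i y. normal_density (x i) (sqrt \<tau>) y"
  define K where "K y = fdet n (\<lambda>i j. ?nd i (y j))" for y
  have sq: "real_of_int (sign p) * real_of_int (sign p) = 1" for p :: "nat \<Rightarrow> nat"
    by (simp add: sign_def)
  \<comment> \<open>Andreief's identity: the permutations in the expansion of \<open>K\<close> give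
    \<open>fact n\<close> equal contributions after the coordinates are relabelled.\<close>
  have sym: "integrable ?L (\<lambda>y. K y * fdet n (\<lambda>j v. \<phi> v (y j)))
      \<and> (LINT y|?L. K y * fdet n (\<lambda>j v. \<phi> v (y j))) = fact n * fdet n (\<lambda>j v. heat \<tau> (\<phi> v) (x j))"
    if \<phi>: "\<And>v. v < n \<Longrightarrow> \<exists>C. cosh_bounded C (\<phi> v)" for \<phi>
  proof -
    let ?D = "\<lambda>y. fdet n (\<lambda>j v. \<phi> v (y j))"
    let ?F = "\<lambda>y. (\<Prod>j<n. ?nd j (y j)) * ?D y"
    have int: "integrable lborel (\<lambda>y. ?nd j y * \<phi> v y)" if "v < n" for j v
      using \<phi>[OF that] \<open>\<tau> > 0\<close> by (auto intro: integrable_heat)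
    have F: "?F y = fdet n (\<lambda>j v. ?nd j (y j) * \<phi> v (y j))" for y
      by (rule fdet_scale_rows[symmetric])
    have intF: "integrable ?L ?F"
      unfolding F by (rule product_integral_fdet(1)[OF product_sigma_finite_lborel int])
    have valF: "integral\<^sup>L ?L ?F = fdet n (\<lambda>j v. heat \<tau> (\<phi> v) (x j))"
      unfolding F heat_def by (rule product_integral_fdet(2)[OF product_sigma_finite_lborel int])
    have perm: "integrable ?L (\<lambda>y. of_int (sign p) * (\<Prod>j<n. ?nd j (y (p j))) * ?D y)
        \<and> (LINT y|?L. of_int (sign p) * (\<Prod>j<n. ?nd j (y (p j))) * ?D y) = integral\<^sup>L ?L ?F"
      if p: "p \<in> {p. p permutes {..<n}}" for p
    proof -
      have Fp: "?F (y \<circ> p) = of_int (sign p) * (\<Prod>j<n. ?nd j (y (p j))) * ?D y" for y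
        using fdet_permute_rows[of p n "\<lambda>j v. \<phi> v (y j)"] p
        by (simp only: comp_def mem_Collect_eq mult.assoc mult.left_commute)
      have "integrable ?L (\<lambda>y. ?F (y \<circ> p))" "(LINT y|?L. ?F (y \<circ> p)) = integral\<^sup>L ?L ?F"
        using p intF borel_measurable_integrable[OF intF] lborel.sigma_finite_measure_axioms
        by (intro integrable_PiM_permutes integral_PiM_permutes; simp)+
      then show ?thesis unfolding Fp by blast
    qed
    have KD: "K y * ?D y = (\<Sum>p | p permutes {..<n}. of_int (sign p) * (\<Prod>j<n. ?nd j (y (p j))) * ?D y)" for y
      by (simp add: K_def fdet_leibniz[of n "\<lambda>i j. ?nd i (y j)"] sum_distrib_right)
    have "integrable ?L (\<lambda>y. K y * ?D y)"
      unfolding KD using perm by (intro Bochner_Integration.integrable_sum) blast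
    moreover have "(LINT y|?L. K y * ?D y) = (\<Sum>p | p permutes {..<n}. integral\<^sup>L ?L ?F)"
      unfolding KD using perm by (subst Bochner_Integration.integral_sum) auto
    ultimately show ?thesis using valF by (simp add: card_permutations)
  qed
  let ?D = "\<lambda>y. fdet n (\<lambda>j v. \<psi> v (y j))"
  \<comment> \<open>For the Hermite polynomials of time \<open>\<tau>\<close> the semigroup leads to
    those of time 0, and both determinants are Vandermonde determinants.\<close>
  have "integrable ?L (\<lambda>y. K y * fdet n (\<lambda>j v. poly (hermite (0 + \<tau>) v) (y j)))
      \<and> (LINT y|?L. K y * fdet n (\<lambda>j v. poly (hermite (0 + \<tau>) v) (y j)))
        = fact n * fdet n (\<lambda>j v. heat \<tau> (poly (hermite (0 + \<tau>) v)) (x j))"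
    by (rule sym[OF poly_cosh_bounded])
  then have V: "integrable ?L (\<lambda>y. K y * vandermonde n y)" "(LINT y|?L. K y * vandermonde n y) = fact n * vandermonde n x"
    unfolding heat_hermite[OF \<open>\<tau> > 0\<close>] fdet_hermite by auto
  have D: "integrable ?L (\<lambda>y. K y * ?D y)" "(LINT y|?L. K y * ?D y) = fact n * fdet n (\<lambda>j v. heat \<tau> (\<psi> v) (x j))"
    using sym[of \<psi>] \<psi> by blast+
  have c: "c \<ge> 0"
    using order_trans[OF abs_ge_zero dom[of x]] True by (simp add: zero_le_mult_iff vandermonde_eq_0_iff)
  have nz: "vandermonde n x \<noteq> 0" using True by (simp add: vandermonde_eq_0_iff)
  \<comment> \<open>The product \<open>K y * vandermonde n y\<close> has the fixed sign of
    \<open>vandermonde n x\<close>, or is 0, so its absolute value can be integrated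
    exactly.\<close>
  have bound: "\<bar>K y * ?D y\<bar> \<le> c * (sgn (vandermonde n x) * (K y * vandermonde n y))" for y
  proof -
    have "0 \<le> K y * vandermonde n x * vandermonde n y"
      unfolding K_def using \<open>\<tau> > 0\<close> by (intro normal_kernel_vandermonde_nonneg) simp
    then have "\<bar>K y * vandermonde n y\<bar> = sgn (vandermonde n x) * (K y * vandermonde n y)"
      using nz by (cases "vandermonde n x > 0")
        (auto simp: zero_le_mult_iff mult_le_0_iff sgn_if abs_mult)
    moreover have "\<bar>K y * ?D y\<bar> \<le> \<bar>K y\<bar> * (c * \<bar>vandermonde n y\<bar>)"
      unfolding abs_mult by (intro mult_left_mono dom) auto
    ultimately show ?thesis by (simp add: abs_mult mult.left_commute)
  qed
  have "fact n * \<bar>fdet n (\<lambda>j v. heat \<tau> (\<psi> v) (x j))\<bar> = \<bar>LINT y|?L. K y * ?D y\<bar>"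
    by (simp add: D(2) abs_mult)
  also have "\<dots> \<le> (LINT y|?L. \<bar>K y * ?D y\<bar>)"
    by (rule integral_abs_bound)
  also have "\<dots> \<le> (LINT y|?L. c * (sgn (vandermonde n x) * (K y * vandermonde n y)))"
    using D(1) V(1) by (intro integral_mono bound integrable_abs integrable_mult_right)
  also have "\<dots> = c * (sgn (vandermonde n x) * (fact n * vandermonde n x))"
    by (simp add: V(2))
  also have "\<dots> = fact n * (c * \<bar>vandermonde n x\<bar>)"
    by (simp add: abs_sgn algebra_simps)
  finally show ?thesis by simp
qed

section \<open>Gaussian vectors\<close>

abbreviation normal_measure :: "real \<Rightarrow> real measure" where
  "normal_measure \<sigma> \<equiv> density lborel (\<lambda>y. ennreal (normal_density 0 \<sigma> y))"

definition gaussian :: "nat \<Rightarrow> real \<Rightarrow> (nat \<Rightarrow> real) measure" where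
  "gaussian N \<sigma> = Pi\<^sub>M {..<N} (\<lambda>_. normal_measure \<sigma>)"

lemma product_sigma_finite_prob: "(\<And>i. prob_space (M i)) \<Longrightarrow> product_sigma_finite M"
  by (simp add: product_sigma_finite_def prob_space_imp_sigma_finite)

lemma sets_gaussian [measurable_cong]: "sets (gaussian N \<sigma>) = sets (Pi\<^sub>M {..<N} (\<lambda>_. borel))"
  unfolding gaussian_def by (intro sets_PiM_cong) auto

lemma prob_space_gaussian: "\<sigma> > 0 \<Longrightarrow> prob_space (gaussian N \<sigma>)"
  unfolding gaussian_def by (intro prob_space_PiM prob_space_normal_density)

lemma gaussian_component: "j < N \<Longrightarrow> (\<lambda>w. w j) \<in> borel_measurable (gaussian N \<sigma>)"
  unfolding measurable_cong_sets[OF sets_gaussian refl]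
  by (rule measurable_component_singleton) simp

lemma normal_integral:
  assumes "f \<in> borel_measurable borel"
  shows "integral\<^sup>L (normal_measure \<sigma>) f = (LINT y|lborel. normal_density 0 \<sigma> y * f y)"
    and "integrable (normal_measure \<sigma>) f \<longleftrightarrow> integrable lborel (\<lambda>y. normal_density 0 \<sigma> y * f y)"
  using assms by (simp_all add: integral_real_density integrable_real_density)

lemma integrable_heat_shift:
  assumes "cosh_bounded C f" "\<tau> > 0"
  shows "integrable lborel (\<lambda>w. normal_density 0 (sqrt \<tau>) w * f (x + w))"
proof -
  have "integrable lborel (\<lambda>w. normal_density x (sqrt \<tau>) w * f w)"
    using assms by (intro integrable_heat) auto
  from lborel_integrable_real_affine[OF this, of 1 x] show ?thesis
    by (simp add: normal_density_def)
qed

lemma gaussian_fdet: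
  assumes \<psi>: "\<And>v. v < N \<Longrightarrow> cosh_bounded C (\<psi> v)" and "\<tau> > 0"
  shows "integrable (gaussian N (sqrt \<tau>)) (\<lambda>w. fdet N (\<lambda>j v. \<psi> v (x j + w j)))"
    and "(LINT w|gaussian N (sqrt \<tau>). fdet N (\<lambda>j v. \<psi> v (x j + w j))) = fdet N (\<lambda>j v. heat \<tau> (\<psi> v) (x j))"
proof -
  have ps: "product_sigma_finite (\<lambda>_::nat. normal_measure (sqrt \<tau>))"
    using \<open>\<tau> > 0\<close> by (intro product_sigma_finite_prob prob_space_normal_density) simp
  have meas: "(\<lambda>w. \<psi> v (x j + w)) \<in> borel_measurable borel" if "v < N" for j v
    using cosh_boundedD(1)[OF \<psi>[OF that]] by measurable
  have int: "integrable (normal_measure (sqrt \<tau>)) (\<lambda>w. \<psi> v (x j + w))" if "v < N" for j v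
    using integrable_heat_shift[OF \<psi>[OF that] \<open>\<tau> > 0\<close>, of "x j"] normal_integral(2)[OF meas[OF that]] by blast
  show "integrable (gaussian N (sqrt \<tau>)) (\<lambda>w. fdet N (\<lambda>j v. \<psi> v (x j + w j)))"
    unfolding gaussian_def by (rule product_integral_fdet(1)[OF ps int])
  have "(LINT w|gaussian N (sqrt \<tau>). fdet N (\<lambda>j v. \<psi> v (x j + w j)))
      = fdet N (\<lambda>j v. LINT w|normal_measure (sqrt \<tau>). \<psi> v (x j + w))"
    unfolding gaussian_def by (rule product_integral_fdet(2)[OF ps int])
  also have "\<dots> = fdet N (\<lambda>j v. heat \<tau> (\<psi> v) (x j))"
    by (intro fdet_cong) (simp add: normal_integral(1)[OF meas] heat_shift)
  finally show "(LINT w|gaussian N (sqrt \<tau>). fdet N (\<lambda>j v. \<psi> v (x j + w j))) = fdet N (\<lambda>j v. heat \<tau> (\<psi> v) (x j))" .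
qed

text \<open>Harmonicity in the form needed for the h-transform: at distinct points,
  \<open>vandermonde N (x + w) / vandermonde N x\<close> integrates to one against the Gaussian
  step.\<close>

lemma gaussian_vandermonde:
  assumes "\<tau> > 0"
  shows "integrable (gaussian N (sqrt \<tau>)) (\<lambda>w. vandermonde N (\<lambda>j. x j + w j))"
    and "(LINT w|gaussian N (sqrt \<tau>). vandermonde N (\<lambda>j. x j + w j)) = vandermonde N x"
proof -
  obtain Cf where Cf: "\<And>v. cosh_bounded (Cf v) (poly (hermite (0 + \<tau>) v))"
    using choice[of "\<lambda>v C. cosh_bounded C (poly (hermite (0 + \<tau>) v))"] poly_cosh_bounded by blast
  define C where "C = (\<Sum>v<N. Cf v)"
  have C: "cosh_bounded C (poly (hermite (0 + \<tau>) v))" if "v < N" for v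
  proof -
    have "Cf v \<le> C"
      unfolding C_def using that cosh_boundedD(3)[OF Cf] by (intro member_le_sum) auto
    then show ?thesis using Cf[of v] unfolding cosh_bounded_def
      by (meson cosh_real_nonneg mult_right_mono order_trans)
  qed
  have "integrable (gaussian N (sqrt \<tau>)) (\<lambda>w. fdet N (\<lambda>j v. poly (hermite (0 + \<tau>) v) (x j + w j)))"
    by (rule gaussian_fdet(1)[OF _ assms]) (rule C)
  then show "integrable (gaussian N (sqrt \<tau>)) (\<lambda>w. vandermonde N (\<lambda>j. x j + w j))"
    by (simp only: fdet_hermite)
  have "(LINT w|gaussian N (sqrt \<tau>). fdet N (\<lambda>j v. poly (hermite (0 + \<tau>) v) (x j + w j)))
      = fdet N (\<lambda>j v. heat \<tau> (poly (hermite (0 + \<tau>) v)) (x j))"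
    by (rule gaussian_fdet(2)[OF _ assms]) (rule C)
  then show "(LINT w|gaussian N (sqrt \<tau>). vandermonde N (\<lambda>j. x j + w j)) = vandermonde N x"
    by (simp only: fdet_hermite heat_hermite[OF assms])
qed

text \<open>Exponential moments will dominate all polynomial error terms; they factor over the
  components, and \<open>exp (a * \<bar>y\<bar>) \<le> 2 * cosh (a * y)\<close> makes each factor
  computable.\<close>

lemma gaussian_exp_norm:
  assumes "\<sigma> > 0"
  shows "integrable (gaussian N \<sigma>) (\<lambda>w. exp (a * (\<Sum>j<N. \<bar>w j\<bar>)))"
    and "(LINT w|gaussian N \<sigma>. exp (a * (\<Sum>j<N. \<bar>w j\<bar>))) \<le> (2 * exp (a\<^sup>2 * \<sigma>\<^sup>2 / 2)) ^ N"
proof -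
  have ps: "product_sigma_finite (\<lambda>_::nat. normal_measure \<sigma>)"
    using assms by (intro product_sigma_finite_prob prob_space_normal_density)
  have dom: "integrable lborel (\<lambda>y. normal_density 0 \<sigma> y * (2 * cosh (a * y)))"
      "(LINT y|lborel. normal_density 0 \<sigma> y * (2 * cosh (a * y))) = 2 * exp (a\<^sup>2 * \<sigma>\<^sup>2 / 2)"
    using has_bochner_integral_mult_right[OF normal_density_cosh_has_integral[OF assms, of 0 a], of 2]
    by (simp_all add: has_bochner_integral_iff mult.left_commute)
  have le: "exp (a * \<bar>y\<bar>) \<le> 2 * cosh (a * y)" for y :: real
    by (cases "y \<ge> 0") (auto simp: cosh_def)
  have int: "integrable lborel (\<lambda>y. normal_density 0 \<sigma> y * exp (a * \<bar>y\<bar>))"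
  proof (rule Bochner_Integration.integrable_bound[OF dom(1)])
    show "AE y in lborel. norm (normal_density 0 \<sigma> y * exp (a * \<bar>y\<bar>)) \<le> norm (normal_density 0 \<sigma> y * (2 * cosh (a * y)))"
      using le by (intro AE_I2) (auto simp: abs_mult intro!: mult_left_mono order_trans[OF le])
  qed measurable
  have e: "exp (a * (\<Sum>j<N. \<bar>w j\<bar>)) = (\<Prod>j<N. exp (a * \<bar>w j\<bar>))" for w :: "nat \<Rightarrow> real"
    by (simp add: sum_distrib_left exp_sum)
  have int': "integrable (normal_measure \<sigma>) (\<lambda>y. exp (a * \<bar>y\<bar>))"
    using int by (subst normal_integral(2)) auto
  show "integrable (gaussian N \<sigma>) (\<lambda>w. exp (a * (\<Sum>j<N. \<bar>w j\<bar>)))"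
    unfolding e gaussian_def by (intro product_sigma_finite.product_integrable_prod[OF ps] int') auto
  have "(LINT w|gaussian N \<sigma>. exp (a * (\<Sum>j<N. \<bar>w j\<bar>))) = (\<Prod>j<N. LINT y|normal_measure \<sigma>. exp (a * \<bar>y\<bar>))"
    unfolding e gaussian_def by (intro product_sigma_finite.product_integral_prod[OF ps] int') auto
  also have "\<dots> \<le> (\<Prod>j<N. 2 * exp (a\<^sup>2 * \<sigma>\<^sup>2 / 2))"
  proof (intro prod_mono conjI)
    show "0 \<le> (LINT y|normal_measure \<sigma>. exp (a * \<bar>y\<bar>))" by (intro integral_nonneg_AE) auto
    have "(LINT y|normal_measure \<sigma>. exp (a * \<bar>y\<bar>)) = (LINT y|lborel. normal_density 0 \<sigma> y * exp (a * \<bar>y\<bar>))"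
      by (subst normal_integral(1)) auto
    also have "\<dots> \<le> (LINT y|lborel. normal_density 0 \<sigma> y * (2 * cosh (a * y)))"
      by (intro integral_mono int dom mult_left_mono le) auto
    finally show "(LINT y|normal_measure \<sigma>. exp (a * \<bar>y\<bar>)) \<le> 2 * exp (a\<^sup>2 * \<sigma>\<^sup>2 / 2)"
      by (simp only: dom(2))
  qed
  finally show "(LINT w|gaussian N \<sigma>. exp (a * (\<Sum>j<N. \<bar>w j\<bar>))) \<le> (2 * exp (a\<^sup>2 * \<sigma>\<^sup>2 / 2)) ^ N"
    by simp
qed

lemma distr_normal_shift:
  assumes "\<sigma> > 0"
  shows "distr (normal_measure \<sigma>) borel (\<lambda>y. m + y)
    = density (normal_measure \<sigma>) (\<lambda>y. ennreal (exp (m * y / \<sigma>\<^sup>2 - m\<^sup>2 / (2 * \<sigma>\<^sup>2))))"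
proof (rule measure_eqI)
  fix A assume "A \<in> sets (distr (normal_measure \<sigma>) borel (\<lambda>y. m + y))"
  then have A [measurable]: "A \<in> sets borel" by simp
  have nd: "normal_density 0 \<sigma> (y - m) = normal_density 0 \<sigma> y * exp (m * y / \<sigma>\<^sup>2 - m\<^sup>2 / (2 * \<sigma>\<^sup>2))" for y
  proof -
    have "- (y - m - 0)\<^sup>2 / (2 * \<sigma>\<^sup>2) = - (y - 0)\<^sup>2 / (2 * \<sigma>\<^sup>2) + (m * y / \<sigma>\<^sup>2 - m\<^sup>2 / (2 * \<sigma>\<^sup>2))"
      using assms by (simp add: field_simps power2_eq_square)
    then show ?thesis by (simp only: normal_density_def exp_add mult.assoc)
  qed
  have "emeasure (distr (normal_measure \<sigma>) borel (\<lambda>y. m + y)) A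
      = (\<integral>\<^sup>+y. ennreal (normal_density 0 \<sigma> y) * indicator A (m + y) \<partial>lborel)"
  proof -
    have pre: "(\<lambda>y. m + y) -` A \<in> sets borel"
      using measurable_sets_borel[of "\<lambda>y. m + y" borel A] A by simp
    have "emeasure (distr (normal_measure \<sigma>) borel (\<lambda>y. m + y)) A = emeasure (normal_measure \<sigma>) ((\<lambda>y. m + y) -` A)"
      by (subst emeasure_distr) auto
    also have "\<dots> = (\<integral>\<^sup>+y. ennreal (normal_density 0 \<sigma> y) * indicator ((\<lambda>y. m + y) -` A) y \<partial>lborel)"
      using pre by (intro emeasure_density) auto
    finally show ?thesis by (simp add: indicator_vimage)
  qed
  also have "\<dots> = (\<integral>\<^sup>+y. ennreal (normal_density 0 \<sigma> (y - m)) * indicator A y \<partial>lborel)"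
    by (subst nn_integral_real_affine[where c = 1 and t = "- m"]) (auto simp: algebra_simps)
  also have "\<dots> = emeasure (density (normal_measure \<sigma>) (\<lambda>y. ennreal (exp (m * y / \<sigma>\<^sup>2 - m\<^sup>2 / (2 * \<sigma>\<^sup>2))))) A"
    by (subst density_density_eq) (auto simp: emeasure_density nd ennreal_mult intro!: nn_integral_cong)
  finally show "emeasure (distr (normal_measure \<sigma>) borel (\<lambda>y. m + y)) A
     = emeasure (density (normal_measure \<sigma>) (\<lambda>y. ennreal (exp (m * y / \<sigma>\<^sup>2 - m\<^sup>2 / (2 * \<sigma>\<^sup>2))))) A" .
qed simp

text \<open>The drift of an Euler step shifts the Gaussian vector by a fixed amount. The formula
  trades the shift for an explicit density, which can be compared with the density of the
  h-transform.\<close>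

lemma gaussian_cameron_martin:
  fixes F :: "(nat \<Rightarrow> real) \<Rightarrow> real"
  assumes "\<sigma> > 0" and F [measurable]: "F \<in> borel_measurable (Pi\<^sub>M {..<N} (\<lambda>_. borel))"
  shows "(LINT w|gaussian N \<sigma>. F (\<lambda>j\<in>{..<N}. m j + w j))
    = (LINT w|gaussian N \<sigma>. exp (\<Sum>j<N. m j * w j / \<sigma>\<^sup>2 - (m j)\<^sup>2 / (2 * \<sigma>\<^sup>2)) * F w)"
proof -
  let ?e = "\<lambda>j y. exp (m j * y / \<sigma>\<^sup>2 - (m j)\<^sup>2 / (2 * \<sigma>\<^sup>2))"
  have pn: "prob_space (normal_measure \<sigma>)" using assms(1) by (rule prob_space_normal_density)
  have pd: "prob_space (distr (normal_measure \<sigma>) borel (\<lambda>y. m j + y))" for j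
    by (rule prob_space.prob_space_distr[OF pn]) simp
  have "distr (gaussian N \<sigma>) (Pi\<^sub>M {..<N} (\<lambda>_. borel)) (\<lambda>w. \<lambda>j\<in>{..<N}. m j + w j)
      = Pi\<^sub>M {..<N} (\<lambda>j. distr (normal_measure \<sigma>) borel (\<lambda>y. m j + y))"
    unfolding gaussian_def using pn pd
    by (intro distr_PiM_components product_sigma_finite_prob) auto
  also have "\<dots> = Pi\<^sub>M {..<N} (\<lambda>j. density (normal_measure \<sigma>) (\<lambda>y. ennreal (?e j y)))"
    by (simp only: distr_normal_shift[OF assms(1)])
  also have "\<dots> = density (gaussian N \<sigma>) (\<lambda>w. \<Prod>j<N. ennreal (?e j (w j)))"
    unfolding gaussian_def using pn pd
    by (intro density_PiM[symmetric] product_sigma_finite_prob) (auto simp: distr_normal_shift[OF assms(1)])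
  also have "(\<lambda>w. \<Prod>j<N. ennreal (?e j (w j))) = (\<lambda>w. ennreal (exp (\<Sum>j<N. m j * w j / \<sigma>\<^sup>2 - (m j)\<^sup>2 / (2 * \<sigma>\<^sup>2))))"
    by (simp add: exp_sum prod_ennreal)
  finally have eq: "distr (gaussian N \<sigma>) (Pi\<^sub>M {..<N} (\<lambda>_. borel)) (\<lambda>w. \<lambda>j\<in>{..<N}. m j + w j)
      = density (gaussian N \<sigma>) (\<lambda>w. ennreal (exp (\<Sum>j<N. m j * w j / \<sigma>\<^sup>2 - (m j)\<^sup>2 / (2 * \<sigma>\<^sup>2))))" .
  have F' [measurable]: "F \<in> borel_measurable (gaussian N \<sigma>)"
    using F by (simp add: measurable_cong_sets[OF sets_gaussian refl])
  have "(LINT w|gaussian N \<sigma>. F (\<lambda>j\<in>{..<N}. m j + w j))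
      = (LINT w|distr (gaussian N \<sigma>) (Pi\<^sub>M {..<N} (\<lambda>_. borel)) (\<lambda>w. \<lambda>j\<in>{..<N}. m j + w j). F w)"
    by (subst integral_distr) (auto intro!: measurable_restrict)
  also have "\<dots> = (LINT w|gaussian N \<sigma>. exp (\<Sum>j<N. m j * w j / \<sigma>\<^sup>2 - (m j)\<^sup>2 / (2 * \<sigma>\<^sup>2)) * F w)"
    unfolding eq by (subst integral_real_density) auto
  finally show ?thesis .
qed

section \<open>From the Euler scheme to the Markov property\<close>

section \<open>One step of the Euler scheme against the h-transform\<close>

text \<open>One induction carries all three bounds, since each of the last two uses the preceding
  one.\<close>

lemma prod_one_plus_bounds:
  fixes a :: "'i \<Rightarrow> real"
  assumes "finite I"
  defines "A \<equiv> \<Sum>i\<in>I. \<bar>a i\<bar>"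
  shows "\<bar>\<Prod>i\<in>I. 1 + a i\<bar> \<le> exp A" "\<bar>(\<Prod>i\<in>I. 1 + a i) - 1\<bar> \<le> A * exp A"
    "\<bar>(\<Prod>i\<in>I. 1 + a i) - 1 - (\<Sum>i\<in>I. a i)\<bar> \<le> A\<^sup>2 * exp A"
proof -
  define P where "P J = (\<Prod>i\<in>J. 1 + a i)" for J
  define S where "S J = (\<Sum>i\<in>J. a i)" for J
  define T where "T J = (\<Sum>i\<in>J. \<bar>a i\<bar>)" for J
  have "\<bar>P I\<bar> \<le> exp (T I) \<and> \<bar>P I - 1\<bar> \<le> T I * exp (T I) \<and> \<bar>P I - 1 - S I\<bar> \<le> (T I)\<^sup>2 * exp (T I)"
    using assms(1)
  proof (induction I rule: finite_induct)
    case (insert i J)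
    have T0: "T J \<ge> 0" unfolding T_def by (intro sum_nonneg) auto
    define b where "b = a i"
    have P: "P (insert i J) = (1 + b) * P J" and S: "S (insert i J) = b + S J" and T: "T (insert i J) = \<bar>b\<bar> + T J"
      using insert(1,2) by (simp_all add: P_def S_def T_def b_def)
    have e: "exp (T J) \<le> exp (\<bar>b\<bar> + T J)" by simp
    have "\<bar>1 + b\<bar> \<le> exp \<bar>b\<bar>" using exp_ge_add_one_self[of "\<bar>b\<bar>"] by linarith
    then have 1: "\<bar>P (insert i J)\<bar> \<le> exp (T (insert i J))"
      unfolding P T abs_mult exp_add using insert(3) by (intro mult_mono) auto
    have "\<bar>P (insert i J) - 1\<bar> \<le> \<bar>P J - 1\<bar> + \<bar>b\<bar> * \<bar>P J\<bar>"
      unfolding P abs_mult[symmetric] by (simp add: algebra_simps)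
    also have "\<dots> \<le> T J * exp (T J) + \<bar>b\<bar> * exp (T J)"
      using insert(3) by (intro add_mono mult_left_mono) auto
    also have "\<dots> = (\<bar>b\<bar> + T J) * exp (T J)" by (simp add: algebra_simps)
    also have "\<dots> \<le> (\<bar>b\<bar> + T J) * exp (\<bar>b\<bar> + T J)" using T0 by (intro mult_left_mono) auto
    finally have 2: "\<bar>P (insert i J) - 1\<bar> \<le> T (insert i J) * exp (T (insert i J))" unfolding T .
    have "P (insert i J) - 1 - S (insert i J) = (P J - 1 - S J) + b * (P J - 1)"
      unfolding P S by (simp add: algebra_simps)
    then have "\<bar>P (insert i J) - 1 - S (insert i J)\<bar> \<le> \<bar>P J - 1 - S J\<bar> + \<bar>b\<bar> * \<bar>P J - 1\<bar>"
      using abs_triangle_ineq[of "P J - 1 - S J" "b * (P J - 1)"] by (simp add: abs_mult)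
    also have "\<dots> \<le> (T J)\<^sup>2 * exp (T J) + \<bar>b\<bar> * (T J * exp (T J))"
      using insert(3) by (intro add_mono mult_left_mono) auto
    also have "\<dots> = ((T J)\<^sup>2 + \<bar>b\<bar> * T J) * exp (T J)" by (simp add: algebra_simps)
    also have "\<dots> \<le> (\<bar>b\<bar> + T J)\<^sup>2 * exp (\<bar>b\<bar> + T J)"
      using T0 by (intro mult_mono) (auto simp: power2_eq_square algebra_simps)
    finally have 3: "\<bar>P (insert i J) - 1 - S (insert i J)\<bar> \<le> (T (insert i J))\<^sup>2 * exp (T (insert i J))" unfolding T .
    show ?case using 1 2 3 by blast
  qed (simp add: P_def S_def T_def)
  then show "\<bar>\<Prod>i\<in>I. 1 + a i\<bar> \<le> exp A" "\<bar>(\<Prod>i\<in>I. 1 + a i) - 1\<bar> \<le> A * exp A"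
    "\<bar>(\<Prod>i\<in>I. 1 + a i) - 1 - (\<Sum>i\<in>I. a i)\<bar> \<le> A\<^sup>2 * exp A"
    by (simp_all add: P_def S_def T_def A_def)
qed

lemma exp_minus_linear_bound: "\<bar>exp z - 1 - z\<bar> \<le> z\<^sup>2 * exp \<bar>z :: real\<bar>"
proof (cases "z = 0")
  case False
  obtain t where t: "\<bar>t\<bar> \<le> \<bar>z\<bar>" "exp z = (\<Sum>m<2. z ^ m / fact m) + exp t / fact 2 * z ^ 2"
    using Maclaurin_exp_le[of z 2] by auto
  then have "\<bar>exp z - 1 - z\<bar> = exp t / 2 * z\<^sup>2"
    by (simp add: numeral_2_eq_2)
  also have "\<dots> \<le> exp \<bar>z\<bar> * z\<^sup>2"
  proof (rule mult_right_mono)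
    have "exp t \<le> exp \<bar>z\<bar>" using t(1) by simp
    then show "exp t / 2 \<le> exp \<bar>z\<bar>" using exp_gt_zero[of t] by linarith
  qed simp
  finally show ?thesis by (simp add: mult.commute)
qed simp

text \<open>Telescoping: one factor is exchanged at a time while the others stay below
  \<open>B\<close>; \<open>B \<ge> 1\<close> allows the full power \<open>card I\<close> in every
  term.\<close>

lemma prod_diff_bound:
  fixes a b :: "'i \<Rightarrow> real"
  assumes "finite I" "B \<ge> 1" "\<And>i. i \<in> I \<Longrightarrow> \<bar>a i\<bar> \<le> B" "\<And>i. i \<in> I \<Longrightarrow> \<bar>b i\<bar> \<le> B"
    "\<And>i. i \<in> I \<Longrightarrow> \<bar>a i - b i\<bar> \<le> d i"
  shows "\<bar>(\<Prod>i\<in>I. a i) - (\<Prod>i\<in>I. b i)\<bar> \<le> B ^ card I * (\<Sum>i\<in>I. d i)"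
  using assms
proof (induction I rule: finite_induct)
  case (insert i J)
  have IH: "\<bar>(\<Prod>i\<in>J. a i) - (\<Prod>i\<in>J. b i)\<bar> \<le> B ^ card J * (\<Sum>i\<in>J. d i)"
    using insert by auto
  have "\<bar>\<Prod>i\<in>J. b i\<bar> \<le> (\<Prod>i\<in>J. B)"
    unfolding abs_prod using insert by (intro prod_mono) auto
  then have Pb: "\<bar>\<Prod>i\<in>J. b i\<bar> \<le> B * B ^ card J"
    using insert(4) order_trans[OF _ mult_right_mono[of 1 B "B ^ card J"]] by auto
  have d: "d i \<ge> 0" using insert(7)[of i] by (simp add: order_trans[OF abs_ge_zero])
  have "\<bar>(\<Prod>i\<in>insert i J. a i) - (\<Prod>i\<in>insert i J. b i)\<bar>
      = \<bar>a i * ((\<Prod>i\<in>J. a i) - (\<Prod>i\<in>J. b i)) + (a i - b i) * (\<Prod>i\<in>J. b i)\<bar>"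
    using insert(1,2) by (simp add: algebra_simps)
  also have "\<dots> \<le> \<bar>a i\<bar> * \<bar>(\<Prod>i\<in>J. a i) - (\<Prod>i\<in>J. b i)\<bar> + \<bar>a i - b i\<bar> * \<bar>\<Prod>i\<in>J. b i\<bar>"
    by (metis abs_mult abs_triangle_ineq)
  also have "\<dots> \<le> B * (B ^ card J * (\<Sum>i\<in>J. d i)) + d i * (B * B ^ card J)"
    using IH Pb insert(4,5,7) d by (intro add_mono mult_mono) auto
  also have "\<dots> = B ^ card (insert i J) * (\<Sum>i\<in>insert i J. d i)"
    using insert(1,2) by (simp add: algebra_simps)
  finally show ?case .
qed simp

definition drift :: "nat \<Rightarrow> (nat \<Rightarrow> real) \<Rightarrow> nat \<Rightarrow> real" where
  "drift N x j = (\<Sum>k\<in>{..<N} - {j}. 1 / (x j - x k))"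

text \<open>Bundles the two quantities on which the constants of the one-step estimate depend: the
  smallest gap and the size of the configuration.\<close>

definition separated :: "nat \<Rightarrow> real \<Rightarrow> real \<Rightarrow> (nat \<Rightarrow> real) \<Rightarrow> bool" where
  "separated N \<epsilon> R x \<longleftrightarrow> (\<forall>j<N. \<bar>x j\<bar> \<le> R) \<and> (\<forall>i<N. \<forall>j<N. i \<noteq> j \<longrightarrow> \<epsilon> \<le> \<bar>x i - x j\<bar>)"

definition fdet_ratio :: "nat \<Rightarrow> (nat \<Rightarrow> real \<Rightarrow> real) \<Rightarrow> (nat \<Rightarrow> real) \<Rightarrow> real" where
  "fdet_ratio N \<psi> x = fdet N (\<lambda>j v. \<psi> v (x j)) / vandermonde N x"

text \<open>Domination by the Vandermonde determinant makes \<open>fdet_ratio\<close> bounded, although it is a quotient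
  that degenerates at collisions (where it has the junk value 0).\<close>

definition dominated :: "nat \<Rightarrow> real \<Rightarrow> real \<Rightarrow> real \<Rightarrow> (nat \<Rightarrow> real \<Rightarrow> real) \<Rightarrow> bool" where
  "dominated N C D c \<psi> \<longleftrightarrow> (\<forall>v<N. cosh_lipschitz C D (\<psi> v))
     \<and> (\<forall>y. \<bar>fdet N (\<lambda>j v. \<psi> v (y j))\<bar> \<le> c * \<bar>vandermonde N y\<bar>)"

lemma drift_abs_le:
  assumes "separated N \<epsilon> R x" "\<epsilon> > 0" "j < N"
  shows "\<bar>drift N x j\<bar> \<le> N / \<epsilon>"
proof -
  have "\<bar>drift N x j\<bar> \<le> (\<Sum>k\<in>{..<N} - {j}. \<bar>1 / (x j - x k)\<bar>)"
    unfolding drift_def by (rule sum_abs)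
  also have "\<dots> \<le> (\<Sum>k\<in>{..<N} - {j}. 1 / \<epsilon>)"
    using assms unfolding separated_def by (intro sum_mono) (auto intro!: frac_le)
  also have "\<dots> \<le> (\<Sum>k<N. 1 / \<epsilon>)"
    using assms(2) by (intro sum_mono2) auto
  finally show ?thesis by simp
qed

lemma separated_vandermonde:
  assumes "separated N \<epsilon> R x" "\<epsilon> > 0"
  shows "(\<Prod>j<N. \<Prod>i<j. \<epsilon>) \<le> \<bar>vandermonde N x\<bar>" "vandermonde N x \<noteq> 0"
proof -
  show 1: "(\<Prod>j<N. \<Prod>i<j. \<epsilon>) \<le> \<bar>vandermonde N x\<bar>"
    unfolding vandermonde_def abs_prod using assms unfolding separated_def
    by (intro prod_mono conjI prod_nonneg) auto
  have "0 < (\<Prod>j<N. \<Prod>i<j. \<epsilon>)" using assms(2) by (intro prod_pos) auto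
  with 1 show "vandermonde N x \<noteq> 0" by auto
qed

text \<open>First order expansion of \<open>h(x + w) / h(x)\<close> for the Vandermonde determinant \<open>h\<close>, whose
  logarithmic gradient is the drift.\<close>

lemma vandermonde_ratio_expansion:
  assumes sep: "separated N \<epsilon> R x" and "\<epsilon> > 0"
  defines "S \<equiv> \<lambda>w. \<Sum>j<N. \<bar>w j\<bar>" and "K \<equiv> real N * real N / \<epsilon>"
  shows "\<bar>vandermonde N (\<lambda>j. x j + w j) / vandermonde N x - 1\<bar> \<le> K * S w * exp (K * S w)"
    and "\<bar>vandermonde N (\<lambda>j. x j + w j) / vandermonde N x - 1 - (\<Sum>j<N. drift N x j * w j)\<bar>
      \<le> (K * S w)\<^sup>2 * exp (K * S w)"
proof -
  define I where "I = (SIGMA j:{..<N}. {..<j})"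
  define a where "a = (\<lambda>(j, i). (w j - w i) / (x j - x i))"
  have neq: "x j - x i \<noteq> 0" if "j < N" "i < j" for i j
    using sep \<open>\<epsilon> > 0\<close> that unfolding separated_def
    by (metis abs_zero less_irrefl not_le order_less_trans)
  have ratio: "vandermonde N (\<lambda>j. x j + w j) / vandermonde N x = (\<Prod>p\<in>I. 1 + a p)"
  proof -
    have "vandermonde N (\<lambda>j. x j + w j) / vandermonde N x
        = (\<Prod>j<N. \<Prod>i<j. (x j + w j - (x i + w i)) / (x j - x i))"
      unfolding vandermonde_def by (simp add: prod_dividef)
    also have "\<dots> = (\<Prod>j<N. \<Prod>i<j. 1 + a (j, i))"
      using neq by (intro prod.cong refl) (simp add: a_def field_simps)
    also have "\<dots> = (\<Prod>p\<in>I. 1 + a p)"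
      unfolding I_def by (subst prod.Sigma) auto
    finally show ?thesis .
  qed
  \<comment> \<open>A pair of points contributes to the drift of both of them, so a sum over pairs
    \<open>i < j\<close> becomes a sum over all ordered pairs.\<close>
  have sum_a: "(\<Sum>p\<in>I. a p) = (\<Sum>j<N. drift N x j * w j)"
  proof -
    let ?t = "\<lambda>j i. w j / (x j - x i)"
    have "(\<Sum>p\<in>I. a p) = (\<Sum>j<N. \<Sum>i<j. ?t j i + ?t i j)"
      unfolding I_def a_def
      by (subst sum.Sigma[symmetric]) (auto simp: diff_divide_distrib minus_divide_right intro!: sum.cong)
    also have "\<dots> = (\<Sum>j<N. \<Sum>i | i \<in> {..<N} \<and> i < j. ?t j i) + (\<Sum>j<N. \<Sum>i | i \<in> {..<N} \<and> i < j. ?t i j)"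
      unfolding sum.distrib by (intro arg_cong2[where f = "(+)"] sum.cong refl) auto
    also have "(\<Sum>j<N. \<Sum>i | i \<in> {..<N} \<and> i < j. ?t i j) = (\<Sum>i<N. \<Sum>j | j \<in> {..<N} \<and> i < j. ?t i j)"
      by (rule sum.swap_restrict) auto
    also have "(\<Sum>j<N. \<Sum>i | i \<in> {..<N} \<and> i < j. ?t j i) + (\<Sum>i<N. \<Sum>j | j \<in> {..<N} \<and> i < j. ?t i j)
        = (\<Sum>j<N. \<Sum>k\<in>{..<N} - {j}. ?t j k)"
      unfolding sum.distrib[symmetric]
    proof (rule sum.cong[OF refl])
      fix j assume "j \<in> {..<N}"
      let ?A = "{i. i \<in> {..<N} \<and> i < j}" and ?B = "{k. k \<in> {..<N} \<and> j < k}"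
      have "(\<Sum>i\<in>?A. ?t j i) + (\<Sum>k\<in>?B. ?t j k) = (\<Sum>k\<in>?A \<union> ?B. ?t j k)"
        by (rule sum.union_disjoint[symmetric]) auto
      also have "?A \<union> ?B = {..<N} - {j}" by auto
      finally show "(\<Sum>i | i \<in> {..<N} \<and> i < j. ?t j i) + (\<Sum>k | k \<in> {..<N} \<and> j < k. ?t j k)
          = (\<Sum>k\<in>{..<N} - {j}. ?t j k)" .
    qed
    also have "\<dots> = (\<Sum>j<N. drift N x j * w j)"
      unfolding drift_def by (simp add: sum_distrib_right)
    finally show ?thesis .
  qed
  define A where "A = (\<Sum>p\<in>I. \<bar>a p\<bar>)"
  have A0: "A \<ge> 0" unfolding A_def by (intro sum_nonneg) auto
  have S0: "S w \<ge> 0" unfolding S_def by (intro sum_nonneg) auto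
  have "A \<le> (\<Sum>p\<in>I. S w / \<epsilon>)"
    unfolding A_def
  proof (rule sum_mono)
    fix p assume "p \<in> I"
    then obtain j i where p: "p = (j, i)" "j < N" "i < j" by (auto simp: I_def)
    have "\<bar>w j - w i\<bar> \<le> \<bar>w j\<bar> + \<bar>w i\<bar>" by (rule abs_triangle_ineq4)
    also have "\<dots> = (\<Sum>k\<in>{j, i}. \<bar>w k\<bar>)" using p by auto
    also have "\<dots> \<le> S w" unfolding S_def using p by (intro sum_mono2) auto
    finally have "\<bar>w j - w i\<bar> \<le> S w" .
    moreover have "\<epsilon> \<le> \<bar>x j - x i\<bar>" using sep p unfolding separated_def by auto
    ultimately show "\<bar>a p\<bar> \<le> S w / \<epsilon>"
      using S0 \<open>\<epsilon> > 0\<close> by (auto simp: p a_def intro!: frac_le)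
  qed
  also have "\<dots> = card I * (S w / \<epsilon>)" by simp
  also have "\<dots> \<le> (real N * real N) * (S w / \<epsilon>)"
  proof (rule mult_right_mono)
    have "card I \<le> card ({..<N} \<times> {..<N})" unfolding I_def by (intro card_mono) auto
    then show "real (card I) \<le> real N * real N" by (simp flip: of_nat_mult)
  qed (use S0 \<open>\<epsilon> > 0\<close> in simp)
  finally have AK: "A \<le> K * S w" by (simp add: K_def)
  have fin: "finite I" by (simp add: I_def)
  have "\<bar>(\<Prod>p\<in>I. 1 + a p) - 1\<bar> \<le> A * exp A"
    using prod_one_plus_bounds(2)[OF fin] by (simp add: A_def)
  also have "\<dots> \<le> K * S w * exp (K * S w)"
    using AK A0 by (intro mult_mono) auto
  finally show "\<bar>vandermonde N (\<lambda>j. x j + w j) / vandermonde N x - 1\<bar> \<le> K * S w * exp (K * S w)"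
    unfolding ratio .
  have "\<bar>(\<Prod>p\<in>I. 1 + a p) - 1 - (\<Sum>p\<in>I. a p)\<bar> \<le> A\<^sup>2 * exp A"
    using prod_one_plus_bounds(3)[OF fin] by (simp add: A_def)
  also have "\<dots> \<le> (K * S w)\<^sup>2 * exp (K * S w)"
    using AK A0 by (intro mult_mono power_mono) auto
  finally show "\<bar>vandermonde N (\<lambda>j. x j + w j) / vandermonde N x - 1 - (\<Sum>j<N. drift N x j * w j)\<bar>
      \<le> (K * S w)\<^sup>2 * exp (K * S w)"
    unfolding ratio sum_a .
qed

text \<open>Leibniz expansion and comparison factor by factor. The exponent \<open>N + 1\<close>
  collects one \<open>exp (S w)\<close> from the size of each of the \<open>N\<close> factors and
  one from the Lipschitz estimate.\<close>

lemma fdet_increment_bound: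
  assumes \<psi>: "\<And>v. v < N \<Longrightarrow> cosh_lipschitz C D (\<psi> v)" and x: "\<And>j. j < N \<Longrightarrow> \<bar>x j\<bar> \<le> R"
    and C: "C \<ge> 0" and D: "D \<ge> 0"
  defines "S \<equiv> \<lambda>w. \<Sum>j<N. \<bar>w j\<bar>"
  shows "\<bar>fdet N (\<lambda>j v. \<psi> v (x j + w j)) - fdet N (\<lambda>j v. \<psi> v (x j))\<bar>
    \<le> fact N * ((C + 1) * exp \<bar>R\<bar>) ^ N * (2 * D * exp \<bar>R\<bar>) * S w * exp ((real N + 1) * S w)"
proof -
  have S0: "S w \<ge> 0" unfolding S_def by (intro sum_nonneg) auto
  have wS: "\<bar>w j\<bar> \<le> S w" if "j < N" for j
    unfolding S_def using that by (intro member_le_sum) auto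
  define E where "E = exp (\<bar>R\<bar> + S w)"
  have E1: "E \<ge> 1" using S0 by (simp add: E_def)
  have ch: "cosh (x j + w j) \<le> E" "cosh (x j) \<le> E" if "j < N" for j
  proof -
    have ce: "cosh y \<le> exp \<bar>y\<bar>" for y :: real
      by (cases "y \<ge> 0") (auto simp: cosh_def)
    have "\<bar>x j + w j\<bar> \<le> \<bar>R\<bar> + S w" "\<bar>x j\<bar> \<le> \<bar>R\<bar> + S w" using x[OF that] wS[OF that] S0 by linarith+
    then show "cosh (x j + w j) \<le> E" "cosh (x j) \<le> E"
      unfolding E_def using ce[of "x j + w j"] ce[of "x j"] by (meson exp_le_cancel_iff order_trans)+
  qed
  define B where "B = (C + 1) * E"
  have B1: "B \<ge> 1" unfolding B_def using C E1 mult_mono[of 1 "C + 1" 1 E] by simp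
  have bnd: "\<bar>\<psi> v (x j + w j)\<bar> \<le> B" "\<bar>\<psi> v (x j)\<bar> \<le> B" if "v < N" "j < N" for v j
  proof -
    have "\<bar>\<psi> v y\<bar> \<le> B" if "cosh y \<le> E" for y
    proof -
      have "\<bar>\<psi> v y\<bar> \<le> C * cosh y" using \<psi>[OF \<open>v < N\<close>] by (auto simp: cosh_lipschitz_def)
      also have "\<dots> \<le> (C + 1) * E" using that C E1 by (intro mult_mono) auto
      finally show ?thesis by (simp add: B_def)
    qed
    then show "\<bar>\<psi> v (x j + w j)\<bar> \<le> B" "\<bar>\<psi> v (x j)\<bar> \<le> B" using ch[OF \<open>j < N\<close>] by auto
  qed
  have dif: "\<bar>\<psi> v (x j + w j) - \<psi> v (x j)\<bar> \<le> 2 * D * E * \<bar>w j\<bar>" if "v < N" "j < N" for v j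
  proof -
    have "\<bar>\<psi> v (x j + w j) - \<psi> v (x j)\<bar> \<le> D * \<bar>x j + w j - x j\<bar> * (cosh (x j + w j) + cosh (x j))"
      using \<psi>[OF \<open>v < N\<close>] unfolding cosh_lipschitz_def by blast
    also have "\<dots> \<le> D * \<bar>w j\<bar> * (2 * E)"
      using ch[OF \<open>j < N\<close>] D by (intro mult_mono) auto
    finally show ?thesis by (simp add: algebra_simps)
  qed
  have "\<bar>fdet N (\<lambda>j v. \<psi> v (x j + w j)) - fdet N (\<lambda>j v. \<psi> v (x j))\<bar>
      = \<bar>\<Sum>p | p permutes {..<N}. of_int (sign p) * ((\<Prod>j<N. \<psi> (p j) (x j + w j)) - (\<Prod>j<N. \<psi> (p j) (x j)))\<bar>"
    unfolding fdet_leibniz by (simp add: right_diff_distrib sum_subtractf)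
  also have "\<dots> \<le> (\<Sum>p | p permutes {..<N}. B ^ N * (2 * D * E * S w))"
  proof (rule order_trans[OF sum_abs], rule sum_mono)
    fix p assume "p \<in> {p. p permutes {..<N}}"
    then have p: "p j < N" if "j < N" for j
      using permutes_in_image[of p "{..<N}" j] that by simp
    have "\<bar>of_int (sign p) * ((\<Prod>j<N. \<psi> (p j) (x j + w j)) - (\<Prod>j<N. \<psi> (p j) (x j)))\<bar>
        = \<bar>(\<Prod>j<N. \<psi> (p j) (x j + w j)) - (\<Prod>j<N. \<psi> (p j) (x j))\<bar>"
      by (simp add: abs_mult sign_def)
    also have "\<dots> \<le> B ^ card {..<N} * (\<Sum>j<N. 2 * D * E * \<bar>w j\<bar>)"
      using B1 bnd dif p by (intro prod_diff_bound) auto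
    also have "\<dots> = B ^ N * (2 * D * E * S w)"
      by (simp add: S_def sum_distrib_left)
    finally show "\<bar>of_int (sign p) * ((\<Prod>j<N. \<psi> (p j) (x j + w j)) - (\<Prod>j<N. \<psi> (p j) (x j)))\<bar> \<le> B ^ N * (2 * D * E * S w)" .
  qed
  also have "\<dots> = fact N * (B ^ N * (2 * D * E * S w))"
    by (simp add: card_permutations)
  also have "\<dots> = fact N * ((C + 1) * exp \<bar>R\<bar>) ^ N * (2 * D * exp \<bar>R\<bar>) * S w * exp ((real N + 1) * S w)"
  proof -
    have "exp ((real N + 1) * S w) = exp (S w) ^ N * exp (S w)"
      by (simp add: distrib_right exp_add exp_of_nat_mult)
    then show ?thesis
      unfolding B_def E_def by (simp only: exp_add power_mult_distrib mult_ac)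
  qed
  finally show ?thesis .
qed

lemma fdet_ratio_cong:
  assumes "\<And>j. j < N \<Longrightarrow> x j = y j"
  shows "fdet_ratio N \<psi> x = fdet_ratio N \<psi> y"
proof -
  have "vandermonde N x = vandermonde N y"
    unfolding vandermonde_def using assms by (intro prod.cong refl) auto
  moreover have "fdet N (\<lambda>j v. \<psi> v (x j)) = fdet N (\<lambda>j v. \<psi> v (y j))"
    using assms by (intro fdet_cong) auto
  ultimately show ?thesis by (simp add: fdet_ratio_def)
qed

lemma measurable_vandermonde [measurable]:
  fixes f :: "nat \<Rightarrow> 'b \<Rightarrow> real"
  assumes "\<And>j. j < n \<Longrightarrow> f j \<in> borel_measurable M"
  shows "(\<lambda>x. vandermonde n (\<lambda>j. f j x)) \<in> borel_measurable M"
  unfolding vandermonde_def using assms by (intro borel_measurable_prod borel_measurable_diff) auto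

lemma measurable_fdet_ratio:
  assumes "\<And>j. j < N \<Longrightarrow> f j \<in> borel_measurable M" "\<And>v. v < N \<Longrightarrow> \<psi> v \<in> borel_measurable borel"
  shows "(\<lambda>x. fdet_ratio N \<psi> (\<lambda>j. f j x)) \<in> borel_measurable M"
  unfolding fdet_ratio_def using assms
  by (intro borel_measurable_divide measurable_fdet measurable_vandermonde measurable_compose[OF assms(1) assms(2)])

text \<open>The fourth claim also holds at collisions, where \<open>fdet_ratio\<close> is 0 by
  division by zero: domination forces the determinant to vanish there. The fifth is the bound that
  makes abandoning the chain affordable.\<close>

lemma dominatedD:
  assumes "dominated N C D c \<psi>"
  shows "v < N \<Longrightarrow> cosh_lipschitz C D (\<psi> v)" "v < N \<Longrightarrow> cosh_bounded C (\<psi> v)"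
    "v < N \<Longrightarrow> \<psi> v \<in> borel_measurable borel"
    "fdet N (\<lambda>j v. \<psi> v (y j)) = fdet_ratio N \<psi> y * vandermonde N y"
    "0 \<le> c \<Longrightarrow> \<bar>fdet_ratio N \<psi> y\<bar> \<le> c"
proof -
  show *: "v < N \<Longrightarrow> cosh_lipschitz C D (\<psi> v)" using assms by (simp add: dominated_def)
  show "v < N \<Longrightarrow> cosh_bounded C (\<psi> v)" using * by (rule cosh_lipschitz_bounded)
  then show "v < N \<Longrightarrow> \<psi> v \<in> borel_measurable borel" by (rule cosh_boundedD(1))
  have d: "\<bar>fdet N (\<lambda>j v. \<psi> v (y j))\<bar> \<le> c * \<bar>vandermonde N y\<bar>" using assms by (simp add: dominated_def)
  show "fdet N (\<lambda>j v. \<psi> v (y j)) = fdet_ratio N \<psi> y * vandermonde N y"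
    using d by (cases "vandermonde N y = 0") (auto simp: fdet_ratio_def)
  show "0 \<le> c \<Longrightarrow> \<bar>fdet_ratio N \<psi> y\<bar> \<le> c"
    using d by (cases "vandermonde N y = 0") (auto simp: fdet_ratio_def abs_divide divide_le_eq)
qed

text \<open>The domination constant \<open>c\<close> does not grow, in contrast to the regularity
  constants \<open>C\<close> and \<open>D\<close>. This is what total positivity is used
  for.\<close>

lemma dominated_heat:
  assumes "dominated N C D c \<psi>" "\<tau> > 0"
  shows "dominated N (exp (\<tau> / 2) * C) (exp (\<tau> / 2) * D) c (\<lambda>v. heat \<tau> (\<psi> v))"
  unfolding dominated_def
proof (intro conjI allI impI)
  show "cosh_lipschitz (exp (\<tau> / 2) * C) (exp (\<tau> / 2) * D) (heat \<tau> (\<psi> v))" if "v < N" for v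
    using dominatedD(1)[OF assms(1) that] assms(2) by (rule heat_lipschitz)
  show "\<bar>fdet N (\<lambda>j v. heat \<tau> (\<psi> v) (y j))\<bar> \<le> c * \<bar>vandermonde N y\<bar>" for y
    by (rule heat_fdet_le_vandermonde[OF _ assms(2)])
      (use assms(1) in \<open>auto intro: dominatedD(2) simp: dominated_def\<close>)
qed

lemma dominated_mono:
  assumes "dominated N C D c \<psi>" "C \<le> C'" "D \<le> D'"
  shows "dominated N C' D' c \<psi>"
  using assms cosh_lipschitz_mono unfolding dominated_def by blast

text \<open>Compares the Cameron-Martin density of a drifted step with its linearisation. The
  exponent has a part of order \<open>S w\<close> and a part of order \<open>\<delta>\<close>, and
  the remainder \<open>exp z - 1 - z\<close> is quadratic in it.\<close>

lemma euler_density_bound: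
  fixes \<delta> :: real
  assumes sep: "separated N \<epsilon> R x" and "\<epsilon> > 0" and \<delta>: "0 < \<delta>" "\<delta> \<le> T"
  defines "S \<equiv> \<lambda>w. \<Sum>j<N. \<bar>w j\<bar>" and "\<beta> \<equiv> real N / \<epsilon>"
  defines "\<kappa> \<equiv> real N * \<beta>\<^sup>2 / 2"
  shows "\<bar>exp (\<Sum>j<N. drift N x j * w j - \<delta> * (drift N x j)\<^sup>2 / 2) - 1 - (\<Sum>j<N. drift N x j * w j)\<bar>
    \<le> (\<kappa> + (2 * \<beta>\<^sup>2 + 2 * T * \<kappa>\<^sup>2) * exp (T * \<kappa>)) * ((S w)\<^sup>2 + \<delta>) * exp (\<beta> * S w)"
proof -
  define L where "L = (\<Sum>j<N. drift N x j * w j)"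
  define q where "q = (\<Sum>j<N. (drift N x j)\<^sup>2 / 2)"
  have S0: "S w \<ge> 0" unfolding S_def by (intro sum_nonneg) auto
  have \<beta>0: "\<beta> \<ge> 0" using \<open>\<epsilon> > 0\<close> by (simp add: \<beta>_def)
  have \<kappa>0: "\<kappa> \<ge> 0" by (simp add: \<kappa>_def)
  have db: "\<bar>drift N x j\<bar> \<le> \<beta>" if "j < N" for j
    unfolding \<beta>_def using drift_abs_le[OF sep \<open>\<epsilon> > 0\<close> that] .
  have L: "\<bar>L\<bar> \<le> \<beta> * S w"
  proof -
    have "\<bar>L\<bar> \<le> (\<Sum>j<N. \<bar>drift N x j\<bar> * \<bar>w j\<bar>)" unfolding L_def abs_mult[symmetric] by (rule sum_abs)
    also have "\<dots> \<le> (\<Sum>j<N. \<beta> * \<bar>w j\<bar>)" using db by (intro sum_mono mult_right_mono) auto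
    finally show ?thesis by (simp add: S_def sum_distrib_left)
  qed
  have q0: "q \<ge> 0" unfolding q_def by (intro sum_nonneg) auto
  have q: "q \<le> \<kappa>"
  proof -
    have "q \<le> (\<Sum>j<N. \<beta>\<^sup>2 / 2)"
      unfolding q_def
    proof (rule sum_mono)
      fix j assume "j \<in> {..<N}"
      then have "\<bar>drift N x j\<bar>\<^sup>2 \<le> \<beta>\<^sup>2" using db by (intro power_mono) auto
      then show "(drift N x j)\<^sup>2 / 2 \<le> \<beta>\<^sup>2 / 2" by simp
    qed
    then show ?thesis by (simp add: \<kappa>_def)
  qed
  define z where "z = L - \<delta> * q"
  have z_eq: "(\<Sum>j<N. drift N x j * w j - \<delta> * (drift N x j)\<^sup>2 / 2) = z"
    by (simp add: z_def L_def q_def sum_subtractf sum_distrib_left)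
  have dq: "\<delta> * q \<le> T * \<kappa>" "0 \<le> \<delta> * q" "(\<delta> * q)\<^sup>2 \<le> T * \<kappa>\<^sup>2 * \<delta>"
  proof -
    show "\<delta> * q \<le> T * \<kappa>" using \<delta> q q0 by (intro mult_mono) auto
    show "0 \<le> \<delta> * q" using \<delta> q0 by simp
    have "(\<delta> * q)\<^sup>2 = \<delta> * (\<delta> * q\<^sup>2)" by (simp add: power2_eq_square)
    also have "\<dots> \<le> \<delta> * (T * \<kappa>\<^sup>2)" using \<delta> q q0 by (intro mult_left_mono mult_mono power_mono) auto
    finally show "(\<delta> * q)\<^sup>2 \<le> T * \<kappa>\<^sup>2 * \<delta>" by (simp add: mult_ac)
  qed
  have z2: "z\<^sup>2 \<le> 2 * \<beta>\<^sup>2 * (S w)\<^sup>2 + 2 * T * \<kappa>\<^sup>2 * \<delta>"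
  proof -
    have "z\<^sup>2 \<le> 2 * L\<^sup>2 + 2 * (\<delta> * q)\<^sup>2"
      unfolding z_def using zero_le_power2[of "L + \<delta> * q"] by (simp add: power2_eq_square algebra_simps)
    moreover have "\<bar>L\<bar>\<^sup>2 \<le> (\<beta> * S w)\<^sup>2" using L by (intro power_mono) auto
    ultimately show ?thesis using dq(3) by (simp add: power_mult_distrib)
  qed
  have ez: "exp \<bar>z\<bar> \<le> exp (T * \<kappa>) * exp (\<beta> * S w)"
  proof -
    have "\<bar>z\<bar> \<le> T * \<kappa> + \<beta> * S w" unfolding z_def using L dq by linarith
    then show ?thesis by (simp flip: exp_add)
  qed
  have "\<bar>exp z - 1 - L\<bar> \<le> \<bar>exp z - 1 - z\<bar> + \<delta> * q" unfolding z_def using dq(2) by linarith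
  also have "\<dots> \<le> z\<^sup>2 * exp \<bar>z\<bar> + \<delta> * \<kappa>"
    using exp_minus_linear_bound[of z] q \<delta> by (intro add_mono mult_left_mono) auto
  also have "z\<^sup>2 * exp \<bar>z\<bar> \<le> (2 * \<beta>\<^sup>2 * (S w)\<^sup>2 + 2 * T * \<kappa>\<^sup>2 * \<delta>) * (exp (T * \<kappa>) * exp (\<beta> * S w))"
    using z2 ez \<delta> by (intro mult_mono) (auto intro!: add_nonneg_nonneg mult_nonneg_nonneg)
  also have "2 * \<beta>\<^sup>2 * (S w)\<^sup>2 + 2 * T * \<kappa>\<^sup>2 * \<delta> \<le> (2 * \<beta>\<^sup>2 + 2 * T * \<kappa>\<^sup>2) * ((S w)\<^sup>2 + \<delta>)"
    using \<delta> by (simp add: algebra_simps)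
  also have "\<delta> * \<kappa> \<le> \<kappa> * ((S w)\<^sup>2 + \<delta>) * exp (\<beta> * S w)"
  proof -
    have "\<kappa> * \<delta> * 1 \<le> \<kappa> * ((S w)\<^sup>2 + \<delta>) * exp (\<beta> * S w)"
      using \<kappa>0 \<delta> \<beta>0 S0 by (intro mult_mono mult_nonneg_nonneg) auto
    then show ?thesis by (simp add: mult_ac)
  qed
  finally have "\<bar>exp z - 1 - L\<bar> \<le> (2 * \<beta>\<^sup>2 + 2 * T * \<kappa>\<^sup>2) * ((S w)\<^sup>2 + \<delta>) * (exp (T * \<kappa>) * exp (\<beta> * S w))
      + \<kappa> * ((S w)\<^sup>2 + \<delta>) * exp (\<beta> * S w)"
    by (simp add: mult_right_mono)
  also have "\<dots> = (\<kappa> + (2 * \<beta>\<^sup>2 + 2 * T * \<kappa>\<^sup>2) * exp (T * \<kappa>)) * ((S w)\<^sup>2 + \<delta>) * exp (\<beta> * S w)"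
    by (simp add: algebra_simps)
  finally show ?thesis unfolding z_eq L_def .
qed

text \<open>In the scaled variable \<open>s = S w / sqrt \<delta>\<close> the cubic error is
  \<open>\<delta> * sqrt \<delta>\<close> times a quantity whose Gaussian moments are bounded
  uniformly in \<open>\<delta>\<close>. The constant 7 is 6 + 1, from
  \<open>s ^ 3 \<le> 6 * exp s\<close> and \<open>s \<le> exp s\<close>.\<close>

lemma gaussian_third_order:
  fixes \<delta> :: real and N :: nat
  assumes "0 < \<delta>" "\<delta> \<le> T" "a \<ge> 0"
  defines "S \<equiv> \<lambda>w. \<Sum>j<N. \<bar>w j\<bar>"
  shows "integrable (gaussian N (sqrt \<delta>)) (\<lambda>w. exp ((1 + a * sqrt T) / sqrt \<delta> * S w))"
    and "((S w)\<^sup>2 + \<delta>) * S w * exp (a * S w) \<le> 7 * (\<delta> * sqrt \<delta>) * exp ((1 + a * sqrt T) / sqrt \<delta> * S w)"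
    and "(LINT w|gaussian N (sqrt \<delta>). exp ((1 + a * sqrt T) / sqrt \<delta> * S w))
      \<le> (2 * exp ((1 + a * sqrt T)\<^sup>2 / 2)) ^ N"
proof -
  have sd: "sqrt \<delta> > 0" using assms by simp
  show "integrable (gaussian N (sqrt \<delta>)) (\<lambda>w. exp ((1 + a * sqrt T) / sqrt \<delta> * S w))"
    unfolding S_def by (rule gaussian_exp_norm(1)[OF sd])
  show "(LINT w|gaussian N (sqrt \<delta>). exp ((1 + a * sqrt T) / sqrt \<delta> * S w))
      \<le> (2 * exp ((1 + a * sqrt T)\<^sup>2 / 2)) ^ N"
    using gaussian_exp_norm(2)[OF sd, of N "(1 + a * sqrt T) / sqrt \<delta>"] assms
    by (simp add: S_def power_divide)
  define s where "s = S w / sqrt \<delta>"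
  have S0: "S w \<ge> 0" unfolding S_def by (intro sum_nonneg) auto
  have s0: "s \<ge> 0" using S0 sd by (simp add: s_def)
  have S: "S w = sqrt \<delta> * s" using sd by (simp add: s_def)
  have s3: "s ^ 3 + s \<le> 7 * exp s"
  proof -
    have "(\<Sum>k\<in>{3}. s ^ k /\<^sub>R fact k) \<le> (\<Sum>k. s ^ k /\<^sub>R fact k)"
      using s0 by (intro sum_le_suminf summable_exp_generic) auto
    then have "s ^ 3 \<le> 6 * exp s" by (simp add: exp_def eval_nat_numeral)
    moreover have "s \<le> exp s" using exp_ge_add_one_self[of s] by linarith
    ultimately show ?thesis by linarith
  qed
  have "((S w)\<^sup>2 + \<delta>) * S w = \<delta> * sqrt \<delta> * (s ^ 3 + s)"
    unfolding S using assms by (simp add: power_mult_distrib algebra_simps power3_eq_cube power2_eq_square)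
  also have "\<dots> \<le> \<delta> * sqrt \<delta> * (7 * exp s)"
    using s3 assms by (intro mult_left_mono) auto
  finally have 1: "((S w)\<^sup>2 + \<delta>) * S w \<le> 7 * (\<delta> * sqrt \<delta>) * exp s" by simp
  have "a * (sqrt \<delta> * s) \<le> a * (sqrt T * s)"
    using assms s0 by (intro mult_left_mono mult_right_mono) auto
  then have 2: "exp (a * S w) \<le> exp (a * sqrt T * s)" unfolding S by (simp add: mult.assoc)
  have "((S w)\<^sup>2 + \<delta>) * S w * exp (a * S w) \<le> 7 * (\<delta> * sqrt \<delta>) * exp s * exp (a * sqrt T * s)"
    by (rule mult_mono[OF 1 2]) (use assms(1) in auto)
  also have "\<dots> = 7 * (\<delta> * sqrt \<delta>) * exp ((1 + a * sqrt T) / sqrt \<delta> * S w)"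
    using sd by (simp add: s_def add_divide_distrib distrib_right mult.assoc flip: exp_add)
  finally show "((S w)\<^sup>2 + \<delta>) * S w * exp (a * S w) \<le> 7 * (\<delta> * sqrt \<delta>) * exp ((1 + a * sqrt T) / sqrt \<delta> * S w)" .
qed

text \<open>Both one-step kernels have total mass one and their densities with respect to the Gaussian step
  agree to first order, so a Lipschitz test function sees a difference of order \<open>\<delta> powr (3 / 2)\<close>.\<close>

lemma euler_step_estimate:
  assumes "\<epsilon> > 0" "C \<ge> 0" "D \<ge> 0" "c \<ge> 0"
  shows "\<exists>K\<ge>0. \<forall>\<delta> x \<psi>. 0 < \<delta> \<longrightarrow> \<delta> \<le> T \<longrightarrow> separated N \<epsilon> R x \<longrightarrow> dominated N C D c \<psi> \<longrightarrow>
    \<bar>(LINT w|gaussian N (sqrt \<delta>). fdet_ratio N \<psi> (\<lambda>j. x j + \<delta> * drift N x j + w j))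
      - fdet_ratio N (\<lambda>v. heat \<delta> (\<psi> v)) x\<bar> \<le> K * (\<delta> * sqrt \<delta>)"
proof -
  define \<beta> where "\<beta> = real N / \<epsilon>"
  define \<kappa> where "\<kappa> = real N * \<beta>\<^sup>2 / 2"
  define Kv where "Kv = real N * real N / \<epsilon>"
  define V0 where "V0 = (\<Prod>j<N. \<Prod>i<j. \<epsilon>)"
  define L1 where "L1 = fact N * ((C + 1) * exp \<bar>R\<bar>) ^ N * (2 * D * exp \<bar>R\<bar>)"
  \<comment> \<open>\<open>M\<close> bounds the difference of the two densities: the first summand
    is the constant of \<open>euler_density_bound\<close>, and \<open>Kv\<^sup>2\<close> comes from
    \<open>vandermonde_ratio_expansion\<close>. The rate \<open>a\<close> exceeds every exponential
    rate that occurs; \<open>K\<close> contains \<open>2 * a\<close> because two such bounds are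
    multiplied.\<close>
  define M where "M = (\<kappa> + (2 * \<beta>\<^sup>2 + 2 * \<bar>T\<bar> * \<kappa>\<^sup>2) * exp (\<bar>T\<bar> * \<kappa>)) + Kv\<^sup>2"
  define a where "a = real N + 1 + Kv + \<beta>"
  define K where "K = (L1 / V0 + c * Kv) * M * 7 * (2 * exp ((1 + 2 * a * sqrt \<bar>T\<bar>)\<^sup>2 / 2)) ^ N"
  have pos: "\<beta> \<ge> 0" "\<kappa> \<ge> 0" "Kv \<ge> 0" "V0 > 0" "L1 \<ge> 0" "M \<ge> 0" "a \<ge> 0"
    using assms by (auto simp: \<beta>_def \<kappa>_def Kv_def V0_def L1_def M_def a_def intro!: prod_pos add_nonneg_nonneg mult_nonneg_nonneg)
  have K0: "K \<ge> 0" unfolding K_def using pos assms by simp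
  show ?thesis
  proof (intro exI[of _ K] conjI allI impI K0)
    fix \<delta> :: real and x \<psi>
    assume \<delta>: "0 < \<delta>" "\<delta> \<le> T" and sep: "separated N \<epsilon> R x" and dom: "dominated N C D c \<psi>"
    note D = dominatedD[OF dom]
    define G where "G = gaussian N (sqrt \<delta>)"
    have sd: "sqrt \<delta> > 0" using \<delta> by simp
    interpret G: prob_space G unfolding G_def by (rule prob_space_gaussian[OF sd])
    have V: "V0 \<le> \<bar>vandermonde N x\<bar>" "vandermonde N x \<noteq> 0"
      using separated_vandermonde[OF sep assms(1)] by (simp_all add: V0_def)
    define S where "S w = (\<Sum>j<N. \<bar>w j\<bar>)" for w :: "nat \<Rightarrow> real"
    have S0: "S w \<ge> 0" for w unfolding S_def by (intro sum_nonneg) auto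
    define f where "f w = fdet_ratio N \<psi> (\<lambda>j. x j + w j)" for w
    define f0 where "f0 = fdet_ratio N \<psi> x"
    \<comment> \<open>Relative to the driftless Gaussian step, \<open>e\<close> is the density of
      the Euler step and \<open>h\<close> that of the h-transform.\<close>
    define e where "e w = exp (\<Sum>j<N. drift N x j * w j - \<delta> * (drift N x j)\<^sup>2 / 2)" for w
    define h where "h w = vandermonde N (\<lambda>j. x j + w j) / vandermonde N x" for w
    have comp: "(\<lambda>w. w j) \<in> borel_measurable G" if "j < N" for j
      unfolding G_def using that by (rule gaussian_component)
    have fm: "f \<in> borel_measurable (Pi\<^sub>M {..<N} (\<lambda>_. borel))" 
      unfolding f_def[abs_def] using D(3) by (intro measurable_fdet_ratio borel_measurable_add borel_measurable_const measurable_component_singleton) auto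
    then have fG: "f \<in> borel_measurable G"
      unfolding G_def by (simp add: measurable_cong_sets[OF sets_gaussian refl])
    have fb: "\<bar>f w\<bar> \<le> c" for w unfolding f_def using D(5) assms(4) by blast
    have em: "e \<in> borel_measurable G"
      unfolding e_def[abs_def] using comp
      by (intro measurable_compose[OF _ borel_measurable_exp] borel_measurable_sum borel_measurable_diff borel_measurable_times borel_measurable_const) auto
    have cm: "(LINT w|G. F (\<lambda>j\<in>{..<N}. \<delta> * drift N x j + w j)) = (LINT w|G. e w * F w)"
      if "F \<in> borel_measurable (Pi\<^sub>M {..<N} (\<lambda>_. borel))" for F
    proof -
      have "(LINT w|G. F (\<lambda>j\<in>{..<N}. \<delta> * drift N x j + w j))
        = (LINT w|G. exp (\<Sum>j<N. \<delta> * drift N x j * w j / (sqrt \<delta>)\<^sup>2 - (\<delta> * drift N x j)\<^sup>2 / (2 * (sqrt \<delta>)\<^sup>2)) * F w)"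
        unfolding G_def by (rule gaussian_cameron_martin[OF sd that])
      also have "(\<lambda>w. exp (\<Sum>j<N. \<delta> * drift N x j * w j / (sqrt \<delta>)\<^sup>2 - (\<delta> * drift N x j)\<^sup>2 / (2 * (sqrt \<delta>)\<^sup>2))) = e"
        unfolding e_def using \<delta> by (intro ext arg_cong[where f = exp] sum.cong) (auto simp: power2_eq_square)
      finally show ?thesis .
    qed
    have "(LINT w|G. f (\<lambda>j\<in>{..<N}. \<delta> * drift N x j + w j)) = (LINT w|G. e w * f w)"
      by (rule cm[OF fm])
    moreover have "f (\<lambda>j\<in>{..<N}. \<delta> * drift N x j + w j) = fdet_ratio N \<psi> (\<lambda>j. x j + \<delta> * drift N x j + w j)" for w
      unfolding f_def by (rule fdet_ratio_cong) simp
    ultimately have lhs: "(LINT w|G. fdet_ratio N \<psi> (\<lambda>j. x j + \<delta> * drift N x j + w j)) = (LINT w|G. e w * f w)"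
      by simp
    have e1: "(LINT w|G. e w) = 1"
      using cm[of "\<lambda>_. 1"] G.prob_space by simp
    \<comment> \<open>A function that is not integrable has Bochner integral 0, so the value 1
      already gives integrability.\<close>
    have ei: "integrable G e"
      using e1 not_integrable_integral_eq[of G e] by fastforce
    have hi: "integrable G h" and h1: "(LINT w|G. h w) = 1"
      unfolding h_def[abs_def] G_def using gaussian_vandermonde[OF \<delta>(1), of N x] V(2) by simp_all
    have fh: "h w * f w = fdet N (\<lambda>j v. \<psi> v (x j + w j)) / vandermonde N x" for w
      unfolding h_def f_def using D(4)[of "\<lambda>j. x j + w j"] by simp
    have fh1: "(LINT w|G. h w * f w) = fdet_ratio N (\<lambda>v. heat \<delta> (\<psi> v)) x"
    proof -
      have "(LINT w|gaussian N (sqrt \<delta>). fdet N (\<lambda>j v. \<psi> v (x j + w j))) = fdet N (\<lambda>j v. heat \<delta> (\<psi> v) (x j))"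
        by (rule gaussian_fdet(2)[OF _ \<delta>(1)]) (rule D(2))
      then show ?thesis unfolding fh fdet_ratio_def G_def by simp
    qed
    have fi: "integrable G (\<lambda>w. k w * f w)" if "integrable G k" for k
      using that fG fb by (intro Bochner_Integration.integrable_bound[OF integrable_mult_right[OF that, of c]])
        (auto simp: abs_mult mult.commute[of c] intro!: AE_I2 mult_left_mono order_trans[OF fb])
    \<comment> \<open>Both densities integrate to 1, so the constant \<open>f0\<close> may be
      subtracted from \<open>f\<close>. This gains one more factor of order
      \<open>S w\<close>.\<close>
    have diff: "(LINT w|G. e w * f w) - (LINT w|G. h w * f w) = (LINT w|G. (e w - h w) * (f w - f0))"
    proof -
      have "(LINT w|G. (e w - h w) * (f w - f0)) = (LINT w|G. (e w * f w - h w * f w) - (f0 * e w - f0 * h w))"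
        by (simp add: algebra_simps)
      also have "\<dots> = ((LINT w|G. e w * f w) - (LINT w|G. h w * f w)) - (f0 * (LINT w|G. e w) - f0 * (LINT w|G. h w))"
        using fi[OF ei] fi[OF hi] ei hi by simp
      finally show ?thesis by (simp add: e1 h1)
    qed
    have di: "integrable G (\<lambda>w. (e w - h w) * (f w - f0))"
      using fi[OF ei] fi[OF hi] ei hi by (simp add: algebra_simps)
    have b1: "\<bar>e w - h w\<bar> \<le> M * ((S w)\<^sup>2 + \<delta>) * exp (a * S w)" for w
    proof -
      let ?L = "\<Sum>j<N. drift N x j * w j"
      have T: "\<bar>T\<bar> = T" using \<delta> by simp
      have "\<bar>e w - h w\<bar> \<le> \<bar>e w - 1 - ?L\<bar> + \<bar>h w - 1 - ?L\<bar>" by linarith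
      also have "\<bar>e w - 1 - ?L\<bar> \<le> (\<kappa> + (2 * \<beta>\<^sup>2 + 2 * \<bar>T\<bar> * \<kappa>\<^sup>2) * exp (\<bar>T\<bar> * \<kappa>)) * ((S w)\<^sup>2 + \<delta>) * exp (\<beta> * S w)"
        unfolding e_def S_def \<kappa>_def \<beta>_def T by (rule euler_density_bound[OF sep assms(1) \<delta>])
      also have "\<dots> \<le> (\<kappa> + (2 * \<beta>\<^sup>2 + 2 * \<bar>T\<bar> * \<kappa>\<^sup>2) * exp (\<bar>T\<bar> * \<kappa>)) * ((S w)\<^sup>2 + \<delta>) * exp (a * S w)"
        using pos S0[of w] \<delta> by (intro mult_left_mono) (auto simp: a_def intro!: mult_right_mono mult_nonneg_nonneg add_nonneg_nonneg)
      also have "\<bar>h w - 1 - ?L\<bar> \<le> (Kv * S w)\<^sup>2 * exp (Kv * S w)"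
        unfolding h_def S_def Kv_def by (rule vandermonde_ratio_expansion(2)[OF sep assms(1)])
      also have "\<dots> \<le> Kv\<^sup>2 * ((S w)\<^sup>2 + \<delta>) * exp (a * S w)"
        unfolding power_mult_distrib using pos S0[of w] \<delta>
        by (intro mult_mono) (auto simp: a_def intro!: mult_right_mono mult_nonneg_nonneg add_nonneg_nonneg)
      finally show ?thesis by (simp add: M_def algebra_simps)
    qed
    have b2: "\<bar>f w - f0\<bar> \<le> (L1 / V0 + c * Kv) * S w * exp (a * S w)" for w
    proof -
      let ?V = "vandermonde N x"
      \<comment> \<open>The product \<open>f * h\<close> is a determinant divided by a fixed number,
        and its increments are under control. Writing \<open>f\<close> as
        \<open>f * h - f * (h - 1)\<close> avoids dividing by the Vandermonde determinant at the
        displaced point.\<close>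
      have "f w - f0 = (fdet N (\<lambda>j v. \<psi> v (x j + w j)) - fdet N (\<lambda>j v. \<psi> v (x j))) / ?V - f w * (h w - 1)"
        using D(4)[of "\<lambda>j. x j + w j"] D(4)[of x] V(2) by (simp add: f_def f0_def h_def field_simps)
      then have "\<bar>f w - f0\<bar> \<le> \<bar>(fdet N (\<lambda>j v. \<psi> v (x j + w j)) - fdet N (\<lambda>j v. \<psi> v (x j))) / ?V\<bar> + \<bar>f w * (h w - 1)\<bar>"
        by (simp only: abs_triangle_ineq4)
      also have "\<bar>(fdet N (\<lambda>j v. \<psi> v (x j + w j)) - fdet N (\<lambda>j v. \<psi> v (x j))) / ?V\<bar> \<le> (L1 * S w * exp ((real N + 1) * S w)) / V0"
        unfolding abs_divide L1_def S_def using V pos(4) sep assms D(1)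
        by (intro frac_le fdet_increment_bound) (auto simp: separated_def intro!: mult_nonneg_nonneg sum_nonneg)
      also have "\<dots> = (L1 / V0) * S w * exp ((real N + 1) * S w)" by simp
      also have "\<dots> \<le> (L1 / V0) * S w * exp (a * S w)"
        using pos S0[of w] by (intro mult_left_mono) (auto simp: a_def intro!: mult_right_mono)
      also have "\<bar>f w * (h w - 1)\<bar> \<le> c * (Kv * S w * exp (Kv * S w))"
        unfolding abs_mult using fb assms(4) vandermonde_ratio_expansion(1)[OF sep assms(1), of w]
        by (intro mult_mono) (auto simp: h_def S_def Kv_def)
      also have "\<dots> \<le> c * (Kv * S w * exp (a * S w))"
        using pos S0[of w] assms(4) by (intro mult_left_mono) (auto simp: a_def intro!: mult_right_mono)
      finally show ?thesis by (simp add: algebra_simps)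
    qed
    have b: "\<bar>(e w - h w) * (f w - f0)\<bar> \<le> (L1 / V0 + c * Kv) * M * 7 * (\<delta> * sqrt \<delta>) * exp ((1 + 2 * a * sqrt \<bar>T\<bar>) / sqrt \<delta> * S w)" for w
    proof -
      have "\<bar>(e w - h w) * (f w - f0)\<bar> \<le> (M * ((S w)\<^sup>2 + \<delta>) * exp (a * S w)) * ((L1 / V0 + c * Kv) * S w * exp (a * S w))"
        unfolding abs_mult using b1 b2 pos \<delta> by (intro mult_mono) (auto intro!: mult_nonneg_nonneg)
      also have "\<dots> = (L1 / V0 + c * Kv) * M * (((S w)\<^sup>2 + \<delta>) * S w * exp (2 * a * S w))"
      proof -
        have "exp (2 * a * S w) = exp (a * S w) * exp (a * S w)" by (simp flip: exp_add)
        then show ?thesis by (simp only: mult_ac)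
      qed
      also have "\<dots> \<le> (L1 / V0 + c * Kv) * M * (7 * (\<delta> * sqrt \<delta>) * exp ((1 + 2 * a * sqrt \<bar>T\<bar>) / sqrt \<delta> * S w))"
        unfolding S_def using \<delta> pos assms
        by (intro mult_left_mono gaussian_third_order(2) mult_nonneg_nonneg add_nonneg_nonneg) auto
      finally show ?thesis by (simp only: mult_ac)
    qed
    have gi: "integrable G (\<lambda>w. exp ((1 + 2 * a * sqrt \<bar>T\<bar>) / sqrt \<delta> * S w))"
      unfolding G_def S_def using \<delta> pos by (intro gaussian_third_order(1)) auto
    have "\<bar>(LINT w|G. e w * f w) - (LINT w|G. h w * f w)\<bar> \<le> (LINT w|G. \<bar>(e w - h w) * (f w - f0)\<bar>)"
      unfolding diff by (rule integral_abs_bound)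
    also have "\<dots> \<le> (LINT w|G. (L1 / V0 + c * Kv) * M * 7 * (\<delta> * sqrt \<delta>) * exp ((1 + 2 * a * sqrt \<bar>T\<bar>) / sqrt \<delta> * S w))"
      using di gi b by (intro integral_mono integrable_abs integrable_mult_right)
    also have "\<dots> = (L1 / V0 + c * Kv) * M * 7 * (\<delta> * sqrt \<delta>) * (LINT w|G. exp ((1 + 2 * a * sqrt \<bar>T\<bar>) / sqrt \<delta> * S w))"
      by (rule integral_mult_right_zero)
    also have "\<dots> \<le> (L1 / V0 + c * Kv) * M * 7 * (\<delta> * sqrt \<delta>) * (2 * exp ((1 + 2 * a * sqrt \<bar>T\<bar>)\<^sup>2 / 2)) ^ N"
      unfolding G_def S_def using \<delta> pos assms
      by (intro mult_left_mono gaussian_third_order(3) mult_nonneg_nonneg add_nonneg_nonneg) auto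
    also have "\<dots> = K * (\<delta> * sqrt \<delta>)" by (simp add: K_def mult_ac)
    finally show "\<bar>(LINT w|gaussian N (sqrt \<delta>). fdet_ratio N \<psi> (\<lambda>j. x j + \<delta> * drift N x j + w j))
      - fdet_ratio N (\<lambda>v. heat \<delta> (\<psi> v)) x\<bar> \<le> K * (\<delta> * sqrt \<delta>)"
      unfolding lhs[unfolded G_def] fh1[symmetric] G_def .
  qed
qed

section \<open>Pathwise convergence of the Euler scheme\<close>

text \<open>Here \<open>w (j, k)\<close> is the noise of component \<open>j\<close> in step
  \<open>k\<close>. As a plain function of these numbers the chain can be studied path by path as
  well as under a law.\<close>

primrec euler :: "nat \<Rightarrow> (nat \<Rightarrow> real) \<Rightarrow> (nat \<Rightarrow> real) \<Rightarrow> (nat \<times> nat \<Rightarrow> real) \<Rightarrow> nat \<Rightarrow> nat \<Rightarrow> real" where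
  "euler N u \<tau> w 0 = u"
| "euler N u \<tau> w (Suc k) =
     (\<lambda>j. euler N u \<tau> w k j + (\<tau> (Suc k) - \<tau> k) * drift N (euler N u \<tau> w k) j + w (j, k))"

lemma ex_small_finite:
  fixes P :: "'i \<Rightarrow> real \<Rightarrow> bool"
  assumes "finite I" "\<And>i. i \<in> I \<Longrightarrow> \<exists>e>0. \<forall>e'. 0 < e' \<longrightarrow> e' \<le> e \<longrightarrow> P i e'"
  shows "\<exists>e>0. \<forall>i\<in>I. P i e"
proof -
  have "\<exists>e>0. \<forall>i\<in>I. \<forall>e'. 0 < e' \<longrightarrow> e' \<le> e \<longrightarrow> P i e'"
    using assms
  proof (induction I rule: finite_induct)
    case (insert i I)
    have "\<exists>e>0. \<forall>i\<in>I. \<forall>e'. 0 < e' \<longrightarrow> e' \<le> e \<longrightarrow> P i e'"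
      by (rule insert.IH, rule insert.prems) simp
    then obtain e1 where e1: "e1 > 0" "\<forall>i\<in>I. \<forall>e'. 0 < e' \<longrightarrow> e' \<le> e1 \<longrightarrow> P i e'" by blast
    obtain e2 where e2: "e2 > 0" "\<forall>e'. 0 < e' \<longrightarrow> e' \<le> e2 \<longrightarrow> P i e'"
      using insert.prems[of i] by blast
    show ?case using e1 e2 by (intro exI[of _ "min e1 e2"]) auto
  qed (auto intro: exI[of _ 1])
  then obtain e where "e > 0" "\<forall>i\<in>I. \<forall>e'. 0 < e' \<longrightarrow> e' \<le> e \<longrightarrow> P i e'" by blast
  then show ?thesis by (intro exI[of _ e]) auto
qed

text \<open>Rests on \<open>1 / a - 1 / c = (c - a) / (a * c)\<close> with both denominators at
  least \<open>\<epsilon>\<close> in absolute value, hence the square.\<close>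

lemma drift_lipschitz:
  assumes x: "separated N \<epsilon> R x" and y: "separated N \<epsilon> R' y" and "\<epsilon> > 0"
    and d: "\<And>j. j < N \<Longrightarrow> \<bar>x j - y j\<bar> \<le> d" and j: "j < N"
  shows "\<bar>drift N x j - drift N y j\<bar> \<le> 2 * real N / \<epsilon>\<^sup>2 * d"
proof -
  have d0: "d \<ge> 0" using d[OF j] by linarith
  have "\<bar>drift N x j - drift N y j\<bar> \<le> (\<Sum>k\<in>{..<N} - {j}. \<bar>1 / (x j - x k) - 1 / (y j - y k)\<bar>)"
    unfolding drift_def sum_subtractf[symmetric] by (rule sum_abs)
  also have "\<dots> \<le> (\<Sum>k\<in>{..<N} - {j}. 2 * d / \<epsilon>\<^sup>2)"
  proof (rule sum_mono)
    fix k assume k: "k \<in> {..<N} - {j}"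
    have gx: "\<epsilon> \<le> \<bar>x j - x k\<bar>" and gy: "\<epsilon> \<le> \<bar>y j - y k\<bar>"
      using x y j k unfolding separated_def by auto
    then have nz: "x j - x k \<noteq> 0" "y j - y k \<noteq> 0" using \<open>\<epsilon> > 0\<close> by auto
    have "\<bar>1 / (x j - x k) - 1 / (y j - y k)\<bar> = \<bar>(y j - y k) - (x j - x k)\<bar> / (\<bar>x j - x k\<bar> * \<bar>y j - y k\<bar>)"
    proof -
      have "1 / a - 1 / c = (c - a) / (a * c)" if "a \<noteq> 0" "c \<noteq> 0" for a c :: real
        using that by (simp add: field_simps)
      from this[OF nz] show ?thesis by (simp only: abs_divide abs_mult)
    qed
    also have "\<dots> \<le> (2 * d) / (\<epsilon> * \<epsilon>)"
    proof (rule frac_le)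
      show "\<bar>(y j - y k) - (x j - x k)\<bar> \<le> 2 * d" using d[OF j] d[of k] k by auto
      show "\<epsilon> * \<epsilon> \<le> \<bar>x j - x k\<bar> * \<bar>y j - y k\<bar>" using gx gy \<open>\<epsilon> > 0\<close> by (intro mult_mono) auto
    qed (use d0 \<open>\<epsilon> > 0\<close> in auto)
    finally show "\<bar>1 / (x j - x k) - 1 / (y j - y k)\<bar> \<le> 2 * d / \<epsilon>\<^sup>2" by (simp add: power2_eq_square)
  qed
  also have "\<dots> \<le> (\<Sum>k<N. 2 * d / \<epsilon>\<^sup>2)" using d0 by (intro sum_mono2) auto
  finally show ?thesis by (simp add: mult_ac)
qed

text \<open>The gaps between components over a compact time interval form a compact set that misses
  0.\<close>

lemma path_separated:
  fixes x :: "nat \<Rightarrow> real \<Rightarrow> real"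
  assumes cont: "\<And>j. j < N \<Longrightarrow> continuous_on {0..T} (x j)"
    and inj: "\<And>t. 0 \<le> t \<Longrightarrow> t \<le> T \<Longrightarrow> inj_on (\<lambda>j. x j t) {..<N}"
  shows "\<exists>\<epsilon>>0. \<exists>R. \<forall>t\<in>{0..T}. separated N \<epsilon> R (\<lambda>j. x j t)"
proof -
  define S where "S = (\<Union>p\<in>{(i, j). i < N \<and> j < N \<and> i \<noteq> j}. (\<lambda>t. \<bar>x (fst p) t - x (snd p) t\<bar>) ` {0..T})"
  have fin: "finite {(i, j). i < N \<and> j < N \<and> i \<noteq> j}"
    by (rule finite_subset[of _ "{..<N} \<times> {..<N}"]) auto
  have "compact S"
    unfolding S_def using fin cont
    by (intro compact_UN compact_continuous_image continuous_intros) auto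
  moreover have "0 \<notin> S" using inj unfolding S_def inj_on_def by auto
  ultimately obtain \<epsilon> where \<epsilon>: "\<epsilon> > 0" "\<forall>y\<in>S. \<epsilon> \<le> dist 0 y"
    using separate_point_closed[of S 0] compact_imp_closed by blast
  have "compact (\<Union>j\<in>{..<N}. x j ` {0..T})"
    using cont by (intro compact_UN compact_continuous_image) auto
  then obtain R where R: "\<forall>y\<in>(\<Union>j\<in>{..<N}. x j ` {0..T}). norm y \<le> R"
    using compact_imp_bounded bounded_iff by metis
  have "separated N \<epsilon> R (\<lambda>j. x j t)" if t: "t \<in> {0..T}" for t
    unfolding separated_def
  proof (intro conjI allI impI)
    show "\<bar>x j t\<bar> \<le> R" if "j < N" for j using R t that by auto
    fix i j assume "i < N" "j < N" "i \<noteq> j"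
    then have "\<bar>x i t - x j t\<bar> \<in> S" using t unfolding S_def by force
    then show "\<epsilon> \<le> \<bar>x i t - x j t\<bar>" using \<epsilon>(2) by fastforce
  qed
  then show ?thesis using \<epsilon>(1) by blast
qed

lemma paths_uniformly_continuous:
  fixes x :: "nat \<Rightarrow> real \<Rightarrow> real"
  assumes cont: "\<And>j. j < N \<Longrightarrow> continuous_on {0..T} (x j)" and "\<rho> > 0"
  shows "\<exists>h>0. \<forall>j<N. \<forall>s\<in>{0..T}. \<forall>t\<in>{0..T}. \<bar>s - t\<bar> \<le> h \<longrightarrow> \<bar>x j s - x j t\<bar> \<le> \<rho>"
proof -
  have "\<exists>h>0. \<forall>j\<in>{..<N}. \<forall>s\<in>{0..T}. \<forall>t\<in>{0..T}. \<bar>s - t\<bar> \<le> h \<longrightarrow> \<bar>x j s - x j t\<bar> \<le> \<rho>"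
  proof (rule ex_small_finite)
    fix j assume "j \<in> {..<N}"
    then have "uniformly_continuous_on {0..T} (x j)"
      using cont by (intro compact_uniformly_continuous) auto
    then obtain d where d: "d > 0" "\<And>s t. s \<in> {0..T} \<Longrightarrow> t \<in> {0..T} \<Longrightarrow> dist t s < d \<Longrightarrow> dist (x j t) (x j s) < \<rho>"
      unfolding uniformly_continuous_on_def using \<open>\<rho> > 0\<close> by metis
    show "\<exists>e>0. \<forall>e'. 0 < e' \<longrightarrow> e' \<le> e \<longrightarrow> (\<forall>s\<in>{0..T}. \<forall>t\<in>{0..T}. \<bar>s - t\<bar> \<le> e' \<longrightarrow> \<bar>x j s - x j t\<bar> \<le> \<rho>)"
    proof (intro exI[of _ "d / 2"] conjI allI impI ballI)
      fix e' s t assume "e' \<le> d / 2" "s \<in> {0..T}" "t \<in> {0..T}" "\<bar>s - t\<bar> \<le> e'"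
      then have "dist (x j s) (x j t) < \<rho>" using d by (intro d(2)) (auto simp: dist_real_def)
      then show "\<bar>x j s - x j t\<bar> \<le> \<rho>" by (simp add: dist_real_def)
    qed (use d in simp)
  qed simp
  then show ?thesis by auto
qed

text \<open>The local truncation error: over one step the drift along the solution is frozen at its
  left end, at the price of the oscillation \<open>\<rho>\<close> times the Lipschitz constant of
  the drift.\<close>

lemma drift_integral_increment:
  fixes x :: "nat \<Rightarrow> real \<Rightarrow> real"
  assumes cont: "\<And>j. j < N \<Longrightarrow> continuous_on {0..T} (x j)" and "\<epsilon> > 0"
    and sep: "\<And>t. t \<in> {0..T} \<Longrightarrow> separated N \<epsilon> R (\<lambda>j. x j t)"
    and eq: "\<And>t. t \<in> {0..T} \<Longrightarrow> x j t = u + b t + (\<Sum>k\<in>{..<N} - {j}. LINT s:{0..t}|lborel. 1 / (x j s - x k s))"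
    and j: "j < N" and st: "0 \<le> s" "s \<le> t" "t \<le> T"
    and osc: "\<And>i r. i < N \<Longrightarrow> r \<in> {s..t} \<Longrightarrow> \<bar>x i r - x i s\<bar> \<le> \<rho>"
  shows "\<bar>x j t - x j s - (b t - b s) - (t - s) * drift N (\<lambda>j. x j s) j\<bar> \<le> (t - s) * (2 * real N / \<epsilon>\<^sup>2 * \<rho>)"
proof -
  let ?f = "\<lambda>k r. 1 / (x j r - x k r)"
  let ?g = "\<lambda>r. drift N (\<lambda>j. x j r) j"
  have cf: "continuous_on {0..T} (?f k)" if "k \<in> {..<N} - {j}" for k
  proof (intro continuous_intros cont)
    show "\<forall>r\<in>{0..T}. x j r - x k r \<noteq> 0"
      using sep j that \<open>\<epsilon> > 0\<close> unfolding separated_def by fastforce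
  qed (use that j in auto)
  have cg: "continuous_on {0..T} ?g"
    unfolding drift_def using cf by (intro continuous_on_sum) auto
  have int: "(\<Sum>k\<in>{..<N} - {j}. LINT s:{0..r}|lborel. ?f k s) = integral {0..r} ?g" if r: "r \<in> {0..T}" for r
  proof -
    have c: "continuous_on {0..r} (?f k)" if "k \<in> {..<N} - {j}" for k
      using continuous_on_subset[OF cf[OF that]] r by auto
    have "(LINT s:{0..r}|lborel. ?f k s) = integral {0..r} (?f k)" if "k \<in> {..<N} - {j}" for k
      using borel_integrable_atLeastAtMost'[OF c[OF that]] by (rule set_borel_integral_eq_integral(2))
    then have "(\<Sum>k\<in>{..<N} - {j}. LINT s:{0..r}|lborel. ?f k s) = (\<Sum>k\<in>{..<N} - {j}. integral {0..r} (?f k))"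
      by (intro sum.cong refl) auto
    also have "\<dots> = integral {0..r} ?g"
      unfolding drift_def using c by (intro integral_sum[symmetric] integrable_continuous_real) auto
    finally show ?thesis .
  qed
  have "integral {0..s} ?g + integral {s..t} ?g = integral {0..t} ?g"
    using st continuous_on_subset[OF cg] by (intro Henstock_Kurzweil_Integration.integral_combine integrable_continuous_real) auto
  then have inc: "x j t - x j s - (b t - b s) = integral {s..t} ?g"
    using eq[of t] eq[of s] int[of t] int[of s] st by auto
  have cst: "continuous_on {s..t} ?g" using st continuous_on_subset[OF cg] by auto
  have "integral {s..t} (\<lambda>r. ?g r - ?g s) = integral {s..t} ?g - (t - s) * ?g s"
    using st cst by (subst Henstock_Kurzweil_Integration.integral_diff) (auto intro!: integrable_continuous_real)
  moreover have "norm (integral {s..t} (\<lambda>r. ?g r - ?g s)) \<le> (2 * real N / \<epsilon>\<^sup>2 * \<rho>) * (t - s)"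
  proof (rule integral_bound)
    show "continuous_on {s..t} (\<lambda>r. ?g r - ?g s)" by (intro continuous_intros cst)
    show "norm (?g r - ?g s) \<le> 2 * real N / \<epsilon>\<^sup>2 * \<rho>" if "r \<in> {s..t}" for r
      using that st osc j \<open>\<epsilon> > 0\<close>
      by (simp only: real_norm_def) (rule drift_lipschitz[OF sep sep]; auto)
  qed (use st in simp)
  ultimately show ?thesis unfolding inc by (simp add: mult.commute)
qed

text \<open>Discrete Gronwall. The drift is Lipschitz only on separated configurations, so the
  induction must also keep the chain among them; it does, because the error stays below a quarter of
  the smallest gap of the solution.\<close>

lemma euler_converges:
  fixes x b :: "nat \<Rightarrow> real \<Rightarrow> real"
  assumes cont: "\<And>j. j < N \<Longrightarrow> continuous_on {0..} (x j)"
    and inj: "\<And>t. 0 \<le> t \<Longrightarrow> inj_on (\<lambda>j. x j t) {..<N}"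
    and x0: "\<And>j. j < N \<Longrightarrow> x j 0 = u j"
    and eq: "\<And>j t. j < N \<Longrightarrow> 0 \<le> t \<Longrightarrow>
      x j t = u j + b j t + (\<Sum>k\<in>{..<N} - {j}. LINT s:{0..t}|lborel. 1 / (x j s - x k s))"
    and "\<eta> > 0"
  shows "\<exists>h>0. \<forall>\<tau> K. \<tau> 0 = 0 \<longrightarrow> (\<forall>k<K. \<tau> k \<le> \<tau> (Suc k) \<and> \<tau> (Suc k) - \<tau> k \<le> h) \<longrightarrow> \<tau> K \<le> T \<longrightarrow>
    (\<forall>k\<le>K. \<forall>j<N. \<bar>euler N u \<tau> (\<lambda>(j, k). b j (\<tau> (Suc k)) - b j (\<tau> k)) k j - x j (\<tau> k)\<bar> \<le> \<eta>)"
proof -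
  have contT: "continuous_on {0..T} (x j)" if "j < N" for j
    using continuous_on_subset[OF cont[OF that]] by auto
  obtain \<epsilon>0 R where \<epsilon>0: "\<epsilon>0 > 0" and sep0: "\<And>t. t \<in> {0..T} \<Longrightarrow> separated N \<epsilon>0 R (\<lambda>j. x j t)"
    using path_separated[of N T x] contT inj by blast
  define \<epsilon> where "\<epsilon> = \<epsilon>0 / 2"
  have \<epsilon>: "\<epsilon> > 0" using \<epsilon>0 by (simp add: \<epsilon>_def)
  have sep: "separated N \<epsilon> R (\<lambda>j. x j t)" if "t \<in> {0..T}" for t
    using sep0[OF that] \<epsilon>0 unfolding separated_def \<epsilon>_def by fastforce
  define L where "L = 2 * real N / \<epsilon>\<^sup>2"
  have L0: "L \<ge> 0" by (simp add: L_def)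
  \<comment> \<open>An error of \<open>\<epsilon>0 / 4\<close> per component reduces a gap by at
    most \<open>\<epsilon>0 / 2\<close> and leaves \<open>\<epsilon>\<close>. The tolerance
    \<open>\<rho>\<close> below is chosen so that the Gronwall factor \<open>exp (L * T)\<close>
    raises it to \<open>\<eta>'\<close> and no further.\<close>
  define \<eta>' where "\<eta>' = min \<eta> (\<epsilon>0 / 4)"
  have \<eta>': "\<eta>' > 0" using \<open>\<eta> > 0\<close> \<epsilon>0 by (simp add: \<eta>'_def)
  define \<rho> where "\<rho> = \<eta>' * exp (- L * T)"
  have \<rho>: "\<rho> > 0" using \<eta>' by (simp add: \<rho>_def)
  obtain h where h: "h > 0" "\<And>j s t. j < N \<Longrightarrow> s \<in> {0..T} \<Longrightarrow> t \<in> {0..T} \<Longrightarrow> \<bar>s - t\<bar> \<le> h \<Longrightarrow> \<bar>x j s - x j t\<bar> \<le> \<rho>"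
    using paths_uniformly_continuous[of N T x, OF contT \<rho>] by metis
  show ?thesis
  proof (intro exI[of _ h] conjI h(1) allI impI)
    fix \<tau> K k j
    assume \<tau>0: "\<tau> 0 = (0::real)" and \<tau>: "\<forall>k<K. \<tau> k \<le> \<tau> (Suc k) \<and> \<tau> (Suc k) - \<tau> k \<le> h" and TK: "\<tau> K \<le> T"
      and k: "k \<le> K" and j: "j < N"
    define e where "e = euler N u \<tau> (\<lambda>(j, k). b j (\<tau> (Suc k)) - b j (\<tau> k))"
    have mono: "\<tau> i \<le> \<tau> l" if "i \<le> l" "l \<le> K" for i l
      using that
    proof (induction l)
      case (Suc l)
      then show ?case using \<tau> by (cases "i = Suc l") (auto intro: order_trans)
    qed simp
    have in_T: "\<tau> l \<in> {0..T}" if "l \<le> K" for l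
      using mono[of 0 l] mono[of l K] that \<tau>0 TK by auto
    \<comment> \<open>Adding \<open>\<rho>\<close> to the error turns the affine recursion into
      multiplication by \<open>1 + L * \<delta>\<close>, with \<open>\<delta>\<close> the length of
      the step.\<close>
    have claim: "\<forall>i<N. \<bar>e l i - x i (\<tau> l)\<bar> + \<rho> \<le> \<rho> * exp (L * \<tau> l)" if "l \<le> K" for l
      using that
    proof (induction l)
      case 0
      then show ?case using x0 \<tau>0 by (simp add: e_def)
    next
      case (Suc l)
      then have IH: "\<bar>e l i - x i (\<tau> l)\<bar> + \<rho> \<le> \<rho> * exp (L * \<tau> l)" if "i < N" for i using that by simp
      have lK: "l \<le> K" and lt: "l < K" using Suc by auto
      have t1: "\<tau> l \<in> {0..T}" "\<tau> (Suc l) \<in> {0..T}" using in_T lK Suc by auto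
      define d where "d = \<rho> * exp (L * \<tau> l) - \<rho>"
      have close: "\<bar>e l i - x i (\<tau> l)\<bar> \<le> d" if "i < N" for i using IH[OF that] by (simp add: d_def)
      have "\<rho> * exp (L * \<tau> l) \<le> \<rho> * exp (L * T)" using \<rho> L0 t1 by (auto intro!: mult_left_mono)
      also have "\<dots> = \<eta>'" by (simp add: \<rho>_def flip: exp_add)
      finally have d4: "d \<le> \<epsilon>0 / 4" using \<rho> by (simp add: d_def \<eta>'_def)
      have sep_e: "separated N \<epsilon> (R + d) (e l)"
        unfolding separated_def
      proof (intro conjI allI impI)
        show "\<bar>e l i\<bar> \<le> R + d" if "i < N" for i
          using close[OF that] sep0[OF t1(1)] that unfolding separated_def by fastforce
        fix i k assume ik: "i < N" "k < N" "i \<noteq> k"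
        then have "\<epsilon>0 \<le> \<bar>x i (\<tau> l) - x k (\<tau> l)\<bar>" using sep0[OF t1(1)] unfolding separated_def by blast
        then show "\<epsilon> \<le> \<bar>e l i - e l k\<bar>" using close[OF ik(1)] close[OF ik(2)] d4 unfolding \<epsilon>_def by linarith
      qed
      show ?case
      proof (intro allI impI)
        fix i assume i: "i < N"
        let ?\<delta> = "\<tau> (Suc l) - \<tau> l"
        have \<delta>: "0 \<le> ?\<delta>" "?\<delta> \<le> h" using \<tau> lt by auto
        have "\<bar>x i (\<tau> (Suc l)) - x i (\<tau> l) - (b i (\<tau> (Suc l)) - b i (\<tau> l)) - ?\<delta> * drift N (\<lambda>j. x j (\<tau> l)) i\<bar>
            \<le> ?\<delta> * (2 * real N / \<epsilon>\<^sup>2 * \<rho>)"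
        proof (rule drift_integral_increment[where T = T and R = R])
          show "x i t = u i + b i t + (\<Sum>k\<in>{..<N} - {i}. LINT s:{0..t}|lborel. 1 / (x i s - x k s))"
            if "t \<in> {0..T}" for t using eq[OF i] that by auto
          show "\<bar>x i' r - x i' (\<tau> l)\<bar> \<le> \<rho>" if "i' < N" "r \<in> {\<tau> l..\<tau> (Suc l)}" for i' r
            using that t1 \<delta> by (intro h(2)) auto
        qed (use contT sep \<epsilon> i t1 \<delta> in auto)
        moreover have "\<bar>?\<delta> * drift N (e l) i - ?\<delta> * drift N (\<lambda>j. x j (\<tau> l)) i\<bar> \<le> ?\<delta> * (2 * real N / \<epsilon>\<^sup>2 * d)"
          unfolding right_diff_distrib[symmetric] abs_mult using \<delta>(1)
          by (simp only: abs_of_nonneg) (rule mult_left_mono[OF drift_lipschitz[OF sep_e sep[OF t1(1)] \<epsilon> close i]])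
        moreover have "e (Suc l) i = e l i + ?\<delta> * drift N (e l) i + (b i (\<tau> (Suc l)) - b i (\<tau> l))"
          by (simp add: e_def)
        ultimately have "\<bar>e (Suc l) i - x i (\<tau> (Suc l))\<bar> \<le> \<bar>e l i - x i (\<tau> l)\<bar> + ?\<delta> * (L * d) + ?\<delta> * (L * \<rho>)"
          unfolding L_def by linarith
        then have "\<bar>e (Suc l) i - x i (\<tau> (Suc l))\<bar> + \<rho> \<le> (d + \<rho>) * (1 + L * ?\<delta>)"
          using close[OF i] by (simp add: algebra_simps)
        also have "\<dots> \<le> (d + \<rho>) * exp (L * ?\<delta>)"
          using \<rho> close[OF i] exp_ge_add_one_self[of "L * ?\<delta>"] by (intro mult_left_mono) auto
        also have "\<dots> = \<rho> * exp (L * \<tau> (Suc l))"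
          by (simp add: d_def right_diff_distrib mult.assoc flip: exp_add)
        finally show "\<bar>e (Suc l) i - x i (\<tau> (Suc l))\<bar> + \<rho> \<le> \<rho> * exp (L * \<tau> (Suc l))" .
      qed
    qed
    have "\<bar>e k j - x j (\<tau> k)\<bar> + \<rho> \<le> \<rho> * exp (L * \<tau> k)" using claim[OF k] j by blast
    also have "\<dots> \<le> \<rho> * exp (L * T)" using \<rho> L0 in_T[OF k] by (auto intro!: mult_left_mono)
    also have "\<dots> = \<eta>'" by (simp add: \<rho>_def flip: exp_add)
    finally show "\<bar>euler N u \<tau> (\<lambda>(j, k). b j (\<tau> (Suc k)) - b j (\<tau> k)) k j - x j (\<tau> k)\<bar> \<le> \<eta>"
      using \<rho> by (simp add: e_def \<eta>'_def)
  qed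
qed

section \<open>Brownian increments on a grid\<close>

locale brownian_grid = prob_space P for P :: "'a measure" +
  fixes N :: nat and B :: "nat \<Rightarrow> real \<Rightarrow> 'a \<Rightarrow> real" and \<tau> :: "nat \<Rightarrow> real" and K :: nat
  assumes N: "0 < N" and BM: "independent_BMs P N B"
    and grid: "strict_mono_on {..K} \<tau>" "\<tau> 0 = 0"
begin

definition incr :: "'a \<Rightarrow> nat \<times> nat \<Rightarrow> real" where
  "incr \<omega> = (\<lambda>(j, k). B j (\<tau> (Suc k)) \<omega> - B j (\<tau> k) \<omega>)"

lemma grid_nonneg: "k \<le> K \<Longrightarrow> 0 \<le> \<tau> k"
  using grid strict_mono_on_leD[OF grid(1), of 0 k] by simp

lemma grid_less: "k < K \<Longrightarrow> \<tau> k < \<tau> (Suc k)"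
  using grid(1) by (auto simp: strict_mono_on_def)

lemma BM_measurable: "j < N \<Longrightarrow> 0 \<le> t \<Longrightarrow> B j t \<in> borel_measurable P"
  using BM unfolding independent_BMs_def standard_BM_def by blast

lemma incr_measurable: "p \<in> {..<N} \<times> {..<K} \<Longrightarrow> (\<lambda>\<omega>. incr \<omega> p) \<in> borel_measurable P"
  unfolding incr_def using BM_measurable grid_nonneg by (cases p) auto

text \<open>Independence between components comes from that of the whole paths, independence along a
  component from the increments of one Brownian motion. The joint statement follows by factorising
  probabilities twice.\<close>

lemma indep_incr: "indep_vars (\<lambda>_. borel) (\<lambda>p \<omega>. incr \<omega> p) ({..<N} \<times> {..<K})"
proof (cases "K = 0")
  case True
  then show ?thesis by (simp add: indep_vars_def2 indep_sets_def)
next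
  case False
  let ?I = "{..<N} \<times> {..<K}"
  let ?Y = "\<lambda>j \<omega>. \<lambda>t\<in>{0..}. B j t \<omega>"
  have indY: "indep_vars (\<lambda>_. Pi\<^sub>M {0..} (\<lambda>_. borel)) ?Y {..<N}"
    using BM unfolding independent_BMs_def by blast
  have indZ: "indep_vars (\<lambda>_. borel) (\<lambda>k \<omega>. B j (\<tau> (Suc k)) \<omega> - B j (\<tau> k) \<omega>) {..<K}" if "j < N" for j
    using BM grid that unfolding independent_BMs_def standard_BM_def by auto
  show ?thesis
    unfolding indep_vars_def2
  proof (intro conjI ballI)
    show "random_variable borel (\<lambda>\<omega>. incr \<omega> p)" if "p \<in> ?I" for p
      using that by (rule incr_measurable)
    show "indep_sets (\<lambda>p. {(\<lambda>\<omega>. incr \<omega> p) -` A \<inter> space P |A. A \<in> sets borel}) ?I"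
    proof (subst indep_sets_finite)
      show "?I \<noteq> {}" using False N by auto
      show "finite ?I" by simp
      show "{(\<lambda>\<omega>. incr \<omega> p) -` A \<inter> space P |A. A \<in> sets borel} \<subseteq> events" if "p \<in> ?I" for p
        using incr_measurable[OF that] by (auto intro: measurable_sets)
      show "space P \<in> {(\<lambda>\<omega>. incr \<omega> p) -` A \<inter> space P |A. A \<in> sets borel}" if "p \<in> ?I" for p
        by (intro CollectI exI[of _ UNIV]) auto
      show "\<forall>E\<in>Pi ?I (\<lambda>p. {(\<lambda>\<omega>. incr \<omega> p) -` A \<inter> space P |A. A \<in> sets borel}).
          prob (\<Inter> (E ` ?I)) = (\<Prod>p\<in>?I. prob (E p))"
      proof
        fix E assume E: "E \<in> Pi ?I (\<lambda>p. {(\<lambda>\<omega>. incr \<omega> p) -` A \<inter> space P |A. A \<in> sets borel})"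
        have "\<forall>p\<in>?I. \<exists>A. A \<in> sets borel \<and> E p = (\<lambda>\<omega>. incr \<omega> p) -` A \<inter> space P"
        proof
          fix p assume "p \<in> ?I"
          from Pi_mem[OF E this] show "\<exists>A. A \<in> sets borel \<and> E p = (\<lambda>\<omega>. incr \<omega> p) -` A \<inter> space P"
            by auto
        qed
        from bchoice[OF this] obtain A
          where A0: "\<forall>p\<in>?I. A p \<in> sets borel \<and> E p = (\<lambda>\<omega>. incr \<omega> p) -` A p \<inter> space P" ..
        have A: "A p \<in> sets borel" "E p = (\<lambda>\<omega>. incr \<omega> p) -` A p \<inter> space P" if "p \<in> ?I" for p
          using A0 that by blast+
        \<comment> \<open>All constraints on the increments of component \<open>j\<close> form one
          measurable set of paths, so that independence of the paths applies.\<close>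
        define C where "C j = {y \<in> space (Pi\<^sub>M {0..} (\<lambda>_. borel :: real measure)).
            \<forall>k\<in>{..<K}. y (\<tau> (Suc k)) - y (\<tau> k) \<in> A (j, k)}" for j
        have C: "C j \<in> sets (Pi\<^sub>M {0..} (\<lambda>_. borel))" if "j < N" for j
          unfolding C_def
        proof (rule sets.sets_Collect_finite_All)
          fix k assume k: "k \<in> {..<K}"
          have "(\<lambda>y. y (\<tau> (Suc k)) - y (\<tau> k)) \<in> borel_measurable (Pi\<^sub>M {0..} (\<lambda>_. borel :: real measure))"
            using k grid_nonneg by (intro borel_measurable_diff measurable_component_singleton) auto
          then have "(\<lambda>y. y (\<tau> (Suc k)) - y (\<tau> k)) -` A (j, k) \<inter> space (Pi\<^sub>M {0..} (\<lambda>_. borel :: real measure))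
              \<in> sets (Pi\<^sub>M {0..} (\<lambda>_. borel :: real measure))"
            using A(1)[of "(j, k)"] k that by (intro measurable_sets) auto
          moreover have "(\<lambda>y. y (\<tau> (Suc k)) - y (\<tau> k)) -` A (j, k) \<inter> space (Pi\<^sub>M {0..} (\<lambda>_. borel :: real measure))
              = {y \<in> space (Pi\<^sub>M {0..} (\<lambda>_. borel)). y (\<tau> (Suc k)) - y (\<tau> k) \<in> A (j, k)}"
            by auto
          ultimately show "{y \<in> space (Pi\<^sub>M {0..} (\<lambda>_. borel)). y (\<tau> (Suc k)) - y (\<tau> k) \<in> A (j, k)}
              \<in> sets (Pi\<^sub>M {0..} (\<lambda>_. borel))"
            by simp
        qed simp
        have Yj: "?Y j -` C j \<inter> space P = (\<Inter>k\<in>{..<K}. E (j, k))" if "j < N" for j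
          using False that A(2) grid_nonneg by (auto simp: C_def incr_def space_PiM Suc_le_eq)
        have "\<Inter> (E ` ?I) = (\<Inter>j\<in>{..<N}. ?Y j -` C j \<inter> space P)"
          using Yj N by auto
        then have "prob (\<Inter> (E ` ?I)) = (\<Prod>j<N. prob (?Y j -` C j \<inter> space P))"
          using indep_varsD_finite[OF indY, of C] C N by auto
        also have "\<dots> = (\<Prod>j<N. \<Prod>k<K. prob (E (j, k)))"
        proof (rule prod.cong[OF refl])
          fix j assume j: "j \<in> {..<N}"
          have Ejk: "E (j, k) = (\<lambda>\<omega>. B j (\<tau> (Suc k)) \<omega> - B j (\<tau> k) \<omega>) -` A (j, k) \<inter> space P" if "k < K" for k
            using A(2)[of "(j, k)"] j that by (simp add: incr_def)
          have "prob (\<Inter>k\<in>{..<K}. (\<lambda>\<omega>. B j (\<tau> (Suc k)) \<omega> - B j (\<tau> k) \<omega>) -` A (j, k) \<inter> space P)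
              = (\<Prod>k<K. prob ((\<lambda>\<omega>. B j (\<tau> (Suc k)) \<omega> - B j (\<tau> k) \<omega>) -` A (j, k) \<inter> space P))"
            using j A(1) False by (intro indep_varsD_finite[OF indZ]) auto
          then show "prob (?Y j -` C j \<inter> space P) = (\<Prod>k<K. prob (E (j, k)))"
            using Yj j Ejk by simp
        qed
        also have "\<dots> = (\<Prod>p\<in>?I. prob (E p))"
          by (simp add: prod.cartesian_product)
        finally show "prob (\<Inter> (E ` ?I)) = (\<Prod>p\<in>?I. prob (E p))" .
      qed
    qed
  qed
qed

lemma distr_step:
  assumes "k < K"
  shows "distr P (Pi\<^sub>M {..<N} (\<lambda>_. borel)) (\<lambda>\<omega>. \<lambda>j\<in>{..<N}. incr \<omega> (j, k)) = gaussian N (sqrt (\<tau> (Suc k) - \<tau> k))"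
proof -
  let ?Y = "\<lambda>j \<omega>. \<lambda>t\<in>{0..}. B j t \<omega>"
  have t: "0 \<le> \<tau> k" "\<tau> k < \<tau> (Suc k)" using grid_nonneg grid_less assms by auto
  have "indep_vars (\<lambda>_. borel) (\<lambda>j \<omega>. ?Y j \<omega> (\<tau> (Suc k)) - ?Y j \<omega> (\<tau> k)) {..<N}"
  proof (rule indep_vars_compose2[where X = ?Y and Y = "\<lambda>_ y. y (\<tau> (Suc k)) - y (\<tau> k)"
        and M' = "\<lambda>_. Pi\<^sub>M {0..} (\<lambda>_. borel)"])
    show "indep_vars (\<lambda>_. Pi\<^sub>M {0..} (\<lambda>_. borel)) ?Y {..<N}"
      using BM unfolding independent_BMs_def by blast
    show "(\<lambda>y. y (\<tau> (Suc k)) - y (\<tau> k)) \<in> borel_measurable (Pi\<^sub>M {0..} (\<lambda>_. borel :: real measure))"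
      using t by (intro borel_measurable_diff measurable_component_singleton) auto
  qed
  then have "indep_vars (\<lambda>_. borel) (\<lambda>j \<omega>. incr \<omega> (j, k)) {..<N}"
    using t by (simp add: incr_def)
  then have "distr P (Pi\<^sub>M {..<N} (\<lambda>_. borel)) (\<lambda>\<omega>. \<lambda>j\<in>{..<N}. incr \<omega> (j, k))
      = Pi\<^sub>M {..<N} (\<lambda>j. distr P borel (\<lambda>\<omega>. incr \<omega> (j, k)))"
    using N assms incr_measurable by (subst (asm) indep_vars_iff_distr_eq_PiM') auto
  also have "\<dots> = gaussian N (sqrt (\<tau> (Suc k) - \<tau> k))"
    unfolding gaussian_def
  proof (rule PiM_cong[OF refl])
    fix j assume "j \<in> {..<N}"
    then have "distributed P lborel (\<lambda>\<omega>. B j (\<tau> (Suc k)) \<omega> - B j (\<tau> k) \<omega>)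
        (\<lambda>x. ennreal (normal_density 0 (sqrt (\<tau> (Suc k) - \<tau> k)) x))"
      using BM t unfolding independent_BMs_def standard_BM_def by blast
    then show "distr P borel (\<lambda>\<omega>. incr \<omega> (j, k)) = normal_measure (sqrt (\<tau> (Suc k) - \<tau> k))"
      using distributed_distr_eq_density[of P lborel] by (simp add: incr_def cong: distr_cong)
  qed
  finally show ?thesis .
qed

text \<open>The past and the next step are independent, so the step can be integrated out with the
  past frozen. This takes the place of a conditional expectation.\<close>

lemma integral_step:
  fixes f :: "(nat \<times> nat \<Rightarrow> real) \<times> (nat \<Rightarrow> real) \<Rightarrow> real"
  assumes k: "k < K"
    and f: "f \<in> borel_measurable (Pi\<^sub>M ({..<N} \<times> {..<k}) (\<lambda>_. borel) \<Otimes>\<^sub>M Pi\<^sub>M {..<N} (\<lambda>_. borel))"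
    and bound: "\<And>y. \<bar>f y\<bar> \<le> c"
  defines "past \<equiv> \<lambda>\<omega>. restrict (incr \<omega>) ({..<N} \<times> {..<k})"
  defines "G \<equiv> gaussian N (sqrt (\<tau> (Suc k) - \<tau> k))"
  shows "past \<in> measurable P (Pi\<^sub>M ({..<N} \<times> {..<k}) (\<lambda>_. borel))"
    and "(\<lambda>x. LINT w|G. f (x, w)) \<in> borel_measurable (Pi\<^sub>M ({..<N} \<times> {..<k}) (\<lambda>_. borel))"
    and "(LINT \<omega>|P. f (past \<omega>, \<lambda>j\<in>{..<N}. incr \<omega> (j, k))) = (LINT \<omega>|P. LINT w|G. f (past \<omega>, w))"
proof -
  let ?A = "{..<N} \<times> {..<k}" and ?B = "{..<N} \<times> {k}"
  let ?MA = "Pi\<^sub>M ?A (\<lambda>_. borel :: real measure)" and ?MN = "Pi\<^sub>M {..<N} (\<lambda>_. borel :: real measure)"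
  let ?W = "\<lambda>\<omega>. \<lambda>j\<in>{..<N}. incr \<omega> (j, k)"
  have sd: "sqrt (\<tau> (Suc k) - \<tau> k) > 0" using grid_less[OF k] by simp
  interpret G: prob_space G unfolding G_def using sd by (rule prob_space_gaussian)
  have sG: "sets G = sets ?MN" unfolding G_def by (rule sets_gaussian)
  have ind0: "indep_var ?MA (\<lambda>\<omega>. \<lambda>p\<in>?A. incr \<omega> p) (Pi\<^sub>M ?B (\<lambda>_. borel)) (\<lambda>\<omega>. \<lambda>p\<in>?B. incr \<omega> p)"
    using k by (intro indep_var_restrict[OF indep_incr]) auto
  have g1: "(\<lambda>y. \<lambda>j\<in>{..<N}. y (j, k)) \<in> measurable (Pi\<^sub>M ?B (\<lambda>_. borel)) ?MN"
    by (rule measurable_restrict, rule measurable_component_singleton) auto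
  let ?MB = "Pi\<^sub>M ?B (\<lambda>_. borel :: real measure)" and ?g = "\<lambda>y. \<lambda>j\<in>{..<N}. y (j, k)"
  let ?V = "\<lambda>\<omega>. \<lambda>p\<in>?B. incr \<omega> p"
  have past: "(\<lambda>\<omega>. \<lambda>p\<in>?A. incr \<omega> p) = past" by (simp add: past_def)
  note ind1 = ind0[unfolded indep_var_distribution_eq past]
  have mp: "past \<in> measurable P ?MA" using ind1 by (rule conjunct1)
  have mv: "?V \<in> measurable P ?MB" using ind1 by (elim conjE)
  have eq: "distr P ?MA past \<Otimes>\<^sub>M distr P ?MB ?V = distr P (?MA \<Otimes>\<^sub>M ?MB) (\<lambda>\<omega>. (past \<omega>, ?V \<omega>))"
    using ind1 by (elim conjE)
  have gV: "?g (?V \<omega>) = ?W \<omega>" for \<omega> by (auto simp: fun_eq_iff)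
  have DV: "distr (distr P ?MB ?V) ?MN ?g = G"
    unfolding G_def distr_step[OF k, symmetric] by (subst distr_distr[OF g1 mv]) (simp only: comp_def gV)
  show "past \<in> measurable P ?MA" by (rule mp)
  have fG: "f \<in> borel_measurable (?MA \<Otimes>\<^sub>M G)"
    using f unfolding measurable_cong_sets[OF sets_pair_measure_cong[OF refl sG] refl] .
  show mG: "(\<lambda>x. LINT w|G. f (x, w)) \<in> borel_measurable ?MA"
    using G.borel_measurable_lebesgue_integral[of "\<lambda>x w. f (x, w)" ?MA] fG by simp
  define f' where "f' = (\<lambda>(x, y). f (x, ?g y))"
  have f': "f' \<in> borel_measurable (?MA \<Otimes>\<^sub>M ?MB)"
    unfolding f'_def case_prod_beta'
    by (intro measurable_compose[OF _ f] measurable_Pair measurable_fst measurable_compose[OF measurable_snd g1])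
  interpret D: prob_space "distr P ?MA past" by (rule prob_space_distr[OF mp])
  interpret V: prob_space "distr P ?MB ?V" by (rule prob_space_distr[OF mv])
  interpret DV: pair_prob_space "distr P ?MA past" "distr P ?MB ?V" ..
  have mpv: "(\<lambda>\<omega>. (past \<omega>, ?V \<omega>)) \<in> measurable P (?MA \<Otimes>\<^sub>M ?MB)"
    using mp mv by (rule measurable_Pair)
  have "(LINT \<omega>|P. f (past \<omega>, ?W \<omega>)) = (LINT \<omega>|P. f' (past \<omega>, ?V \<omega>))"
    by (simp only: f'_def prod.case gV)
  also have "\<dots> = (LINT y|distr P (?MA \<Otimes>\<^sub>M ?MB) (\<lambda>\<omega>. (past \<omega>, ?V \<omega>)). f' y)"
    by (rule integral_distr[OF mpv f', symmetric])
  also have "\<dots> = (LINT y|(distr P ?MA past \<Otimes>\<^sub>M distr P ?MB ?V). f' y)"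
    unfolding eq ..
  also have "\<dots> = (LINT x|distr P ?MA past. LINT y|distr P ?MB ?V. f' (x, y))"
  proof (rule DV.integral_fst'[symmetric])
    show "integrable (distr P ?MA past \<Otimes>\<^sub>M distr P ?MB ?V) f'"
    proof (rule DV.P.integrable_const_bound[of _ c])
      show "f' \<in> borel_measurable (distr P ?MA past \<Otimes>\<^sub>M distr P ?MB ?V)"
        using f' by (simp add: measurable_cong_sets[OF sets_pair_measure_cong[OF sets_distr sets_distr] refl])
      show "AE y in distr P ?MA past \<Otimes>\<^sub>M distr P ?MB ?V. norm (f' y) \<le> c"
        using bound by (intro AE_I2) (auto simp: f'_def split: prod.split)
    qed
  qed
  also have "\<dots> = (LINT x|distr P ?MA past. LINT w|G. f (x, w))"
  proof (rule Bochner_Integration.integral_cong[OF refl])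
    fix x assume "x \<in> space (distr P ?MA past)"
    then have x: "x \<in> space ?MA" by simp
    have "(\<lambda>w. f (x, w)) \<in> borel_measurable ?MN"
      using measurable_Pair2[OF f x] .
    from integral_distr[OF _ this, of ?g "distr P ?MB ?V"] g1
    show "(LINT y|distr P ?MB ?V. f' (x, y)) = (LINT w|G. f (x, w))"
      unfolding DV by (simp add: f'_def)
  qed
  also have "\<dots> = (LINT \<omega>|P. LINT w|G. f (past \<omega>, w))"
    by (rule integral_distr[OF mp mG])
  finally show "(LINT \<omega>|P. f (past \<omega>, ?W \<omega>)) = (LINT \<omega>|P. LINT w|G. f (past \<omega>, w))" .
qed

end

section \<open>The Euler chain\<close>

lemma drift_cong:
  assumes "\<And>j. j < N \<Longrightarrow> x j = y j" "j < N"
  shows "drift N x j = drift N y j"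
  unfolding drift_def using assms by (intro sum.cong refl) auto

lemma separated_cong:
  assumes "\<And>j. j < N \<Longrightarrow> x j = y j"
  shows "separated N \<epsilon> R x \<longleftrightarrow> separated N \<epsilon> R y"
  unfolding separated_def using assms by auto

text \<open>After \<open>k\<close> steps the chain has seen only the noise of the steps before
  \<open>k\<close>; this is the adaptedness that \<open>integral_step\<close> relies on.\<close>

lemma euler_cong:
  assumes "\<And>j i. j < N \<Longrightarrow> i < k \<Longrightarrow> w (j, i) = w' (j, i)" "j < N"
  shows "euler N u \<tau> w k j = euler N u \<tau> w' k j"
  using assms
proof (induction k arbitrary: j)
  case (Suc k)
  have *: "euler N u \<tau> w k i = euler N u \<tau> w' k i" if "i < N" for i
    using Suc.prems(1) that by (intro Suc.IH) auto
  then show ?case using Suc.prems drift_cong[of N "euler N u \<tau> w k" "euler N u \<tau> w' k" j] by simp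
qed simp

lemma measurable_euler:
  assumes "\<And>j i. j < N \<Longrightarrow> i < k \<Longrightarrow> (\<lambda>y. w y (j, i)) \<in> borel_measurable M" "j < N"
  shows "(\<lambda>y. euler N u \<tau> (w y) k j) \<in> borel_measurable M"
  using assms
proof (induction k arbitrary: j)
  case (Suc k)
  have *: "(\<lambda>y. euler N u \<tau> (w y) k i) \<in> borel_measurable M" if "i < N" for i
    using Suc.prems(1) that by (intro Suc.IH) auto
  show ?case
    unfolding euler.simps drift_def using * Suc.prems
    by (intro borel_measurable_add borel_measurable_times borel_measurable_const borel_measurable_sum
        borel_measurable_divide borel_measurable_diff) auto
qed simp

lemma pred_separated:
  assumes g: "\<And>j. j < N \<Longrightarrow> g j \<in> borel_measurable M"
  shows "{x \<in> space M. separated N \<epsilon> R (\<lambda>j. g j x)} \<in> sets M"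
proof -
  have 1: "{x \<in> space M. \<forall>j\<in>{..<N}. \<bar>g j x\<bar> \<le> R} \<in> sets M"
    using g by (intro sets.sets_Collect_finite_All borel_measurable_le borel_measurable_abs) auto
  have 2: "{x \<in> space M. \<forall>i\<in>{..<N}. \<forall>j\<in>{..<N} - {i}. \<epsilon> \<le> \<bar>g i x - g j x\<bar>} \<in> sets M"
    using g by (intro sets.sets_Collect_finite_All borel_measurable_le borel_measurable_abs borel_measurable_diff) auto
  have "{x \<in> space M. separated N \<epsilon> R (\<lambda>j. g j x)} = {x \<in> space M. \<forall>j\<in>{..<N}. \<bar>g j x\<bar> \<le> R}
      \<inter> {x \<in> space M. \<forall>i\<in>{..<N}. \<forall>j\<in>{..<N} - {i}. \<epsilon> \<le> \<bar>g i x - g j x\<bar>}"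
    unfolding separated_def by auto
  with 1 2 show ?thesis by auto
qed

lemma measurable_of_bool_separated:
  assumes "finite L" "\<And>l j. l \<in> L \<Longrightarrow> j < N \<Longrightarrow> g l j \<in> borel_measurable M"
  shows "(\<lambda>x. of_bool (\<forall>l\<in>L. separated N \<epsilon> R (\<lambda>j. g l j x)) :: real) \<in> borel_measurable M"
proof -
  have "{x \<in> space M. \<forall>l\<in>L. separated N \<epsilon> R (\<lambda>j. g l j x)} \<in> sets M"
    using assms by (intro sets.sets_Collect_finite_All pred_separated) auto
  then have "(\<lambda>x. indicator {x \<in> space M. \<forall>l\<in>L. separated N \<epsilon> R (\<lambda>j. g l j x)} x :: real) \<in> borel_measurable M"
    by simp
  then show ?thesis by (rule measurable_cong[THEN iffD1, rotated]) (auto simp: indicator_def)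
qed

context brownian_grid
begin

lemma measurable_chain:
  assumes "k \<le> K" "j < N"
  shows "(\<lambda>\<omega>. euler N u \<tau> (incr \<omega>) k j) \<in> borel_measurable P"
  using assms incr_measurable by (intro measurable_euler) auto

text \<open>The weight and the position after \<open>k\<close> steps are functions of the earlier
  increments, so what remains is a Gaussian integral at a fixed configuration. The indicator
  \<open>I (Suc k)\<close> includes the test at index \<open>k\<close>, which makes that
  configuration separated whenever the weight is not 0.\<close>

lemma chain_step:
  fixes u :: "nat \<Rightarrow> real"
  assumes \<eta>: "\<eta> \<ge> 0" and k: "k0 \<le> k" "k < K"
    and Q: "Q \<in> borel_measurable (Pi\<^sub>M ({..<N} \<times> {..<k0}) (\<lambda>_. borel))" "\<And>w. \<bar>Q w\<bar> \<le> q"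
    and dom: "dominated N C D c \<psi>" and c: "c \<ge> 0"
    and step: "\<And>x. separated N \<epsilon> R x \<Longrightarrow>
      \<bar>(LINT w|gaussian N (sqrt (\<tau> (Suc k) - \<tau> k)). fdet_ratio N \<psi> (\<lambda>j. x j + (\<tau> (Suc k) - \<tau> k) * drift N x j + w j))
        - fdet_ratio N (\<lambda>v. heat (\<tau> (Suc k) - \<tau> k) (\<psi> v)) x\<bar> \<le> \<eta>"
  defines "X \<equiv> \<lambda>k \<omega>. euler N u \<tau> (incr \<omega>) k"
    and "I \<equiv> \<lambda>k \<omega>. of_bool (\<forall>l\<in>{k0..<k}. separated N \<epsilon> R (euler N u \<tau> (incr \<omega>) l)) :: real"
    and "q0 \<equiv> \<lambda>\<omega>. Q (restrict (incr \<omega>) ({..<N} \<times> {..<k0}))"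
  shows "\<bar>(LINT \<omega>|P. I (Suc k) \<omega> * q0 \<omega> * fdet_ratio N \<psi> (X (Suc k) \<omega>))
    - (LINT \<omega>|P. I (Suc k) \<omega> * q0 \<omega> * fdet_ratio N (\<lambda>v. heat (\<tau> (Suc k) - \<tau> k) (\<psi> v)) (X k \<omega>))\<bar> \<le> q * \<eta>"
proof -
  let ?\<delta> = "\<tau> (Suc k) - \<tau> k"
  let ?A = "{..<N} \<times> {..<k}" and ?B = "{..<N} \<times> {..<k0}"
  let ?MA = "Pi\<^sub>M ?A (\<lambda>_. borel :: real measure)" and ?MN = "Pi\<^sub>M {..<N} (\<lambda>_. borel :: real measure)"
  let ?G = "gaussian N (sqrt ?\<delta>)"
  define past where "past \<omega> = restrict (incr \<omega>) ?A" for \<omega>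
  define e where "e y l = euler N u \<tau> y l" for y l
  define J where "J y = (of_bool (\<forall>l\<in>{k0..<Suc k}. separated N \<epsilon> R (e y l)) :: real)" for y
  define Q' where "Q' y = Q (restrict y ?B)" for y
  define f where "f = (\<lambda>(y, w). J y * Q' y * fdet_ratio N \<psi> (\<lambda>j. e y k j + ?\<delta> * drift N (e y k) j + w j))"
  note D = dominatedD[OF dom]
  have q0: "q \<ge> 0" using Q(2)[of undefined] by linarith
  have \<delta>: "?\<delta> > 0" using grid_less[OF k(2)] by simp
  have "dominated N (exp (?\<delta> / 2) * C) (exp (?\<delta> / 2) * D) c (\<lambda>v. heat ?\<delta> (\<psi> v))"
    by (rule dominated_heat[OF dom \<delta>])
  note D' = dominatedD[OF this]
  have em: "(\<lambda>y. e y l j) \<in> borel_measurable ?MA" if "l \<le> k" "j < N" for l j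
    unfolding e_def using that by (intro measurable_euler measurable_component_singleton) auto
  have Jm: "J \<in> borel_measurable ?MA"
    unfolding J_def[abs_def] using em by (intro measurable_of_bool_separated) auto
  have rest: "(\<lambda>y. restrict y ?B) \<in> measurable ?MA (Pi\<^sub>M ?B (\<lambda>_. borel))"
    using k(1) by (intro measurable_restrict_subset) auto
  have Qm: "Q' \<in> borel_measurable ?MA"
    unfolding Q'_def[abs_def] by (rule measurable_compose[OF rest Q(1)])
  have J01: "0 \<le> J y" "J y \<le> 1" for y by (auto simp: J_def)
  have emf: "(\<lambda>y. e (fst y) k j) \<in> borel_measurable (?MA \<Otimes>\<^sub>M ?MN)" if "j < N" for j
    using that by (intro measurable_compose[OF measurable_fst em]) auto
  have fm: "f \<in> borel_measurable (?MA \<Otimes>\<^sub>M ?MN)"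
    unfolding f_def case_prod_beta' drift_def
    using measurable_compose[OF measurable_fst Jm] measurable_compose[OF measurable_fst Qm]
      emf D(3)
    by (intro borel_measurable_times measurable_fdet_ratio borel_measurable_add borel_measurable_sum
        borel_measurable_divide borel_measurable_diff borel_measurable_const
        measurable_compose[OF measurable_snd measurable_component_singleton]) auto
  have fb: "\<bar>f y\<bar> \<le> q * c" for y
  proof (cases y)
    case (Pair a w)
    have "\<bar>J a * Q' a\<bar> \<le> 1 * q" unfolding abs_mult using J01 Q(2) by (intro mult_mono) (auto simp: Q'_def)
    then show ?thesis
      unfolding f_def Pair prod.case abs_mult using D(5)[OF c] q0 by (intro mult_mono) (auto simp: abs_mult)
  qed
  note st = integral_step[OF k(2) fm fb, folded past_def]
  have e_past: "e (past \<omega>) l j = X l \<omega> j" if "l \<le> k" "j < N" for l j \<omega>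
    unfolding e_def X_def past_def using that by (intro euler_cong) auto
  have JI: "J (past \<omega>) = I (Suc k) \<omega>" for \<omega>
  proof -
    have "separated N \<epsilon> R (e (past \<omega>) l) \<longleftrightarrow> separated N \<epsilon> R (X l \<omega>)" if "l \<in> {k0..<Suc k}" for l
      using that by (intro separated_cong e_past) auto
    then show ?thesis unfolding J_def I_def X_def by auto
  qed
  have QI: "Q' (past \<omega>) = q0 \<omega>" for \<omega>
  proof -
    have "restrict (past \<omega>) ?B = restrict (incr \<omega>) ?B"
      unfolding past_def using k(1) by (auto simp: fun_eq_iff restrict_def)
    then show ?thesis by (simp add: Q'_def q0_def)
  qed
  have dr: "drift N (e (past \<omega>) k) j = drift N (X k \<omega>) j" if "j < N" for j \<omega>
    using that by (intro drift_cong e_past) auto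
  have f_past: "f (past \<omega>, \<lambda>j\<in>{..<N}. incr \<omega> (j, k)) = I (Suc k) \<omega> * q0 \<omega> * fdet_ratio N \<psi> (X (Suc k) \<omega>)" for \<omega>
    unfolding f_def prod.case JI QI
    by (intro arg_cong2[where f = "(*)"] refl fdet_ratio_cong) (simp add: e_past dr, simp add: X_def)
  have f_past2: "f (past \<omega>, w) = I (Suc k) \<omega> * q0 \<omega> * fdet_ratio N \<psi> (\<lambda>j. X k \<omega> j + ?\<delta> * drift N (X k \<omega>) j + w j)" for \<omega> w
    unfolding f_def prod.case JI QI
    by (intro arg_cong2[where f = "(*)"] refl fdet_ratio_cong) (simp add: e_past dr)
  define H where "H \<omega> = I (Suc k) \<omega> * q0 \<omega> * fdet_ratio N (\<lambda>v. heat ?\<delta> (\<psi> v)) (X k \<omega>)" for \<omega>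
  define L where "L \<omega> = (LINT w|?G. f (past \<omega>, w))" for \<omega>
  have Lm: "L \<in> borel_measurable P"
    unfolding L_def[abs_def] by (rule measurable_compose[OF st(1,2)])
  have Hm: "H \<in> borel_measurable P"
  proof -
    have "(\<lambda>\<omega>. J (past \<omega>) * Q' (past \<omega>) * fdet_ratio N (\<lambda>v. heat ?\<delta> (\<psi> v)) (X k \<omega>)) \<in> borel_measurable P"
      using measurable_compose[OF st(1) Jm] measurable_compose[OF st(1) Qm] measurable_chain k D'(3)
      unfolding X_def by (intro borel_measurable_times measurable_fdet_ratio) auto
    then show ?thesis by (simp add: H_def[abs_def] JI QI)
  qed
  have I01: "0 \<le> I l \<omega>" "I l \<omega> \<le> 1" for l \<omega> by (auto simp: I_def)
  have LH: "\<bar>L \<omega> - H \<omega>\<bar> \<le> q * (I (Suc k) \<omega> * \<eta>)" for \<omega>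
  proof (cases "I (Suc k) \<omega> = 0")
    case True
    then show ?thesis by (simp add: L_def H_def f_past2)
  next
    case False
    then have one: "I (Suc k) \<omega> = 1" and sep: "separated N \<epsilon> R (X k \<omega>)"
      using k(1) by (auto simp: I_def X_def)
    have "L \<omega> = q0 \<omega> * (LINT w|?G. fdet_ratio N \<psi> (\<lambda>j. X k \<omega> j + ?\<delta> * drift N (X k \<omega>) j + w j))"
      by (simp add: L_def f_past2 one)
    then have "\<bar>L \<omega> - H \<omega>\<bar> = \<bar>q0 \<omega>\<bar> * \<bar>(LINT w|?G. fdet_ratio N \<psi> (\<lambda>j. X k \<omega> j + ?\<delta> * drift N (X k \<omega>) j + w j))
        - fdet_ratio N (\<lambda>v. heat ?\<delta> (\<psi> v)) (X k \<omega>)\<bar>"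
      by (simp add: H_def one abs_mult[symmetric] right_diff_distrib)
    also have "\<dots> \<le> q * \<eta>"
      using Q(2) step[OF sep] q0 unfolding q0_def by (intro mult_mono) auto
    finally show ?thesis by (simp add: one)
  qed
  have bq: "\<bar>q0 \<omega>\<bar> \<le> q" for \<omega> unfolding q0_def by (rule Q(2))
  have Hb: "\<bar>H \<omega>\<bar> \<le> 1 * q * c" for \<omega>
    unfolding H_def abs_mult using I01[of "Suc k" \<omega>] bq[of \<omega>] D'(5)[OF c] q0 by (intro mult_mono) auto
  have Hi: "integrable P H"
    using Hm Hb by (intro integrable_const_bound[of _ "1 * q * c"]) auto
  have LH': "\<bar>L \<omega> - H \<omega>\<bar> \<le> q * \<eta>" for \<omega>
  proof -
    have "q * (I (Suc k) \<omega> * \<eta>) \<le> q * (1 * \<eta>)"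
      using I01[of "Suc k" \<omega>] q0 \<eta> by (intro mult_left_mono mult_right_mono) auto
    then show ?thesis using LH[of \<omega>] by simp
  qed
  have Lb: "\<bar>L \<omega>\<bar> \<le> q * \<eta> + 1 * q * c" for \<omega>
    using LH'[of \<omega>] Hb[of \<omega>] by linarith
  have Li: "integrable P L"
    using Lm Lb by (intro integrable_const_bound[of _ "q * \<eta> + 1 * q * c"]) auto
  have "(LINT \<omega>|P. I (Suc k) \<omega> * q0 \<omega> * fdet_ratio N \<psi> (X (Suc k) \<omega>)) = (LINT \<omega>|P. L \<omega>)"
    unfolding f_past[symmetric] L_def by (rule st(3))
  then have "\<bar>(LINT \<omega>|P. I (Suc k) \<omega> * q0 \<omega> * fdet_ratio N \<psi> (X (Suc k) \<omega>)) - (LINT \<omega>|P. H \<omega>)\<bar>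
      = \<bar>LINT \<omega>|P. L \<omega> - H \<omega>\<bar>"
    using Li Hi by simp
  also have "\<dots> \<le> (LINT \<omega>|P. \<bar>L \<omega> - H \<omega>\<bar>)" by (rule integral_abs_bound)
  also have "\<dots> \<le> (LINT \<omega>|P. q * \<eta>)"
    using Li Hi LH' by (intro integral_mono integrable_abs) auto
  finally show ?thesis unfolding H_def by (simp add: prob_space)
qed

text \<open>The chain is given up as soon as it leaves the separated configurations, where the one-step
  estimate fails; the second error term is the probability of that event.\<close>

lemma chain_estimate:
  fixes u :: "nat \<Rightarrow> real" and \<Psi> :: "nat \<Rightarrow> nat \<Rightarrow> real \<Rightarrow> real"
  assumes k0: "k0 \<le> K"
    and Q: "Q \<in> borel_measurable (Pi\<^sub>M ({..<N} \<times> {..<k0}) (\<lambda>_. borel))" "\<And>w. \<bar>Q w\<bar> \<le> q"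
    and dom: "\<And>k. k0 \<le> k \<Longrightarrow> k \<le> K \<Longrightarrow> dominated N C D c (\<Psi> k)" and c: "c \<ge> 0" and \<kappa>: "\<kappa> \<ge> 0"
    and heat: "\<And>k v. k0 \<le> k \<Longrightarrow> k < K \<Longrightarrow> v < N \<Longrightarrow> \<Psi> k v = heat (\<tau> (Suc k) - \<tau> k) (\<Psi> (Suc k) v)"
    and mesh: "\<And>k. k < K \<Longrightarrow> \<tau> (Suc k) - \<tau> k \<le> h" "h \<le> T"
    and onestep: "\<And>\<delta> x \<psi>. 0 < \<delta> \<Longrightarrow> \<delta> \<le> T \<Longrightarrow> separated N \<epsilon> R x \<Longrightarrow> dominated N C D c \<psi> \<Longrightarrow>
      \<bar>(LINT w|gaussian N (sqrt \<delta>). fdet_ratio N \<psi> (\<lambda>j. x j + \<delta> * drift N x j + w j))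
        - fdet_ratio N (\<lambda>v. heat \<delta> (\<psi> v)) x\<bar> \<le> \<kappa> * (\<delta> * sqrt \<delta>)"
  defines "X \<equiv> \<lambda>k \<omega>. euler N u \<tau> (incr \<omega>) k"
    and "I \<equiv> \<lambda>k \<omega>. of_bool (\<forall>l\<in>{k0..<k}. separated N \<epsilon> R (euler N u \<tau> (incr \<omega>) l)) :: real"
    and "q0 \<equiv> \<lambda>\<omega>. Q (restrict (incr \<omega>) ({..<N} \<times> {..<k0}))"
  shows "\<bar>(LINT \<omega>|P. q0 \<omega> * fdet_ratio N (\<Psi> K) (X K \<omega>)) - (LINT \<omega>|P. q0 \<omega> * fdet_ratio N (\<Psi> k0) (X k0 \<omega>))\<bar>
    \<le> q * \<kappa> * sqrt h * (\<tau> K - \<tau> k0) + 2 * q * c * (1 - (LINT \<omega>|P. I K \<omega>))"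
proof -
  have q0: "q \<ge> 0" using Q(2)[of undefined] by linarith
  have bq: "\<bar>q0 \<omega>\<bar> \<le> q" for \<omega> unfolding q0_def by (rule Q(2))
  have I01: "0 \<le> I l \<omega>" "I l \<omega> \<le> 1" for l \<omega> by (auto simp: I_def)
  have Idec: "I (Suc l) \<omega> \<le> I l \<omega>" for l \<omega> by (auto simp: I_def)
  have qm: "q0 \<in> borel_measurable P"
    unfolding q0_def[abs_def]
  proof (rule measurable_compose[OF _ Q(1)])
    show "(\<lambda>\<omega>. restrict (incr \<omega>) ({..<N} \<times> {..<k0})) \<in> measurable P (Pi\<^sub>M ({..<N} \<times> {..<k0}) (\<lambda>_. borel))"
      using k0 by (intro measurable_restrict incr_measurable) auto
  qed
  have Im: "I k \<in> borel_measurable P" if "k \<le> K" for k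
    unfolding I_def[abs_def] using that measurable_chain by (intro measurable_of_bool_separated) auto
  have Fm: "(\<lambda>\<omega>. fdet_ratio N (\<Psi> k) (X l \<omega>)) \<in> borel_measurable P" if "k0 \<le> k" "k \<le> K" "l \<le> K" for k l
    unfolding X_def using that measurable_chain dominatedD(3)[OF dom[OF that(1,2)]] by (intro measurable_fdet_ratio) auto
  have Fb: "\<bar>fdet_ratio N (\<Psi> k) x\<bar> \<le> c" if "k0 \<le> k" "k \<le> K" for k x
    by (rule dominatedD(5)[OF dom[OF that] c])
  have Ii: "integrable P (I k)" if "k \<le> K" for k
    using Im[OF that] I01 by (intro integrable_const_bound[of _ 1]) auto
  have qFi: "integrable P (\<lambda>\<omega>. q0 \<omega> * fdet_ratio N (\<Psi> k) (X l \<omega>))"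
    if "k0 \<le> k" "k \<le> K" "l \<le> K" for k l
  proof (rule integrable_const_bound[of _ "q * c"])
    show "(\<lambda>\<omega>. q0 \<omega> * fdet_ratio N (\<Psi> k) (X l \<omega>)) \<in> borel_measurable P"
      using qm Fm[OF that] by simp
    have "\<bar>q0 \<omega> * fdet_ratio N (\<Psi> k) (X l \<omega>)\<bar> \<le> q * c" for \<omega>
      unfolding abs_mult using bq Fb[OF that(1,2)] q0 by (intro mult_mono) auto
    then show "AE \<omega> in P. norm (q0 \<omega> * fdet_ratio N (\<Psi> k) (X l \<omega>)) \<le> q * c" by simp
  qed
  have IqFi: "integrable P (\<lambda>\<omega>. I m \<omega> * q0 \<omega> * fdet_ratio N (\<Psi> k) (X l \<omega>))"
    if "k0 \<le> k" "k \<le> K" "l \<le> K" "m \<le> K" for k l m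
  proof (rule Bochner_Integration.integrable_bound[OF qFi[OF that(1-3)]])
    show "(\<lambda>\<omega>. I m \<omega> * q0 \<omega> * fdet_ratio N (\<Psi> k) (X l \<omega>)) \<in> borel_measurable P"
      using qm Fm[OF that(1-3)] Im[OF that(4)] by simp
    have "\<bar>I m \<omega>\<bar> * \<bar>q0 \<omega> * fdet_ratio N (\<Psi> k) (X l \<omega>)\<bar> \<le> 1 * \<bar>q0 \<omega> * fdet_ratio N (\<Psi> k) (X l \<omega>)\<bar>" for \<omega>
      using I01 by (intro mult_right_mono) auto
    then show "AE \<omega> in P. norm (I m \<omega> * q0 \<omega> * fdet_ratio N (\<Psi> k) (X l \<omega>)) \<le> norm (q0 \<omega> * fdet_ratio N (\<Psi> k) (X l \<omega>))"
      by (simp add: abs_mult mult.assoc)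
  qed
  have drop: "\<bar>(LINT \<omega>|P. J \<omega> * q0 \<omega> * fdet_ratio N (\<Psi> k) (X l \<omega>)) - (LINT \<omega>|P. J' \<omega> * q0 \<omega> * fdet_ratio N (\<Psi> k) (X l \<omega>))\<bar>
      \<le> q * c * ((LINT \<omega>|P. J \<omega>) - (LINT \<omega>|P. J' \<omega>))"
    if kl: "k0 \<le> k" "k \<le> K" "l \<le> K" and J: "\<And>\<omega>. J' \<omega> \<le> J \<omega>" "integrable P J" "integrable P J'"
      "integrable P (\<lambda>\<omega>. J \<omega> * q0 \<omega> * fdet_ratio N (\<Psi> k) (X l \<omega>))"
      "integrable P (\<lambda>\<omega>. J' \<omega> * q0 \<omega> * fdet_ratio N (\<Psi> k) (X l \<omega>))" for k l J J'
  proof -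
    let ?F = "\<lambda>\<omega>. fdet_ratio N (\<Psi> k) (X l \<omega>)"
    have "\<bar>(LINT \<omega>|P. J \<omega> * q0 \<omega> * ?F \<omega>) - (LINT \<omega>|P. J' \<omega> * q0 \<omega> * ?F \<omega>)\<bar>
        = \<bar>LINT \<omega>|P. J \<omega> * q0 \<omega> * ?F \<omega> - J' \<omega> * q0 \<omega> * ?F \<omega>\<bar>"
      using J by simp
    also have "\<dots> \<le> (LINT \<omega>|P. \<bar>J \<omega> * q0 \<omega> * ?F \<omega> - J' \<omega> * q0 \<omega> * ?F \<omega>\<bar>)" by (rule integral_abs_bound)
    also have "\<dots> \<le> (LINT \<omega>|P. q * c * (J \<omega> - J' \<omega>))"
    proof (rule integral_mono)
      fix \<omega>
      have "\<bar>q0 \<omega> * ?F \<omega>\<bar> \<le> q * c"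
        unfolding abs_mult using bq Fb[OF kl(1,2)] q0 by (intro mult_mono) auto
      then have "(J \<omega> - J' \<omega>) * \<bar>q0 \<omega> * ?F \<omega>\<bar> \<le> (J \<omega> - J' \<omega>) * (q * c)"
        using J(1)[of \<omega>] by (intro mult_left_mono) auto
      moreover have "\<bar>(J \<omega> - J' \<omega>) * (q0 \<omega> * ?F \<omega>)\<bar> = (J \<omega> - J' \<omega>) * \<bar>q0 \<omega> * ?F \<omega>\<bar>"
        using J(1)[of \<omega>] by (subst abs_mult) simp
      ultimately have "\<bar>(J \<omega> - J' \<omega>) * (q0 \<omega> * ?F \<omega>)\<bar> \<le> (J \<omega> - J' \<omega>) * (q * c)" by simp
      then show "\<bar>J \<omega> * q0 \<omega> * ?F \<omega> - J' \<omega> * q0 \<omega> * ?F \<omega>\<bar> \<le> q * c * (J \<omega> - J' \<omega>)"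
        by (simp add: algebra_simps)
    qed (use J in auto)
    also have "\<dots> = q * c * ((LINT \<omega>|P. J \<omega>) - (LINT \<omega>|P. J' \<omega>))"
      using J by simp
    finally show ?thesis .
  qed
  define a where "a k = (LINT \<omega>|P. I k \<omega> * q0 \<omega> * fdet_ratio N (\<Psi> k) (X k \<omega>))" for k
  \<comment> \<open>Two errors per step. In the one-step error \<open>sqrt \<delta>\<close> is
    replaced by \<open>sqrt h\<close>, so that the rest sums to a time difference; the passage from
    the indicator \<open>I k\<close> to \<open>I (Suc k)\<close> costs a decrement that
    telescopes.\<close>
  have main: "\<bar>a k - a k0\<bar> \<le> q * \<kappa> * sqrt h * (\<tau> k - \<tau> k0) + q * c * (1 - (LINT \<omega>|P. I k \<omega>))"
    if "k0 \<le> k" "k \<le> K" for k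
    using that
  proof (induction k rule: dec_induct)
    case base
    then show ?case using q0 c by (simp add: I_def prob_space)
  next
    case (step k)
    then have k: "k0 \<le> k" "k < K" by auto
    let ?\<delta> = "\<tau> (Suc k) - \<tau> k"
    have \<delta>: "0 < ?\<delta>" "?\<delta> \<le> h" "?\<delta> \<le> T" using grid_less[OF k(2)] mesh(1)[OF k(2)] mesh(2) by auto
    have hk: "fdet_ratio N (\<Psi> k) x = fdet_ratio N (\<lambda>v. heat ?\<delta> (\<Psi> (Suc k) v)) x" for x
      unfolding fdet_ratio_def using heat[OF k] by (intro arg_cong2[where f = "(/)"] fdet_cong refl) simp
    have "\<bar>a (Suc k) - (LINT \<omega>|P. I (Suc k) \<omega> * q0 \<omega> * fdet_ratio N (\<Psi> k) (X k \<omega>))\<bar> \<le> q * (\<kappa> * (?\<delta> * sqrt ?\<delta>))"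
      unfolding a_def hk I_def q0_def X_def
    proof (rule chain_step[OF _ k Q _ c])
      show "\<kappa> * (?\<delta> * sqrt ?\<delta>) \<ge> 0" using \<kappa> \<delta> by simp
      show d: "dominated N C D c (\<Psi> (Suc k))" using k by (intro dom) auto
      show "\<bar>(LINT w|gaussian N (sqrt ?\<delta>). fdet_ratio N (\<Psi> (Suc k)) (\<lambda>j. x j + ?\<delta> * drift N x j + w j))
        - fdet_ratio N (\<lambda>v. heat ?\<delta> (\<Psi> (Suc k) v)) x\<bar> \<le> \<kappa> * (?\<delta> * sqrt ?\<delta>)"
        if "separated N \<epsilon> R x" for x
        by (rule onestep[OF \<delta>(1,3) that d])
    qed
    moreover have "q * (\<kappa> * (?\<delta> * sqrt ?\<delta>)) \<le> q * (\<kappa> * (?\<delta> * sqrt h))"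
      using q0 \<kappa> \<delta> by (intro mult_left_mono) auto
    moreover have "\<bar>a k - (LINT \<omega>|P. I (Suc k) \<omega> * q0 \<omega> * fdet_ratio N (\<Psi> k) (X k \<omega>))\<bar>
        \<le> q * c * ((LINT \<omega>|P. I k \<omega>) - (LINT \<omega>|P. I (Suc k) \<omega>))"
      unfolding a_def using k Idec Ii IqFi by (intro drop) auto
    ultimately show ?case using step.IH k by (simp add: algebra_simps)
  qed
  \<comment> \<open>Removing the indicator at the end costs the same probability once more, hence
    the factor 2 in the claim.\<close>
  have "\<bar>(LINT \<omega>|P. 1 * q0 \<omega> * fdet_ratio N (\<Psi> K) (X K \<omega>)) - a K\<bar> \<le> q * c * ((LINT \<omega>|P. 1) - (LINT \<omega>|P. I K \<omega>))"
    unfolding a_def using k0 I01 Ii IqFi qFi by (intro drop) auto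
  moreover have "a k0 = (LINT \<omega>|P. q0 \<omega> * fdet_ratio N (\<Psi> k0) (X k0 \<omega>))"
    by (simp add: a_def I_def)
  ultimately show ?thesis using main[OF k0 order_refl] by (simp add: prob_space algebra_simps)
qed

end

section \<open>The Markov property in the limit\<close>

text \<open>Sort the prescribed times, the end points and the multiples of \<open>h\<close> in the
  interval. The prescribed times have to be grid points so that observations at these times are
  values of the chain.\<close>

lemma ex_grid:
  assumes "finite F" "F \<subseteq> {0..T}" "T > 0" "h > 0"
  shows "\<exists>\<tau> K. strict_mono_on {..K} \<tau> \<and> \<tau> 0 = 0 \<and> \<tau> K = (T::real) \<and> (\<forall>k<K. \<tau> (Suc k) - \<tau> k \<le> h)
    \<and> (\<forall>s\<in>F. \<exists>k\<le>K. \<tau> k = s)"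
proof -
  define S where "S = F \<union> {0, T} \<union> ((\<lambda>i. real i * h) ` {..nat \<lceil>T / h\<rceil>} \<inter> {0..T})"
  have fin: "finite S" using assms(1) by (simp add: S_def)
  have ST: "S \<subseteq> {0..T}" using assms by (auto simp: S_def)
  define xs where "xs = sorted_list_of_set S"
  have xs: "sorted_wrt (<) xs" "set xs = S" using fin by (simp_all add: xs_def)
  have "xs \<noteq> []" using xs(2) by (auto simp: S_def)
  define K where "K = length xs - 1"
  have len: "length xs = Suc K" using \<open>xs \<noteq> []\<close> by (cases xs) (auto simp: K_def)
  define \<tau> where "\<tau> k = xs ! k" for k
  have mono: "strict_mono_on {..K} \<tau>"
    using sorted_wrt_nth_less[OF xs(1)] len by (auto simp: strict_mono_on_def \<tau>_def)
  have in_S: "\<tau> k \<in> S" if "k \<le> K" for k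
    using that len xs(2) nth_mem[of k xs] by (simp add: \<tau>_def)
  have ex: "\<exists>k\<le>K. \<tau> k = s" if "s \<in> S" for s
    using that len xs(2) by (metis \<tau>_def in_set_conv_nth less_Suc_eq_le)
  have le: "\<tau> k \<le> \<tau> l" if "k \<le> l" "l \<le> K" for k l
    using strict_mono_on_leD[OF mono, of k l] that by simp
  have \<tau>0: "\<tau> 0 = 0"
  proof -
    obtain k where "k \<le> K" "\<tau> k = 0" using ex[of 0] by (auto simp: S_def)
    then have "\<tau> 0 \<le> 0" using le[of 0 k] by simp
    then show ?thesis using in_S[of 0] ST by fastforce
  qed
  have \<tau>K: "\<tau> K = T"
  proof -
    obtain k where "k \<le> K" "\<tau> k = T" using ex[of T] by (auto simp: S_def)
    then have "T \<le> \<tau> K" using le[of k K] by simp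
    then show ?thesis using in_S[of K] ST by fastforce
  qed
  have mesh: "\<tau> (Suc k) - \<tau> k \<le> h" if k: "k < K" for k
  proof (rule ccontr)
    assume "\<not> \<tau> (Suc k) - \<tau> k \<le> h"
    then have gt: "\<tau> k + h < \<tau> (Suc k)" by simp
    have t0: "0 \<le> \<tau> k" using in_S[of k] ST k by auto
    have tT: "\<tau> (Suc k) \<le> T" using in_S[of "Suc k"] ST k by auto
    \<comment> \<open>The first multiple of \<open>h\<close> after \<open>\<tau> k\<close> would be
      a grid point strictly between two neighbours more than \<open>h\<close> apart.\<close>
    define i where "i = nat \<lfloor>\<tau> k / h\<rfloor> + 1"
    have ri: "real i = of_int \<lfloor>\<tau> k / h\<rfloor> + 1" using t0 assms(4) by (simp add: i_def)
    have "\<tau> k / h < real i" "real i \<le> \<tau> k / h + 1" unfolding ri by linarith+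
    then have b: "\<tau> k < real i * h" "real i * h \<le> \<tau> k + h"
      using assms(4) by (simp_all add: field_simps)
    have "real i * h \<le> T" using b gt tT by linarith
    then have "real i \<le> T / h" using assms(4) by (simp add: field_simps)
    then have "i \<le> nat \<lceil>T / h\<rceil>" by linarith
    then have "real i * h \<in> S" using b t0 \<open>real i * h \<le> T\<close> by (auto simp: S_def)
    then obtain l where l: "l \<le> K" "\<tau> l = real i * h" using ex by blast
    have "\<not> l \<le> k" using le[of l k] k b l by force
    moreover have "\<not> Suc k \<le> l" using le[of "Suc k" l] l b gt by force
    ultimately show False by simp
  qed
  show ?thesis
    using mono \<tau>0 \<tau>K mesh ex by (intro exI[of _ \<tau>] exI[of _ K]) (auto simp: S_def)
qed

lemma fdet_ratio_tendsto:
  assumes "\<And>j. j < N \<Longrightarrow> (\<lambda>i. y i j) \<longlonglongrightarrow> y0 j" "\<And>v. v < N \<Longrightarrow> continuous_on UNIV (\<psi> v)" "vandermonde N y0 \<noteq> 0"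
  shows "(\<lambda>i. fdet_ratio N \<psi> (y i)) \<longlonglongrightarrow> fdet_ratio N \<psi> y0"
  unfolding fdet_ratio_def
proof (intro tendsto_divide assms(3))
  show "(\<lambda>i. vandermonde N (y i)) \<longlonglongrightarrow> vandermonde N y0"
    unfolding vandermonde_def using assms(1) by (intro tendsto_prod tendsto_diff) auto
  have *: "(\<lambda>i. \<psi> v (y i j)) \<longlonglongrightarrow> \<psi> v (y0 j)" if "v < N" "j < N" for v j
    using continuous_on_tendsto_compose[OF assms(2)[OF that(1)] assms(1)[OF that(2)]] by simp
  show "(\<lambda>i. fdet N (\<lambda>j v. \<psi> v (y i j))) \<longlonglongrightarrow> fdet N (\<lambda>j v. \<psi> v (y0 j))"
    unfolding fdet_leibniz
  proof (intro tendsto_sum tendsto_mult tendsto_const tendsto_prod *)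
    fix p j assume "p \<in> {p. p permutes {..<N}}" "j \<in> {..<N}"
    then show "p j < N" "j < N" using permutes_in_image[of p "{..<N}" j] by auto
  qed
qed

text \<open>Each path has its own separation constants on the bounded interval. It therefore passes
  the tests with gap \<open>1 / (i + 1)\<close> and size \<open>i\<close> from an index on that
  depends on the path.\<close>

lemma noncolliding_euler_limits:
  fixes X B :: "nat \<Rightarrow> real \<Rightarrow> 'a \<Rightarrow> real" and \<tau> :: "nat \<Rightarrow> nat \<Rightarrow> real" and K :: "nat \<Rightarrow> nat"
  assumes cont: "\<And>j. j < N \<Longrightarrow> continuous_on {0..} (\<lambda>t. X j t \<omega>)"
    and inj: "\<And>t. 0 \<le> t \<Longrightarrow> inj_on (\<lambda>j. X j t \<omega>) {..<N}"
    and X0: "\<And>j. j < N \<Longrightarrow> X j 0 \<omega> = u j"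
    and eq: "\<And>j t. j < N \<Longrightarrow> 0 \<le> t \<Longrightarrow>
      X j t \<omega> = u j + B j t \<omega> + (\<Sum>k\<in>{..<N} - {j}. LINT s:{0..t}|lborel. 1 / (X j s \<omega> - X k s \<omega>))"
    and grid: "\<And>i. strict_mono_on {..K i} (\<tau> i)" "\<And>i. \<tau> i 0 = 0" "\<And>i. \<tau> i (K i) = T"
    and mesh: "\<And>i k. k < K i \<Longrightarrow> \<tau> i (Suc k) - \<tau> i k \<le> 1 / (real i + 1)"
  defines "E \<equiv> \<lambda>i. euler N u (\<tau> i) (\<lambda>(j, k). B j (\<tau> i (Suc k)) \<omega> - B j (\<tau> i k) \<omega>)"
  shows "\<And>k s j. (\<And>i. k i \<le> K i) \<Longrightarrow> (\<And>i. \<tau> i (k i) = s) \<Longrightarrow> j < N \<Longrightarrow> (\<lambda>i. E i (k i) j) \<longlonglongrightarrow> X j s \<omega>"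
    and "\<forall>\<^sub>F i in sequentially. \<forall>l\<le>K i. separated N (1 / (real i + 1)) (real i) (E i l)"
proof -
  have ev_small: "\<forall>\<^sub>F i in sequentially. 1 / (real i + 1) \<le> h" if "h > 0" for h
  proof -
    have "(\<lambda>i. 1 / (real i + 1)) \<longlonglongrightarrow> 0" using LIMSEQ_inverse_real_of_nat by (simp add: inverse_eq_divide add.commute)
    from order_tendstoD(2)[OF this that] show ?thesis by eventually_elim simp
  qed
  have le: "\<tau> i k \<le> \<tau> i l" if "k \<le> l" "l \<le> K i" for i k l
    using strict_mono_on_leD[OF grid(1)[of i], of k l] that by simp
  have close: "\<forall>\<^sub>F i in sequentially. \<forall>k\<le>K i. \<forall>j<N. \<bar>E i k j - X j (\<tau> i k) \<omega>\<bar> \<le> \<eta>" if \<eta>: "\<eta> > 0" for \<eta>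
  proof -
    obtain h where h: "h > 0" "\<forall>\<tau> K. \<tau> 0 = 0 \<longrightarrow> (\<forall>k<K. \<tau> k \<le> \<tau> (Suc k) \<and> \<tau> (Suc k) - \<tau> k \<le> h) \<longrightarrow> \<tau> K \<le> T \<longrightarrow>
      (\<forall>k\<le>K. \<forall>j<N. \<bar>euler N u \<tau> (\<lambda>(j, k). B j (\<tau> (Suc k)) \<omega> - B j (\<tau> k) \<omega>) k j - X j (\<tau> k) \<omega>\<bar> \<le> \<eta>)"
      using euler_converges[where x = "\<lambda>j t. X j t \<omega>" and b = "\<lambda>j t. B j t \<omega>" and N = N and u = u and T = T,
          OF cont inj X0 eq \<eta>] by blast
    from ev_small[OF h(1)] show ?thesis
    proof eventually_elim
      case (elim i)
      have "\<tau> i k \<le> \<tau> i (Suc k) \<and> \<tau> i (Suc k) - \<tau> i k \<le> h" if "k < K i" for k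
        using le[of k "Suc k" i] mesh[OF that] elim that by auto
      then show ?case using h(2)[rule_format, of "\<tau> i" "K i"] grid(2,3) unfolding E_def by auto
    qed
  qed
  show "(\<lambda>i. E i (k i) j) \<longlonglongrightarrow> X j s \<omega>" if k: "\<And>i. k i \<le> K i" "\<And>i. \<tau> i (k i) = s" and j: "j < N" for k s j
  proof (rule tendstoI)
    fix e :: real assume "e > 0"
    then have "e / 2 > 0" by simp
    from close[OF this] show "\<forall>\<^sub>F i in sequentially. dist (E i (k i) j) (X j s \<omega>) < e"
    proof eventually_elim
      case (elim i)
      then have "\<bar>E i (k i) j - X j (\<tau> i (k i)) \<omega>\<bar> \<le> e / 2" using k(1) j by blast
      then show ?case using k(2) \<open>e > 0\<close> by (simp add: dist_real_def)
    qed
  qed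
  obtain \<epsilon> R where \<epsilon>: "\<epsilon> > 0" and sep: "\<forall>t\<in>{0..T}. separated N \<epsilon> R (\<lambda>j. X j t \<omega>)"
  proof -
    have "continuous_on {0..T} (\<lambda>t. X j t \<omega>)" if "j < N" for j
      by (rule continuous_on_subset[OF cont[OF that]]) auto
    with path_separated[of N T "\<lambda>j t. X j t \<omega>"] inj that show ?thesis by blast
  qed
  have ev_large: "\<forall>\<^sub>F i in sequentially. R + \<epsilon> / 4 \<le> real i"
    using filterlim_real_sequentially unfolding filterlim_at_top by blast
  have e4: "\<epsilon> / 4 > 0" and e2: "\<epsilon> / 2 > 0" using \<epsilon> by auto
  show "\<forall>\<^sub>F i in sequentially. \<forall>l\<le>K i. separated N (1 / (real i + 1)) (real i) (E i l)"
    using close[OF e4] ev_small[OF e2] ev_large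
  proof eventually_elim
    case (elim i)
    show ?case
    proof (intro allI impI)
      fix l assume l: "l \<le> K i"
      have "\<tau> i l \<in> {0..T}" using le[of 0 l i] le[of l "K i" i] l grid(2,3) by auto
      with sep have s: "separated N \<epsilon> R (\<lambda>j. X j (\<tau> i l) \<omega>)" by blast
      have c: "\<bar>E i l j - X j (\<tau> i l) \<omega>\<bar> \<le> \<epsilon> / 4" if "j < N" for j using elim(1) l that by blast
      show "separated N (1 / (real i + 1)) (real i) (E i l)"
        unfolding separated_def
      proof (intro conjI allI impI)
        fix j assume j: "j < N"
        then have "\<bar>X j (\<tau> i l) \<omega>\<bar> \<le> R" using s by (simp add: separated_def)
        then show "\<bar>E i l j\<bar> \<le> real i" using c[OF j] elim(3) by linarith
      next
        fix j k assume jk: "j < N" "k < N" "j \<noteq> k"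
        then have "\<epsilon> \<le> \<bar>X j (\<tau> i l) \<omega> - X k (\<tau> i l) \<omega>\<bar>" using s by (simp add: separated_def)
        then show "1 / (real i + 1) \<le> \<bar>E i l j - E i l k\<bar>" using c[OF jk(1)] c[OF jk(2)] elim(2) by linarith
      qed
    qed
  qed
qed

text \<open>The identity holds for Euler chains up to the error of \<open>chain_estimate\<close> and
  is passed to the limit by dominated convergence. The separation requirement is relaxed along the
  sequence, so the one-step constants \<open>\<kappa> i\<close> may grow without control and each
  mesh has to be chosen after its \<open>\<kappa> i\<close>.\<close>

lemma noncolliding_markov:
  fixes P :: "'a measure" and X B :: "nat \<Rightarrow> real \<Rightarrow> 'a \<Rightarrow> real" and M :: nat
    and t :: "nat \<Rightarrow> real" and g :: "nat \<Rightarrow> real \<Rightarrow> real"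
  assumes P: "prob_space P" and N: "0 < N" and nBM: "noncolliding_BM P N u B X"
    and dom: "dominated N C D c \<psi>" and nonneg: "C \<ge> 0" "D \<ge> 0" "c \<ge> 0" and S: "0 \<le> S" "S < T"
    and t: "\<And>m. m < M \<Longrightarrow> 0 \<le> t m \<and> t m \<le> S"
    and g: "\<And>m. m < M \<Longrightarrow> continuous_on UNIV (g m)" "\<And>m x. m < M \<Longrightarrow> \<bar>g m x\<bar> \<le> \<gamma>" "\<gamma> \<ge> (0::real)"
  shows "(LINT \<omega>|P. (\<Prod>m<M. \<Prod>j<N. g m (X j (t m) \<omega>)) * fdet_ratio N \<psi> (\<lambda>j. X j T \<omega>))
    = (LINT \<omega>|P. (\<Prod>m<M. \<Prod>j<N. g m (X j (t m) \<omega>)) * fdet_ratio N (\<lambda>v. heat (T - S) (\<psi> v)) (\<lambda>j. X j S \<omega>))"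
proof -
  interpret prob_space P by (rule P)
  have T: "T > 0" using S by simp
  define q where "q = (\<Prod>m<M. \<Prod>j<N. \<gamma>)"
  have q: "q \<ge> 0" unfolding q_def using g(3) by (intro prod_nonneg) auto
  define C' where "C' = exp (T / 2) * C"
  define D' where "D' = exp (T / 2) * D"
  have C'D': "C' \<ge> 0" "D' \<ge> 0" using nonneg by (simp_all add: C'_def D'_def)
  have expT: "exp (r / 2) * a \<le> exp (T / 2) * a" if "r \<le> T" "a \<ge> 0" for r a
    using that by (intro mult_right_mono) auto
  have "\<forall>i. \<exists>\<kappa>\<ge>0. \<forall>\<delta> x \<psi>. 0 < \<delta> \<longrightarrow> \<delta> \<le> T \<longrightarrow> separated N (1 / (real i + 1)) (real i) x \<longrightarrow> dominated N C' D' c \<psi> \<longrightarrow>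
    \<bar>(LINT w|gaussian N (sqrt \<delta>). fdet_ratio N \<psi> (\<lambda>j. x j + \<delta> * drift N x j + w j))
      - fdet_ratio N (\<lambda>v. heat \<delta> (\<psi> v)) x\<bar> \<le> \<kappa> * (\<delta> * sqrt \<delta>)"
    using C'D' nonneg by (intro allI euler_step_estimate) auto
  from choice[OF this] obtain \<kappa> where \<kappa>: "\<And>i. \<kappa> i \<ge> 0"
    "\<And>i \<delta> x \<psi>. 0 < \<delta> \<Longrightarrow> \<delta> \<le> T \<Longrightarrow> separated N (1 / (real i + 1)) (real i) x \<Longrightarrow> dominated N C' D' c \<psi> \<Longrightarrow>
    \<bar>(LINT w|gaussian N (sqrt \<delta>). fdet_ratio N \<psi> (\<lambda>j. x j + \<delta> * drift N x j + w j))
      - fdet_ratio N (\<lambda>v. heat \<delta> (\<psi> v)) x\<bar> \<le> \<kappa> i * (\<delta> * sqrt \<delta>)" by blast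
  \<comment> \<open>The last term is designed for
    \<open>q * \<kappa> i * sqrt (h i) * T \<le> 1 / (i + 1)\<close>; the summand 1 keeps the
    denominator positive.\<close>
  define h where "h i = min (1 / (real i + 1)) (min T ((1 / ((q * \<kappa> i * T + 1) * (real i + 1)))\<^sup>2))" for i
  have pos: "(q * \<kappa> i * T + 1) * (real i + 1) > 0" for i
    using q \<kappa>(1)[of i] T by (intro mult_pos_pos add_nonneg_pos mult_nonneg_nonneg) auto
  have h: "h i > 0" "h i \<le> 1 / (real i + 1)" "h i \<le> T" for i
    using pos[of i] T by (auto simp: h_def)
  have hq: "q * \<kappa> i * sqrt (h i) * T \<le> 1 / (real i + 1)" for i
  proof -
    have "h i \<le> (1 / ((q * \<kappa> i * T + 1) * (real i + 1)))\<^sup>2"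
      unfolding h_def by (intro min.coboundedI2) simp
    from real_sqrt_le_mono[OF this] have "sqrt (h i) \<le> \<bar>1 / ((q * \<kappa> i * T + 1) * (real i + 1))\<bar>"
      by (simp only: real_sqrt_abs)
    also have "\<dots> = 1 / ((q * \<kappa> i * T + 1) * (real i + 1))" using pos[of i] by (intro abs_of_pos) simp
    finally have "q * \<kappa> i * T * sqrt (h i) \<le> q * \<kappa> i * T * (1 / ((q * \<kappa> i * T + 1) * (real i + 1)))"
      using q \<kappa>(1)[of i] T by (intro mult_left_mono) auto
    also have "\<dots> = (q * \<kappa> i * T / (q * \<kappa> i * T + 1)) * (1 / (real i + 1))" by simp
    also have "\<dots> \<le> 1 * (1 / (real i + 1))"
      using q \<kappa>(1)[of i] T by (intro mult_right_mono) (auto simp: divide_le_eq_1 add_nonneg_pos)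
    finally show ?thesis by (simp add: mult_ac)
  qed
  \<comment> \<open>Grid and number of steps are packed into a pair so that one application of
    choice yields both.\<close>
  have "\<forall>i. \<exists>p. strict_mono_on {..snd p} (fst p) \<and> fst p 0 = 0 \<and> fst p (snd p) = T \<and>
      (\<forall>k<snd p. fst p (Suc k) - fst p k \<le> h i) \<and> (\<forall>s\<in>insert S (t ` {..<M}). \<exists>k\<le>snd p. fst p k = s)"
  proof
    fix i
    have sub: "insert S (t ` {..<M}) \<subseteq> {0..T}" using S t by force
    have fin: "finite (insert S (t ` {..<M}))" by simp
    obtain \<tau> K where "strict_mono_on {..K} \<tau>" "\<tau> 0 = 0" "\<tau> K = T" "\<forall>k<K. \<tau> (Suc k) - \<tau> k \<le> h i"
      "\<forall>s\<in>insert S (t ` {..<M}). \<exists>k\<le>K. \<tau> k = s"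
      using ex_grid[OF fin sub T h(1)[of i]] by blast
    then show "\<exists>p. strict_mono_on {..snd p} (fst p) \<and> fst p 0 = 0 \<and> fst p (snd p) = T \<and>
      (\<forall>k<snd p. fst p (Suc k) - fst p k \<le> h i) \<and> (\<forall>s\<in>insert S (t ` {..<M}). \<exists>k\<le>snd p. fst p k = s)"
      by (intro exI[of _ "(\<tau>, K)"]) simp
  qed
  from choice[OF this] obtain p where p: "\<And>i. strict_mono_on {..snd (p i)} (fst (p i))" "\<And>i. fst (p i) 0 = 0"
    "\<And>i. fst (p i) (snd (p i)) = T" "\<And>i k. k < snd (p i) \<Longrightarrow> fst (p i) (Suc k) - fst (p i) k \<le> h i"
    "\<And>i s. s \<in> insert S (t ` {..<M}) \<Longrightarrow> \<exists>k\<le>snd (p i). fst (p i) k = s" by blast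
  define \<tau> where "\<tau> i = fst (p i)" for i
  define K where "K i = snd (p i)" for i
  have grid: "strict_mono_on {..K i} (\<tau> i)" "\<tau> i 0 = 0" "\<tau> i (K i) = T" for i
    using p(1-3) by (simp_all add: \<tau>_def K_def)
  have mesh: "\<tau> i (Suc k) - \<tau> i k \<le> h i" if "k < K i" for i k
    using p(4) that by (simp add: \<tau>_def K_def)
  have "\<forall>i. \<exists>k\<le>K i. \<tau> i k = S" using p(5) by (simp add: \<tau>_def K_def)
  then obtain k0 where k0: "\<And>i. k0 i \<le> K i" "\<And>i. \<tau> i (k0 i) = S" by metis
  have "\<forall>m. \<exists>k. m < M \<longrightarrow> (\<forall>i. k i \<le> K i \<and> \<tau> i (k i) = t m)"
  proof
    fix m
    show "\<exists>k. m < M \<longrightarrow> (\<forall>i. k i \<le> K i \<and> \<tau> i (k i) = t m)"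
    proof (cases "m < M")
      case True
      then have "\<forall>i. \<exists>k. k \<le> K i \<and> \<tau> i k = t m" using p(5) by (auto simp: \<tau>_def K_def)
      from choice[OF this] show ?thesis by blast
    qed simp
  qed
  from choice[OF this] obtain kt where kt: "\<And>m i. m < M \<Longrightarrow> kt m i \<le> K i" "\<And>m i. m < M \<Longrightarrow> \<tau> i (kt m i) = t m"
    by blast
  have lt_iff: "\<tau> i k < \<tau> i l \<longleftrightarrow> k < l" if "k \<le> K i" "l \<le> K i" for i k l
    using grid(1)[of i] that by (simp add: strict_mono_on_less)
  have kt0: "kt m i \<le> k0 i" if "m < M" for m i
    using lt_iff[of "k0 i" i "kt m i"] k0 kt[OF that] t[OF that] by force
  have iBM: "independent_BMs P N B" using nBM by (simp add: noncolliding_BM_def)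
  have G: "brownian_grid P N B (\<tau> i) (K i)" for i
    using N iBM grid by unfold_locales auto
  define E where "E i \<omega> = euler N u (\<tau> i) (brownian_grid.incr B (\<tau> i) \<omega>)" for i \<omega>
  have Em: "(\<lambda>\<omega>. E i \<omega> k j) \<in> borel_measurable P" if "k \<le> K i" "j < N" for i k j
    unfolding E_def using brownian_grid.measurable_chain[OF G that] .
  define Q where "Q y = (\<Prod>m<M. \<Prod>j<N. g m (y m j))" for y :: "nat \<Rightarrow> nat \<Rightarrow> real"
  have Qb: "\<bar>Q y\<bar> \<le> q" for y
    unfolding Q_def q_def abs_prod using g(2) by (intro prod_mono conjI prod_nonneg) auto
  have gm: "g m \<in> borel_measurable borel" if "m < M" for m
    using g(1)[OF that] by (rule borel_measurable_continuous_onI)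
  have Qm: "(\<lambda>y. Q (\<lambda>m j. f m j y)) \<in> borel_measurable A" 
    if "\<And>m j. m < M \<Longrightarrow> j < N \<Longrightarrow> f m j \<in> borel_measurable A" for f and A :: "'z measure"
    unfolding Q_def using that gm by (intro borel_measurable_prod measurable_compose[OF that gm]) auto
  \<comment> \<open>The backward heat evolution with end value \<open>\<psi>\<close> at time
    \<open>T\<close>. The end point is a separate case because \<open>heat 0\<close> is not the
    identity.\<close>
  define \<Psi> where "\<Psi> i k = (if \<tau> i k < T then \<lambda>v. heat (T - \<tau> i k) (\<psi> v) else \<psi>)" for i k
  have \<Psi>K: "\<Psi> i (K i) = \<psi>" for i by (simp add: \<Psi>_def grid)
  have \<Psi>k0: "\<Psi> i (k0 i) = (\<lambda>v. heat (T - S) (\<psi> v))" for i using S by (simp add: \<Psi>_def k0)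
  note D\<psi> = dominatedD[OF dom]
  have domh: "dominated N C' D' c (\<lambda>v. heat r (\<psi> v))" if "0 < r" "r \<le> T" for r
    using dominated_heat[OF dom that(1)] by (rule dominated_mono) (auto simp: C'_def D'_def intro!: expT that nonneg)
  have dom': "dominated N C' D' c \<psi>"
    using dom by (rule dominated_mono) (use expT[of 0] T nonneg in \<open>auto simp: C'_def D'_def\<close>)
  have t0: "0 \<le> \<tau> i k" if "k \<le> K i" for i k
    using strict_mono_on_leD[OF grid(1)[of i], of 0 k] that grid(2) by simp
  have dom\<Psi>: "dominated N C' D' c (\<Psi> i k)" if "k \<le> K i" for i k
    using domh[of "T - \<tau> i k"] dom' t0[OF that] by (simp add: \<Psi>_def)
  have heat\<Psi>: "\<Psi> i k v = heat (\<tau> i (Suc k) - \<tau> i k) (\<Psi> i (Suc k) v)" if "k < K i" "v < N" for i k v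
  proof -
    have less: "\<tau> i k < \<tau> i (Suc k)" "\<tau> i k < T"
      using lt_iff[of k i "Suc k"] lt_iff[of k i "K i"] that grid(3) by auto
    show ?thesis
    proof (cases "\<tau> i (Suc k) < T")
      case True
      then have "heat (\<tau> i (Suc k) - \<tau> i k) (heat (T - \<tau> i (Suc k)) (\<psi> v)) = heat (T - \<tau> i k) (\<psi> v)"
        using heat_heat[OF D\<psi>(2)[OF that(2)], of "\<tau> i (Suc k) - \<tau> i k" "T - \<tau> i (Suc k)"] less by (intro ext) simp
      then show ?thesis using True less by (simp add: \<Psi>_def)
    next
      case False
      then have "\<tau> i (Suc k) = T"
        using that grid(3) strict_mono_on_leD[OF grid(1)[of i], of "Suc k" "K i"] by auto
      then show ?thesis using less by (simp add: \<Psi>_def)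
    qed
  qed
  define A where "A i = (LINT \<omega>|P. Q (\<lambda>m j. E i \<omega> (kt m i) j) * fdet_ratio N \<psi> (E i \<omega> (K i)))" for i
  define A' where "A' i = (LINT \<omega>|P. Q (\<lambda>m j. E i \<omega> (kt m i) j) * fdet_ratio N (\<lambda>v. heat (T - S) (\<psi> v)) (E i \<omega> (k0 i)))" for i
  define J where "J i \<omega> = (of_bool (\<forall>l\<in>{k0 i..<K i}. separated N (1 / (real i + 1)) (real i) (E i \<omega> l)) :: real)" for i \<omega>
  have est: "\<bar>A i - A' i\<bar> \<le> 1 / (real i + 1) + 2 * q * c * (1 - (LINT \<omega>|P. J i \<omega>))" for i
  proof -
    interpret G: brownian_grid P N B "\<tau> i" "K i" by (rule G)
    define Q' where "Q' w = Q (\<lambda>m j. euler N u (\<tau> i) w (kt m i) j)" for w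
    have Q'm: "Q' \<in> borel_measurable (Pi\<^sub>M ({..<N} \<times> {..<k0 i}) (\<lambda>_. borel))"
      unfolding Q'_def[abs_def]
    proof (rule Qm)
      fix m j assume mj: "m < M" "j < N"
      show "(\<lambda>w. euler N u (\<tau> i) w (kt m i) j) \<in> borel_measurable (Pi\<^sub>M ({..<N} \<times> {..<k0 i}) (\<lambda>_. borel))"
        using mj kt0[OF mj(1), of i] by (intro measurable_euler measurable_component_singleton) auto
    qed
    have Q'b: "\<bar>Q' w\<bar> \<le> q" for w unfolding Q'_def by (rule Qb)
    have Q'E: "Q' (restrict (G.incr \<omega>) ({..<N} \<times> {..<k0 i})) = Q (\<lambda>m j. E i \<omega> (kt m i) j)" for \<omega>
      unfolding Q'_def Q_def
    proof (intro prod.cong refl arg_cong[where f = "g _"])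
      fix m j assume mj: "m \<in> {..<M}" "j \<in> {..<N}"
      then show "euler N u (\<tau> i) (restrict (G.incr \<omega>) ({..<N} \<times> {..<k0 i})) (kt m i) j = E i \<omega> (kt m i) j"
        unfolding E_def using kt0[of m i] by (intro euler_cong) auto
    qed
    have "\<bar>(LINT \<omega>|P. Q' (restrict (G.incr \<omega>) ({..<N} \<times> {..<k0 i})) * fdet_ratio N (\<Psi> i (K i)) (euler N u (\<tau> i) (G.incr \<omega>) (K i)))
        - (LINT \<omega>|P. Q' (restrict (G.incr \<omega>) ({..<N} \<times> {..<k0 i})) * fdet_ratio N (\<Psi> i (k0 i)) (euler N u (\<tau> i) (G.incr \<omega>) (k0 i)))\<bar>
      \<le> q * \<kappa> i * sqrt (h i) * (\<tau> i (K i) - \<tau> i (k0 i)) + 2 * q * c * (1 - (LINT \<omega>|P.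
        of_bool (\<forall>l\<in>{k0 i..<K i}. separated N (1 / (real i + 1)) (real i) (euler N u (\<tau> i) (G.incr \<omega>) l))))"
      by (rule G.chain_estimate[OF k0(1) Q'm Q'b dom\<Psi> nonneg(3) \<kappa>(1) heat\<Psi> mesh h(3) \<kappa>(2)])
    then have "\<bar>A i - A' i\<bar> \<le> q * \<kappa> i * sqrt (h i) * (T - S) + 2 * q * c * (1 - (LINT \<omega>|P. J i \<omega>))"
      unfolding Q'E \<Psi>K \<Psi>k0 A_def A'_def J_def E_def grid(3) k0(2) .
    also have "q * \<kappa> i * sqrt (h i) * (T - S) \<le> q * \<kappa> i * sqrt (h i) * T"
      using q \<kappa>(1)[of i] h(1)[of i] S by (intro mult_left_mono) auto
    finally show ?thesis using hq[of i] by linarith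
  qed
  have ae: "AE \<omega> in P. (\<forall>j<N. continuous_on {0..} (\<lambda>t. X j t \<omega>)) \<and>
        (\<forall>t\<ge>0. inj_on (\<lambda>j. X j t \<omega>) {..<N}) \<and> (\<forall>j<N. X j 0 \<omega> = u j) \<and>
        (\<forall>j<N. \<forall>t\<ge>0. X j t \<omega> = u j + B j t \<omega> +
           (\<Sum>k\<in>{..<N} - {j}. LINT s:{0..t}|lborel. 1 / (X j s \<omega> - X k s \<omega>)))"
    using nBM by (simp add: noncolliding_BM_def)
  have Xm: "X j s \<in> borel_measurable P" if "j < N" "0 \<le> s" for j s
    using nBM that by (simp add: noncolliding_BM_def)
  have lims: "AE \<omega> in P. (\<forall>k s j. (\<forall>i. k i \<le> K i) \<longrightarrow> (\<forall>i. \<tau> i (k i) = s) \<longrightarrow> j < N \<longrightarrow> (\<lambda>i. E i \<omega> (k i) j) \<longlonglongrightarrow> X j s \<omega>)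
      \<and> (\<forall>\<^sub>F i in sequentially. \<forall>l\<le>K i. separated N (1 / (real i + 1)) (real i) (E i \<omega> l))
      \<and> (\<forall>t\<ge>0. inj_on (\<lambda>j. X j t \<omega>) {..<N})"
    using ae
  proof (rule AE_mp, intro AE_I2 impI)
    fix \<omega>
    assume good: "(\<forall>j<N. continuous_on {0..} (\<lambda>t. X j t \<omega>)) \<and>
        (\<forall>t\<ge>0. inj_on (\<lambda>j. X j t \<omega>) {..<N}) \<and> (\<forall>j<N. X j 0 \<omega> = u j) \<and>
        (\<forall>j<N. \<forall>t\<ge>0. X j t \<omega> = u j + B j t \<omega> +
           (\<Sum>k\<in>{..<N} - {j}. LINT s:{0..t}|lborel. 1 / (X j s \<omega> - X k s \<omega>)))"
    have E_eq: "E i \<omega> = euler N u (\<tau> i) (\<lambda>(j, k). B j (\<tau> i (Suc k)) \<omega> - B j (\<tau> i k) \<omega>)" for i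
      by (simp add: E_def brownian_grid.incr_def[OF G])
    have mesh': "\<tau> i (Suc k) - \<tau> i k \<le> 1 / (real i + 1)" if "k < K i" for i k
      using mesh[OF that] h(2)[of i] by linarith
    have c: "continuous_on {0..} (\<lambda>t. X j t \<omega>)" "X j 0 \<omega> = u j"
      "0 \<le> t \<Longrightarrow> X j t \<omega> = u j + B j t \<omega> + (\<Sum>k\<in>{..<N} - {j}. LINT s:{0..t}|lborel. 1 / (X j s \<omega> - X k s \<omega>))"
      if "j < N" for j t
      using good that by blast+
    have inj: "inj_on (\<lambda>j. X j t \<omega>) {..<N}" if "0 \<le> t" for t using good that by blast
    note lim = noncolliding_euler_limits[where X = X and B = B and \<omega> = \<omega> and T = T,
        OF c(1) inj c(2,3) grid mesh', folded E_eq]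
    have "(\<lambda>i. E i \<omega> (k i) j) \<longlonglongrightarrow> X j s \<omega>" if "\<forall>i. k i \<le> K i" "\<forall>i. \<tau> i (k i) = s" "j < N" for k s j
      using that by (intro lim(1)) auto
    moreover note lim(2)
    ultimately show "(\<forall>k s j. (\<forall>i. k i \<le> K i) \<longrightarrow> (\<forall>i. \<tau> i (k i) = s) \<longrightarrow> j < N \<longrightarrow> (\<lambda>i. E i \<omega> (k i) j) \<longlonglongrightarrow> X j s \<omega>)
      \<and> (\<forall>\<^sub>F i in sequentially. \<forall>l\<le>K i. separated N (1 / (real i + 1)) (real i) (E i \<omega> l))
      \<and> (\<forall>t\<ge>0. inj_on (\<lambda>j. X j t \<omega>) {..<N})" using inj by blast
  qed
  have QF: "(\<lambda>i. LINT \<omega>|P. Q (\<lambda>m j. E i \<omega> (kt m i) j) * fdet_ratio N \<phi> (E i \<omega> (k i)))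
      \<longlonglongrightarrow> (LINT \<omega>|P. Q (\<lambda>m j. X j (t m) \<omega>) * fdet_ratio N \<phi> (\<lambda>j. X j s \<omega>))"
    if k: "\<And>i. k i \<le> K i" "\<And>i. \<tau> i (k i) = s" and s: "0 \<le> s" and \<phi>: "dominated N C' D' c \<phi>" for \<phi> k s
  proof (rule integral_dominated_convergence[where w = "\<lambda>_. q * c"])
    note D\<phi> = dominatedD[OF \<phi>]
    show "(\<lambda>\<omega>. Q (\<lambda>m j. X j (t m) \<omega>) * fdet_ratio N \<phi> (\<lambda>j. X j s \<omega>)) \<in> borel_measurable P"
      using Xm s t D\<phi>(3) by (intro borel_measurable_times Qm measurable_fdet_ratio) auto
    show "(\<lambda>\<omega>. Q (\<lambda>m j. E i \<omega> (kt m i) j) * fdet_ratio N \<phi> (E i \<omega> (k i))) \<in> borel_measurable P" for i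
      using Em kt k D\<phi>(3) by (intro borel_measurable_times Qm measurable_fdet_ratio) auto
    show "AE \<omega> in P. norm (Q (\<lambda>m j. E i \<omega> (kt m i) j) * fdet_ratio N \<phi> (E i \<omega> (k i))) \<le> q * c" for i
      unfolding real_norm_def abs_mult using Qb D\<phi>(5)[OF nonneg(3)] q by (intro AE_I2 mult_mono) auto
    show "AE \<omega> in P. (\<lambda>i. Q (\<lambda>m j. E i \<omega> (kt m i) j) * fdet_ratio N \<phi> (E i \<omega> (k i)))
        \<longlonglongrightarrow> Q (\<lambda>m j. X j (t m) \<omega>) * fdet_ratio N \<phi> (\<lambda>j. X j s \<omega>)"
      using lims
    proof (rule AE_mp, intro AE_I2 impI)
      fix \<omega>
      assume l: "(\<forall>k s j. (\<forall>i. k i \<le> K i) \<longrightarrow> (\<forall>i. \<tau> i (k i) = s) \<longrightarrow> j < N \<longrightarrow> (\<lambda>i. E i \<omega> (k i) j) \<longlonglongrightarrow> X j s \<omega>)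
        \<and> (\<forall>\<^sub>F i in sequentially. \<forall>l\<le>K i. separated N (1 / (real i + 1)) (real i) (E i \<omega> l))
        \<and> (\<forall>t\<ge>0. inj_on (\<lambda>j. X j t \<omega>) {..<N})"
      \<comment> \<open>The limiting configuration has distinct points, so \<open>fdet_ratio\<close>
        is continuous there.\<close>
      have V: "vandermonde N (\<lambda>j. X j s \<omega>) \<noteq> 0" using l s by (simp add: vandermonde_eq_0_iff)
      have 1: "(\<lambda>i. fdet_ratio N \<phi> (E i \<omega> (k i))) \<longlonglongrightarrow> fdet_ratio N \<phi> (\<lambda>j. X j s \<omega>)"
        using l k V cosh_lipschitz_continuous[OF D\<phi>(1)] by (intro fdet_ratio_tendsto) auto
      have 2: "(\<lambda>i. Q (\<lambda>m j. E i \<omega> (kt m i) j)) \<longlonglongrightarrow> Q (\<lambda>m j. X j (t m) \<omega>)"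
        unfolding Q_def
      proof (intro tendsto_prod)
        fix m j assume mj: "m \<in> {..<M}" "j \<in> {..<N}"
        then have "(\<lambda>i. E i \<omega> (kt m i) j) \<longlonglongrightarrow> X j (t m) \<omega>" using l kt[of m] by auto
        with continuous_on_tendsto_compose[OF g(1)[of m] this] mj
        show "(\<lambda>i. g m (E i \<omega> (kt m i) j)) \<longlonglongrightarrow> g m (X j (t m) \<omega>)" by simp
      qed
      show "(\<lambda>i. Q (\<lambda>m j. E i \<omega> (kt m i) j) * fdet_ratio N \<phi> (E i \<omega> (k i)))
        \<longlonglongrightarrow> Q (\<lambda>m j. X j (t m) \<omega>) * fdet_ratio N \<phi> (\<lambda>j. X j s \<omega>)"
        using 1 2 by (rule tendsto_mult[rotated])
    qed
  qed simp
  \<comment> \<open>Almost every path eventually passes all separation tests, so the probability of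
    abandoning the chain tends to 0.\<close>
  have J: "(\<lambda>i. LINT \<omega>|P. J i \<omega>) \<longlonglongrightarrow> (LINT \<omega>|P. 1)"
  proof (rule integral_dominated_convergence[where w = "\<lambda>_. 1"])
    show "J i \<in> borel_measurable P" for i
      unfolding J_def[abs_def] using Em by (intro measurable_of_bool_separated) auto
    show "AE \<omega> in P. norm (J i \<omega>) \<le> 1" for i by (intro AE_I2) (auto simp: J_def)
    show "AE \<omega> in P. (\<lambda>i. J i \<omega>) \<longlonglongrightarrow> 1"
      using lims
    proof (rule AE_mp, intro AE_I2 impI tendsto_eventually)
      fix \<omega>
      assume "(\<forall>k s j. (\<forall>i. k i \<le> K i) \<longrightarrow> (\<forall>i. \<tau> i (k i) = s) \<longrightarrow> j < N \<longrightarrow> (\<lambda>i. E i \<omega> (k i) j) \<longlonglongrightarrow> X j s \<omega>)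
        \<and> (\<forall>\<^sub>F i in sequentially. \<forall>l\<le>K i. separated N (1 / (real i + 1)) (real i) (E i \<omega> l))
        \<and> (\<forall>t\<ge>0. inj_on (\<lambda>j. X j t \<omega>) {..<N})"
      then have "\<forall>\<^sub>F i in sequentially. \<forall>l\<le>K i. separated N (1 / (real i + 1)) (real i) (E i \<omega> l)" by blast
      then show "\<forall>\<^sub>F i in sequentially. J i \<omega> = 1"
        by eventually_elim (auto simp: J_def)
    qed
  qed auto
  have "A \<longlonglongrightarrow> (LINT \<omega>|P. Q (\<lambda>m j. X j (t m) \<omega>) * fdet_ratio N \<psi> (\<lambda>j. X j T \<omega>))"
    unfolding A_def[abs_def] using S by (intro QF order_refl grid(3) dom') auto
  moreover have "A' \<longlonglongrightarrow> (LINT \<omega>|P. Q (\<lambda>m j. X j (t m) \<omega>) * fdet_ratio N (\<lambda>v. heat (T - S) (\<psi> v)) (\<lambda>j. X j S \<omega>))"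
    unfolding A'_def[abs_def] using S by (intro QF k0 domh) auto
  ultimately have L: "(\<lambda>i. \<bar>A i - A' i\<bar>) \<longlonglongrightarrow> \<bar>(LINT \<omega>|P. Q (\<lambda>m j. X j (t m) \<omega>) * fdet_ratio N \<psi> (\<lambda>j. X j T \<omega>))
      - (LINT \<omega>|P. Q (\<lambda>m j. X j (t m) \<omega>) * fdet_ratio N (\<lambda>v. heat (T - S) (\<psi> v)) (\<lambda>j. X j S \<omega>))\<bar>"
    by (intro tendsto_rabs tendsto_diff)
  have "(\<lambda>i. 1 / (real i + 1)) \<longlonglongrightarrow> 0"
    using LIMSEQ_inverse_real_of_nat by (simp add: inverse_eq_divide add.commute)
  then have U: "(\<lambda>i. 1 / (real i + 1) + 2 * q * c * (1 - (LINT \<omega>|P. J i \<omega>))) \<longlonglongrightarrow> 0 + 2 * q * c * (1 - (LINT \<omega>|P. 1))"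
    by (intro tendsto_intros J)
  have "\<bar>(LINT \<omega>|P. Q (\<lambda>m j. X j (t m) \<omega>) * fdet_ratio N \<psi> (\<lambda>j. X j T \<omega>))
      - (LINT \<omega>|P. Q (\<lambda>m j. X j (t m) \<omega>) * fdet_ratio N (\<lambda>v. heat (T - S) (\<psi> v)) (\<lambda>j. X j S \<omega>))\<bar>
      \<le> 0 + 2 * q * c * (1 - (LINT \<omega>|P. 1))"
    using est by (intro LIMSEQ_le[OF L U]) auto
  then show ?thesis by (simp add: Q_def prob_space)
qed

section \<open>Multi-time expectations, martingale polynomials and the kernel\<close>

section \<open>Multi-time expectations as determinants\<close>

text \<open>From the top down: flow back from \<open>t (Suc M)\<close> to \<open>t M\<close>,
  multiply by \<open>g M\<close>, and so on until time 0. An observation at the top time has to be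
  part of \<open>\<psi>\<close>.\<close>

primrec backward :: "(nat \<Rightarrow> real) \<Rightarrow> (nat \<Rightarrow> real \<Rightarrow> real) \<Rightarrow> nat \<Rightarrow> (real \<Rightarrow> real) \<Rightarrow> real \<Rightarrow> real" where
  "backward t g 0 \<psi> = heat (t 0) \<psi>"
| "backward t g (Suc M) \<psi> = backward t g M (\<lambda>x. g M x * heat (t (Suc M) - t M) \<psi> x)"

lemma fdet_ratio_scale:
  "fdet_ratio N (\<lambda>v x. g x * \<psi> v x) x = (\<Prod>j<N. g (x j)) * fdet_ratio N \<psi> x"
  using fdet_scale_rows[of N "\<lambda>j. g (x j)" "\<lambda>j v. \<psi> v (x j)"] by (simp add: fdet_ratio_def)

text \<open>Multiplying every row function by the same \<open>g\<close> multiplies the determinant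
  by \<open>N\<close> values of \<open>g\<close>, hence \<open>\<gamma> ^ N\<close>. The Lipschitz
  assumption is what keeps the \<open>cosh_lipschitz\<close> part.\<close>

lemma dominated_scale:
  assumes dom: "dominated N C D c \<psi>" and g: "\<And>x. \<bar>g x\<bar> \<le> \<gamma>" "\<And>x y. \<bar>g x - g y\<bar> \<le> l * \<bar>x - y\<bar>"
    and l: "l \<ge> 0"
  shows "dominated N (\<gamma> * C) (\<gamma> * D + l * C) (\<gamma> ^ N * c) (\<lambda>v x. g x * \<psi> v x)"
  unfolding dominated_def
proof (intro conjI allI impI)
  show "cosh_lipschitz (\<gamma> * C) (\<gamma> * D + l * C) (\<lambda>x. g x * \<psi> v x)" if "v < N" for v
    by (rule cosh_lipschitz_mult[OF dominatedD(1)[OF dom that] g l])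
  fix y
  have \<gamma>: "\<gamma> \<ge> 0" using g(1)[of 0] by linarith
  have "\<bar>\<Prod>j<N. g (y j)\<bar> \<le> (\<Prod>j<N. \<gamma>)" unfolding abs_prod using g by (intro prod_mono) auto
  then have "\<bar>\<Prod>j<N. g (y j)\<bar> * \<bar>fdet N (\<lambda>j v. \<psi> v (y j))\<bar> \<le> \<gamma> ^ N * (c * \<bar>vandermonde N y\<bar>)"
    using dom \<gamma> unfolding dominated_def by (intro mult_mono) auto
  then show "\<bar>fdet N (\<lambda>j v. g (y j) * \<psi> v (y j))\<bar> \<le> \<gamma> ^ N * c * \<bar>vandermonde N y\<bar>"
    using fdet_scale_rows[of N "\<lambda>j. g (y j)" "\<lambda>j v. \<psi> v (y j)"] by (simp add: abs_mult)
qed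

lemma lipschitz_continuous_on:
  fixes g :: "real \<Rightarrow> real"
  assumes "\<And>x y. \<bar>g x - g y\<bar> \<le> l * \<bar>x - y\<bar>"
  shows "continuous_on UNIV g"
proof (rule continuous_at_imp_continuous_on, rule ballI)
  fix x
  have "((\<lambda>y. g y - g x) \<longlongrightarrow> 0) (at x)"
  proof (rule Lim_null_comparison)
    show "\<forall>\<^sub>F y in at x. norm (g y - g x) \<le> l * \<bar>y - x\<bar>" using assms by simp
    show "((\<lambda>y. l * \<bar>y - x\<bar>) \<longlongrightarrow> 0) (at x)" by (auto intro!: tendsto_eq_intros)
  qed
  then show "isCont g x" by (simp add: continuous_at LIM_zero_iff)
qed

text \<open>Each step uses the Markov property between the two last times and then absorbs the
  product of \<open>g M\<close> over the points into the row functions. At time 0 the configuration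
  is the deterministic \<open>u\<close>.\<close>

lemma noncolliding_backward:
  fixes P :: "'a measure" and X B :: "nat \<Rightarrow> real \<Rightarrow> 'a \<Rightarrow> real" and M :: nat
    and t :: "nat \<Rightarrow> real" and g :: "nat \<Rightarrow> real \<Rightarrow> real"
  assumes P: "prob_space P" and N: "0 < N" and nBM: "noncolliding_BM P N u B X"
    and dom: "dominated N C D c \<psi>" and nonneg: "C \<ge> 0" "D \<ge> 0" "c \<ge> 0"
    and t: "0 < t 0" "strict_mono_on {..M} t"
    and g: "\<And>m x. m < M \<Longrightarrow> \<bar>g m x\<bar> \<le> \<gamma>" "\<And>m x y. m < M \<Longrightarrow> \<bar>g m x - g m y\<bar> \<le> l * \<bar>x - y\<bar>"
    and \<gamma>: "\<gamma> \<ge> 0" "l \<ge> 0"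
  shows "(LINT \<omega>|P. (\<Prod>m<M. \<Prod>j<N. g m (X j (t m) \<omega>)) * fdet_ratio N \<psi> (\<lambda>j. X j (t M) \<omega>))
    = fdet_ratio N (\<lambda>v. backward t g M (\<psi> v)) u"
  using dom nonneg t g
proof (induction M arbitrary: C D c \<psi>)
  case 0
  interpret prob_space P by (rule P)
  let ?F = "fdet_ratio N (\<lambda>v. heat (t 0) (\<psi> v))"
  have "(LINT \<omega>|P. (\<Prod>m<(0::nat). \<Prod>j<N. g m (X j (t m) \<omega>)) * fdet_ratio N \<psi> (\<lambda>j. X j (t 0) \<omega>))
      = (LINT \<omega>|P. (\<Prod>m<(0::nat). \<Prod>j<N. g m (X j (t m) \<omega>)) * fdet_ratio N (\<lambda>v. heat (t 0 - 0) (\<psi> v)) (\<lambda>j. X j 0 \<omega>))"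
    using 0 \<gamma> by (intro noncolliding_markov[OF P N nBM 0(1-4), where \<gamma> = \<gamma>]) auto
  also have "\<dots> = (LINT \<omega>|P. ?F u)"
  proof (rule integral_cong_AE)
    have "AE \<omega> in P. \<forall>j<N. X j 0 \<omega> = u j"
      using nBM unfolding noncolliding_BM_def by (auto elim: AE_mp)
    then show "AE \<omega> in P. (\<Prod>m<(0::nat). \<Prod>j<N. g m (X j (t m) \<omega>)) * fdet_ratio N (\<lambda>v. heat (t 0 - 0) (\<psi> v)) (\<lambda>j. X j 0 \<omega>) = ?F u"
    proof (rule AE_mp, intro AE_I2 impI)
      fix \<omega> assume "\<forall>j<N. X j 0 \<omega> = u j"
      then have "?F (\<lambda>j. X j 0 \<omega>) = ?F u" by (intro fdet_ratio_cong) auto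
      then show "(\<Prod>m<(0::nat). \<Prod>j<N. g m (X j (t m) \<omega>)) * fdet_ratio N (\<lambda>v. heat (t 0 - 0) (\<psi> v)) (\<lambda>j. X j 0 \<omega>) = ?F u"
        by simp
    qed
    have "X j 0 \<in> borel_measurable P" if "j < N" for j
      using nBM that by (simp add: noncolliding_BM_def)
    then show "(\<lambda>\<omega>. (\<Prod>m<(0::nat). \<Prod>j<N. g m (X j (t m) \<omega>)) * fdet_ratio N (\<lambda>v. heat (t 0 - 0) (\<psi> v)) (\<lambda>j. X j 0 \<omega>)) \<in> borel_measurable P"
      using dominatedD(3)[OF 0(1)] by (simp, intro measurable_fdet_ratio heat_measurable) auto
  qed simp
  finally show ?case by (simp add: prob_space)
next
  case (Suc M)
  let ?h = "\<lambda>v. heat (t (Suc M) - t M) (\<psi> v)" and ?s = "t (Suc M) - t M"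
  have tt: "t M < t (Suc M)" and mono: "strict_mono_on {..M} t"
    using Suc.prems(6) by (auto simp: strict_mono_on_def)
  have t0: "0 < t m" if "m \<le> Suc M" for m
    using Suc.prems(5) strict_mono_on_leD[OF Suc.prems(6), of 0 m] that by simp
  have cont: "continuous_on UNIV (g m)" if "m < Suc M" for m
    using Suc.prems(8)[OF that] by (rule lipschitz_continuous_on)
  have tS: "0 \<le> t m \<and> t m \<le> t M" if "m < Suc M" for m
    using t0[of m] strict_mono_on_leD[OF mono, of m M] that by simp
  have domh: "dominated N (exp (?s / 2) * C) (exp (?s / 2) * D) c ?h"
    using Suc.prems(1) tt by (intro dominated_heat) auto
  have domg: "dominated N (\<gamma> * (exp (?s / 2) * C)) (\<gamma> * (exp (?s / 2) * D) + l * (exp (?s / 2) * C)) (\<gamma> ^ N * c) (\<lambda>v x. g M x * ?h v x)"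
    using Suc.prems(7,8) \<gamma> by (intro dominated_scale[OF domh]) auto
  have "(LINT \<omega>|P. (\<Prod>m<Suc M. \<Prod>j<N. g m (X j (t m) \<omega>)) * fdet_ratio N \<psi> (\<lambda>j. X j (t (Suc M)) \<omega>))
      = (LINT \<omega>|P. (\<Prod>m<Suc M. \<Prod>j<N. g m (X j (t m) \<omega>)) * fdet_ratio N ?h (\<lambda>j. X j (t M) \<omega>))"
    using t0[of M] tt Suc.prems(7) \<gamma> cont tS
    by (intro noncolliding_markov[OF P N nBM Suc.prems(1-4), where \<gamma> = \<gamma>]) auto
  also have "\<dots> = (LINT \<omega>|P. (\<Prod>m<M. \<Prod>j<N. g m (X j (t m) \<omega>)) * fdet_ratio N (\<lambda>v x. g M x * ?h v x) (\<lambda>j. X j (t M) \<omega>))"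
    by (simp add: fdet_ratio_scale mult.assoc)
  also have "\<dots> = fdet_ratio N (\<lambda>v. backward t g M (\<lambda>x. g M x * ?h v x)) u"
    using Suc.prems \<gamma> mono by (intro Suc.IH[OF domg]) auto
  finally show ?case by simp
qed

text \<open>For the polynomials \<open>p v\<close> the ratio equals the constant
  \<open>1 / vandermonde N u\<close> at every configuration without collisions, so the determinant
  drops out of the expectation.\<close>

lemma noncolliding_lipschitz_formula:
  fixes P :: "'a measure" and X B :: "nat \<Rightarrow> real \<Rightarrow> 'a \<Rightarrow> real" and M :: nat
    and t :: "nat \<Rightarrow> real" and g :: "nat \<Rightarrow> real \<Rightarrow> real"
  assumes P: "prob_space P" and N: "0 < N" and nBM: "noncolliding_BM P N u B X"
    and u: "vandermonde N u \<noteq> 0"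
    and p: "\<And>y. fdet N (\<lambda>j v. poly (p v) (y j)) = vandermonde N y / vandermonde N u"
    and t: "0 < t 0" "strict_mono_on {..M} t"
    and g: "\<And>m x. m \<le> M \<Longrightarrow> \<bar>g m x\<bar> \<le> \<gamma>" "\<And>m x y. m \<le> M \<Longrightarrow> \<bar>g m x - g m y\<bar> \<le> l * \<bar>x - y\<bar>"
    and \<gamma>: "\<gamma> \<ge> 0" "l \<ge> 0"
  shows "(LINT \<omega>|P. (\<Prod>m<Suc M. \<Prod>j<N. g m (X j (t m) \<omega>)))
    = fdet N (\<lambda>j v. backward t g M (\<lambda>x. g M x * poly (p v) x) (u j))"
proof -
  interpret prob_space P by (rule P)
  have "\<forall>v. \<exists>CD. cosh_lipschitz (fst CD) (snd CD) (poly (p v))"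
    using poly_cosh_lipschitz by (metis fst_conv snd_conv)
  from choice[OF this] obtain CD where CD: "\<And>v. cosh_lipschitz (fst (CD v)) (snd (CD v)) (poly (p v))" by blast
  define C where "C = (\<Sum>v<N. fst (CD v))"
  define D where "D = (\<Sum>v<N. snd (CD v))"
  have CD0: "fst (CD v) \<ge> 0" "snd (CD v) \<ge> 0" for v
    using cosh_boundedD(3)[OF cosh_lipschitz_bounded[OF CD]] CD[of v] by (auto simp: cosh_lipschitz_def)
  have CD00: "C \<ge> 0" "D \<ge> 0" unfolding C_def D_def using CD0 by (auto intro: sum_nonneg)
  have dom: "dominated N C D (1 / \<bar>vandermonde N u\<bar>) (\<lambda>v. poly (p v))"
    unfolding dominated_def
  proof (intro conjI allI impI)
    show "cosh_lipschitz C D (poly (p v))" if "v < N" for v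
      unfolding C_def D_def using that CD0 by (intro cosh_lipschitz_mono[OF CD] member_le_sum) auto
  qed (simp add: p)
  let ?c = "\<gamma> ^ N * (1 / \<bar>vandermonde N u\<bar>)"
  have domg: "dominated N (\<gamma> * C) (\<gamma> * D + l * C) ?c (\<lambda>v x. g M x * poly (p v) x)"
    using g \<gamma> by (intro dominated_scale[OF dom]) auto
  have tM: "0 \<le> t M" using t strict_mono_on_leD[OF t(2), of 0 M] by simp
  have "(LINT \<omega>|P. (\<Prod>m<M. \<Prod>j<N. g m (X j (t m) \<omega>)) * fdet_ratio N (\<lambda>v x. g M x * poly (p v) x) (\<lambda>j. X j (t M) \<omega>))
      = fdet_ratio N (\<lambda>v. backward t g M (\<lambda>x. g M x * poly (p v) x)) u"
    using g \<gamma> t CD00 by (intro noncolliding_backward[OF P N nBM domg, where \<gamma> = \<gamma> and l = l]) auto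
  moreover have "(LINT \<omega>|P. (\<Prod>m<M. \<Prod>j<N. g m (X j (t m) \<omega>)) * fdet_ratio N (\<lambda>v x. g M x * poly (p v) x) (\<lambda>j. X j (t M) \<omega>))
      = (LINT \<omega>|P. (\<Prod>m<Suc M. \<Prod>j<N. g m (X j (t m) \<omega>)) / vandermonde N u)"
  proof (rule integral_cong_AE)
    have "AE \<omega> in P. \<forall>t\<ge>0. inj_on (\<lambda>j. X j t \<omega>) {..<N}"
      using nBM unfolding noncolliding_BM_def by (auto elim: AE_mp)
    then show "AE \<omega> in P. (\<Prod>m<M. \<Prod>j<N. g m (X j (t m) \<omega>)) * fdet_ratio N (\<lambda>v x. g M x * poly (p v) x) (\<lambda>j. X j (t M) \<omega>)
        = (\<Prod>m<Suc M. \<Prod>j<N. g m (X j (t m) \<omega>)) / vandermonde N u"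
    proof (rule AE_mp, intro AE_I2 impI)
      fix \<omega> assume "\<forall>t\<ge>0. inj_on (\<lambda>j. X j t \<omega>) {..<N}"
      then have "vandermonde N (\<lambda>j. X j (t M) \<omega>) \<noteq> 0" using tM by (simp add: vandermonde_eq_0_iff)
      then show "(\<Prod>m<M. \<Prod>j<N. g m (X j (t m) \<omega>)) * fdet_ratio N (\<lambda>v x. g M x * poly (p v) x) (\<lambda>j. X j (t M) \<omega>)
        = (\<Prod>m<Suc M. \<Prod>j<N. g m (X j (t m) \<omega>)) / vandermonde N u"
        by (simp add: fdet_ratio_scale) (simp add: fdet_ratio_def p)
    qed
    have Xm: "X j s \<in> borel_measurable P" if "j < N" "0 \<le> s" for j s
      using nBM that by (simp add: noncolliding_BM_def)
    have gm: "g m \<in> borel_measurable borel" if "m \<le> M" for m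
      using g(2)[OF that] by (intro borel_measurable_continuous_onI lipschitz_continuous_on) auto
    have t0: "0 \<le> t m" if "m \<le> M" for m
      using t strict_mono_on_leD[OF t(2), of 0 m] that by simp
    have prm: "(\<lambda>\<omega>. \<Prod>m<M'. \<Prod>j<N. g m (X j (t m) \<omega>)) \<in> borel_measurable P" if "M' \<le> Suc M" for M'
      using that t0 Xm gm by (intro borel_measurable_prod measurable_compose[OF Xm gm]) auto
    show "(\<lambda>\<omega>. (\<Prod>m<Suc M. \<Prod>j<N. g m (X j (t m) \<omega>)) / vandermonde N u) \<in> borel_measurable P"
      using prm[of "Suc M"] by simp
    show "(\<lambda>\<omega>. (\<Prod>m<M. \<Prod>j<N. g m (X j (t m) \<omega>)) * fdet_ratio N (\<lambda>v x. g M x * poly (p v) x) (\<lambda>j. X j (t M) \<omega>)) \<in> borel_measurable P"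
      using prm[of M] Xm tM by (intro borel_measurable_times measurable_fdet_ratio dominatedD(3)[OF domg]) auto
  qed
  ultimately have "(LINT \<omega>|P. (\<Prod>m<Suc M. \<Prod>j<N. g m (X j (t m) \<omega>))) / vandermonde N u
      = fdet N (\<lambda>j v. backward t g M (\<lambda>x. g M x * poly (p v) x) (u j)) / vandermonde N u"
    by (simp only: integral_divide_zero fdet_ratio_def)
  then show ?thesis using u by (simp only: divide_cancel_right simp_thms)
qed

text \<open>Approximation from below by the infimal convolutions of \<open>g\<close> with \<open>l * \<bar>x\<bar>\<close>.\<close>

lemma lipschitz_approximation:
  fixes g :: "real \<Rightarrow> real"
  assumes cont: "continuous_on UNIV g" and bound: "\<And>x. \<bar>g x\<bar> \<le> \<gamma>"
  shows "\<exists>G. (\<forall>l::nat. (\<forall>x. \<bar>G l x\<bar> \<le> \<gamma>) \<and> (\<forall>x y. \<bar>G l x - G l y\<bar> \<le> real l * \<bar>x - y\<bar>))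
    \<and> (\<forall>x. (\<lambda>l. G l x) \<longlonglongrightarrow> g x)"
proof -
  define G where "G l x = (INF y. g y + real l * \<bar>x - y\<bar>)" for l x
  have bdd: "bdd_below (range (\<lambda>y. g y + real l * \<bar>x - y\<bar>))" for l x
  proof (rule bdd_belowI2)
    fix y
    have "- \<gamma> \<le> g y" using bound[of y] by linarith
    then show "- \<gamma> \<le> g y + real l * \<bar>x - y\<bar>" by (simp add: add_increasing2)
  qed
  have le: "G l x \<le> g y + real l * \<bar>x - y\<bar>" for l x y
    unfolding G_def using bdd by (rule cINF_lower) simp
  have ge: "a \<le> G l x" if "\<And>y. a \<le> g y + real l * \<bar>x - y\<bar>" for a l x
    unfolding G_def using that by (intro cINF_greatest) auto
  have lip: "G l x \<le> G l y + real l * \<bar>x - y\<bar>" for l x y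
  proof -
    have "G l x - real l * \<bar>x - y\<bar> \<le> G l y"
    proof (rule ge)
      fix z
      have "real l * \<bar>x - z\<bar> \<le> real l * (\<bar>x - y\<bar> + \<bar>y - z\<bar>)" by (intro mult_left_mono) auto
      then show "G l x - real l * \<bar>x - y\<bar> \<le> g z + real l * \<bar>y - z\<bar>"
        using le[of l x z] by (simp add: algebra_simps)
    qed
    then show ?thesis by simp
  qed
  have "\<bar>G l x - G l y\<bar> \<le> real l * \<bar>x - y\<bar>" for l x y
    using lip[of l x y] lip[of l y x] by (simp add: abs_minus_commute abs_le_iff)
  moreover have "\<bar>G l x\<bar> \<le> \<gamma>" for l x
  proof -
    have "- \<gamma> \<le> G l x"
    proof (rule ge)
      fix y
      have "- \<gamma> \<le> g y" using bound[of y] by linarith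
      then show "- \<gamma> \<le> g y + real l * \<bar>x - y\<bar>" by (simp add: add_increasing2)
    qed
    moreover have "G l x \<le> g x" using le[of l x x] by simp
    ultimately show ?thesis using bound[of x] by linarith
  qed
  moreover have "(\<lambda>l. G l x) \<longlonglongrightarrow> g x" for x
  proof (rule tendstoI)
    fix e :: real assume e: "e > 0"
    have "isCont g x" using cont by (simp add: continuous_on_eq_continuous_at)
    then obtain r where r: "r > 0" "\<And>y. \<bar>y - x\<bar> < r \<Longrightarrow> \<bar>g y - g x\<bar> < e / 2"
      using e unfolding continuous_at_eps_delta dist_real_def by (metis half_gt_zero)
    have "\<forall>\<^sub>F l in sequentially. 2 * \<gamma> / r \<le> real l"
      using filterlim_real_sequentially unfolding filterlim_at_top by blast
    then show "\<forall>\<^sub>F l in sequentially. dist (G l x) (g x) < e"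
    proof eventually_elim
      case (elim l)
      have "g x - e / 2 \<le> G l x"
      proof (rule ge)
        fix y
        show "g x - e / 2 \<le> g y + real l * \<bar>x - y\<bar>"
        proof (cases "\<bar>y - x\<bar> < r")
          case True
          from r(2)[OF this] have "g x - e / 2 \<le> g y" by linarith
          then show ?thesis by (simp add: add_increasing2)
        next
          case False
          have "2 * \<gamma> \<le> real l * r" using elim r(1) by (simp add: field_simps)
          also have "\<dots> \<le> real l * \<bar>x - y\<bar>" using False by (intro mult_left_mono) auto
          finally show ?thesis using bound[of x] bound[of y] e by linarith
        qed
      qed
      moreover have "G l x \<le> g x" using le[of l x x] by simp
      ultimately show ?case using e by (simp add: dist_real_def)
    qed
  qed
  ultimately show ?thesis by blast
qed

lemma heat_tendsto:
  assumes f: "\<And>l. cosh_bounded C (f l)" and lim: "\<And>x. (\<lambda>l. f l x) \<longlonglongrightarrow> f' x" and \<tau>: "\<tau> > 0"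
  shows "cosh_bounded C f'" "(\<lambda>l::nat. heat \<tau> (f l) x) \<longlonglongrightarrow> heat \<tau> f' x"
proof -
  have fm: "f l \<in> borel_measurable borel" for l by (rule cosh_boundedD(1)[OF f])
  have fm': "f' \<in> borel_measurable borel"
    using borel_measurable_LIMSEQ_real[OF lim fm] by simp
  have "\<bar>f' x\<bar> \<le> C * cosh x" for x
    using tendsto_rabs[OF lim[of x]] cosh_boundedD(2)[OF f] by (intro LIMSEQ_le_const2) auto
  with fm' show "cosh_bounded C f'" by (simp add: cosh_bounded_def)
  show "(\<lambda>l. heat \<tau> (f l) x) \<longlonglongrightarrow> heat \<tau> f' x"
    unfolding heat_def
  proof (rule integral_dominated_convergence[where w = "\<lambda>y. C * (normal_density x (sqrt \<tau>) y * cosh y)"])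
    show "integrable lborel (\<lambda>y. C * (normal_density x (sqrt \<tau>) y * cosh y))"
      using normal_density_cosh(1)[of "sqrt \<tau>"] \<tau> by simp
    show "AE y in lborel. (\<lambda>l. normal_density x (sqrt \<tau>) y * f l y) \<longlonglongrightarrow> normal_density x (sqrt \<tau>) y * f' y"
      by (intro AE_I2 tendsto_mult tendsto_const lim)
    show "AE y in lborel. norm (normal_density x (sqrt \<tau>) y * f l y) \<le> C * (normal_density x (sqrt \<tau>) y * cosh y)" for l
      using mult_left_mono[OF cosh_boundedD(2)[OF f], of "normal_density x (sqrt \<tau>) _"]
      by (intro AE_I2) (auto simp: abs_mult mult.left_commute)
  qed (use fm fm' in auto)
qed

text \<open>Dominated convergence at every level; the common bound \<open>\<gamma>\<close> provides
  a multiple of \<open>cosh\<close> that dominates all approximations at once.\<close>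

lemma backward_tendsto:
  assumes t: "0 < t 0" "strict_mono_on {..M} t"
    and G: "\<And>l m x. m < M \<Longrightarrow> \<bar>G l m x\<bar> \<le> \<gamma>" "\<And>l m. m < M \<Longrightarrow> G l m \<in> borel_measurable borel"
      "\<And>m x. m < M \<Longrightarrow> (\<lambda>l::nat. G l m x) \<longlonglongrightarrow> g m x"
    and f: "\<And>l. cosh_bounded C (f l)" "\<And>x. (\<lambda>l. f l x) \<longlonglongrightarrow> f' x"
  shows "(\<lambda>l. backward t (G l) M (f l) x) \<longlonglongrightarrow> backward t g M f' x"
  using t G f
proof (induction M arbitrary: C f f')
  case 0
  then show ?case using heat_tendsto(2)[OF 0(6,7), of "t 0"] by simp
next
  case (Suc M)
  let ?s = "t (Suc M) - t M"
  have s: "?s > 0" using Suc.prems(2) by (auto simp: strict_mono_on_def)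
  have hb: "cosh_bounded (exp (?s / 2) * C) (heat ?s (f l))" for l
    using heat_bounded[OF Suc.prems(6) s] .
  have \<gamma>: "\<gamma> \<ge> 0" using Suc.prems(3)[of M undefined undefined] by (simp add: order_trans[OF abs_ge_zero])
  show ?case
    unfolding backward.simps
  proof (rule Suc.IH)
    show "strict_mono_on {..M} t" using Suc.prems(2) by (auto simp: strict_mono_on_def)
    show "cosh_bounded (\<gamma> * (exp (?s / 2) * C)) (\<lambda>x. G l M x * heat ?s (f l) x)" for l
      unfolding cosh_bounded_def
    proof (intro conjI allI)
      show "(\<lambda>x. G l M x * heat ?s (f l) x) \<in> borel_measurable borel"
        using Suc.prems(4)[of M] cosh_boundedD(1)[OF hb] by simp
      show "\<bar>G l M x * heat ?s (f l) x\<bar> \<le> \<gamma> * (exp (?s / 2) * C) * cosh x" for x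
        unfolding abs_mult mult.assoc[of \<gamma>] using Suc.prems(3)[of M] cosh_boundedD(2)[OF hb] \<gamma>
        by (intro mult_mono) auto
    qed
    show "(\<lambda>l. G l M x * heat ?s (f l) x) \<longlonglongrightarrow> g M x * heat ?s f' x" for x
      using Suc.prems(5)[of M] heat_tendsto(2)[OF Suc.prems(6,7) s] by (intro tendsto_mult) auto
  qed (use Suc.prems in auto)
qed

text \<open>Neither side of the formula contains the Lipschitz constant, so the formula passes from
  the Lipschitz approximations to bounded continuous observables.\<close>

theorem noncolliding_multitime_expectation:
  fixes P :: "'a measure" and X B :: "nat \<Rightarrow> real \<Rightarrow> 'a \<Rightarrow> real" and M :: nat
    and t :: "nat \<Rightarrow> real" and g :: "nat \<Rightarrow> real \<Rightarrow> real"
  assumes P: "prob_space P" and N: "0 < N" and nBM: "noncolliding_BM P N u B X"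
    and u: "vandermonde N u \<noteq> 0"
    and p: "\<And>y. fdet N (\<lambda>j v. poly (p v) (y j)) = vandermonde N y / vandermonde N u"
    and t: "0 < t 0" "strict_mono_on {..M} t"
    and g: "\<And>m. m \<le> M \<Longrightarrow> continuous_on UNIV (g m)" "\<And>m x. m \<le> M \<Longrightarrow> \<bar>g m x\<bar> \<le> \<gamma>"
  shows "(LINT \<omega>|P. (\<Prod>m<Suc M. \<Prod>j<N. g m (X j (t m) \<omega>)))
    = fdet N (\<lambda>j v. backward t g M (\<lambda>x. g M x * poly (p v) x) (u j))"
proof -
  interpret prob_space P by (rule P)
  have \<gamma>: "\<gamma> \<ge> 0" using g(2)[of 0 0] by linarith
  have "\<forall>m. \<exists>G. m \<le> M \<longrightarrow> ((\<forall>l::nat. (\<forall>x. \<bar>G l x\<bar> \<le> \<gamma>) \<and> (\<forall>x y. \<bar>G l x - G l y\<bar> \<le> real l * \<bar>x - y\<bar>))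
    \<and> (\<forall>x. (\<lambda>l. G l x) \<longlonglongrightarrow> g m x))"
    using lipschitz_approximation[OF g(1) g(2)] by blast
  from choice[OF this] obtain G0 where G0: "\<forall>m. m \<le> M \<longrightarrow> ((\<forall>l::nat. (\<forall>x. \<bar>G0 m l x\<bar> \<le> \<gamma>) \<and>
      (\<forall>x y. \<bar>G0 m l x - G0 m l y\<bar> \<le> real l * \<bar>x - y\<bar>)) \<and> (\<forall>x. (\<lambda>l. G0 m l x) \<longlonglongrightarrow> g m x))" ..
  define G where "G l m = G0 m l" for l m
  have Gb: "\<bar>G l m x\<bar> \<le> \<gamma>" and Gl: "\<bar>G l m x - G l m y\<bar> \<le> real l * \<bar>x - y\<bar>"
    and Glim: "(\<lambda>l. G l m x) \<longlonglongrightarrow> g m x" if "m \<le> M" for l m x y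
    using G0 that by (auto simp: G_def)
  have Gm: "G l m \<in> borel_measurable borel" if "m \<le> M" for l m
    using Gl[OF that] by (intro borel_measurable_continuous_onI lipschitz_continuous_on) auto
  have gm: "g m \<in> borel_measurable borel" if "m \<le> M" for m
    using g(1)[OF that] by (rule borel_measurable_continuous_onI)
  have t0: "0 \<le> t m" if "m \<le> M" for m
    using t strict_mono_on_leD[OF t(2), of 0 m] that by simp
  have Xm: "X j s \<in> borel_measurable P" if "j < N" "0 \<le> s" for j s
    using nBM that by (simp add: noncolliding_BM_def)
  have "(\<lambda>l. LINT \<omega>|P. (\<Prod>m<Suc M. \<Prod>j<N. G l m (X j (t m) \<omega>))) \<longlonglongrightarrow> (LINT \<omega>|P. (\<Prod>m<Suc M. \<Prod>j<N. g m (X j (t m) \<omega>)))"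
  proof (rule integral_dominated_convergence[where w = "\<lambda>_. \<Prod>m<Suc M. \<Prod>j<N. \<gamma>"])
    show "(\<lambda>\<omega>. \<Prod>m<Suc M. \<Prod>j<N. g m (X j (t m) \<omega>)) \<in> borel_measurable P"
      using t0 Xm gm by (intro borel_measurable_prod measurable_compose[OF Xm gm]) auto
    show "(\<lambda>\<omega>. \<Prod>m<Suc M. \<Prod>j<N. G l m (X j (t m) \<omega>)) \<in> borel_measurable P" for l
      using t0 Xm Gm by (intro borel_measurable_prod measurable_compose[OF Xm Gm]) auto
    show "AE \<omega> in P. (\<lambda>l. \<Prod>m<Suc M. \<Prod>j<N. G l m (X j (t m) \<omega>)) \<longlonglongrightarrow> (\<Prod>m<Suc M. \<Prod>j<N. g m (X j (t m) \<omega>))"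
      using Glim by (intro AE_I2 tendsto_prod) auto
    show "AE \<omega> in P. norm (\<Prod>m\<in>{..<Suc M}. \<Prod>j<N. G l m (X j (t m) \<omega>)) \<le> (\<Prod>m<Suc M. \<Prod>j<N. \<gamma>)" for l
      unfolding real_norm_def abs_prod using Gb
      by (intro AE_I2 prod_mono conjI prod_nonneg) auto
  qed (simp del: prod.lessThan_Suc prod_constant)
  moreover have "(LINT \<omega>|P. (\<Prod>m<Suc M. \<Prod>j<N. G l m (X j (t m) \<omega>)))
      = fdet N (\<lambda>j v. backward t (G l) M (\<lambda>x. G l M x * poly (p v) x) (u j))" for l
    using Gb Gl \<gamma> by (intro noncolliding_lipschitz_formula[OF P N nBM u p t, where l = "real l"]) auto
  moreover have "(\<lambda>l. fdet N (\<lambda>j v. backward t (G l) M (\<lambda>x. G l M x * poly (p v) x) (u j)))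
      \<longlonglongrightarrow> fdet N (\<lambda>j v. backward t g M (\<lambda>x. g M x * poly (p v) x) (u j))"
    unfolding fdet_leibniz
  proof (intro tendsto_sum tendsto_mult tendsto_const tendsto_prod)
    fix q :: "nat \<Rightarrow> nat" and j :: nat
    let ?q = "poly (p (q j))"
    have "\<exists>C. cosh_bounded C ?q" using poly_cosh_bounded by blast
    then obtain C where C: "cosh_bounded C ?q" ..
    show "(\<lambda>l. backward t (G l) M (\<lambda>x. G l M x * ?q x) (u j)) \<longlonglongrightarrow> backward t g M (\<lambda>x. g M x * ?q x) (u j)"
    proof (rule backward_tendsto[OF t, where \<gamma> = \<gamma>])
      show "cosh_bounded (\<gamma> * C) (\<lambda>x. G l M x * ?q x)" for l
        unfolding cosh_bounded_def
      proof (intro conjI allI)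
        show "(\<lambda>x. G l M x * ?q x) \<in> borel_measurable borel"
          using Gm[of M] cosh_boundedD(1)[OF C] by simp
        show "\<bar>G l M x * ?q x\<bar> \<le> \<gamma> * C * cosh x" for x
          unfolding abs_mult mult.assoc using Gb[of M] cosh_boundedD(2)[OF C] \<gamma> by (intro mult_mono) auto
      qed
      show "(\<lambda>l. G l M x * ?q x) \<longlonglongrightarrow> g M x * ?q x" for x
        using Glim[of M] by (intro tendsto_mult tendsto_const) auto
    qed (use Gb Gm Glim in auto)
  qed
  ultimately show ?thesis using LIMSEQ_unique by (simp only:) blast
qed

section \<open>The martingale polynomials\<close>

text \<open>The function \<open>Phi\<close> of the initial configuration at the node
  \<open>u v\<close>, as a real polynomial.\<close>

definition lagrange_basis :: "nat \<Rightarrow> (nat \<Rightarrow> real) \<Rightarrow> nat \<Rightarrow> real poly" where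
  "lagrange_basis N u v = (\<Prod>l\<in>{..<N} - {v}. Polynomial.smult (1 / (u v - u l)) [:- u l, 1:])"

text \<open>Replacing powers by Hermite polynomials of time \<open>t\<close> applies the backward
  heat flow. The family is thus harmonic in space-time and starts from the Lagrange basis.\<close>

definition mart_poly :: "nat \<Rightarrow> (nat \<Rightarrow> real) \<Rightarrow> real \<Rightarrow> nat \<Rightarrow> real poly" where
  "mart_poly N u t v = (\<Sum>i<N. Polynomial.smult (Polynomial.coeff (lagrange_basis N u v) i) (hermite t i))"

lemma degree_lagrange_basis:
  assumes "v < N"
  shows "degree (lagrange_basis N u v) < N"
proof -
  have "degree (lagrange_basis N u v) \<le> sum (degree \<circ> (\<lambda>l. Polynomial.smult (1 / (u v - u l)) [:- u l, 1:])) ({..<N} - {v})"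
    unfolding lagrange_basis_def by (rule degree_prod_sum_le) simp
  also have "\<dots> \<le> (\<Sum>l\<in>{..<N} - {v}. 1)"
    by (intro sum_mono) (simp add: degree_smult_le)
  finally show ?thesis using assms by simp
qed

lemma lagrange_basis_node:
  assumes "inj_on u {..<N}" "v < N" "w < N"
  shows "poly (lagrange_basis N u v) (u w) = (if w = v then 1 else 0)"
proof (cases "w = v")
  case True
  have "u v \<noteq> u l" if "l \<in> {..<N} - {v}" for l using assms that by (auto simp: inj_on_def)
  then show ?thesis using True unfolding lagrange_basis_def poly_prod
    by (simp, intro prod.neutral ballI) (simp flip: diff_divide_distrib)
next
  case False
  then have "w \<in> {..<N} - {v}" using assms by simp
  then have "poly (lagrange_basis N u v) (u w) = 0" unfolding lagrange_basis_def poly_prod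
    by (intro prod_zero bexI[of _ w]) auto
  then show ?thesis using False by simp
qed

lemma poly_mart_poly:
  "poly (mart_poly N u t v) y = (\<Sum>i<N. poly (hermite t i) y * Polynomial.coeff (lagrange_basis N u v) i)"
  by (simp add: mart_poly_def poly_sum mult.commute)

lemma poly_eq_sum_less:
  fixes p :: "'a::comm_semiring_1 poly"
  assumes "degree p < N"
  shows "poly p x = (\<Sum>i<N. Polynomial.coeff p i * x ^ i)"
  unfolding poly_altdef using assms by (intro sum.mono_neutral_left) (auto simp: coeff_eq_0 not_le)

lemma mart_poly_0:
  assumes "v < N"
  shows "mart_poly N u 0 v = lagrange_basis N u v"
  by (rule poly_ext)
    (simp add: poly_mart_poly hermite_0 poly_monom poly_eq_sum_less[OF degree_lagrange_basis[OF assms]] mult.commute)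

text \<open>The coefficient matrix does not depend on the time, so its determinant can be read off
  at time 0 and at the nodes, where the Lagrange basis gives the identity matrix.\<close>

lemma fdet_mart_poly:
  assumes "vandermonde N u \<noteq> 0"
  shows "fdet N (\<lambda>j v. poly (mart_poly N u t v) (y j)) = vandermonde N y / vandermonde N u"
proof -
  let ?c = "fdet N (\<lambda>i v. Polynomial.coeff (lagrange_basis N u v) i)"
  have *: "fdet N (\<lambda>j v. poly (mart_poly N u s v) (z j)) = vandermonde N z * ?c" for s z
    unfolding poly_mart_poly fdet_mult fdet_hermite ..
  have inj: "inj_on u {..<N}" using assms by (simp add: vandermonde_eq_0_iff)
  have "fdet N (\<lambda>j v. poly (mart_poly N u 0 v) (u j)) = fdet N (\<lambda>i j. if i = j then 1 else 0)"
    by (rule fdet_cong) (simp add: mart_poly_0 lagrange_basis_node[OF inj])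
  then have "vandermonde N u * ?c = 1" unfolding * by (simp add: fdet_identity)
  then show ?thesis using assms unfolding * by (simp add: field_simps)
qed

lemma heat_sum:
  assumes "finite I" "\<And>i. i \<in> I \<Longrightarrow> \<exists>C. cosh_bounded C (f i)" "\<tau> > 0"
  shows "heat \<tau> (\<lambda>x. \<Sum>i\<in>I. f i x) x = (\<Sum>i\<in>I. heat \<tau> (f i) x)"
proof -
  have "integrable lborel (\<lambda>y. normal_density x (sqrt \<tau>) y * f i y)" if i: "i \<in> I" for i
    using assms(2)[OF i] integrable_heat[of _ "f i" "sqrt \<tau>" x] assms(3) by auto
  then show ?thesis unfolding heat_def sum_distrib_left by (rule Bochner_Integration.integral_sum)
qed

lemma heat_mart_poly:
  assumes "\<tau> > 0"
  shows "heat \<tau> (poly (mart_poly N u (t + \<tau>) v)) x = poly (mart_poly N u t v) x"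
proof -
  have "heat \<tau> (poly (mart_poly N u (t + \<tau>) v)) x
      = heat \<tau> (\<lambda>y. \<Sum>i<N. poly (Polynomial.smult (Polynomial.coeff (lagrange_basis N u v) i) (hermite (t + \<tau>) i)) y) x"
    by (rule arg_cong[where f = "\<lambda>f. heat \<tau> f x"]) (simp add: mart_poly_def poly_sum fun_eq_iff)
  also have "\<dots> = (\<Sum>i<N. heat \<tau> (poly (Polynomial.smult (Polynomial.coeff (lagrange_basis N u v) i) (hermite (t + \<tau>) i))) x)"
    using assms by (intro heat_sum poly_cosh_bounded) auto
  also have "\<dots> = (\<Sum>i<N. Polynomial.coeff (lagrange_basis N u v) i * poly (hermite t i) x)"
    using assms heat_hermite[OF assms] by (intro sum.cong refl) (simp add: heat_cmult[where f = "poly _"] poly_smult[abs_def])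
  finally show ?thesis by (simp add: poly_mart_poly mult.commute)
qed

section \<open>The correlation kernel of a finite configuration\<close>

lemma msupp_point_config: "msupp (point_config N u) = u ` {..<N}"
proof -
  have em: "emeasure (point_config N u) S = of_nat (card (u -` S \<inter> {..<N}))" if "S \<in> sets borel" for S
    using that by (simp add: point_config_def emeasure_distr)
  show ?thesis
  proof (intro equalityI subsetI)
    fix r assume r: "r \<in> msupp (point_config N u)"
    show "r \<in> u ` {..<N}"
    proof (rule ccontr)
      assume "r \<notin> u ` {..<N}"
      moreover have op: "open (- (u ` {..<N}))" by (intro open_Compl finite_imp_closed) auto
      ultimately have "emeasure (point_config N u) (- (u ` {..<N})) \<noteq> 0"
        using r by (simp add: msupp_def)
      moreover have "u -` (- (u ` {..<N})) \<inter> {..<N} = {}" by auto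
      ultimately show False using em[of "- (u ` {..<N})"] op by simp
    qed
  next
    fix r assume "r \<in> u ` {..<N}"
    then obtain v where v: "v < N" "r = u v" by auto
    show "r \<in> msupp (point_config N u)"
      unfolding msupp_def
    proof (clarify)
      fix S assume S: "open S" "r \<in> S" "emeasure (point_config N u) S = 0"
      have "v \<in> u -` S \<inter> {..<N}" using v S by auto
      then have "card (u -` S \<inter> {..<N}) \<noteq> 0" by auto
      then show False using em[of S] S by simp
    qed
  qed
qed

lemma poly_map_poly_complex_of_real_mult:
  "poly (map_poly complex_of_real (p * q)) z = poly (map_poly complex_of_real p) z * poly (map_poly complex_of_real q) z"
proof (induction p)
  case (pCons a p)
  have "map_poly complex_of_real (r + s) = map_poly complex_of_real r + map_poly complex_of_real s" for r s
    by (rule poly_eqI) (simp add: coeff_map_poly)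
  then show ?case using pCons.IH by (simp add: map_poly_pCons map_poly_smult algebra_simps)
qed simp

lemma Phi_point_config:
  assumes inj: "inj_on u {..<N}" and v: "v < N"
  shows "Phi (point_config N u) (u v) z
    = (\<Sum>i<N. complex_of_real (Polynomial.coeff (lagrange_basis N u v) i) * z ^ i)"
proof -
  have prod: "poly (map_poly complex_of_real (\<Prod>l\<in>S. Polynomial.smult (a l) [:b l, 1:])) z
      = (\<Prod>l\<in>S. complex_of_real (a l) * (complex_of_real (b l) + z))" for S :: "nat set" and a b
    by (induction S rule: infinite_finite_induct)
      (simp_all add: poly_map_poly_complex_of_real_mult map_poly_smult map_poly_pCons
        distrib_left mult.assoc mult.commute[of z] del: mult_pCons_left mult_smult_left)
  have "u ` {..<N} - {u v} = u ` ({..<N} - {v})" using inj v by (auto simp: inj_on_def)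
  then have "Phi (point_config N u) (u v) z = (\<Prod>l\<in>{..<N} - {v}. (z - complex_of_real (u l)) / complex_of_real (u v - u l))"
    using inj by (simp add: Phi_def msupp_point_config prod.reindex inj_on_diff)
  also have "\<dots> = poly (map_poly complex_of_real (lagrange_basis N u v)) z"
    unfolding lagrange_basis_def prod by (intro prod.cong refl) simp
  also have "\<dots> = (\<Sum>i<N. Polynomial.coeff (map_poly complex_of_real (lagrange_basis N u v)) i * z ^ i)"
    using degree_lagrange_basis[OF v, of u] by (intro poly_eq_sum_less) (simp add: degree_map_poly)
  finally show ?thesis by (simp add: coeff_map_poly)
qed

text \<open>The integral is linear in the coefficients of the Lagrange polynomial, and each power of
  \<open>\<i> * w\<close> integrates to a Hermite polynomial in \<open>y\<close>.\<close>

lemma mart_point_config: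
  assumes inj: "inj_on u {..<N}" and v: "v < N" and t: "t > 0"
  shows "mart (point_config N u) (u v) t y = complex_of_real (poly (mart_poly N u t v) y)"
proof -
  let ?a = "Polynomial.coeff (lagrange_basis N u v)"
  let ?Q = "\<Sum>i<N. Polynomial.smult (complex_of_real (?a i)) ([:0, \<i>:] ^ i)"
  have "Phi (point_config N u) (u v) (\<i> * complex_of_real w) = poly ?Q (complex_of_real w)" for w
    by (simp add: Phi_point_config[OF inj v] poly_sum poly_power mult.commute)
  then have "mart (point_config N u) (u v) t y = cgauss (\<i> * complex_of_real y) t ?Q"
    using t by (simp add: mart_def cgauss_def)
  also have "\<dots> = (\<Sum>i<N. complex_of_real (?a i) * complex_of_real (poly (hermite t i) y))"
    by (simp only: cgauss_sum[OF t] cgauss_smult cgauss_imaginary_power[OF t])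
  finally show ?thesis by (simp add: poly_mart_poly mult.commute)
qed

lemma heat_density_eq_normal_density:
  "t \<ge> 0 \<Longrightarrow> heat_density t y x = normal_density x (sqrt t) y"
  by (simp add: heat_density_def normal_density_def power2_commute)

text \<open>The kernel integrates over \<open>v\<close> against a measure on the whole line, so
  measurability concerns all real \<open>v\<close>. Off the finite support \<open>Phi\<close> splits
  into a factor depending on \<open>z\<close> and a factor depending on \<open>v\<close>; the
  support itself is a countable exception.\<close>

lemma measurable_mart_point_config:
  assumes t: "t > 0"
  shows "(\<lambda>v. complex_of_real (heat_density s x v) * mart (point_config N u) v t y) \<in> borel_measurable borel"
proof -
  let ?S = "u ` {..<N}"
  define c where "c = (LINT w|lborel. complex_of_real (1 / sqrt (2 * pi * t))
          * exp (- ((\<i> * complex_of_real y + complex_of_real w)\<^sup>2 / complex_of_real (2 * t)))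
          * (\<Prod>r\<in>?S. (\<i> * complex_of_real w) - complex_of_real r))"
  have "(\<lambda>v. complex_of_real (heat_density s x v) * (c / (\<Prod>r\<in>?S. complex_of_real (v - r)))) \<in> borel_measurable borel"
    unfolding heat_density_def by measurable
  then show ?thesis
  proof (rule measurable_discrete_difference[where X = ?S])
    fix v assume v: "v \<in> space borel" "v \<notin> ?S"
    have "Phi (point_config N u) v z = (\<Prod>r\<in>?S. z - complex_of_real r) / (\<Prod>r\<in>?S. complex_of_real (v - r))" for z
      using v by (simp add: Phi_def msupp_point_config prod_dividef)
    then show "complex_of_real (heat_density s x v) * (c / (\<Prod>r\<in>?S. complex_of_real (v - r)))
        = complex_of_real (heat_density s x v) * mart (point_config N u) v t y"
      using t by (simp add: mart_def c_def del: of_real_diff of_real_prod)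
  qed (auto intro!: countable_finite)
qed

lemma integral_point_config:
  fixes F :: "real \<Rightarrow> 'b::{banach, second_countable_topology}"
  assumes "F \<in> borel_measurable borel"
  shows "(LINT v|point_config N u. F v) = (\<Sum>v<N. F (u v))"
  unfolding point_config_def using assms
  by (subst integral_distr) (auto simp: lebesgue_integral_count_space_finite)

lemma corr_kernel_point_config:
  assumes inj: "inj_on u {..<N}" and s: "s > 0" and t: "t > 0"
  shows "corr_kernel (point_config N u) s x t y = complex_of_real
    ((\<Sum>v<N. normal_density (u v) (sqrt s) x * poly (mart_poly N u t v) y)
      - (if t < s then normal_density y (sqrt (s - t)) x else 0))"
  using s unfolding corr_kernel_def integral_point_config[OF measurable_mart_point_config[OF t]]
  by (simp add: mart_point_config[OF inj _ t] heat_density_eq_normal_density)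

section \<open>Bordered determinants and the integration of points, last time first\<close>

section \<open>Bordered determinants\<close>

text \<open>The cofactors along row \<open>v\<close> do not involve row \<open>v\<close>, so one
  coefficient vector serves all rows that may be put there. Sums and integrals over that row can
  then be taken inside the determinant.\<close>

lemma fdet_row_expansion:
  fixes f :: "nat \<Rightarrow> nat \<Rightarrow> 'b::comm_ring_1"
  assumes "v < n"
  shows "\<exists>c. \<forall>r. fdet n (\<lambda>a b. if a = v then r b else f a b) = (\<Sum>b<n. r b * c b)"
proof -
  let ?A = "\<lambda>r. Matrix.mat n n (\<lambda>(a, b). if a = v then r b else f a b)"
  define c where "c b = cofactor (?A (\<lambda>_. 0)) v b" for b
  have cof: "cofactor (?A r) v j = c j" if "j < n" for r j
  proof -
    have "mat_delete (?A r) v j = mat_delete (?A (\<lambda>_. 0)) v j"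
      unfolding mat_delete_def using that by (intro eq_matI) auto
    then show ?thesis unfolding c_def cofactor_def by (rule arg_cong)
  qed
  have "fdet n (\<lambda>a b. if a = v then r b else f a b) = (\<Sum>b<n. r b * cofactor (?A r) v b)" for r
    unfolding fdet_def using assms by (subst laplace_expansion_row[of _ n v]) auto
  then show ?thesis by (intro exI[of _ c]) (simp add: cof del: index_mat)
qed

lemma fdet_lower_left_zero:
  fixes f :: "nat \<Rightarrow> nat \<Rightarrow> 'b::idom"
  assumes "\<And>a b. a < m \<Longrightarrow> b < n \<Longrightarrow> f (n + a) b = 0"
  shows "fdet (n + m) f = fdet n f * fdet m (\<lambda>a b. f (n + a) (n + b))"
proof -
  let ?M = "four_block_mat (Matrix.mat n n (\<lambda>(a, b). f a b)) (Matrix.mat n m (\<lambda>(a, b). f a (n + b)))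
    (0\<^sub>m m n) (Matrix.mat m m (\<lambda>(a, b). f (n + a) (n + b)))"
  have "Matrix.mat (n + m) (n + m) (\<lambda>(a, b). f a b) = ?M"
  proof (rule eq_matI)
    fix i j assume "i < dim_row ?M" "j < dim_col ?M"
    then show "Matrix.mat (n + m) (n + m) (\<lambda>(a, b). f a b) $$ (i, j) = ?M $$ (i, j)"
      using assms[of "i - n" j] by auto
  qed auto
  then show ?thesis unfolding fdet_def
    by (simp only:) (intro det_four_block_mat_lower_left_zero, auto)
qed

text \<open>Expansion along the last column, which is supported on the first \<open>N\<close> rows.
  In the term of row \<open>v\<close> the last row takes the vacant place; this exchange of two rows
  accounts for the sign.\<close>

lemma fdet_single_point:
  fixes f :: "nat \<Rightarrow> nat \<Rightarrow> 'b::idom"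
  assumes "N \<le> n" "\<And>a. N \<le> a \<Longrightarrow> a \<le> n \<Longrightarrow> f a n = 0"
  shows "fdet (Suc n) f = - (\<Sum>v<N. f v n * fdet n (\<lambda>a b. if a = v then f n b else f a b))"
proof -
  obtain c where c: "\<And>r. fdet (Suc n) (\<lambda>a b. if a = n then r b else f b a) = (\<Sum>b<Suc n. r b * c b)"
    using fdet_row_expansion[of n "Suc n" "\<lambda>a b. f b a"] by auto
  have exp: "fdet (Suc n) (\<lambda>a b. if b = n then r a else f a b) = (\<Sum>b<Suc n. r b * c b)" for r
    using fdet_transpose[of "Suc n" "\<lambda>a b. if a = n then r b else f b a"] c by simp
  have "fdet (Suc n) f = fdet (Suc n) (\<lambda>a b. if b = n then f a n else f a b)"
    by (rule fdet_cong) auto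
  also have "\<dots> = (\<Sum>v<Suc n. f v n * c v)" by (rule exp)
  also have "\<dots> = (\<Sum>v<N. f v n * c v)"
    using assms by (intro sum.mono_neutral_right) (auto simp: not_less)
  also have "\<dots> = (\<Sum>v<N. f v n * - fdet n (\<lambda>a b. if a = v then f n b else f a b))"
  proof (intro sum.cong refl arg_cong2[where f = "(*)"])
    fix v assume "v \<in> {..<N}"
    then have v: "v < n" using assms(1) by simp
    \<comment> \<open>The coefficient \<open>c v\<close> is the determinant with a unit vector as
      last column. Exchanging rows \<open>v\<close> and \<open>n\<close> moves its 1 into the
      corner, where the determinant splits.\<close>
    let ?e = "\<lambda>a b. if b = n then (if a = v then 1 else 0) else f a b" and ?p = "Transposition.transpose v n"
    have p: "?p permutes {..<Suc n}" using v by (intro permutes_swap_id) auto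
    have "c v = (\<Sum>b<Suc n. (if b = v then 1 else 0) * c b)"
      using v by (simp add: if_distrib[of "\<lambda>x. x * _"] cong: if_cong)
    also have "\<dots> = fdet (Suc n) ?e" by (rule exp[symmetric])
    finally have "c v = fdet (Suc n) ?e" .
    then have "- c v = fdet (Suc n) (\<lambda>a. ?e (?p a))"
      using fdet_permute_rows[OF p, of ?e] v by (simp add: sign_swap_id)
    also have "\<dots> = fdet (n + 1) (\<lambda>a b. ?e (?p b) a)"
      using fdet_transpose[of "Suc n" "\<lambda>a b. ?e (?p b) a"] by simp
    also have "\<dots> = fdet n (\<lambda>a b. ?e (?p b) a) * fdet 1 (\<lambda>a b. ?e (?p (n + b)) (n + a))"
      using v by (intro fdet_lower_left_zero) (auto simp: Transposition.transpose_def)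
    also have "fdet 1 (\<lambda>a b. ?e (?p (n + b)) (n + a)) = 1"
      using v by (subst fdet_upper_triangular) auto
    also have "fdet n (\<lambda>a b. ?e (?p b) a) = fdet n (\<lambda>a b. ?e (?p a) b)" by (rule fdet_transpose)
    also have "\<dots> = fdet n (\<lambda>a b. if a = v then f n b else f a b)"
      using v by (intro fdet_cong) (auto simp: Transposition.transpose_def)
    finally have "- c v = fdet n (\<lambda>a b. if a = v then f n b else f a b)" by (simp only: mult_1_right)
    then show "c v = - fdet n (\<lambda>a b. if a = v then f n b else f a b)" by (metis minus_minus)
  qed
  finally show ?thesis by (simp add: sum_negf)
qed

lemma fdet_add_rows:
  fixes f g :: "nat \<Rightarrow> nat \<Rightarrow> 'b::comm_ring_1"
  assumes "S \<subseteq> {..<n}"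
  shows "fdet n (\<lambda>a b. if a \<in> S then f a b + g a b else f a b)
    = (\<Sum>K\<in>Pow S. fdet n (\<lambda>a b. if a \<in> K then g a b else f a b))"
  using finite_subset[OF assms finite_lessThan] assms
proof (induction S arbitrary: f rule: finite_induct)
  case (insert v S)
  have v: "v < n" using insert.prems by simp
  let ?F = "\<lambda>r a b. if a = v then r b else if a \<in> S then f a b + g a b else f a b"
  obtain c where c: "\<And>r. fdet n (?F r) = (\<Sum>b<n. r b * c b)"
    using fdet_row_expansion[OF v, of "\<lambda>a b. if a \<in> S then f a b + g a b else f a b"] by blast
  have "fdet n (\<lambda>a b. if a \<in> insert v S then f a b + g a b else f a b) = fdet n (?F (\<lambda>b. f v b + g v b))"
    by (rule fdet_cong) auto
  also have "\<dots> = fdet n (?F (f v)) + fdet n (?F (g v))"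
    unfolding c by (simp add: distrib_right sum.distrib)
  also have "fdet n (?F (f v)) = fdet n (\<lambda>a b. if a \<in> S then f a b + g a b else f a b)"
    using insert.hyps by (intro fdet_cong) auto
  also have "\<dots> = (\<Sum>K\<in>Pow S. fdet n (\<lambda>a b. if a \<in> K then g a b else f a b))"
    using insert.prems by (intro insert.IH) auto
  also have "fdet n (?F (g v)) = fdet n (\<lambda>a b. if a \<in> S then (if a = v then g v b else f a b) + g a b
      else (if a = v then g v b else f a b))"
    using insert.hyps by (intro fdet_cong) auto
  also have "\<dots> = (\<Sum>K\<in>Pow S. fdet n (\<lambda>a b. if a \<in> K then g a b else (if a = v then g v b else f a b)))"
    using insert.prems by (intro insert.IH[of "\<lambda>a b. if a = v then g v b else f a b"]) auto
  also have "\<dots> = (\<Sum>K\<in>insert v ` Pow S. fdet n (\<lambda>a b. if a \<in> K then g a b else f a b))"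
  proof (subst sum.reindex)
    show "inj_on (insert v) (Pow S)" using insert.hyps by (auto simp: inj_on_def)
    show "(\<Sum>K\<in>Pow S. fdet n (\<lambda>a b. if a \<in> K then g a b else (if a = v then g v b else f a b)))
      = sum ((\<lambda>K. fdet n (\<lambda>a b. if a \<in> K then g a b else f a b)) \<circ> insert v) (Pow S)"
      unfolding comp_def by (intro sum.cong refl fdet_cong) auto
  qed
  finally show ?case
    unfolding Pow_insert using insert.hyps by (subst sum.union_disjoint) auto
qed (simp cong: if_cong)

lemma abs_fdet_le:
  fixes f :: "nat \<Rightarrow> nat \<Rightarrow> real"
  assumes "\<And>a b. a < n \<Longrightarrow> b < n \<Longrightarrow> \<bar>f a b\<bar> \<le> C"
  shows "\<bar>fdet n f\<bar> \<le> fact n * C ^ n"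
proof -
  have "\<bar>fdet n f\<bar> \<le> (\<Sum>p | p permutes {..<n}. \<bar>of_int (sign p) * (\<Prod>i<n. f i (p i))\<bar>)"
    unfolding fdet_leibniz by (rule sum_abs)
  also have "\<dots> \<le> (\<Sum>p | p permutes {..<n}. C ^ n)"
  proof (rule sum_mono)
    fix p assume "p \<in> {p. p permutes {..<n}}"
    then have "p i < n" if "i < n" for i using permutes_in_image[of p "{..<n}" i] that by auto
    then have "\<bar>\<Prod>i<n. f i (p i)\<bar> \<le> (\<Prod>i<n. C)"
      unfolding abs_prod using assms by (intro prod_mono) auto
    then show "\<bar>of_int (sign p) * (\<Prod>i<n. f i (p i))\<bar> \<le> C ^ n"
      by (simp add: abs_mult sign_def)
  qed
  also have "\<dots> = fact n * C ^ n" using card_permutations[of "{..<n}" n] by simp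
  finally show ?thesis .
qed

section \<open>The augmented determinant of a list of space-time points\<close>

text \<open>Rows and columns $0, \dots, N-1$ stand for the starting points \<open>u\<close>, which form level 0; the
  point labelled \<open>i\<close> is at level \<open>Suc (fst i)\<close>.\<close>

definition entry_level :: "nat \<Rightarrow> (nat \<times> nat) list \<Rightarrow> nat \<Rightarrow> nat" where
  "entry_level N L b = (if b < N then 0 else Suc (fst (L ! (b - N))))"

definition entry_pos :: "nat \<Rightarrow> (nat \<Rightarrow> real) \<Rightarrow> (nat \<times> nat) list \<Rightarrow> (nat \<times> nat \<Rightarrow> real) \<Rightarrow> nat \<Rightarrow> real" where
  "entry_pos N u L x b = (if b < N then u b else x (L ! (b - N)))"

text \<open>The sign of the lower rows is such that clearing their first \<open>N\<close> columns
  with the upper rows leaves a sum of products of \<open>q\<close> and \<open>\<Lambda>\<close>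
  minus \<open>q\<close>, which is the shape of the correlation kernel.\<close>

definition augmented :: "nat \<Rightarrow> (nat \<Rightarrow> real) \<Rightarrow> (nat \<Rightarrow> real \<Rightarrow> nat \<Rightarrow> real \<Rightarrow> real) \<Rightarrow> (nat \<Rightarrow> nat \<Rightarrow> real \<Rightarrow> real)
    \<Rightarrow> (nat \<times> nat) list \<Rightarrow> (nat \<times> nat \<Rightarrow> real) \<Rightarrow> real" where
  "augmented N u q \<Lambda> L x = fdet (N + length L)
     (\<lambda>a b. if a < N then \<Lambda> a (entry_level N L b) (entry_pos N u L x b)
            else - q (entry_level N L a) (entry_pos N u L x a) (entry_level N L b) (entry_pos N u L x b))"

lemma augmented_cong:
  assumes "\<And>i. i \<in> set L \<Longrightarrow> x i = y i"
  shows "augmented N u q \<Lambda> L x = augmented N u q \<Lambda> L y"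
proof -
  have "entry_pos N u L x b = entry_pos N u L y b" if "b < N + length L" for b
    using assms[of "L ! (b - N)"] that by (simp add: entry_pos_def)
  then show ?thesis unfolding augmented_def by (intro fdet_cong) auto
qed

text \<open>The assumption says that the column of \<open>i\<close> vanishes in the lower rows. The
  minus sign of the lower rows cancels the one from the row exchange, so row \<open>v\<close>
  becomes \<open>q\<close> itself.\<close>

lemma augmented_snoc:
  assumes q: "\<And>j y z. j \<in> set (L @ [i]) \<Longrightarrow> q (Suc (fst j)) y (Suc (fst i)) z = 0"
  shows "augmented N u q \<Lambda> (L @ [i]) x
    = (\<Sum>v<N. \<Lambda> v (Suc (fst i)) (x i) * augmented N u q (\<Lambda>(v := q (Suc (fst i)) (x i))) L x)"
proof -
  let ?n = "N + length L"
  let ?M = "\<lambda>a b. if a < N then \<Lambda> a (entry_level N (L @ [i]) b) (entry_pos N u (L @ [i]) x b)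
    else - q (entry_level N (L @ [i]) a) (entry_pos N u (L @ [i]) x a) (entry_level N (L @ [i]) b) (entry_pos N u (L @ [i]) x b)"
  have last: "entry_level N (L @ [i]) ?n = Suc (fst i)" "entry_pos N u (L @ [i]) x ?n = x i"
    by (simp_all add: entry_level_def entry_pos_def)
  have init: "entry_level N (L @ [i]) b = entry_level N L b" "entry_pos N u (L @ [i]) x b = entry_pos N u L x b"
    if "b < ?n" for b
    using that by (auto simp: entry_level_def entry_pos_def nth_append)
  have "augmented N u q \<Lambda> (L @ [i]) x = fdet (Suc ?n) ?M" by (simp add: augmented_def)
  also have "\<dots> = - (\<Sum>v<N. ?M v ?n * fdet ?n (\<lambda>a b. if a = v then ?M ?n b else ?M a b))"
  proof (rule fdet_single_point)
    fix a assume "N \<le> a" "a \<le> ?n"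
    then have "(L @ [i]) ! (a - N) \<in> set (L @ [i])" by (intro nth_mem) auto
    from q[OF this] show "?M a ?n = 0" unfolding last
      using \<open>N \<le> a\<close> by (simp add: entry_level_def del: append_assoc)
  qed simp
  also have "\<dots> = - (\<Sum>v<N. \<Lambda> v (Suc (fst i)) (x i) * - augmented N u q (\<Lambda>(v := q (Suc (fst i)) (x i))) L x)"
  proof (rule arg_cong[where f = uminus], intro sum.cong refl arg_cong2[where f = "(*)"])
    fix v assume v: "v \<in> {..<N}"
    then show "?M v ?n = \<Lambda> v (Suc (fst i)) (x i)" by (simp only: last lessThan_iff if_True)
    let ?g = "\<lambda>a b. if a < N then (\<Lambda>(v := q (Suc (fst i)) (x i))) a (entry_level N L b) (entry_pos N u L x b)
            else - q (entry_level N L a) (entry_pos N u L x a) (entry_level N L b) (entry_pos N u L x b)"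
    have "fdet ?n (\<lambda>a b. if a = v then ?M ?n b else ?M a b) = fdet ?n (\<lambda>a b. (if a = v then -1 else 1) * ?g a b)"
      using v last init by (intro fdet_cong) auto
    also have "\<dots> = (\<Prod>a<?n. if a = v then -1 else 1) * fdet ?n ?g" by (rule fdet_scale_rows)
    also have "(\<Prod>a<?n. if a = v then -1 else (1::real)) = -1" using v by simp
    finally show "fdet ?n (\<lambda>a b. if a = v then ?M ?n b else ?M a b) = - augmented N u q (\<Lambda>(v := q (Suc (fst i)) (x i))) L x"
      by (simp add: augmented_def)
  qed
  finally show ?thesis by (simp add: sum_negf)
qed

lemma augmented_row_expansion:
  assumes "v < N"
  shows "\<exists>c. \<forall>r. augmented N u q (\<Lambda>(v := r)) L x
    = (\<Sum>b<N + length L. r (entry_level N L b) (entry_pos N u L x b) * c b)"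
proof -
  obtain c where c: "\<And>r. fdet (N + length L) (\<lambda>a b. if a = v then r b else
      if a < N then \<Lambda> a (entry_level N L b) (entry_pos N u L x b)
      else - q (entry_level N L a) (entry_pos N u L x a) (entry_level N L b) (entry_pos N u L x b))
      = (\<Sum>b<N + length L. r b * c b)"
    using fdet_row_expansion[of v "N + length L" "\<lambda>a b. if a < N then \<Lambda> a (entry_level N L b) (entry_pos N u L x b)
      else - q (entry_level N L a) (entry_pos N u L x a) (entry_level N L b) (entry_pos N u L x b)"] assms by auto
  have "augmented N u q (\<Lambda>(v := r)) L x = (\<Sum>b<N + length L. r (entry_level N L b) (entry_pos N u L x b) * c b)" for r
    unfolding c[symmetric] augmented_def using assms by (intro fdet_cong) auto
  then show ?thesis by blast
qed

lemma augmented_add: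
  "augmented N u q (\<lambda>v l y. \<Lambda> v l y + U v l y) L x
    = (\<Sum>K\<in>Pow {..<N}. augmented N u q (\<lambda>v. if v \<in> K then U v else \<Lambda> v) L x)"
proof -
  let ?f = "\<lambda>a b. if a < N then \<Lambda> a (entry_level N L b) (entry_pos N u L x b)
      else - q (entry_level N L a) (entry_pos N u L x a) (entry_level N L b) (entry_pos N u L x b)"
  let ?g = "\<lambda>a b. U a (entry_level N L b) (entry_pos N u L x b)"
  have "augmented N u q (\<lambda>v l y. \<Lambda> v l y + U v l y) L x
      = fdet (N + length L) (\<lambda>a b. if a \<in> {..<N} then ?f a b + ?g a b else ?f a b)"
    unfolding augmented_def by (intro fdet_cong) auto
  also have "\<dots> = (\<Sum>K\<in>Pow {..<N}. fdet (N + length L) (\<lambda>a b. if a \<in> K then ?g a b else ?f a b))"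
    by (intro fdet_add_rows) auto
  also have "\<dots> = (\<Sum>K\<in>Pow {..<N}. augmented N u q (\<lambda>v. if v \<in> K then U v else \<Lambda> v) L x)"
    unfolding augmented_def by (intro sum.cong fdet_cong refl) auto
  finally show ?thesis .
qed

lemma augmented_zero_row:
  assumes "v < N" "\<And>l y. \<Lambda> v l y = 0"
  shows "augmented N u q \<Lambda> L x = 0"
proof -
  have "augmented N u q (\<Lambda>(v := \<lambda>_ _. 0)) L x = 0"
    using augmented_row_expansion[OF assms(1), of u q \<Lambda> L x] by auto
  moreover have "\<Lambda>(v := \<lambda>_ _. 0) = \<Lambda>" using assms(2) by (auto simp: fun_eq_iff)
  ultimately show ?thesis by simp
qed

text \<open>The upper left block is the identity matrix, and the matrix on the right is its Schur complement.\<close>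

lemma augmented_eq_fdet_kernel:
  assumes \<Lambda>: "\<And>v w. v < N \<Longrightarrow> w < N \<Longrightarrow> \<Lambda> v 0 (u w) = (if v = w then 1 else 0)"
  shows "augmented N u q \<Lambda> L x = fdet (length L) (\<lambda>a b.
    (\<Sum>v<N. q (Suc (fst (L ! a))) (x (L ! a)) 0 (u v) * \<Lambda> v (Suc (fst (L ! b))) (x (L ! b)))
      - q (Suc (fst (L ! a))) (x (L ! a)) (Suc (fst (L ! b))) (x (L ! b)))"
    (is "_ = fdet _ ?K")
proof -
  let ?n = "N + length L" and ?l = "entry_level N L" and ?p = "entry_pos N u L x"
  let ?M = "\<lambda>a b. if a < N then \<Lambda> a (?l b) (?p b) else - q (?l a) (?p a) (?l b) (?p b)"
  \<comment> \<open>The matrix is the product of the unit lower triangular \<open>?P\<close> and the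
    block triangular \<open>?R\<close>, whose diagonal blocks are the identity and the
    kernel.\<close>
  let ?P = "\<lambda>a k. (if a = k then 1 else 0) - (if N \<le> a \<and> k < N then q (?l a) (?p a) 0 (u k) else 0)"
  let ?R = "\<lambda>k b. if k < N then \<Lambda> k (?l b) (?p b) else if b < N then 0 else ?K (k - N) (b - N)"
  have "augmented N u q \<Lambda> L x = fdet ?n ?M" by (simp add: augmented_def)
  also have "\<dots> = fdet ?n (\<lambda>a b. \<Sum>k<?n. ?P a k * ?R k b)"
  proof (rule fdet_cong)
    fix a b assume a: "a < ?n" and b: "b < ?n"
    have "(\<Sum>k<?n. ?P a k * ?R k b) = (\<Sum>k<?n. (if a = k then ?R k b else 0))
        - (\<Sum>k<?n. (if N \<le> a \<and> k < N then q (?l a) (?p a) 0 (u k) * ?R k b else 0))"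
      unfolding sum_subtractf[symmetric] by (intro sum.cong refl) auto
    also have "(\<Sum>k<?n. (if a = k then ?R k b else 0)) = ?R a b"
      using a by (subst sum.delta') auto
    also have "(\<Sum>k<?n. (if N \<le> a \<and> k < N then q (?l a) (?p a) 0 (u k) * ?R k b else 0))
        = (if N \<le> a then (\<Sum>k<N. q (?l a) (?p a) 0 (u k) * \<Lambda> k (?l b) (?p b)) else 0)"
    proof (cases "N \<le> a")
      case True
      then have "(\<Sum>k<?n. (if N \<le> a \<and> k < N then q (?l a) (?p a) 0 (u k) * ?R k b else 0))
        = (\<Sum>k<N. (if N \<le> a \<and> k < N then q (?l a) (?p a) 0 (u k) * ?R k b else 0))"
        by (intro sum.mono_neutral_right) auto
      then show ?thesis using True by simp
    qed simp
    finally have 1: "(\<Sum>k<?n. ?P a k * ?R k b) = ?R a b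
      - (if N \<le> a then (\<Sum>k<N. q (?l a) (?p a) 0 (u k) * \<Lambda> k (?l b) (?p b)) else 0)" .
    show "?M a b = (\<Sum>k<?n. ?P a k * ?R k b)"
    proof (cases "a < N")
      case False
      show ?thesis
      proof (cases "b < N")
        case True
        then have lb: "?l b = 0" "?p b = u b" by (simp_all add: entry_level_def entry_pos_def)
        have "(\<Sum>k<N. q (?l a) (?p a) 0 (u k) * \<Lambda> k (?l b) (?p b)) = (\<Sum>k<N. if k = b then q (?l a) (?p a) 0 (u k) else 0)"
          unfolding lb using True \<Lambda> by (intro sum.cong refl) auto
        then show ?thesis unfolding 1 using True False lb by simp
      next
        case b: False
        with False have "?l a = Suc (fst (L ! (a - N)))" "?p a = x (L ! (a - N))"
          "?l b = Suc (fst (L ! (b - N)))" "?p b = x (L ! (b - N))"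
          by (simp_all add: entry_level_def entry_pos_def)
        then show ?thesis unfolding 1 using False b by simp
      qed
    qed (use 1 in simp)
  qed
  also have "\<dots> = fdet ?n ?P * fdet ?n ?R" by (rule fdet_mult)
  also have "fdet ?n ?P = fdet ?n (\<lambda>a k. ?P k a)" by (rule fdet_transpose[symmetric])
  also have "\<dots> = 1" by (subst fdet_upper_triangular) (auto intro!: prod.neutral)
  also have "fdet ?n ?R = fdet N ?R * fdet (length L) (\<lambda>a b. ?R (N + a) (N + b))"
    by (rule fdet_lower_left_zero) auto
  also have "fdet N ?R = fdet N (\<lambda>i j. if i = j then 1 else 0)"
    using \<Lambda> by (intro fdet_cong) (simp add: entry_level_def entry_pos_def)
  finally show ?thesis by (simp add: fdet_identity)
qed

section \<open>Integrating out the points of the last time\<close>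

text \<open>Double counting of pairs formed by a set of size \<open>k + 1\<close> and one of its
  elements.\<close>

lemma sum_insert_subsets:
  fixes G :: "'b set \<Rightarrow> real"
  assumes S: "finite S"
  shows "(\<Sum>v\<in>S. \<Sum>K | K \<subseteq> S \<and> card K = k \<and> v \<notin> K. G (insert v K))
    = real (Suc k) * (\<Sum>K | K \<subseteq> S \<and> card K = Suc k. G K)"
proof -
  have fin: "finite {K. K \<subseteq> S \<and> P K}" for P
    using S by (intro finite_subset[OF _ finite_Pow_iff[THEN iffD2, OF S]]) auto
  have finK: "finite K" if "K \<subseteq> S" for K using that S finite_subset by blast
  have "(\<Sum>v\<in>S. \<Sum>K | K \<subseteq> S \<and> card K = k \<and> v \<notin> K. G (insert v K))
      = (\<Sum>(v, K)\<in>(SIGMA v:S. {K. K \<subseteq> S \<and> card K = k \<and> v \<notin> K}). G (insert v K))"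
    using S fin by (intro sum.Sigma) auto
  also have "\<dots> = (\<Sum>(K, v)\<in>(SIGMA K:{K. K \<subseteq> S \<and> card K = Suc k}. K). G K)"
    by (rule sum.reindex_bij_witness[where i = "\<lambda>(K, v). (v, K - {v})" and j = "\<lambda>(v, K). (insert v K, v)"])
      (auto simp: finK insert_absorb card_insert_if)
  also have "\<dots> = (\<Sum>K | K \<subseteq> S \<and> card K = Suc k. \<Sum>v\<in>K. G K)"
    using fin finK by (intro sum.Sigma[symmetric]) auto
  also have "\<dots> = real (Suc k) * (\<Sum>K | K \<subseteq> S \<and> card K = Suc k. G K)"
    unfolding sum_distrib_left by (intro sum.cong refl) simp
  finally show ?thesis .
qed

text \<open>The test function \<open>\<eta>\<close> is the paper's $\chi$ (the symbol is a binder in HOL-Analysis), and \<open>q\<close> is the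
  transition density from the second space-time point to the first, zero unless the first is later.\<close>

locale space_time_kernel =
  fixes N :: nat and u :: "nat \<Rightarrow> real" and q :: "nat \<Rightarrow> real \<Rightarrow> nat \<Rightarrow> real \<Rightarrow> real"
    and \<eta> :: "nat \<Rightarrow> real \<Rightarrow> real" and R \<gamma> \<kappa> :: real
  assumes q_measurable: "(\<lambda>(y, z). q l y l' z) \<in> borel_measurable (borel \<Otimes>\<^sub>M borel)"
    and q_bound: "\<bar>q l y l' z\<bar> \<le> \<kappa>"
    and q_zero: "l \<le> l' \<Longrightarrow> q l y l' z = 0"
    and \<eta>_measurable: "\<eta> m \<in> borel_measurable borel"
    and \<eta>_bound: "\<bar>\<eta> m y\<bar> \<le> \<gamma>"
    and \<eta>_support: "\<bar>y\<bar> > R \<Longrightarrow> \<eta> m y = 0"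
    and u_bound: "v < N \<Longrightarrow> \<bar>u v\<bar> \<le> R"
    and R_nonneg: "R \<ge> 0"
begin

text \<open>Rows need a bound on \<open>[- R, R]\<close> only: the test functions vanish outside and
  the starting points lie inside. Polynomial rows could not be bounded on the whole line.\<close>

definition admissible :: "(nat \<Rightarrow> nat \<Rightarrow> real \<Rightarrow> real) \<Rightarrow> bool" where
  "admissible \<Lambda> \<longleftrightarrow> (\<forall>v<N. \<forall>l. \<Lambda> v l \<in> borel_measurable borel)
     \<and> (\<exists>C. \<forall>v<N. \<forall>l y. \<bar>y\<bar> \<le> R \<longrightarrow> \<bar>\<Lambda> v l y\<bar> \<le> C)"

text \<open>What row \<open>v\<close> becomes when a point of level \<open>Suc m\<close> takes its
  place, weighted by the old row at that point, and is integrated against the test function.\<close>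

definition update :: "nat \<Rightarrow> (nat \<Rightarrow> nat \<Rightarrow> real \<Rightarrow> real) \<Rightarrow> nat \<Rightarrow> nat \<Rightarrow> real \<Rightarrow> real" where
  "update m \<Lambda> v l z = (LINT y|lborel. \<eta> m y * \<Lambda> v (Suc m) y * q (Suc m) y l z)"

definition weight :: "(nat \<times> nat) set \<Rightarrow> (nat \<times> nat \<Rightarrow> real) \<Rightarrow> real" where
  "weight I x = (\<Prod>i\<in>I. \<eta> (fst i) (x i))"

lemma \<kappa>_nonneg: "\<kappa> \<ge> 0"
  using q_bound[of 0 0 0 0] by linarith

lemma \<gamma>_nonneg: "\<gamma> \<ge> 0"
  using \<eta>_bound[of 0 0] by linarith

lemma q_measurable_fst [measurable]: "(\<lambda>y. q l y l' z) \<in> borel_measurable borel"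
  using measurable_compose[OF _ q_measurable, of "\<lambda>y. (y, z)" borel l l'] by simp

lemma admissibleD:
  assumes "admissible \<Lambda>"
  obtains C where "C \<ge> 0" "\<And>v l y. v < N \<Longrightarrow> \<bar>y\<bar> \<le> R \<Longrightarrow> \<bar>\<Lambda> v l y\<bar> \<le> C"
proof -
  from assms obtain C where "\<And>v l y. v < N \<Longrightarrow> \<bar>y\<bar> \<le> R \<Longrightarrow> \<bar>\<Lambda> v l y\<bar> \<le> C"
    unfolding admissible_def by blast
  then have "\<bar>\<Lambda> v l y\<bar> \<le> \<bar>C\<bar>" if "v < N" "\<bar>y\<bar> \<le> R" for v l y using that by (meson abs_ge_self order_trans)
  then show thesis using that[of "\<bar>C\<bar>"] by simp
qed

lemma integral_interval: "integrable lborel (\<lambda>y. c * indicator {-R..R} y :: real)"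
    "(LINT y|lborel. c * indicator {-R..R} y :: real) = c * (2 * R)"
  using R_nonneg by simp_all

lemma integrable_update:
  assumes "admissible \<Lambda>" "v < N" and f: "f \<in> borel_measurable borel" "\<And>y. \<bar>f y\<bar> \<le> b"
  shows "integrable lborel (\<lambda>y. \<eta> m y * \<Lambda> v l y * f y)"
proof -
  have [measurable]: "\<Lambda> v l \<in> borel_measurable borel" "\<eta> m \<in> borel_measurable borel"
    using assms \<eta>_measurable by (auto simp: admissible_def)
  obtain C where C: "C \<ge> 0" "\<And>v l y. v < N \<Longrightarrow> \<bar>y\<bar> \<le> R \<Longrightarrow> \<bar>\<Lambda> v l y\<bar> \<le> C"
    by (rule admissibleD[OF assms(1)]) blast
  show ?thesis
  proof (rule Bochner_Integration.integrable_bound[OF integral_interval(1)[of "\<gamma> * C * b"]])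
    show "AE y in lborel. norm (\<eta> m y * \<Lambda> v l y * f y) \<le> norm (\<gamma> * C * b * indicator {-R..R} y)"
    proof (rule AE_I2)
      fix y
      show "norm (\<eta> m y * \<Lambda> v l y * f y) \<le> norm (\<gamma> * C * b * indicator {-R..R} y)"
      proof (cases "\<bar>y\<bar> \<le> R")
        case True
        have "\<bar>\<eta> m y\<bar> * \<bar>\<Lambda> v l y\<bar> * \<bar>f y\<bar> \<le> \<gamma> * C * b"
          using True C assms(2) f(2) \<eta>_bound \<gamma>_nonneg by (intro mult_mono) auto
        then have "\<bar>\<eta> m y\<bar> * \<bar>\<Lambda> v l y\<bar> * \<bar>f y\<bar> \<le> \<bar>\<gamma> * C * b\<bar>" by linarith
        then show ?thesis using True by (simp add: abs_mult abs_le_iff)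
      qed (simp add: \<eta>_support)
    qed
  qed (use f in measurable)
qed

lemma admissible_update:
  assumes "admissible \<Lambda>"
  shows "admissible (update m \<Lambda>)"
  unfolding admissible_def
proof (intro conjI allI impI)
  fix v l assume v: "v < N"
  have [measurable]: "\<Lambda> v (Suc m) \<in> borel_measurable borel" "\<eta> m \<in> borel_measurable borel"
    using assms v \<eta>_measurable by (auto simp: admissible_def)
  have [measurable]: "(\<lambda>p. q (Suc m) (snd p) l (fst p)) \<in> borel_measurable (borel \<Otimes>\<^sub>M lborel)"
    using measurable_compose[OF _ q_measurable, of "\<lambda>p. (snd p, fst p)" "borel \<Otimes>\<^sub>M lborel" "Suc m" l] by simp
  show "update m \<Lambda> v l \<in> borel_measurable borel"
    unfolding update_def by (rule lborel.borel_measurable_lebesgue_integral) (simp add: case_prod_beta)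
next
  obtain C where C: "C \<ge> 0" "\<And>v l y. v < N \<Longrightarrow> \<bar>y\<bar> \<le> R \<Longrightarrow> \<bar>\<Lambda> v l y\<bar> \<le> C"
    by (rule admissibleD[OF assms]) blast
  have "\<bar>update m \<Lambda> v l z\<bar> \<le> \<gamma> * C * \<kappa> * (2 * R)" if v: "v < N" for v l z
  proof -
    have "\<bar>update m \<Lambda> v l z\<bar> \<le> (LINT y|lborel. \<bar>\<eta> m y * \<Lambda> v (Suc m) y * q (Suc m) y l z\<bar>)"
      unfolding update_def by (rule integral_abs_bound)
    also have "\<dots> \<le> (LINT y|lborel. \<gamma> * C * \<kappa> * indicator {-R..R} y)"
    proof (rule integral_mono)
      show "integrable lborel (\<lambda>y. \<bar>\<eta> m y * \<Lambda> v (Suc m) y * q (Suc m) y l z\<bar>)"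
        using integrable_update[OF assms v, of "\<lambda>y. q (Suc m) y l z" \<kappa>] q_bound
        by (intro integrable_abs) auto
      fix y :: real
      show "\<bar>\<eta> m y * \<Lambda> v (Suc m) y * q (Suc m) y l z\<bar> \<le> \<gamma> * C * \<kappa> * indicator {-R..R} y"
      proof (cases "\<bar>y\<bar> \<le> R")
        case True
        have "\<bar>\<eta> m y\<bar> * \<bar>\<Lambda> v (Suc m) y\<bar> * \<bar>q (Suc m) y l z\<bar> \<le> \<gamma> * C * \<kappa>"
          using True C v q_bound \<eta>_bound \<gamma>_nonneg by (intro mult_mono) auto
        then show ?thesis using True by (simp add: abs_mult abs_le_iff)
      next
        case False
        then have "y \<notin> {-R..R}" by auto
        then show ?thesis using False by (simp add: \<eta>_support)
      qed
    qed (rule integral_interval)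
    finally show ?thesis by (simp only: integral_interval)
  qed
  then show "\<exists>C. \<forall>v<N. \<forall>l y. \<bar>y\<bar> \<le> R \<longrightarrow> \<bar>update m \<Lambda> v l y\<bar> \<le> C" by blast
qed

lemma admissible_add:
  assumes "admissible \<Lambda>" "admissible U"
  shows "admissible (\<lambda>v l y. \<Lambda> v l y + U v l y)"
proof -
  obtain C where "C \<ge> 0" "\<And>v l y. v < N \<Longrightarrow> \<bar>y\<bar> \<le> R \<Longrightarrow> \<bar>\<Lambda> v l y\<bar> \<le> C" by (rule admissibleD[OF assms(1)]) blast
  moreover obtain D where "D \<ge> 0" "\<And>v l y. v < N \<Longrightarrow> \<bar>y\<bar> \<le> R \<Longrightarrow> \<bar>U v l y\<bar> \<le> D" by (rule admissibleD[OF assms(2)]) blast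
  ultimately have "\<forall>v<N. \<forall>l y. \<bar>y\<bar> \<le> R \<longrightarrow> \<bar>\<Lambda> v l y + U v l y\<bar> \<le> C + D"
    by (meson abs_triangle_ineq add_mono order_trans)
  moreover have "\<Lambda> v l \<in> borel_measurable borel" "U v l \<in> borel_measurable borel" if "v < N" for v l
    using assms that by (auto simp: admissible_def)
  then have "(\<lambda>y. \<Lambda> v l y + U v l y) \<in> borel_measurable borel" if "v < N" for v l
    using that by (intro borel_measurable_add) auto
  ultimately show ?thesis unfolding admissible_def by blast
qed

lemma admissible_if:
  assumes "admissible \<Lambda>" "admissible U"
  shows "admissible (\<lambda>v. if v \<in> K then U v else \<Lambda> v)"
proof -
  obtain C where "C \<ge> 0" "\<And>v l y. v < N \<Longrightarrow> \<bar>y\<bar> \<le> R \<Longrightarrow> \<bar>\<Lambda> v l y\<bar> \<le> C" by (rule admissibleD[OF assms(1)]) blast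
  moreover obtain D where "D \<ge> 0" "\<And>v l y. v < N \<Longrightarrow> \<bar>y\<bar> \<le> R \<Longrightarrow> \<bar>U v l y\<bar> \<le> D" by (rule admissibleD[OF assms(2)]) blast
  ultimately have "\<forall>v<N. \<forall>l y. \<bar>y\<bar> \<le> R \<longrightarrow> \<bar>(if v \<in> K then U v else \<Lambda> v) l y\<bar> \<le> C + D"
    by (auto intro: add_increasing add_increasing2)
  moreover have "\<forall>v<N. \<forall>l. (if v \<in> K then U v else \<Lambda> v) l \<in> borel_measurable borel"
    using assms by (simp add: admissible_def)
  ultimately show ?thesis unfolding admissible_def by blast
qed

lemma admissible_fun_upd:
  assumes "admissible \<Lambda>" "admissible U"
  shows "admissible (\<Lambda>(v := U v))"
  using admissible_if[OF assms, of "{v}"] by (simp add: fun_upd_def cong: if_cong)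

text \<open>The weight vanishes outside a box of finite measure, and on the box the Leibniz formula
  bounds the determinant.\<close>

lemma integrable_weight_augmented:
  assumes \<Lambda>: "admissible \<Lambda>"
  shows "integrable (Pi\<^sub>M (set L) (\<lambda>_. lborel)) (\<lambda>x. weight (set L) x * augmented N u q \<Lambda> L x)"
proof -
  let ?P = "Pi\<^sub>M (set L) (\<lambda>_. lborel) :: (nat \<times> nat \<Rightarrow> real) measure" and ?n = "N + length L"
  obtain C where C: "C \<ge> 0" "\<And>v l y. v < N \<Longrightarrow> \<bar>y\<bar> \<le> R \<Longrightarrow> \<bar>\<Lambda> v l y\<bar> \<le> C"
    by (rule admissibleD[OF \<Lambda>]) blast
  define box where "box = (\<Pi>\<^sub>E i\<in>set L. {-R..R})"
  have box: "box \<in> sets ?P" unfolding box_def by (intro sets_PiM_I_finite) auto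
  have "emeasure ?P box = (\<Prod>i\<in>set L. emeasure lborel {-R..R})"
    unfolding box_def by (rule product_sigma_finite.emeasure_PiM[OF product_sigma_finite_lborel]) auto
  then have fin: "emeasure ?P box < \<infinity>" by (simp add: R_nonneg ennreal_power)
  let ?B = "\<gamma> ^ card (set L) * (fact ?n * (C + \<kappa>) ^ ?n)"
  have pos: "(\<lambda>x. entry_pos N u L x b) \<in> borel_measurable ?P" if "b < ?n" for b
  proof (cases "b < N")
    case False
    then have "L ! (b - N) \<in> set L" using that by (intro nth_mem) auto
    then have "(\<lambda>x. x (L ! (b - N))) \<in> measurable ?P lborel" by (rule measurable_component_singleton)
    then show ?thesis using False by (simp add: entry_pos_def)
  qed (simp add: entry_pos_def)
  have meas: "(\<lambda>x. weight (set L) x * augmented N u q \<Lambda> L x) \<in> borel_measurable ?P"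
  proof (intro borel_measurable_times)
    show "weight (set L) \<in> borel_measurable ?P"
      unfolding weight_def[abs_def]
    proof (rule borel_measurable_prod)
      fix i assume "i \<in> set L"
      then have "(\<lambda>x. x i) \<in> measurable ?P lborel" by (rule measurable_component_singleton)
      then show "(\<lambda>x. \<eta> (fst i) (x i)) \<in> borel_measurable ?P"
        by (rule measurable_compose) (simp add: \<eta>_measurable)
    qed
    show "augmented N u q \<Lambda> L \<in> borel_measurable ?P"
      unfolding augmented_def[abs_def]
    proof (rule measurable_fdet)
      fix a b assume a: "a < ?n" and b: "b < ?n"
      show "(\<lambda>x. if a < N then \<Lambda> a (entry_level N L b) (entry_pos N u L x b)
            else - q (entry_level N L a) (entry_pos N u L x a) (entry_level N L b) (entry_pos N u L x b)) \<in> borel_measurable ?P"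
      proof (cases "a < N")
        case True
        then have "\<Lambda> a (entry_level N L b) \<in> borel_measurable borel" using \<Lambda> by (simp add: admissible_def)
        from measurable_compose[OF pos[OF b] this] show ?thesis using True by simp
      next
        case False
        have "(\<lambda>x. (entry_pos N u L x a, entry_pos N u L x b)) \<in> measurable ?P (borel \<Otimes>\<^sub>M borel)"
          using pos a b by (intro measurable_Pair)
        from measurable_compose[OF this q_measurable] show ?thesis using False by simp
      qed
    qed
  qed
  have bound: "\<bar>weight (set L) x * augmented N u q \<Lambda> L x\<bar> \<le> ?B * indicator box x" if x: "x \<in> space ?P" for x
  proof (cases "x \<in> box")
    case True
    then have R: "\<bar>x i\<bar> \<le> R" if "i \<in> set L" for i
      using that PiE_mem[of x "set L" "\<lambda>_. {-R..R}" i] by (auto simp: box_def)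
    have "\<bar>weight (set L) x\<bar> \<le> (\<Prod>i\<in>set L. \<gamma>)"
      unfolding weight_def abs_prod using \<eta>_bound by (intro prod_mono) auto
    then have w: "\<bar>weight (set L) x\<bar> \<le> \<gamma> ^ card (set L)" by simp
    have pR: "\<bar>entry_pos N u L x b\<bar> \<le> R" if "b < ?n" for b
      using that R[of "L ! (b - N)"] u_bound[of b] by (simp add: entry_pos_def)
    have "\<bar>augmented N u q \<Lambda> L x\<bar> \<le> fact ?n * (C + \<kappa>) ^ ?n"
      unfolding augmented_def using C \<kappa>_nonneg q_bound pR
      by (intro abs_fdet_le) (auto intro: add_increasing add_increasing2)
    with w show ?thesis using True unfolding abs_mult by (simp add: mult_mono \<gamma>_nonneg)
  next
    case False
    have "x \<in> extensional (set L)" using x by (simp add: space_PiM PiE_def)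
    then obtain i where i: "i \<in> set L" "x i \<notin> {-R..R}" using False unfolding box_def PiE_iff by blast
    then have "\<bar>x i\<bar> > R" by auto
    with i(1) have "weight (set L) x = 0" unfolding weight_def by (intro prod_zero bexI[of _ i]) (auto simp: \<eta>_support)
    then show ?thesis using False by simp
  qed
  show ?thesis
  proof (rule Bochner_Integration.integrable_bound)
    show "integrable ?P (\<lambda>x. ?B * indicator box x)" using box fin by simp
    show "AE x in ?P. norm (weight (set L) x * augmented N u q \<Lambda> L x) \<le> norm (?B * indicator box x)"
      by (rule AE_I2) (simp add: order_trans[OF bound])
  qed (rule meas)
qed

text \<open>The determinant is linear in row \<open>v\<close>, so the integral over the point passes
  into that row.\<close>

lemma integral_augmented_row:
  assumes \<Lambda>: "admissible \<Lambda>" and v: "v < N"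
  shows "integrable lborel (\<lambda>y. \<eta> m y * \<Lambda> v (Suc m) y * augmented N u q (\<Lambda>(v := q (Suc m) y)) L x)"
    and "(LINT y|lborel. \<eta> m y * \<Lambda> v (Suc m) y * augmented N u q (\<Lambda>(v := q (Suc m) y)) L x)
      = augmented N u q (\<Lambda>(v := update m \<Lambda> v)) L x"
proof -
  obtain c where c: "\<And>r. augmented N u q (\<Lambda>(v := r)) L x
    = (\<Sum>b<N + length L. r (entry_level N L b) (entry_pos N u L x b) * c b)"
    using augmented_row_expansion[OF v] by blast
  have int: "integrable lborel (\<lambda>y. (\<eta> m y * \<Lambda> v (Suc m) y * q (Suc m) y l z) * c b)" for l z b
    using integrable_update[OF \<Lambda> v, of "\<lambda>y. q (Suc m) y l z" \<kappa> m "Suc m"] q_bound by auto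
  show "integrable lborel (\<lambda>y. \<eta> m y * \<Lambda> v (Suc m) y * augmented N u q (\<Lambda>(v := q (Suc m) y)) L x)"
    unfolding c sum_distrib_left mult.assoc[symmetric] using int by (intro Bochner_Integration.integrable_sum)
  have "(LINT y|lborel. \<eta> m y * \<Lambda> v (Suc m) y * augmented N u q (\<Lambda>(v := q (Suc m) y)) L x)
      = (\<Sum>b<N + length L. (LINT y|lborel. \<eta> m y * \<Lambda> v (Suc m) y * q (Suc m) y (entry_level N L b) (entry_pos N u L x b) * c b))"
    unfolding c sum_distrib_left mult.assoc[symmetric] using int by (intro Bochner_Integration.integral_sum)
  also have "\<dots> = augmented N u q (\<Lambda>(v := update m \<Lambda> v)) L x"
    unfolding c by (simp add: update_def)
  finally show "(LINT y|lborel. \<eta> m y * \<Lambda> v (Suc m) y * augmented N u q (\<Lambda>(v := q (Suc m) y)) L x)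
      = augmented N u q (\<Lambda>(v := update m \<Lambda> v)) L x" .
qed

definition block_integral :: "(nat \<Rightarrow> nat \<Rightarrow> real \<Rightarrow> real) \<Rightarrow> (nat \<times> nat) list \<Rightarrow> real" where
  "block_integral \<Lambda> L = (LINT x|Pi\<^sub>M (set L) (\<lambda>_. lborel). weight (set L) x * augmented N u q \<Lambda> L x)"

text \<open>The column of a point of the last time vanishes outside the rows \<open>v < N\<close>. Expanding along it, the
  row \<open>v\<close> is replaced by the row of the point, and integration turns that row into \<open>update\<close>.\<close>

lemma block_integral_snoc:
  assumes \<Lambda>: "admissible \<Lambda>" and i: "i \<notin> set L" "\<And>j. j \<in> set L \<Longrightarrow> fst j \<le> fst i"
  shows "block_integral \<Lambda> (L @ [i]) = (\<Sum>v<N. block_integral (\<Lambda>(v := update (fst i) \<Lambda> v)) L)"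
proof -
  let ?m = "fst i"
  let ?P = "Pi\<^sub>M (set L) (\<lambda>_. lborel) :: (nat \<times> nat \<Rightarrow> real) measure"
  have "block_integral \<Lambda> (L @ [i]) = (LINT x|?P. (LINT y|lborel. weight (insert i (set L)) (x(i := y)) * augmented N u q \<Lambda> (L @ [i]) (x(i := y))))"
    using product_sigma_finite.product_integral_insert[OF product_sigma_finite_lborel finite_set i(1), of "\<lambda>x. weight (insert i (set L)) x * augmented N u q \<Lambda> (L @ [i]) x"]
      integrable_weight_augmented[OF \<Lambda>, of "L @ [i]"]
    by (simp add: block_integral_def)
  also have "\<dots> = (LINT x|?P. (\<Sum>v<N. weight (set L) x * augmented N u q (\<Lambda>(v := update ?m \<Lambda> v)) L x))"
  proof (intro Bochner_Integration.integral_cong refl)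
    fix x
    have cong: "augmented N u q \<Lambda>' L (x(i := y)) = augmented N u q \<Lambda>' L x" for \<Lambda>' y
      using i(1) by (intro augmented_cong) auto
    have w: "weight (insert i (set L)) (x(i := y)) = weight (set L) x * \<eta> ?m y" for y
    proof -
      have "(\<Prod>j\<in>set L. \<eta> (fst j) ((x(i := y)) j)) = weight (set L) x"
        unfolding weight_def using i(1) by (intro prod.cong) auto
      then show ?thesis using i(1) by (simp add: weight_def)
    qed
    have "augmented N u q \<Lambda> (L @ [i]) (x(i := y))
        = (\<Sum>v<N. \<Lambda> v (Suc ?m) y * augmented N u q (\<Lambda>(v := q (Suc ?m) y)) L x)" for y
      using i by (subst augmented_snoc) (auto simp: q_zero cong)
    then have "(LINT y|lborel. weight (insert i (set L)) (x(i := y)) * augmented N u q \<Lambda> (L @ [i]) (x(i := y)))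
        = (LINT y|lborel. weight (set L) x * (\<Sum>v<N. \<eta> ?m y * \<Lambda> v (Suc ?m) y * augmented N u q (\<Lambda>(v := q (Suc ?m) y)) L x))"
      unfolding w by (simp add: sum_distrib_left mult.assoc)
    also have "\<dots> = weight (set L) x * (\<Sum>v<N. augmented N u q (\<Lambda>(v := update ?m \<Lambda> v)) L x)"
      using integral_augmented_row[OF \<Lambda>] by (simp add: Bochner_Integration.integral_sum)
    finally show "(LINT y|lborel. weight (insert i (set L)) (x(i := y)) * augmented N u q \<Lambda> (L @ [i]) (x(i := y)))
        = (\<Sum>v<N. weight (set L) x * augmented N u q (\<Lambda>(v := update ?m \<Lambda> v)) L x)"
      by (simp add: sum_distrib_left)
  qed
  also have "\<dots> = (\<Sum>v<N. block_integral (\<Lambda>(v := update ?m \<Lambda> v)) L)"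
    unfolding block_integral_def
    by (intro Bochner_Integration.integral_sum integrable_weight_augmented admissible_fun_upd admissible_update \<Lambda>)
  finally show ?thesis .
qed

text \<open>Each point of the block replaces a row. No row is replaced twice, because a replaced row
  vanishes at the level of the block; so the points occupy distinct rows, and every set
  \<open>K\<close> of rows arises in \<open>fact k\<close> orders.\<close>

lemma block_integral_block:
  assumes \<Lambda>: "admissible \<Lambda>" and L: "\<And>j. j \<in> set L \<Longrightarrow> fst j < m"
  shows "block_integral \<Lambda> (L @ map (Pair m) [0..<k])
    = fact k * (\<Sum>K | K \<subseteq> {..<N} \<and> card K = k. block_integral (\<lambda>v. if v \<in> K then update m \<Lambda> v else \<Lambda> v) L)"
  using \<Lambda>
proof (induction k arbitrary: \<Lambda>)
  case 0
  have "{K. K \<subseteq> {..<N} \<and> card K = 0} = {{}}" by (auto dest: finite_subset)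
  then show ?case by simp
next
  case (Suc k)
  let ?G = "\<lambda>K. block_integral (\<lambda>v. if v \<in> K then update m \<Lambda> v else \<Lambda> v) L"
  have "block_integral \<Lambda> (L @ map (Pair m) [0..<Suc k]) = block_integral \<Lambda> ((L @ map (Pair m) [0..<k]) @ [(m, k)])"
    by simp
  also have "\<dots> = (\<Sum>v<N. block_integral (\<Lambda>(v := update m \<Lambda> v)) (L @ map (Pair m) [0..<k]))"
  proof (subst block_integral_snoc[OF Suc.prems])
      show "(m, k) \<notin> set (L @ map (Pair m) [0..<k])" using L[of "(m, k)"] by auto
      show "fst j \<le> fst (m, k)" if "j \<in> set (L @ map (Pair m) [0..<k])" for j
        using that L[of j] by auto
    qed simp
  also have "\<dots> = (\<Sum>v<N. fact k * (\<Sum>K | K \<subseteq> {..<N} \<and> card K = k \<and> v \<notin> K. ?G (insert v K)))"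
  proof (intro sum.cong refl)
    fix v assume "v \<in> {..<N}"
    then have v: "v < N" by simp
    let ?\<Lambda> = "\<Lambda>(v := update m \<Lambda> v)"
    let ?H = "\<lambda>K. block_integral (\<lambda>w. if w \<in> K then update m ?\<Lambda> w else ?\<Lambda> w) L"
    have "block_integral ?\<Lambda> (L @ map (Pair m) [0..<k]) = fact k * (\<Sum>K | K \<subseteq> {..<N} \<and> card K = k. ?H K)"
      by (intro Suc.IH admissible_fun_upd admissible_update Suc.prems)
    also have "(\<Sum>K | K \<subseteq> {..<N} \<and> card K = k. ?H K) = (\<Sum>K | K \<subseteq> {..<N} \<and> card K = k \<and> v \<notin> K. ?G (insert v K))"
    proof (rule sum.mono_neutral_cong_right)
      show "finite {K. K \<subseteq> {..<N} \<and> card K = k}"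
        by (rule finite_subset[of _ "Pow {..<N}"]) auto
      show "\<forall>K\<in>{K. K \<subseteq> {..<N} \<and> card K = k} - {K. K \<subseteq> {..<N} \<and> card K = k \<and> v \<notin> K}. ?H K = 0"
      proof
        fix K assume "K \<in> {K. K \<subseteq> {..<N} \<and> card K = k} - {K. K \<subseteq> {..<N} \<and> card K = k \<and> v \<notin> K}"
        then have K: "v \<in> K" by simp
        \<comment> \<open>After one replacement, row \<open>v\<close> at level \<open>Suc m\<close>
          is an integral of transitions from level \<open>Suc m\<close> to itself, which are
          zero.\<close>
        have "update m ?\<Lambda> v l z = 0" for l z
          by (simp add: update_def[of m ?\<Lambda>] update_def[of m \<Lambda> v "Suc m"] q_zero)
        then have "augmented N u q (\<lambda>w. if w \<in> K then update m ?\<Lambda> w else ?\<Lambda> w) L x = 0" for x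
          using K by (intro augmented_zero_row[OF v]) simp
        then show "?H K = 0" by (simp add: block_integral_def)
      qed
      fix K assume "K \<in> {K. K \<subseteq> {..<N} \<and> card K = k \<and> v \<notin> K}"
      then have "(\<lambda>w. if w \<in> K then update m ?\<Lambda> w else ?\<Lambda> w) = (\<lambda>w. if w \<in> insert v K then update m \<Lambda> w else \<Lambda> w)"
        by (auto simp: fun_eq_iff update_def)
      then show "?H K = ?G (insert v K)" by simp
    qed auto
    finally show "block_integral ?\<Lambda> (L @ map (Pair m) [0..<k])
      = fact k * (\<Sum>K | K \<subseteq> {..<N} \<and> card K = k \<and> v \<notin> K. ?G (insert v K))" .
  qed
  also have "\<dots> = fact (Suc k) * (\<Sum>K | K \<subseteq> {..<N} \<and> card K = Suc k. ?G K)"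
    using sum_insert_subsets[of "{..<N}" ?G k] by (simp add: sum_distrib_left[symmetric] algebra_simps)
  finally show ?case .
qed

text \<open>Summed over the number of points at the last time, the subsets \<open>K\<close> of rows that were replaced
  build up the determinant with rows \<open>\<Lambda> + update \<Lambda>\<close>, by multilinearity.\<close>

primrec final_row :: "nat \<Rightarrow> (nat \<Rightarrow> nat \<Rightarrow> real \<Rightarrow> real) \<Rightarrow> nat \<Rightarrow> real \<Rightarrow> real" where
  "final_row 0 \<Lambda> v = \<Lambda> v 0"
| "final_row (Suc M) \<Lambda> v = final_row M (\<lambda>v l y. \<Lambda> v l y + update M \<Lambda> v l y) v"

text \<open>The division removes the orderings of the points within each time: for the kernel at
  hand, symmetry makes this the integral over the product of Weyl chambers.\<close>

definition term_integral :: "nat \<Rightarrow> (nat \<Rightarrow> nat) \<Rightarrow> (nat \<Rightarrow> nat \<Rightarrow> real \<Rightarrow> real) \<Rightarrow> real" where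
  "term_integral M n \<Lambda> = block_integral \<Lambda> (block_indices M n) / (\<Prod>m<M. fact (n m))"

lemma set_block_indices: "set (block_indices M n) = (SIGMA m:{..<M}. {..<n m})"
  by (auto simp: block_indices_def)

lemma block_indices_Suc: "block_indices (Suc M) n = block_indices M n @ map (Pair M) [0..<n M]"
  by (simp add: block_indices_def)

lemma block_indices_cong: "(\<And>m. m < M \<Longrightarrow> n m = n' m) \<Longrightarrow> block_indices M n = block_indices M n'"
  unfolding block_indices_def by (rule arg_cong[where f = concat]) auto

lemma term_integral_Suc:
  assumes "admissible \<Lambda>"
  shows "term_integral (Suc M) n \<Lambda>
    = (\<Sum>K | K \<subseteq> {..<N} \<and> card K = n M. term_integral M n (\<lambda>v. if v \<in> K then update M \<Lambda> v else \<Lambda> v))"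
proof -
  have "fst j < M" if "j \<in> set (block_indices M n)" for j using that by (auto simp: set_block_indices)
  then have blk: "block_integral \<Lambda> (block_indices M n @ map (Pair M) [0..<n M]) = fact (n M)
      * (\<Sum>K | K \<subseteq> {..<N} \<and> card K = n M. block_integral (\<lambda>v. if v \<in> K then update M \<Lambda> v else \<Lambda> v) (block_indices M n))"
    by (rule block_integral_block[OF assms])
  show ?thesis
    unfolding term_integral_def block_indices_Suc blk sum_divide_distrib[symmetric]
    by (simp add: field_simps)
qed

text \<open>More than \<open>N\<close> points at one time would have to occupy more than
  \<open>N\<close> distinct rows.\<close>

lemma term_integral_eq_0:
  assumes "admissible \<Lambda>" "m < M" "N < n m"
  shows "term_integral M n \<Lambda> = 0"
  using assms
proof (induction M arbitrary: \<Lambda>)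
  case (Suc M)
  show ?case
  proof (cases "m = M")
    case True
    have "card K \<noteq> n M" if "K \<subseteq> {..<N}" for K
      using card_mono[OF finite_lessThan that] Suc.prems(3) True by simp
    then have "{K. K \<subseteq> {..<N} \<and> card K = n M} = {}" by blast
    then show ?thesis unfolding term_integral_Suc[OF Suc.prems(1)] by (simp only: sum.empty)
  next
    case False
    then have "m < M" using Suc.prems(2) by simp
    then show ?thesis unfolding term_integral_Suc[OF Suc.prems(1)]
      by (intro sum.neutral ballI Suc.IH admissible_if admissible_update Suc.prems)
  qed
qed simp

lemma sum_term_integral:
  assumes "admissible \<Lambda>"
  shows "(\<Sum>n\<in>{..<M} \<rightarrow>\<^sub>E {..N}. term_integral M n \<Lambda>) = fdet N (\<lambda>v w. final_row M \<Lambda> v (u w))"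
  using assms
proof (induction M arbitrary: \<Lambda>)
  case 0
  \<comment> \<open>Without points the product space has a single element, and only the rows and
    columns of the starting points remain.\<close>
  have "block_integral \<Lambda> [] = augmented N u q \<Lambda> [] (\<lambda>_. undefined)"
    by (simp add: block_integral_def weight_def PiM_empty lebesgue_integral_count_space_finite)
  also have "\<dots> = fdet N (\<lambda>v w. \<Lambda> v 0 (u w))"
    unfolding augmented_def by (simp, intro fdet_cong) (auto simp: entry_level_def entry_pos_def)
  finally show ?case by (simp add: term_integral_def block_indices_def)
next
  case (Suc M)
  let ?\<Lambda> = "\<lambda>K v. if v \<in> K then update M \<Lambda> v else \<Lambda> v"
  have adm: "admissible (?\<Lambda> K)" for K by (intro admissible_if admissible_update Suc.prems)
  have "(\<Sum>n\<in>{..<Suc M} \<rightarrow>\<^sub>E {..N}. term_integral (Suc M) n \<Lambda>)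
      = (\<Sum>(k, n)\<in>{..N} \<times> ({..<M} \<rightarrow>\<^sub>E {..N}). term_integral (Suc M) (n(M := k)) \<Lambda>)"
    unfolding lessThan_Suc
    by (subst PiE_insert_eq, subst sum.reindex) (auto simp: case_prod_beta intro!: inj_combinator)
  also have "\<dots> = (\<Sum>k\<le>N. \<Sum>n\<in>{..<M} \<rightarrow>\<^sub>E {..N}. term_integral (Suc M) (n(M := k)) \<Lambda>)"
    by (rule sum.cartesian_product[symmetric])
  also have "\<dots> = (\<Sum>n\<in>{..<M} \<rightarrow>\<^sub>E {..N}. \<Sum>k\<le>N. term_integral (Suc M) (n(M := k)) \<Lambda>)"
    by (rule sum.swap)
  also have "\<dots> = (\<Sum>n\<in>{..<M} \<rightarrow>\<^sub>E {..N}. term_integral M n (\<lambda>v l y. \<Lambda> v l y + update M \<Lambda> v l y))"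
  proof (intro sum.cong refl)
    fix n
    have "term_integral M (n(M := k)) \<Lambda>' = term_integral M n \<Lambda>'" for k \<Lambda>'
      using block_indices_cong[of M "n(M := k)" n] by (simp add: term_integral_def)
    then have "(\<Sum>k\<le>N. term_integral (Suc M) (n(M := k)) \<Lambda>)
        = (\<Sum>k\<le>N. \<Sum>K | K \<in> Pow {..<N} \<and> card K = k. term_integral M n (?\<Lambda> K))"
      by (simp add: term_integral_Suc[OF Suc.prems])
    also have "\<dots> = (\<Sum>K\<in>Pow {..<N}. term_integral M n (?\<Lambda> K))"
      using card_mono[of "{..<N}"] by (intro sum.group) auto
    also have "\<dots> = (\<Sum>K\<in>Pow {..<N}. block_integral (?\<Lambda> K) (block_indices M n)) / (\<Prod>m<M. fact (n m))"
      by (simp add: term_integral_def sum_divide_distrib)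
    also have "(\<Sum>K\<in>Pow {..<N}. block_integral (?\<Lambda> K) (block_indices M n))
        = block_integral (\<lambda>v l y. \<Lambda> v l y + update M \<Lambda> v l y) (block_indices M n)"
      unfolding block_integral_def augmented_add sum_distrib_left
      by (rule Bochner_Integration.integral_sum[symmetric]) (rule integrable_weight_augmented[OF adm])
    finally show "(\<Sum>k\<le>N. term_integral (Suc M) (n(M := k)) \<Lambda>)
        = term_integral M n (\<lambda>v l y. \<Lambda> v l y + update M \<Lambda> v l y)"
      by (simp only: term_integral_def)
  qed
  also have "\<dots> = fdet N (\<lambda>v w. final_row (Suc M) \<Lambda> v (u w))"
    using Suc.IH[OF admissible_add[OF Suc.prems admissible_update[OF Suc.prems]], of M] by simp
  finally show ?case .
qed

end

section \<open>Weyl chambers, the Fredholm series of the kernel and the conclusion\<close>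

section \<open>Integrals over Weyl chambers\<close>

text \<open>With the other coordinates fixed, the condition \<open>x i = x j\<close> confines the
  coordinate \<open>i\<close> to a single point.\<close>

lemma AE_PiM_lborel_distinct:
  assumes "finite I" "i \<in> I" "j \<in> I" "i \<noteq> j"
  shows "AE x in Pi\<^sub>M I (\<lambda>_. lborel :: real measure). x i \<noteq> x j"
proof -
  let ?P = "Pi\<^sub>M I (\<lambda>_. lborel :: real measure)" and ?J = "I - {i}"
  let ?S = "{x \<in> space ?P. x i = x j}"
  have I: "insert i ?J = I" using assms by auto
  have S: "?S \<in> sets ?P" using assms by measurable
  have "emeasure ?P ?S = (\<integral>\<^sup>+ x. indicator ?S x \<partial>?P)" using S by simp
  also have "\<dots> = (\<integral>\<^sup>+ x. (\<integral>\<^sup>+ y. indicator ?S (x(i := y)) \<partial>lborel) \<partial>Pi\<^sub>M ?J (\<lambda>_. lborel))"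
    using product_sigma_finite.product_nn_integral_insert[OF product_sigma_finite_lborel, of ?J i "indicator ?S"] assms(1) S
    unfolding I by simp
  also have "\<dots> = (\<integral>\<^sup>+ x. 0 \<partial>Pi\<^sub>M ?J (\<lambda>_. lborel :: real measure))"
  proof (rule nn_integral_cong)
    fix x
    have "(\<integral>\<^sup>+ y. indicator ?S (x(i := y)) \<partial>lborel) \<le> (\<integral>\<^sup>+ y. indicator {x j} y \<partial>lborel)"
      using assms(4) by (intro nn_integral_mono) (auto simp: indicator_def)
    also have "\<dots> = 0" by simp
    finally show "(\<integral>\<^sup>+ y. indicator ?S (x(i := y)) \<partial>lborel) = 0" by simp
  qed
  finally have "?S \<in> null_sets ?P" using S by (simp add: null_sets_def)
  then show ?thesis by (rule AE_I') auto
qed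

text \<open>Two sorting permutations differ by a strictly increasing permutation of
  \<open>{..<n}\<close>, which can only be the identity.\<close>

lemma sorting_permutation_unique:
  fixes y :: "nat \<Rightarrow> real"
  assumes p: "p permutes {..<n}" "strict_mono_on {..<n} (y \<circ> p)"
    and q: "q permutes {..<n}" "strict_mono_on {..<n} (y \<circ> q)"
  shows "p = q"
proof -
  define r where "r = inv_into UNIV p \<circ> q"
  have r: "r permutes {..<n}" unfolding r_def using p(1) q(1) permutes_compose permutes_inv by blast
  have pr: "p (r i) = q i" for i unfolding r_def using p(1) by (simp add: permutes_inverses)
  have rn: "r i < n" if "i < n" for i using permutes_in_image[OF r, of i] that by simp
  have mono: "r i < r j" if "i < j" "j < n" for i j
  proof -
    have "(y \<circ> p) (r i) < (y \<circ> p) (r j)"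
      using strict_mono_onD[OF q(2), of i j] that by (simp add: pr)
    then show ?thesis using strict_mono_on_less[OF p(2), of "r i" "r j"] rn that by simp
  qed
  have "i \<le> r i" if "i < n" for i
    using that
  proof (induction i)
    case (Suc i)
    then show ?case using mono[of i "Suc i"] by simp
  qed simp
  then have "r = id" using permutes_natset_ge[OF r] by simp
  then show ?thesis using pr by (simp add: fun_eq_iff)
qed

lemma measurable_weyl_chambers:
  "{x \<in> space (Pi\<^sub>M (SIGMA m:{..<M}. {..<n m}) (\<lambda>_. lborel)). x \<in> weyl_chambers M n}
    \<in> sets (Pi\<^sub>M (SIGMA m:{..<M}. {..<n m}) (\<lambda>_. lborel))"
proof -
  let ?P = "Pi\<^sub>M (SIGMA m:{..<M}. {..<n m}) (\<lambda>_. lborel) :: (nat \<times> nat \<Rightarrow> real) measure"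
  have "{x \<in> space ?P. \<forall>m\<in>{..<M}. \<forall>k\<in>{..<n m}. \<forall>j\<in>{..<k}. x (m, j) < x (m, k)} \<in> sets ?P"
    by (intro sets.sets_Collect_finite_All borel_measurable_less) auto
  also have "{x \<in> space ?P. \<forall>m\<in>{..<M}. \<forall>k\<in>{..<n m}. \<forall>j\<in>{..<k}. x (m, j) < x (m, k)}
      = {x \<in> space ?P. x \<in> weyl_chambers M n}"
    by (auto simp: weyl_chambers_def)
  finally show ?thesis .
qed

text \<open>Almost everywhere the points are distinct, so exactly one choice of relabellings, one
  per time, sorts them. The relabelled chambers thus tile the space up to a null set, and symmetry
  gives them equal integrals.\<close>

lemma integral_weyl_chambers:
  fixes F :: "(nat \<times> nat \<Rightarrow> real) \<Rightarrow> real"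
  defines "I n M \<equiv> SIGMA m:{..<M}. {..<n m}"
  assumes F: "integrable (Pi\<^sub>M (I n M) (\<lambda>_. lborel)) F"
    and sym: "\<And>s x. s permutes I n M \<Longrightarrow> (\<And>i. fst (s i) = fst i) \<Longrightarrow> F (x \<circ> s) = F x"
  shows "(LINT x|Pi\<^sub>M (I n M) (\<lambda>_. lborel). F x)
    = (\<Prod>m<M. fact (n m)) * (LINT x|Pi\<^sub>M (I n M) (\<lambda>_. lborel). indicator (weyl_chambers M n) x * F x)"
proof -
  let ?I = "I n M" and ?W = "weyl_chambers M n"
  let ?P = "Pi\<^sub>M ?I (\<lambda>_. lborel) :: (nat \<times> nat \<Rightarrow> real) measure"
  define Q where "Q = (\<Pi>\<^sub>E m\<in>{..<M}. {p. p permutes {..<n m}})"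
  define s where "s p i = (if fst i < M then (fst i, p (fst i) (snd i)) else i)" for p :: "nat \<Rightarrow> nat \<Rightarrow> nat" and i :: "nat \<times> nat"
  have finI: "finite ?I" by (simp add: I_def)
  have finQ: "finite Q" unfolding Q_def by (intro finite_PiE) (auto intro: finite_permutations)
  have cardQ: "card Q = (\<Prod>m<M. fact (n m))"
    unfolding Q_def by (subst card_PiE) (simp_all add: card_permutations[of "{..<_}"])
  have s: "s p permutes ?I" if p: "p \<in> Q" for p
  proof -
    have pm: "p m permutes {..<n m}" if "m < M" for m using PiE_mem[of p "{..<M}"] p that by (auto simp: Q_def)
    show ?thesis
    proof (rule bij_imp_permutes)
      show "bij_betw (s p) ?I ?I"
      proof (rule bij_betw_byWitness[where f' = "\<lambda>i. (fst i, inv_into UNIV (p (fst i)) (snd i))"])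
        show "\<forall>i\<in>?I. (fst (s p i), inv_into UNIV (p (fst (s p i))) (snd (s p i))) = i"
          using permutes_inverses[OF pm] by (auto simp: s_def I_def)
        show "\<forall>i\<in>?I. s p (fst i, inv_into UNIV (p (fst i)) (snd i)) = i"
          using permutes_inverses[OF pm] by (auto simp: s_def I_def)
        show "s p ` ?I \<subseteq> ?I"
        proof (intro subsetI, elim imageE)
          fix x i assume "x = s p i" "i \<in> ?I"
          then show "x \<in> ?I" using permutes_in_image[OF pm[of "fst i"], of "snd i"] by (auto simp: s_def I_def)
        qed
        show "(\<lambda>i. (fst i, inv_into UNIV (p (fst i)) (snd i))) ` ?I \<subseteq> ?I"
        proof (intro subsetI, elim imageE)
          fix x i assume "x = (fst i, inv_into UNIV (p (fst i)) (snd i))" "i \<in> ?I"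
          then show "x \<in> ?I" using permutes_in_image[OF permutes_inv[OF pm[of "fst i"]], of "snd i"] by (auto simp: I_def)
        qed
      qed
      fix i assume i: "i \<notin> ?I"
      show "s p i = i"
      proof (cases "fst i < M")
        case True
        then have "snd i \<notin> {..<n (fst i)}" using i by (cases i) (auto simp: I_def)
        then have "p (fst i) (snd i) = snd i" by (rule permutes_not_in[OF pm[OF True]])
        then show ?thesis by (simp add: s_def)
      qed (simp add: s_def)
    qed
  qed
  have W: "x \<circ> s p \<in> ?W \<longleftrightarrow> (\<forall>m<M. strict_mono_on {..<n m} ((\<lambda>j. x (m, j)) \<circ> p m))" for x :: "nat \<times> nat \<Rightarrow> real" and p
    by (auto simp: weyl_chambers_def strict_mono_on_def s_def)
  have tile: "(\<Sum>p\<in>Q. indicator ?W (x \<circ> s p)) = (1::real)"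
    if x: "\<And>i j. i \<in> ?I \<Longrightarrow> j \<in> ?I \<Longrightarrow> i \<noteq> j \<Longrightarrow> x i \<noteq> x j" for x
  proof -
    have "\<exists>p. p permutes {..<n m} \<and> strict_mono_on {..<n m} ((\<lambda>j. x (m, j)) \<circ> p)" if "m < M" for m
      using x that by (intro ex_sorting_permutation) (auto simp: inj_on_def I_def)
    then have "\<forall>m. \<exists>p. m < M \<longrightarrow> p permutes {..<n m} \<and> strict_mono_on {..<n m} ((\<lambda>j. x (m, j)) \<circ> p)" by blast
    from choice[OF this] obtain p where p: "\<And>m. m < M \<Longrightarrow> p m permutes {..<n m}"
      "\<And>m. m < M \<Longrightarrow> strict_mono_on {..<n m} ((\<lambda>j. x (m, j)) \<circ> p m)" by blast
    let ?p = "restrict p {..<M}"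
    have pQ: "?p \<in> Q" unfolding Q_def using p(1) by auto
    have "x \<circ> s p' \<in> ?W \<longleftrightarrow> p' = ?p" if p': "p' \<in> Q" for p'
    proof
      assume "x \<circ> s p' \<in> ?W"
      then have "p' m = ?p m" if "m < M" for m
        using that p p' PiE_mem[of p' "{..<M}" _ m] unfolding W Q_def
        by (auto intro!: sorting_permutation_unique[of "p' m" "n m" "\<lambda>j. x (m, j)" "p m"])
      then show "p' = ?p" using p' pQ unfolding Q_def by (intro PiE_ext) auto
    next
      assume "p' = ?p"
      then show "x \<circ> s p' \<in> ?W" unfolding W using p(2) by simp
    qed
    then have "(\<Sum>p\<in>Q. indicator ?W (x \<circ> s p)) = (\<Sum>p'\<in>Q. if p' = ?p then 1 else (0::real))"
      by (intro sum.cong refl) (simp add: indicator_def)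
    then show ?thesis using finQ pQ by simp
  qed
  have ne: "AE x in ?P. \<forall>i\<in>?I. \<forall>j\<in>?I. i \<noteq> j \<longrightarrow> x i \<noteq> x j"
    using finI AE_PiM_lborel_distinct[OF finI] by (auto intro!: AE_finite_allI AE_impI)
  have Wm: "(\<lambda>x. indicator ?W x :: real) \<in> borel_measurable ?P"
    using measurable_weyl_chambers[of M n] unfolding I_def
    by (subst measurable_cong[of _ _ "indicator {x \<in> space (Pi\<^sub>M (SIGMA m:{..<M}. {..<n m}) (\<lambda>_. lborel)). x \<in> ?W}"])
      (auto simp: indicator_def)
  have WF: "integrable ?P (\<lambda>x. indicator ?W x * F x)"
    using F Wm by (intro Bochner_Integration.integrable_bound[OF F]) (auto simp: indicator_def)
  have sig: "sigma_finite_measure (lborel :: real measure)" by (rule lborel.sigma_finite_measure_axioms)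
  have WFs: "integrable ?P (\<lambda>x. indicator ?W (x \<circ> s p) * F x)" "(LINT x|?P. indicator ?W (x \<circ> s p) * F x) = (LINT x|?P. indicator ?W x * F x)"
    if p: "p \<in> Q" for p
  proof -
    have "F (x \<circ> s p) = F x" for x using s[OF p] by (intro sym) (auto simp: s_def)
    then have "(\<lambda>x. indicator ?W (x \<circ> s p) * F x) = (\<lambda>x. indicator ?W (x \<circ> s p) * F (x \<circ> s p))" by simp
    then show "integrable ?P (\<lambda>x. indicator ?W (x \<circ> s p) * F x)" "(LINT x|?P. indicator ?W (x \<circ> s p) * F x) = (LINT x|?P. indicator ?W x * F x)"
      using integrable_PiM_permutes[OF finI sig s[OF p] WF]
        integral_PiM_permutes[OF finI sig s[OF p] borel_measurable_integrable[OF WF]] by simp_all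
  qed
  have "(LINT x|?P. F x) = (LINT x|?P. (\<Sum>p\<in>Q. indicator ?W (x \<circ> s p) * F x))"
  proof (rule integral_cong_AE)
    show "AE x in ?P. F x = (\<Sum>p\<in>Q. indicator ?W (x \<circ> s p) * F x)"
      using ne by (rule AE_mp) (intro AE_I2 impI, simp add: tile flip: sum_distrib_right)
  qed (use F WFs(1) in \<open>auto intro!: borel_measurable_sum borel_measurable_integrable\<close>)
  also have "\<dots> = (\<Sum>p\<in>Q. LINT x|?P. indicator ?W (x \<circ> s p) * F x)"
    by (rule Bochner_Integration.integral_sum) (rule WFs(1))
  also have "\<dots> = real (card Q) * (LINT x|?P. indicator ?W x * F x)" by (simp add: WFs(2))
  finally show ?thesis by (simp add: cardQ)
qed

text \<open>Relabelling the points permutes rows and columns in the same way, so the sign appears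
  squared.\<close>

lemma fdet_permute_list:
  assumes L: "distinct L" and s: "s permutes set L"
  shows "fdet (length L) (\<lambda>a b. G (s (L ! a)) (s (L ! b))) = fdet (length L) (\<lambda>a b. G (L ! a) (L ! b))"
proof -
  let ?n = "length L"
  have nth: "bij_betw ((!) L) {..<?n} (set L)" using L by (rule bij_betw_nth) auto
  define \<sigma> where "\<sigma> a = (if a < ?n then inv_into {..<?n} ((!) L) (s (L ! a)) else a)" for a
  have "bij_betw (inv_into {..<?n} ((!) L) \<circ> (s \<circ> (!) L)) {..<?n} {..<?n}"
    using nth permutes_imp_bij[OF s] by (intro bij_betw_trans[OF bij_betw_trans] bij_betw_inv_into)
  then have "bij_betw \<sigma> {..<?n} {..<?n}" by (rule bij_betw_cong[THEN iffD1, rotated]) (simp add: \<sigma>_def)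
  then have \<sigma>: "\<sigma> permutes {..<?n}" by (rule bij_imp_permutes) (simp add: \<sigma>_def)
  have L\<sigma>: "L ! \<sigma> a = s (L ! a)" if "a < ?n" for a
    using that bij_betw_inv_into_right[OF nth, of "s (L ! a)"] permutes_in_image[OF s, of "L ! a"]
    by (simp add: \<sigma>_def)
  have "fdet ?n (\<lambda>a b. G (s (L ! a)) (s (L ! b))) = fdet ?n (\<lambda>a b. G (L ! \<sigma> a) (L ! \<sigma> b))"
    by (rule fdet_cong) (simp add: L\<sigma>)
  also have "\<dots> = of_int (sign \<sigma>) * (of_int (sign \<sigma>) * fdet ?n (\<lambda>a b. G (L ! a) (L ! b)))"
    by (simp only: fdet_permute_rows[OF \<sigma>, of "\<lambda>a b. G (L ! a) (L ! \<sigma> b)"]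
        fdet_permute_cols[OF \<sigma>, of "\<lambda>a b. G (L ! a) (L ! b)"])
  finally show ?thesis by (simp add: sign_def)
qed

section \<open>The Fredholm expansion of the correlation kernel\<close>

text \<open>Level 0 is the starting time and level \<open>Suc m\<close> the observation time
  \<open>t m\<close>, in agreement with \<open>entry_level\<close>.\<close>

primrec level_time :: "(nat \<Rightarrow> real) \<Rightarrow> nat \<Rightarrow> real" where
  "level_time t 0 = 0"
| "level_time t (Suc m) = t m"

locale noncolliding_kernel =
  fixes N :: nat and u :: "nat \<Rightarrow> real" and M :: nat and t :: "nat \<Rightarrow> real"
    and \<eta> :: "nat \<Rightarrow> real \<Rightarrow> real" and R \<gamma> :: real
  assumes u: "strict_mono_on {..<N} u"
    and t_pos: "m < M \<Longrightarrow> 0 < t m" and t_mono: "strict_mono_on {..<M} t"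
    and \<eta>_measurable: "\<eta> m \<in> borel_measurable borel"
    and \<eta>_bound: "\<bar>\<eta> m y\<bar> \<le> \<gamma>"
    and \<eta>_support: "\<bar>y\<bar> > R \<Longrightarrow> \<eta> m y = 0"
    and u_bound: "v < N \<Longrightarrow> \<bar>u v\<bar> \<le> R"
    and R_nonneg: "R \<ge> 0"
begin

text \<open>The cutoff at \<open>M\<close> leaves finitely many levels, so that one bound serves
  them all; beyond them the function \<open>t\<close> is unconstrained.\<close>

definition transition :: "nat \<Rightarrow> real \<Rightarrow> nat \<Rightarrow> real \<Rightarrow> real" where
  "transition l y l' z
    = (if l' < l \<and> l \<le> M then normal_density z (sqrt (level_time t l - level_time t l')) y else 0)"

text \<open>The sum of the peak values of all Gaussians that occur, in place of their
  maximum.\<close>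

definition kernel_bound :: real where
  "kernel_bound = (\<Sum>l\<le>M. \<Sum>l'<l. 1 / sqrt (2 * pi * (level_time t l - level_time t l')))"

text \<open>Cut off as well, because \<open>admissible\<close> asks for one bound valid at all
  levels.\<close>

definition mart_row :: "nat \<Rightarrow> nat \<Rightarrow> real \<Rightarrow> real" where
  "mart_row v l y = (if l \<le> M then poly (mart_poly N u (level_time t l) v) y else 0)"

lemma level_time_less: "l' < l \<Longrightarrow> l \<le> M \<Longrightarrow> level_time t l' < level_time t l"
  using t_pos strict_mono_onD[OF t_mono] by (cases l; cases l') auto

lemma inj_u: "inj_on u {..<N}"
  using u by (rule strict_mono_on_imp_inj_on)

lemma vandermonde_u: "vandermonde N u \<noteq> 0"
  using inj_u by (simp add: vandermonde_eq_0_iff)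

lemma transition_bound: "\<bar>transition l y l' z\<bar> \<le> kernel_bound"
proof -
  have nonneg: "0 \<le> 1 / sqrt (2 * pi * (level_time t l - level_time t l'))" if "l \<le> M" "l' < l" for l l'
    using level_time_less[OF that(2,1)] by simp
  show ?thesis
  proof (cases "l' < l \<and> l \<le> M")
    case True
    let ?d = "level_time t l - level_time t l'"
    have d: "?d > 0" using True level_time_less by simp
    have "\<bar>transition l y l' z\<bar> = 1 / sqrt (2 * pi * ?d) * exp (- (y - z)\<^sup>2 / (2 * ?d))"
      using True d by (simp add: transition_def normal_density_def)
    also have "\<dots> \<le> 1 / sqrt (2 * pi * ?d) * 1" using d by (intro mult_left_mono) auto
    also have "\<dots> \<le> (\<Sum>l'<l. 1 / sqrt (2 * pi * (level_time t l - level_time t l')))"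
      using True nonneg by (simp, intro member_le_sum) auto
    also have "\<dots> \<le> kernel_bound"
      unfolding kernel_bound_def using True nonneg
      by (intro member_le_sum[of l "{..M}" "\<lambda>l. \<Sum>l'<l. 1 / sqrt (2 * pi * (level_time t l - level_time t l'))"] sum_nonneg) auto
    finally show ?thesis .
  next
    case False
    have "0 \<le> kernel_bound" unfolding kernel_bound_def using nonneg by (intro sum_nonneg) auto
    then show ?thesis using False by (auto simp: transition_def)
  qed
qed

sublocale space_time_kernel N u transition \<eta> R \<gamma> kernel_bound
proof
  show "(\<lambda>(y, z). transition l y l' z) \<in> borel_measurable (borel \<Otimes>\<^sub>M borel)" for l l'
    unfolding transition_def normal_density_def by measurable
  show "l \<le> l' \<Longrightarrow> transition l y l' z = 0" for l l' y z by (simp add: transition_def)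
qed (use \<eta>_measurable \<eta>_bound \<eta>_support u_bound R_nonneg transition_bound in auto)

lemma admissible_mart_row: "admissible mart_row"
proof -
  have "\<forall>p. \<exists>C. \<forall>x::real. \<bar>poly p x\<bar> \<le> C * cosh x" using poly_le_cosh by blast
  from choice[OF this] obtain C where C: "\<And>p (x::real). \<bar>poly p x\<bar> \<le> C p * cosh x" by blast
  have C0: "C p \<ge> 0" for p using order_trans[OF abs_ge_zero C[of p 0]] by simp
  let ?C = "\<Sum>v<N. \<Sum>l\<le>M. C (mart_poly N u (level_time t l) v) * cosh R"
  have "\<bar>mart_row v l y\<bar> \<le> ?C" if v: "v < N" and y: "\<bar>y\<bar> \<le> R" for v l y
  proof (cases "l \<le> M")
    case True
    have "cosh y \<le> cosh R" using y R_nonneg cosh_real_nonneg_le_iff[of "\<bar>y\<bar>" R] by simp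
    then have "\<bar>mart_row v l y\<bar> \<le> C (mart_poly N u (level_time t l) v) * cosh R"
      using True C order_trans[OF C mult_left_mono[OF _ C0]] by (simp add: mart_row_def)
    also have "\<dots> \<le> (\<Sum>l\<le>M. C (mart_poly N u (level_time t l) v) * cosh R)"
      using True C0 by (intro member_le_sum[of l "{..M}" "\<lambda>l. C (mart_poly N u (level_time t l) v) * cosh R"]) auto
    also have "\<dots> \<le> ?C" using v C0
      by (intro member_le_sum[of v "{..<N}" "\<lambda>v. \<Sum>l\<le>M. C (mart_poly N u (level_time t l) v) * cosh R"] sum_nonneg) auto
    finally show ?thesis .
  next
    case False
    have "0 \<le> ?C" using C0 by (intro sum_nonneg) auto
    then show ?thesis using False by (simp add: mart_row_def)
  qed
  moreover have "mart_row v l \<in> borel_measurable borel" for v l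
    unfolding mart_row_def by (cases "l \<le> M") (simp_all add: borel_measurable_continuous_onI continuous_intros)
  ultimately show ?thesis unfolding admissible_def by blast
qed

text \<open>If the rows are space-time harmonic below the last level, adding the update for that level
  multiplies the top function by \<open>1 + \<eta>\<close> and keeps the rows harmonic below the next level.\<close>

lemma final_row_eq_backward:
  assumes "m < M" "cosh_bounded C \<psi>" "\<Lambda> v (Suc m) = \<psi>"
    and "\<And>l z. l \<le> m \<Longrightarrow> \<Lambda> v l z = heat (t m - level_time t l) \<psi> z"
  shows "final_row (Suc m) \<Lambda> v z = backward t (\<lambda>m x. 1 + \<eta> m x) m (\<lambda>x. (1 + \<eta> m x) * \<psi> x) z"
  using assms
proof (induction m arbitrary: \<Lambda> \<psi> C z)
  case (0 \<Lambda> \<psi>)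
  have bd: "cosh_bounded (\<gamma> * C) (\<lambda>x. \<eta> 0 x * \<psi> x)"
    unfolding cosh_bounded_def abs_mult mult.assoc
    using cosh_boundedD[OF 0(2)] \<eta>_measurable \<eta>_bound \<gamma>_nonneg by (auto intro!: mult_mono)
  have "update 0 \<Lambda> v 0 z = heat (t 0) (\<lambda>x. \<eta> 0 x * \<psi> x) z"
    using 0(1,3) by (simp add: update_def heat_def transition_def mult.commute)
  then have "final_row (Suc 0) \<Lambda> v z = heat (t 0) \<psi> z + heat (t 0) (\<lambda>x. \<eta> 0 x * \<psi> x) z"
    using 0(4)[of 0 z] by simp
  also have "\<dots> = heat (t 0) (\<lambda>x. \<psi> x + \<eta> 0 x * \<psi> x) z"
    using heat_add[OF 0(2) bd t_pos[OF 0(1)]] by simp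
  finally show ?case by (simp add: algebra_simps)
next
  case (Suc m \<Lambda> \<psi>)
  let ?g = "\<lambda>x. (1 + \<eta> (Suc m) x) * \<psi> x"
  let ?\<Lambda> = "\<lambda>v l y. \<Lambda> v l y + update (Suc m) \<Lambda> v l y"
  let ?s = "t (Suc m) - t m"
  have s: "?s > 0" using level_time_less[of "Suc m" "Suc (Suc m)"] Suc.prems(1) by simp
  have bd: "cosh_bounded (\<gamma> * C) (\<lambda>x. \<eta> (Suc m) x * \<psi> x)"
    unfolding cosh_bounded_def abs_mult mult.assoc
    using cosh_boundedD[OF Suc.prems(2)] \<eta>_measurable \<eta>_bound \<gamma>_nonneg by (auto intro!: mult_mono)
  have bd1: "cosh_bounded (C + \<gamma> * C) ?g"
    unfolding cosh_bounded_def
  proof (intro conjI allI)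
    show "?g \<in> borel_measurable borel" using cosh_boundedD(1)[OF Suc.prems(2)] \<eta>_measurable by simp
    fix x
    have "\<bar>?g x\<bar> \<le> \<bar>\<psi> x\<bar> + \<bar>\<eta> (Suc m) x * \<psi> x\<bar>" by (simp add: algebra_simps abs_triangle_ineq)
    then show "\<bar>?g x\<bar> \<le> (C + \<gamma> * C) * cosh x"
      using cosh_boundedD(2)[OF Suc.prems(2), of x] cosh_boundedD(2)[OF bd, of x] by (simp add: algebra_simps)
  qed
  have new: "?\<Lambda> v l z = heat (t (Suc m) - level_time t l) ?g z" if l: "l \<le> Suc m" for l z
  proof -
    have d: "t (Suc m) - level_time t l > 0" using level_time_less[of l "Suc (Suc m)"] l Suc.prems(1) by simp
    have "update (Suc m) \<Lambda> v l z = heat (t (Suc m) - level_time t l) (\<lambda>x. \<eta> (Suc m) x * \<psi> x) z"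
      using Suc.prems(1,3) l by (simp add: update_def heat_def transition_def mult.commute)
    then have "?\<Lambda> v l z = heat (t (Suc m) - level_time t l) (\<lambda>x. \<psi> x + \<eta> (Suc m) x * \<psi> x) z"
      using Suc.prems(4)[OF l, of z] heat_add[OF Suc.prems(2) bd d] by simp
    then show ?thesis by (simp add: algebra_simps)
  qed
  have "final_row (Suc m) ?\<Lambda> v z = backward t (\<lambda>m x. 1 + \<eta> m x) m (\<lambda>x. (1 + \<eta> m x) * heat ?s ?g x) z"
  proof (rule Suc.IH)
    show "cosh_bounded (exp (?s / 2) * (C + \<gamma> * C)) (heat ?s ?g)" by (rule heat_bounded[OF bd1 s])
    show "?\<Lambda> v (Suc m) = heat ?s ?g" using new[of "Suc m"] by (auto simp: fun_eq_iff)
    fix l z assume l: "l \<le> m"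
    have d: "t m - level_time t l > 0" using level_time_less[of l "Suc m"] l Suc.prems(1) by simp
    show "?\<Lambda> v l z = heat (t m - level_time t l) (heat ?s ?g) z"
      using new[of l z] l heat_heat[OF bd1 d s, of z] by simp
  qed (use Suc.prems in simp)
  then show ?case by simp
qed

lemma final_row_mart_row:
  assumes "M = Suc m"
  shows "final_row M mart_row v z
    = backward t (\<lambda>m x. 1 + \<eta> m x) m (\<lambda>x. (1 + \<eta> m x) * poly (mart_poly N u (t m) v) x) z"
proof -
  obtain C where C: "cosh_bounded C (poly (mart_poly N u (t m) v))" using poly_cosh_bounded by blast
  have "final_row (Suc m) mart_row v z
      = backward t (\<lambda>m x. 1 + \<eta> m x) m (\<lambda>x. (1 + \<eta> m x) * poly (mart_poly N u (t m) v) x) z"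
  proof (rule final_row_eq_backward[OF _ C])
    have le: "l \<le> M" if "l \<le> Suc m" for l using assms that by simp
    show "mart_row v (Suc m) = poly (mart_poly N u (t m) v)" using le[of "Suc m"] by (auto simp: mart_row_def)
    fix l z assume l: "l \<le> m"
    then have d: "t m - level_time t l > 0" using level_time_less[of l "Suc m"] assms by simp
    show "mart_row v l z = heat (t m - level_time t l) (poly (mart_poly N u (t m) v)) z"
      using heat_mart_poly[OF d, of N u "level_time t l" v z] le[of l] l by (simp add: mart_row_def)
  qed (use assms in simp)
  then show ?thesis by (simp only: assms[symmetric])
qed

lemma mart_row_node:
  "v < N \<Longrightarrow> w < N \<Longrightarrow> mart_row v 0 (u w) = (if v = w then 1 else 0)"
  using lagrange_basis_node[OF inj_u, of v w] by (simp add: mart_row_def mart_poly_0)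

lemma distinct_block_indices: "distinct (block_indices M' n)"
proof (induction M')
  case (Suc M')
  then show ?case
    by (auto simp: block_indices_Suc distinct_map inj_on_def set_block_indices)
qed (simp add: block_indices_def)

abbreviation kernel_entry :: "nat \<times> nat \<Rightarrow> real \<Rightarrow> nat \<times> nat \<Rightarrow> real \<Rightarrow> real" where
  "kernel_entry i y j z \<equiv>
     (\<Sum>v<N. transition (Suc (fst i)) y 0 (u v) * mart_row v (Suc (fst j)) z)
       - transition (Suc (fst i)) y (Suc (fst j)) z"

text \<open>The times increase with the index, so the condition \<open>s > t\<close> of the kernel
  becomes a comparison of levels; the integral over the initial configuration is the sum over
  transitions from level 0.\<close>

lemma corr_kernel_eq_kernel_entry:
  assumes "fst i < M" "fst j < M"
  shows "corr_kernel (point_config N u) (t (fst i)) y (t (fst j)) z = complex_of_real (kernel_entry i y j z)"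
proof -
  have "fst j < fst i \<longleftrightarrow> t (fst j) < t (fst i)"
    using strict_mono_on_less[OF t_mono, of "fst j" "fst i"] assms by simp
  then show ?thesis
    using assms t_pos by (subst corr_kernel_point_config[OF inj_u]) (auto simp: transition_def mart_row_def)
qed

lemma det_kernel_matrix:
  "Determinant.det (kernel_matrix (corr_kernel (point_config N u)) M t n x)
    = complex_of_real (augmented N u transition mart_row (block_indices M n) x)"
proof -
  let ?L = "block_indices M n"
  have L: "fst (?L ! a) < M" if "a < length ?L" for a
    using nth_mem[OF that] unfolding set_block_indices by auto
  have "Determinant.det (kernel_matrix (corr_kernel (point_config N u)) M t n x)
      = fdet (length ?L) (\<lambda>a b. corr_kernel (point_config N u) (t (fst (?L ! a))) (x (?L ! a)) (t (fst (?L ! b))) (x (?L ! b)))"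
    by (simp add: kernel_matrix_def fdet_def Let_def)
  also have "\<dots> = fdet (length ?L) (\<lambda>a b. complex_of_real (kernel_entry (?L ! a) (x (?L ! a)) (?L ! b) (x (?L ! b))))"
    using L by (intro fdet_cong corr_kernel_eq_kernel_entry)
  also have "\<dots> = complex_of_real (augmented N u transition mart_row ?L x)"
    by (simp only: fdet_of_real augmented_eq_fdet_kernel[of N mart_row u, OF mart_row_node])
  finally show ?thesis .
qed

text \<open>A separate \<open>h\<close> is allowed because the test functions are arbitrary at
  indices from \<open>M\<close> on, whereas the locale wants \<open>\<eta>\<close> bounded and
  supported at all indices.\<close>

lemma fredholm_term_corr_kernel:
  assumes h: "\<And>m y. m < M \<Longrightarrow> h m y = \<eta> m y"
  shows "fredholm_term (corr_kernel (point_config N u)) M t h n = complex_of_real (term_integral M n mart_row)"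
proof -
  let ?L = "block_indices M n" and ?I = "SIGMA m:{..<M}. {..<n m}" and ?W = "weyl_chambers M n"
  let ?P = "Pi\<^sub>M ?I (\<lambda>_. lborel) :: (nat \<times> nat \<Rightarrow> real) measure"
  let ?F = "\<lambda>x. weight ?I x * augmented N u transition mart_row ?L x"
  have "(\<Prod>m<M. \<Prod>j<n m. h m (x (m, j))) = weight ?I x" for x
    unfolding weight_def using h by (subst prod.Sigma) (auto simp: case_prod_beta intro!: prod.cong)
  then have "fredholm_term (corr_kernel (point_config N u)) M t h n
      = (LINT x|?P. complex_of_real (indicator ?W x * ?F x))"
    by (simp add: fredholm_term_def set_lebesgue_integral_def det_kernel_matrix scaleR_conv_of_real del: of_real_prod)
  also have "\<dots> = complex_of_real (LINT x|?P. indicator ?W x * ?F x)"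
    by (rule integral_complex_of_real)
  also have "(LINT x|?P. indicator ?W x * ?F x) = term_integral M n mart_row"
  proof -
    have "(LINT x|?P. ?F x) = (\<Prod>m<M. fact (n m)) * (LINT x|?P. indicator ?W x * ?F x)"
    proof (rule integral_weyl_chambers)
      show "integrable ?P ?F"
        using integrable_weight_augmented[OF admissible_mart_row, of ?L] by (simp add: set_block_indices)
      fix s :: "nat \<times> nat \<Rightarrow> nat \<times> nat" and x :: "nat \<times> nat \<Rightarrow> real"
      assume s: "s permutes ?I" and fst: "\<And>i. fst (s i) = fst i"
      have "weight ?I (x \<circ> s) = (\<Prod>i\<in>?I. ((\<lambda>i. \<eta> (fst i) (x i)) \<circ> s) i)"
        by (simp add: weight_def fst)
      also have "\<dots> = weight ?I x" unfolding weight_def by (rule prod.permute[OF s, symmetric])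
      finally have "weight ?I (x \<circ> s) = weight ?I x" .
      moreover have "augmented N u transition mart_row ?L (x \<circ> s) = augmented N u transition mart_row ?L x"
        using fdet_permute_list[OF distinct_block_indices, of s M n "\<lambda>i j. kernel_entry i (x i) j (x j)"] s
        by (simp add: augmented_eq_fdet_kernel[of N mart_row u, OF mart_row_node] set_block_indices fst)
      ultimately show "?F (x \<circ> s) = ?F x" by simp
    qed
    moreover have "(\<Prod>m<M. fact (n m)) \<noteq> (0::real)" by simp
    ultimately show ?thesis by (simp add: term_integral_def block_integral_def set_block_indices)
  qed
  finally show ?thesis .
qed

text \<open>Terms with more than \<open>N\<close> points at some time vanish, so the series reduces
  to a finite sum.\<close>

lemma fredholm_expansion:
  assumes "\<And>m y. m < M \<Longrightarrow> h m y = \<eta> m y"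
  shows "(fredholm_term (corr_kernel (point_config N u)) M t h has_sum
    complex_of_real (fdet N (\<lambda>j v. final_row M mart_row v (u j)))) ({..<M} \<rightarrow>\<^sub>E UNIV)"
proof -
  let ?T = "\<lambda>n. complex_of_real (term_integral M n mart_row)"
  have sum: "(\<Sum>n\<in>{..<M} \<rightarrow>\<^sub>E {..N}. ?T n) = complex_of_real (fdet N (\<lambda>j v. final_row M mart_row v (u j)))"
    using sum_term_integral[OF admissible_mart_row, of M] fdet_transpose[of N "\<lambda>j v. final_row M mart_row v (u j)"]
    by (simp flip: of_real_sum)
  have "finite ({..<M} \<rightarrow>\<^sub>E {..N})" by (intro finite_PiE) auto
  then have "(?T has_sum complex_of_real (fdet N (\<lambda>j v. final_row M mart_row v (u j)))) ({..<M} \<rightarrow>\<^sub>E {..N})"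
    unfolding sum[symmetric] by (rule has_sum_finite)
  also have "?this \<longleftrightarrow> (fredholm_term (corr_kernel (point_config N u)) M t h has_sum
    complex_of_real (fdet N (\<lambda>j v. final_row M mart_row v (u j)))) ({..<M} \<rightarrow>\<^sub>E UNIV)"
  proof (rule has_sum_cong_neutral)
    fix n assume "n \<in> ({..<M} \<rightarrow>\<^sub>E UNIV) - ({..<M} \<rightarrow>\<^sub>E {..N})"
    then obtain m where "m < M" "N < n m" by (auto simp: PiE_iff not_le)
    then show "fredholm_term (corr_kernel (point_config N u)) M t h n = 0"
      by (simp add: fredholm_term_corr_kernel[OF assms] term_integral_eq_0[OF admissible_mart_row])
  qed (auto simp: fredholm_term_corr_kernel[OF assms] PiE_iff)
  finally show ?thesis .
qed

end

theorem corollary5p5: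
  fixes P :: "'a measure" and N :: nat and u :: "nat \<Rightarrow> real"
    and B X :: "nat \<Rightarrow> real \<Rightarrow> 'a \<Rightarrow> real"
  assumes "prob_space P"
    and "N \<ge> 1"
    and "strict_mono_on {..<N} u"
    and "noncolliding_BM P N u B X"
  shows "determinantal P (\<lambda>t \<omega>. point_config N (\<lambda>j. X j t \<omega>)) (corr_kernel (point_config N u))"
  unfolding determinantal_def
proof (intro allI impI)
  fix M :: nat and t :: "nat \<Rightarrow> real" and f :: "nat \<Rightarrow> real \<Rightarrow> real"
  assume asm: "(\<forall>m<M. 0 < t m) \<and> strict_mono_on {..<M} t \<and>
    (\<forall>m<M. continuous_on UNIV (f m) \<and> compact (closure {x. f m x \<noteq> 0}))"
  interpret prob_space P by (rule assms(1))
  let ?h = "\<lambda>m x. exp (f m x) - 1"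
  \<comment> \<open>Nothing is known of \<open>f\<close> beyond \<open>M\<close>; the value 0 there
    meets the assumptions of the locale, which range over all indices.\<close>
  define \<eta> where "\<eta> m x = (if m < M then ?h m x else 0)" for m x
  have "\<exists>r. \<forall>x. f m x \<noteq> 0 \<longrightarrow> \<bar>x\<bar> \<le> r" if "m < M" for m
  proof -
    have "bounded {x. f m x \<noteq> 0}"
      using asm that bounded_subset[OF compact_imp_bounded closure_subset] by blast
    then show ?thesis by (auto simp: bounded_iff)
  qed
  then have "\<forall>m. \<exists>r. m < M \<longrightarrow> (\<forall>x. f m x \<noteq> 0 \<longrightarrow> \<bar>x\<bar> \<le> r)" by blast
  from choice[OF this] obtain r where r: "\<And>m x. m < M \<Longrightarrow> f m x \<noteq> 0 \<Longrightarrow> \<bar>x\<bar> \<le> r m" by blast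
  \<comment> \<open>One radius for the supports of all test functions and for the starting points;
    sums stand in for maxima.\<close>
  define R where "R = (\<Sum>m<M. \<bar>r m\<bar>) + (\<Sum>v<N. \<bar>u v\<bar>)"
  have rR: "r m \<le> R" if "m < M" for m
  proof -
    have "\<bar>r m\<bar> \<le> (\<Sum>m<M. \<bar>r m\<bar>)" using that by (intro member_le_sum) auto
    moreover have "0 \<le> (\<Sum>v<N. \<bar>u v\<bar>)" by (intro sum_nonneg) auto
    ultimately show ?thesis unfolding R_def by linarith
  qed
  have uR: "\<bar>u v\<bar> \<le> R" if "v < N" for v
  proof -
    have "\<bar>u v\<bar> \<le> (\<Sum>v<N. \<bar>u v\<bar>)" using that by (intro member_le_sum) auto
    moreover have "0 \<le> (\<Sum>m<M. \<bar>r m\<bar>)" by (intro sum_nonneg) auto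
    ultimately show ?thesis unfolding R_def by linarith
  qed
  have R0: "R \<ge> 0" unfolding R_def by (intro add_nonneg_nonneg sum_nonneg) auto
  have cont: "continuous_on UNIV (f m)" if "m < M" for m using asm that by blast
  have support: "f m x = 0" if "m < M" "\<bar>x\<bar> > R" for m x
    using r[OF that(1), of x] rR[OF that(1)] that(2) by linarith
  have "\<exists>c. \<forall>x. \<bar>?h m x\<bar> \<le> c" if m: "m < M" for m
  proof -
    have "compact ((\<lambda>x. \<bar>?h m x\<bar>) ` {-R..R})"
      by (intro compact_continuous_image continuous_intros continuous_on_subset[OF cont[OF m]]) auto
    then have "bounded ((\<lambda>x. \<bar>?h m x\<bar>) ` {-R..R})" by (rule compact_imp_bounded)
    then obtain c where c: "\<And>x. x \<in> {-R..R} \<Longrightarrow> \<bar>?h m x\<bar> \<le> c" unfolding bounded_iff by fastforce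
    have "\<bar>?h m x\<bar> \<le> \<bar>c\<bar>" for x
    proof (cases "\<bar>x\<bar> \<le> R")
      case True
      then have "x \<in> {-R..R}" by auto
      from c[OF this] show ?thesis by linarith
    next
      case False
      then show ?thesis using support[OF m, of x] by simp
    qed
    then show ?thesis by blast
  qed
  then have "\<forall>m. \<exists>c. m < M \<longrightarrow> (\<forall>x. \<bar>?h m x\<bar> \<le> c)" by blast
  from choice[OF this] obtain c where c: "\<And>m x. m < M \<Longrightarrow> \<bar>?h m x\<bar> \<le> c m" by blast
  define \<gamma> where "\<gamma> = (\<Sum>m<M. \<bar>c m\<bar>)"
  have \<gamma>: "\<bar>\<eta> m x\<bar> \<le> \<gamma>" for m x
  proof (cases "m < M")
    case True
    have "\<bar>?h m x\<bar> \<le> \<bar>c m\<bar>" using c[OF True, of x] by linarith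
    also have "\<dots> \<le> \<gamma>" unfolding \<gamma>_def using True by (intro member_le_sum) auto
    finally show ?thesis using True by (simp add: \<eta>_def)
  qed (simp add: \<eta>_def \<gamma>_def sum_nonneg)
  interpret noncolliding_kernel N u M t \<eta> R \<gamma>
  proof
    show "\<eta> m \<in> borel_measurable borel" for m
    proof (cases "m < M")
      case True
      then have "\<eta> m = ?h m" by (simp add: \<eta>_def fun_eq_iff)
      then show ?thesis using cont[OF True] by (simp add: borel_measurable_continuous_onI continuous_intros)
    qed (simp add: \<eta>_def[abs_def])
    show "\<eta> m y = 0" if "\<bar>y\<bar> > R" for m y using support[OF _ that] by (simp add: \<eta>_def)
  qed (use asm assms(3) \<gamma> uR R0 in auto)
  have "(LINT \<omega>|P. exp (\<Sum>m<M. LINT x|point_config N (\<lambda>j. X j (t m) \<omega>). f m x))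
      = (LINT \<omega>|P. (\<Prod>m<M. \<Prod>j<N. 1 + \<eta> m (X j (t m) \<omega>)))"
  proof (intro Bochner_Integration.integral_cong refl)
    fix \<omega>
    have "(\<Sum>m<M. LINT x|point_config N (\<lambda>j. X j (t m) \<omega>). f m x) = (\<Sum>m<M. \<Sum>j<N. f m (X j (t m) \<omega>))"
      using cont by (intro sum.cong refl integral_point_config borel_measurable_continuous_onI) auto
    then show "exp (\<Sum>m<M. LINT x|point_config N (\<lambda>j. X j (t m) \<omega>). f m x) = (\<Prod>m<M. \<Prod>j<N. 1 + \<eta> m (X j (t m) \<omega>))"
      by (simp add: exp_sum \<eta>_def)
  qed
  also have "\<dots> = fdet N (\<lambda>j v. final_row M mart_row v (u j))"
  proof (cases M)
    \<comment> \<open>The formula for multi-time expectations speaks of at least one time. Without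
      any, both sides are 1, since the rows are the Lagrange basis at the nodes.\<close>
    case 0
    have "fdet N (\<lambda>j v. final_row M mart_row v (u j)) = fdet N (\<lambda>i j. if i = j then 1 else 0)"
    proof (rule fdet_cong)
      fix i j assume "i < N" "j < N"
      moreover have "final_row M' mart_row j = mart_row j 0" if "M' = 0" for M' using that by simp
      from this[OF 0] have "final_row M mart_row j = mart_row j 0" .
      ultimately show "final_row M mart_row j (u i) = (if i = j then 1 else 0)" by (simp add: mart_row_node)
    qed
    moreover have "(LINT \<omega>|P. (\<Prod>m<M. \<Prod>j<N. 1 + \<eta> m (X j (t m) \<omega>))) = 1" unfolding 0 by (simp add: prob_space)
    ultimately show ?thesis by (simp only: fdet_identity)
  next
    case (Suc m)
    have "(LINT \<omega>|P. (\<Prod>m<Suc m. \<Prod>j<N. 1 + \<eta> m (X j (t m) \<omega>)))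
        = fdet N (\<lambda>j v. backward t (\<lambda>m x. 1 + \<eta> m x) m (\<lambda>x. (1 + \<eta> m x) * poly (mart_poly N u (t m) v) x) (u j))"
    proof (rule noncolliding_multitime_expectation[OF assms(1) _ assms(4) vandermonde_u fdet_mart_poly[OF vandermonde_u]])
      show "strict_mono_on {..m} t" using t_mono Suc by (simp add: lessThan_Suc_atMost)
      show "continuous_on UNIV (\<lambda>x. 1 + \<eta> m' x)" if "m' \<le> m" for m'
        using that Suc cont[of m'] by (auto simp: \<eta>_def intro!: continuous_intros)
      show "\<bar>1 + \<eta> m' x\<bar> \<le> 1 + \<gamma>" for m' x using \<gamma>[of m' x] by linarith
    qed (use assms(2) t_pos Suc in auto)
    then show ?thesis by (simp only: Suc[symmetric] final_row_mart_row[OF Suc])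
  qed
  finally show "(fredholm_term (corr_kernel (point_config N u)) M t ?h has_sum
      complex_of_real (LINT \<omega>|P. exp (\<Sum>m<M. LINT x|point_config N (\<lambda>j. X j (t m) \<omega>). f m x))) ({..<M} \<rightarrow>\<^sub>E UNIV)"
    using fredholm_expansion[of ?h] by (simp add: \<eta>_def)
qed

end
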